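(* Let $n\in\{0,1,\ldots\}$. A solution $\boldsymbol\phi$ of $\partial_t^2\phi-\partial_x^2\phi+U'(\phi)=0$ is a kink $n$-cluster if and only if $\boldsymbol\phi$ takes values in $\mathcal E_{1,(-1)^n}$ and $$\lim_{t\to\infty}\mathbf d(\boldsymbol\phi(t))=0.$$
   Context: Setting. $U:\mathbb R\to[0,\infty)$ is a fixed $C^\infty$ even function with $U(\phi)>0$ for $\phi\in(-1,1)$, $U(\pm1)=0$, $U''(\pm1)=1$. The equation is written as the first-order system $\partial_t\phi=\dot\phi$, $\partial_t\dot\phi=\partial_x^2\phi-U'(\phi)$ for $\boldsymbol\phi=(\phi,\dot\phi)$, $(t,x)\in\mathbb R\times\mathbb R$. Energies: $E_p(\phi_0)=\int_{\mathbb R}(\tfrac12(\partial_x\phi_0)^2+U(\phi_0))dx$, $E(\boldsymbol\phi_0)=E_p(\phi_0)+\int_{\mathbb R}\tfrac12\dot\phi_0^2dx$. For $\iota_-,\iota_+\in\{-1,1\}$, $\mathcal E_{\iota_-,\iota_+}$ is the set of $\boldsymbol\phi_0=(\phi_0,\dot\phi_0)$ with $E(\boldsymbol\phi_0)<\infty$, $\lim_{x\to-\infty}\phi_0=\iota_-$, $\lim_{x\to+\infty}\phi_0=\iota_+$; it is an affine space parallel to $\mathcal E=H^1(\mathbb R)\times L^2(\mathbb R)$. All states considered belong to one of these four spaces. A solution is $\boldsymbol\phi\in C(\mathbb R;\mathcal E_{\iota_-,\iota_+})$ satisfying the system in the sense of distributions (for each initial data there is a unique global solution and $E$ is conserved;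 write $E(\boldsymbol\phi)$). $H:\mathbb R\to(-1,1)$ is the increasing odd function $H=G^{-1}$, $G(\psi)=\int_0^\psi dy/\sqrt{2U(y)}$; it satisfies $\partial_x^2H=U'(H)$. A solution $\boldsymbol\phi$ is a kink $n$-cluster if $E(\boldsymbol\phi)\le nE_p(H)$ and there exist real-valued functions $x_0(t)\le\ldots\le x_n(t)$ such that $\lim_{t\to\infty}\phi(t,x_k(t))=(-1)^k$ for all $k\in\{0,\ldots,n\}$. For $(a,v)\in\mathbb R\times(-1,1)$, $\gamma_v=(1-v^2)^{-1/2}$, $H(a,v;x)=H(\gamma_v(x-a))$, $\boldsymbol H(a,v)=(H(a,v),-v\,\partial_xH(a,v))$. For $\vec a\in\mathbb R^n$ with $a_1\le\ldots\le a_n$ and $\vec v\in(-1,1)^n$: $\boldsymbol H(\vec a,\vec v)=\boldsymbol 1+\sum_{k=1}^n(-1)^k(\boldsymbol H(a_k,v_k)+\boldsymbol 1)$, $\boldsymbol 1=(1,0)$; $\rho(\vec a,\vec v)=\sum_{k=1}^{n-1}e^{-(a_{k+1}-a_k)}+\sum_{k=1}^nv_k^2$. For $\boldsymbol\phi_0\in\mathcal E_{1,(-1)^n}$, $\mathbf d(\boldsymbol\phi_0)=\inf_{(\vec a,\vec v)}\big(\|\boldsymbol\phi_0-\boldsymbol H(\vec a,\vec v)\|_{\mathcal E}^2+\rho(\vec a,\vec v)\big)$ (for $n=0$, $\boldsymbol H(\vec a,\vec v)=\boldsymbol 1$ and $\rho=0$). *)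

theory Defs
  imports "HOL-Analysis.Analysis"
begin

section \<open>Smooth functions and weak derivatives\<close>

fun times_cont_diff :: "nat \<Rightarrow> ('a::euclidean_space \<Rightarrow> real) \<Rightarrow> bool" where
  "times_cont_diff 0 f \<longleftrightarrow> continuous_on UNIV f"
| "times_cont_diff (Suc k) f \<longleftrightarrow>
     (\<forall>z. f differentiable (at z)) \<and> (\<forall>h. times_cont_diff k (\<lambda>z. frechet_derivative f (at z) h))"

definition smooth :: "('a::euclidean_space \<Rightarrow> real) \<Rightarrow> bool" where
  "smooth f \<longleftrightarrow> (\<forall>k. times_cont_diff k f)"

definition test_function :: "('a::euclidean_space \<Rightarrow> real) \<Rightarrow> bool" where
  "test_function \<psi> \<longleftrightarrow> smooth \<psi> \<and> compact (closure {z. \<psi> z \<noteq> 0})"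

definition locally_integrable :: "(real \<Rightarrow> real) \<Rightarrow> bool" where
  "locally_integrable f \<longleftrightarrow> (\<forall>a b. set_integrable lborel {a..b} f)"

definition has_weak_derivative :: "(real \<Rightarrow> real) \<Rightarrow> (real \<Rightarrow> real) \<Rightarrow> bool" where
  "has_weak_derivative f g \<longleftrightarrow> locally_integrable f \<and> locally_integrable g \<and>
     (\<forall>\<psi>. test_function \<psi> \<longrightarrow> (LBINT x. f x * deriv \<psi> x) = - (LBINT x. g x * \<psi> x))"

text \<open>The weak derivative is unique only up to null sets; below it occurs only inside integrals.\<close>

definition weak_deriv :: "(real \<Rightarrow> real) \<Rightarrow> real \<Rightarrow> real" where
  "weak_deriv f = (SOME g. has_weak_derivative f g)"


section \<open>States and energy\<close>

text \<open>
  A state is a pair of functions. The first component is always the continuous representative, so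
  that it can be evaluated at points; the second one is a Borel representative of a class of
  functions modulo null sets. Energies and squared norms take values in the extended nonnegative
  reals, so that no integrability side conditions are needed to make sense of them.
\<close>

type_synonym state = "(real \<Rightarrow> real) \<times> (real \<Rightarrow> real)"

definition potential_energy :: "(real \<Rightarrow> real) \<Rightarrow> (real \<Rightarrow> real) \<Rightarrow> ennreal" where
  "potential_energy U f = (\<integral>\<^sup>+x. ennreal ((weak_deriv f x)\<^sup>2 / 2 + U (f x)) \<partial>lborel)"

definition energy :: "(real \<Rightarrow> real) \<Rightarrow> state \<Rightarrow> ennreal" where
  "energy U u = potential_energy U (fst u) + (\<integral>\<^sup>+x. ennreal ((snd u x)\<^sup>2 / 2) \<partial>lborel)"

definition energy_sector :: "(real \<Rightarrow> real) \<Rightarrow> real \<Rightarrow> real \<Rightarrow> state set" where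
  "energy_sector U l r = {u.
     continuous_on UNIV (fst u) \<and> (\<exists>g. has_weak_derivative (fst u) g) \<and>
     snd u \<in> borel_measurable borel \<and> energy U u < \<infinity> \<and>
     (fst u \<longlongrightarrow> l) at_bot \<and> (fst u \<longlongrightarrow> r) at_top}"

text \<open>
  The square of the norm of \<open>H\<^sup>1 \<times> L\<^sup>2\<close>. It is only applied to differences of two states from the
  same sector, whose first component is weakly differentiable.
\<close>

definition sqnorm_HL :: "state \<Rightarrow> ennreal" where
  "sqnorm_HL u =
     (\<integral>\<^sup>+x. ennreal ((fst u x)\<^sup>2 + (weak_deriv (fst u) x)\<^sup>2) \<partial>lborel) +
     (\<integral>\<^sup>+x. ennreal ((snd u x)\<^sup>2) \<partial>lborel)"


section \<open>Solutions\<close>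

text \<open>
  The pairings with a space-time test function \<open>\<psi>\<close> are iterated integrals, with space as the inner
  variable: the second component is a continuous curve in \<open>L\<^sup>2\<close>, and an arbitrary choice of
  representatives at each time need not be jointly measurable.
\<close>

definition weak_solution :: "(real \<Rightarrow> real) \<Rightarrow> (real \<Rightarrow> state) \<Rightarrow> bool" where
  "weak_solution U u \<longleftrightarrow> (\<forall>\<psi> :: real \<times> real \<Rightarrow> real. test_function \<psi> \<longrightarrow>
     - (LBINT t. LBINT x. fst (u t) x * deriv (\<lambda>s. \<psi> (s, x)) t)
       = (LBINT t. LBINT x. snd (u t) x * \<psi> (t, x)) \<and>
     - (LBINT t. LBINT x. snd (u t) x * deriv (\<lambda>s. \<psi> (s, x)) t)
       = (LBINT t. LBINT x. fst (u t) x * (deriv ^^ 2) (\<lambda>y. \<psi> (t, y)) x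
                            - deriv U (fst (u t) x) * \<psi> (t, x)))"

definition solution :: "(real \<Rightarrow> real) \<Rightarrow> (real \<Rightarrow> state) \<Rightarrow> bool" where
  "solution U u \<longleftrightarrow>
     (\<exists>l \<in> {-1, 1}. \<exists>r \<in> {-1, 1}. \<forall>t. u t \<in> energy_sector U l r) \<and>
     (\<forall>t. ((\<lambda>s. sqnorm_HL (u s - u t)) \<longlongrightarrow> 0) (at t)) \<and>
     weak_solution U u"


section \<open>Kinks, kink clusters and the distance to multikinks\<close>

definition kink_inv :: "(real \<Rightarrow> real) \<Rightarrow> real \<Rightarrow> real" where
  "kink_inv U p = (LBINT y=0..p. 1 / sqrt (2 * U y))"

definition kink :: "(real \<Rightarrow> real) \<Rightarrow> real \<Rightarrow> real" where
  "kink U = inv_into {-1<..<1} (kink_inv U)"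

text \<open>The energy of a solution is conserved; the value at time 0 stands for it.\<close>

definition kink_cluster :: "(real \<Rightarrow> real) \<Rightarrow> nat \<Rightarrow> (real \<Rightarrow> state) \<Rightarrow> bool" where
  "kink_cluster U n u \<longleftrightarrow>
     energy U (u 0) \<le> of_nat n * potential_energy U (kink U) \<and>
     (\<exists>x :: nat \<Rightarrow> real \<Rightarrow> real.
        (\<forall>t. \<forall>k<n. x k t \<le> x (Suc k) t) \<and>
        (\<forall>k\<le>n. ((\<lambda>t. fst (u t) (x k t)) \<longlongrightarrow> (-1) ^ k) at_top))"

definition lorentz :: "real \<Rightarrow> real" where
  "lorentz v = 1 / sqrt (1 - v\<^sup>2)"

definition boosted_kink :: "(real \<Rightarrow> real) \<Rightarrow> real \<Rightarrow> real \<Rightarrow> real \<Rightarrow> real" where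
  "boosted_kink U a v x = kink U (lorentz v * (x - a))"

text \<open>
  Parameter vectors of length \<open>n\<close> are functions on \<^typ>\<open>nat\<close> of which only the values at
  \<open>1, \<dots>, n\<close> are used.
\<close>

definition multikink :: "(real \<Rightarrow> real) \<Rightarrow> nat \<Rightarrow> (nat \<Rightarrow> real) \<Rightarrow> (nat \<Rightarrow> real) \<Rightarrow> state" where
  "multikink U n a v =
     ((\<lambda>x. 1 + (\<Sum>k=1..n. (-1) ^ k * (boosted_kink U (a k) (v k) x + 1))),
      (\<lambda>x. \<Sum>k=1..n. (-1) ^ k * (- v k * deriv (boosted_kink U (a k) (v k)) x)))"

definition interaction :: "nat \<Rightarrow> (nat \<Rightarrow> real) \<Rightarrow> (nat \<Rightarrow> real) \<Rightarrow> real" where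
  "interaction n a v =
     (\<Sum>k\<in>{1..<n}. exp (- (a (Suc k) - a k))) + (\<Sum>k=1..n. (v k)\<^sup>2)"

definition multikink_dist :: "(real \<Rightarrow> real) \<Rightarrow> nat \<Rightarrow> state \<Rightarrow> ennreal" where
  "multikink_dist U n u =
     (INF (a, v) \<in> {(a, v). (\<forall>k\<in>{1..<n}. a k \<le> a (Suc k)) \<and> (\<forall>k\<in>{1..n}. \<bar>v k\<bar> < 1)}.
        sqnorm_HL (u - multikink U n a v) + ennreal (interaction n a v))"

end

theory Submission
  imports Defs
begin

text \<open>
  Both directions compare the energy of a state with the number of its transitions between the two
  vacua \<open>1\<close> and \<open>-1\<close>. Let \<open>W\<close> be a primitive of \<open>sqrt (2 * U)\<close>. Completing the square in the
  energy density gives the Bogomolny identity (\<open>bogomolny\<close>): on an interval, the potential energy is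
  \<open>\<plusminus>\<close> the increment of \<open>W\<close> along the state plus half the squared \<open>L\<^sup>2\<close> norm of the defect in the
  first-order equation \<open>f' = \<plusminus> sqrt (2 * U f)\<close> of the kink. So a transition costs at least
  \<open>W 1 - W (-1)\<close>, which is the energy of a kink, and a transition that costs hardly more has a small
  defect.

  Suppose that the state is close to alternating vacua at \<open>n + 1\<close> ordered points and has energy at most
  \<open>n\<close> times that of a kink. Then each of the \<open>n\<close> transitions has a small defect, and Gronwall's
  inequality shows that the state follows a translated kink on a long window around a zero
  (\<open>transition\<close>). The \<open>n\<close> windows already carry nearly all the energy. Outside of them the potential
  energy and everywhere the kinetic energy are therefore small, the state cannot leave the vacuum
  that it visits there, and near a vacuum \<open>U\<close> controls the squared distance because \<open>U''\<close> is
  \<open>1\<close>. Hence the state is close in \<open>H\<^sup>1 \<times> L\<^sup>2\<close> to a multikink with zero velocities and its limits at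
  infinity are forced (\<open>cluster_near_multikink\<close>).

  Conversely, let the state be close to a multikink with slow and widely separated kinks. At every
  point at most one of the kinks is away from its limits; the others contribute only tails that are
  small in \<open>L\<^sup>2\<close>. So the energy is at most \<open>n\<close> times that of a kink up to a small error
  (\<open>energy_near_multikink\<close>), and the points half way between neighbouring kinks, together with one
  point far out on each side, see the alternating vacua (\<open>value_at_cluster_point\<close>).

  Both arguments work at a fixed late time, whereas the bound in the definition of a cluster is
  imposed at time \<open>0\<close>. The link is conservation of energy for solutions that are merely continuous with
  values in the energy space (\<open>energy_conserved\<close>). Such a solution may not be differentiated, so
  the energy identity cannot be obtained by testing with the time derivative. Write \<open>w\<close> for the
  displacement from the initial profile and \<open>p\<close> for the velocity. The pairing of \<open>p t\<close> with \<open>w s\<close> is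
  a \<open>C\<^sup>1\<close> function of the \<^emph>\<open>two\<close> times, since each equation may be tested with a state at another time. Its
  antisymmetrisation \<open>D (t, s)\<close> vanishes for \<open>t = s\<close>; there its derivative in \<open>s\<close> is twice the
  kinetic energy plus the squared norm of the slope, up to terms with an explicit primitive, while the
  derivative of \<open>D (\<tau>, \<tau> + h)\<close> in \<open>\<tau>\<close> contains only terms without derivatives. Division by \<open>h\<close>
  and the trapezoidal rule for \<open>U\<close> give the conservation law as \<open>h\<close> tends to \<open>0\<close>.

  The analysis rests on one fact about weak derivatives: a continuous function on the line has the weak
  derivative \<open>g\<close> if and only if it is an indefinite integral of \<open>g\<close> (\<open>weak_imp_ac\<close> and \<open>ac_imp_weak\<close>). This
  turns distributional statements in space and in time into identities between integrals, and it makes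
  the chain rule, the product rule and the embedding of \<open>H\<^sup>1\<close> into bounded functions elementary.
\<close>

section \<open>Smooth functions and smooth cutoffs\<close>

lemma ex_antideriv:
  fixes m' :: "real \<Rightarrow> real"
  assumes "continuous_on UNIV m'"
  obtains F where "\<And>x. (F has_real_derivative m' x) (at x)"
proof -
  have "isCont m' x" for x using assms by (simp add: continuous_on_eq_continuous_at)
  then show ?thesis
    using einterval_antiderivative[of "-\<infinity>" "\<infinity>" m'] that
    by (auto simp: has_real_derivative_iff_has_vector_derivative)
qed

lemma times_cont_diff_const: "times_cont_diff k (\<lambda>z. c)"
  by (induction k arbitrary: c) (auto simp: frechet_derivative_const)

lemma times_cont_diff_cmult:
  "times_cont_diff k f \<Longrightarrow> times_cont_diff k (\<lambda>z. c * f z)"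
proof (induction k arbitrary: f)
  case 0
  then show ?case by (auto intro: continuous_intros)
next
  case (Suc k)
  have "frechet_derivative (\<lambda>z. c * f z) (at z) h = c * frechet_derivative f (at z) h" for z h
  proof -
    have "(f has_derivative frechet_derivative f (at z)) (at z)"
      using Suc.prems by (simp add: frechet_derivative_works)
    from frechet_derivative_at[OF has_derivative_mult_right[OF this, of c]]
    show ?thesis by metis
  qed
  with Suc show ?case by (auto intro: differentiable_mult differentiable_const)
qed

lemma times_cont_diff_add:
  "times_cont_diff k f \<Longrightarrow> times_cont_diff k g \<Longrightarrow> times_cont_diff k (\<lambda>z. f z + g z)"
proof (induction k arbitrary: f g)
  case 0
  then show ?case by (auto intro: continuous_intros)
next
  case (Suc k)
  have "frechet_derivative (\<lambda>z. f z + g z) (at z) h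
      = frechet_derivative f (at z) h + frechet_derivative g (at z) h" for z h
  proof -
    have "(f has_derivative frechet_derivative f (at z)) (at z)"
      "(g has_derivative frechet_derivative g (at z)) (at z)"
      using Suc.prems by (simp_all add: frechet_derivative_works)
    from frechet_derivative_at[OF has_derivative_add[OF this]]
    show ?thesis by metis
  qed
  with Suc show ?case by auto
qed

lemma frechet_derivative_real:
  fixes f :: "real \<Rightarrow> real"
  assumes "(f has_real_derivative D) (at x)"
  shows "frechet_derivative f (at x) h = h * D"
  using assms frechet_derivative_at[of f "(*) D" x] by (simp add: has_field_derivative_def mult.commute)

text \<open>
  On the line the directional derivatives are multiples of the ordinary one, so the recursion in
  \<^const>\<open>times_cont_diff\<close> reduces to a recursion along \<^const>\<open>deriv\<close>.
\<close>

lemma times_cont_diff_SucI: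
  fixes f :: "real \<Rightarrow> real"
  assumes "\<And>x. (f has_real_derivative f' x) (at x)" "times_cont_diff k f'"
  shows "times_cont_diff (Suc k) f"
proof -
  have "frechet_derivative f (at x) h = h * f' x" for x h
    by (rule frechet_derivative_real[OF assms(1)])
  then show ?thesis
    using assms times_cont_diff_cmult
    by (auto simp: real_differentiable_def intro!: differentiableI[OF has_field_derivative_imp_has_derivative])
qed

lemma times_cont_diff_SucD:
  fixes f :: "real \<Rightarrow> real"
  assumes "times_cont_diff (Suc k) f"
  shows "(f has_real_derivative deriv f x) (at x)" and "times_cont_diff k (deriv f)"
proof -
  have d: "(f has_real_derivative deriv f x) (at x)" for x
    using assms by (simp add: DERIV_deriv_iff_real_differentiable)
  show "(f has_real_derivative deriv f x) (at x)" by (rule d)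
  have "times_cont_diff k (\<lambda>z. frechet_derivative f (at z) 1)"
    using assms by simp
  moreover have "(\<lambda>z. frechet_derivative f (at z) 1) = deriv f"
    using frechet_derivative_real[OF d] by fastforce
  ultimately show "times_cont_diff k (deriv f)" by simp
qed

lemma times_cont_diff_mono:
  fixes f :: "real \<Rightarrow> real"
  assumes "times_cont_diff (Suc k) f"
  shows "times_cont_diff k f"
  using assms
proof (induction k arbitrary: f)
  case 0
  have "isCont f x" for x
    using times_cont_diff_SucD(1)[OF 0, of x] by (rule DERIV_isCont)
  then show ?case by (simp add: continuous_on_eq_continuous_at)
next
  case (Suc k)
  show ?case
    using times_cont_diff_SucD(1)[OF Suc.prems] Suc.IH[OF times_cont_diff_SucD(2)[OF Suc.prems]]
    by (rule times_cont_diff_SucI)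
qed

lemma times_cont_diff_mult:
  fixes f g :: "real \<Rightarrow> real"
  assumes "times_cont_diff k f" "times_cont_diff k g"
  shows "times_cont_diff k (\<lambda>x. f x * g x)"
  using assms
proof (induction k arbitrary: f g)
  case 0
  then show ?case by (auto intro: continuous_intros)
next
  case (Suc k)
  note f = times_cont_diff_SucD[OF Suc.prems(1)] and g = times_cont_diff_SucD[OF Suc.prems(2)]
  note m = times_cont_diff_mono[OF Suc.prems(1)] times_cont_diff_mono[OF Suc.prems(2)]
  show ?case
  proof (rule times_cont_diff_SucI)
    show "((\<lambda>x. f x * g x) has_real_derivative deriv f x * g x + deriv g x * f x) (at x)" for x
      by (rule DERIV_mult[OF f(1) g(1)])
    show "times_cont_diff k (\<lambda>x. deriv f x * g x + deriv g x * f x)"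
      by (intro times_cont_diff_add Suc.IH f g m)
  qed
qed

lemma times_cont_diff_affine:
  fixes f :: "real \<Rightarrow> real"
  assumes "times_cont_diff k f"
  shows "times_cont_diff k (\<lambda>x. f (c * x + d))"
  using assms
proof (induction k arbitrary: f)
  case 0
  then show ?case by (auto intro!: continuous_on_compose2[of UNIV f] continuous_intros)
next
  case (Suc k)
  note f = times_cont_diff_SucD[OF Suc.prems(1)]
  show ?case
  proof (rule times_cont_diff_SucI)
    show "((\<lambda>x. f (c * x + d)) has_real_derivative c * deriv f (c * x + d)) (at x)" for x
      by (rule DERIV_chain'[OF _ f(1), THEN DERIV_cong]) (auto intro!: derivative_eq_intros)
    show "times_cont_diff k (\<lambda>x. c * deriv f (c * x + d))"
      by (intro times_cont_diff_cmult Suc.IH f)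
  qed
qed

lemma smooth_cmult: "smooth f \<Longrightarrow> smooth (\<lambda>x. c * f x)"
  by (simp add: smooth_def times_cont_diff_cmult)

lemma smooth_add: "smooth f \<Longrightarrow> smooth g \<Longrightarrow> smooth (\<lambda>x. f x + g x)"
  by (simp add: smooth_def times_cont_diff_add)

lemma smooth_diff: "smooth f \<Longrightarrow> smooth g \<Longrightarrow> smooth (\<lambda>x. f x - g x)"
  using smooth_add[of f "\<lambda>x. -1 * g x"] smooth_cmult[of g "-1"] by simp

lemma smooth_mult: "smooth f \<Longrightarrow> smooth g \<Longrightarrow> smooth (\<lambda>x. f x * g x)" for f g :: "real \<Rightarrow> real"
  by (simp add: smooth_def times_cont_diff_mult)

lemma smooth_affine: "smooth f \<Longrightarrow> smooth (\<lambda>x. f (c * x + d))" for f :: "real \<Rightarrow> real"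
  by (simp add: smooth_def times_cont_diff_affine)

lemma smooth_deriv: "smooth f \<Longrightarrow> smooth (deriv f)" for f :: "real \<Rightarrow> real"
  unfolding smooth_def using times_cont_diff_SucD(2) by blast

lemma smooth_has_deriv: "smooth f \<Longrightarrow> (f has_real_derivative deriv f x) (at x)" for f :: "real \<Rightarrow> real"
  unfolding smooth_def using times_cont_diff_SucD(1) by blast

lemma smooth_continuous: "smooth f \<Longrightarrow> continuous_on S f"
  unfolding smooth_def using times_cont_diff.simps(1) continuous_on_subset by blast

lemma smooth_antideriv:
  fixes f :: "real \<Rightarrow> real"
  assumes "\<And>x. (f has_real_derivative f' x) (at x)" "smooth f'"
  shows "smooth f"
  unfolding smooth_def
proof
  fix k
  have "times_cont_diff (Suc k) f"
    by (rule times_cont_diff_SucI[OF assms(1)]) (use assms(2) in \<open>simp add: smooth_def\<close>)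
  then show "times_cont_diff k f" by (rule times_cont_diff_mono)
qed

text \<open>
  The family is closed under differentiation up to linear combinations (\<open>flat_exp_deriv\<close>); this is
  why the powers of \<open>1 / x\<close> are included.
\<close>

definition flat_exp :: "nat \<Rightarrow> real \<Rightarrow> real" where
  "flat_exp m x = (if x > 0 then (1 / x) ^ m * exp (- (1 / x)) else 0)"

lemma flat_exp_tendsto: "((\<lambda>x. (1 / x) ^ m * exp (- (1 / x))) \<longlongrightarrow> 0) (at_right (0::real))"
proof -
  have "((\<lambda>y::real. y ^ m / exp y) \<longlongrightarrow> 0) at_top" by (rule tendsto_power_div_exp_0)
  then have "((\<lambda>y::real. y ^ m * exp (- y)) \<longlongrightarrow> 0) at_top" by (simp add: exp_minus divide_inverse)
  moreover have "filterlim (\<lambda>x::real. 1 / x) at_top (at_right 0)"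
    using filterlim_inverse_at_top_right by (simp add: inverse_eq_divide)
  ultimately show ?thesis by (rule filterlim_compose)
qed

lemma flat_exp_deriv:
  "(flat_exp m has_real_derivative (flat_exp (m + 2) x - of_nat m * flat_exp (m + 1) x)) (at x)"
proof -
  consider "x < 0" | "x > 0" | "x = 0" by linarith
  then show ?thesis
  proof cases
    case 1
    have "(flat_exp m has_real_derivative 0) (at x)"
      by (rule has_field_derivative_transform_within_open[of "\<lambda>_. 0" _ _ "{..<0}"])
         (use 1 in \<open>auto simp: flat_exp_def\<close>)
    then show ?thesis using 1 by (simp add: flat_exp_def)
  next
    case 2
    have "((\<lambda>x. (1 / x) ^ m * exp (- (1 / x))) has_real_derivative
       (1/x)^(m+2) * exp (- (1/x)) - of_nat m * ((1/x)^(m+1) * exp (- (1/x)))) (at x)"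
      using 2
    proof -
      have "((\<lambda>x. 1 / x) has_real_derivative - ((1/x)^2)) (at x)"
        using 2 by (auto intro!: derivative_eq_intros simp: power2_eq_square)
      from DERIV_power[OF this, of m]
      have p: "((\<lambda>x. (1/x) ^ m) has_real_derivative - of_nat m * (1/x) ^ (m+1)) (at x)"
      proof (rule DERIV_cong)
        have "real m * (- (q ^ 2) * q ^ (m - Suc 0)) = - real m * q ^ (m + 1)" for q :: real
          by (cases m) (auto simp: power2_eq_square algebra_simps)
        then show "real m * (- ((1/x)^2) * (1/x) ^ (m - Suc 0)) = - real m * (1/x) ^ (m + 1)" .
      qed
      have e: "((\<lambda>x. exp (- (1/x))) has_real_derivative (1/x)^2 * exp (- (1/x))) (at x)"
        using 2 by (auto intro!: derivative_eq_intros simp: power2_eq_square)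
      show ?thesis
        by (rule DERIV_cong[OF DERIV_mult[OF p e]]) (simp add: power2_eq_square algebra_simps)
    qed
    then have "(flat_exp m has_real_derivative
       (1/x)^(m+2) * exp (- (1/x)) - of_nat m * ((1/x)^(m+1) * exp (- (1/x)))) (at x)"
      by (rule has_field_derivative_transform_within_open[of _ _ _ "{0<..}"])
         (use 2 in \<open>auto simp: flat_exp_def\<close>)
    then show ?thesis using 2 by (simp add: flat_exp_def)
  next
    case 3
    have r: "((\<lambda>h. flat_exp m h / h) \<longlongrightarrow> 0) (at_right 0)"
    proof (rule Lim_transform_eventually[OF flat_exp_tendsto[of "Suc m"]])
      show "\<forall>\<^sub>F x in at_right 0. (1 / x) ^ Suc m * exp (- (1 / x)) = flat_exp m x / x"
        using eventually_at_right_less[of 0] by eventually_elim (auto simp: flat_exp_def)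
    qed
    have l: "((\<lambda>h. flat_exp m h / h) \<longlongrightarrow> 0) (at_left 0)"
    proof (rule Lim_transform_eventually[OF tendsto_const])
      show "\<forall>\<^sub>F x in at_left 0. 0 = flat_exp m x / x"
        by (auto simp: eventually_at_filter flat_exp_def)
    qed
    have "((\<lambda>h. flat_exp m h / h) \<longlongrightarrow> 0) (at 0)"
      using l r by (simp add: filterlim_split_at)
    then show ?thesis using 3 by (simp add: DERIV_def flat_exp_def)
  qed
qed

lemma smooth_flat_exp: "smooth (flat_exp m)"
  unfolding smooth_def
proof
  have cont: "continuous_on UNIV (flat_exp m)" for m
    by (intro continuous_at_imp_continuous_on ballI DERIV_isCont[OF flat_exp_deriv])
  show "times_cont_diff k (flat_exp m)" for k
  proof (induction k arbitrary: m)
    case 0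
    then show ?case using cont by simp
  next
    case (Suc k)
    have "times_cont_diff k (\<lambda>x. flat_exp (m + 2) x + (- of_nat m) * flat_exp (m + 1) x)"
      by (intro times_cont_diff_add times_cont_diff_cmult Suc)
    then show ?case by (intro times_cont_diff_SucI[OF flat_exp_deriv]) simp
  qed
qed

text \<open>
  A bump \<open>\<eta>\<close> of mass one and its primitive \<open>S\<close>, obtained from \<^term>\<open>flat_exp 0 x * flat_exp 0 (1 - x)\<close> by
  normalisation. All cutoffs and mollifiers below are rescalings of these two functions.
\<close>

lemma ex_smooth_step:
  obtains \<eta> S :: "real \<Rightarrow> real" where "smooth \<eta>" "\<And>x. \<eta> x \<ge> 0" "\<And>x. x \<le> 0 \<or> x \<ge> 1 \<Longrightarrow> \<eta> x = 0"
    "smooth S" "\<And>x. (S has_real_derivative \<eta> x) (at x)" "\<And>x. x \<le> 0 \<Longrightarrow> S x = 0" "\<And>x. x \<ge> 1 \<Longrightarrow> S x = 1"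
    "\<And>x. 0 \<le> S x" "\<And>x. S x \<le> 1"
proof -
  define b where "b = (\<lambda>x. flat_exp 0 x * flat_exp 0 ((-1) * x + 1))"
  have b: "smooth b" unfolding b_def by (intro smooth_mult smooth_affine smooth_flat_exp)
  have b0: "b x \<ge> 0" for x by (auto simp: b_def flat_exp_def)
  have bz: "b x = 0" if "x \<le> 0 \<or> x \<ge> 1" for x using that by (auto simp: b_def flat_exp_def)
  have bp: "b x > 0" if "0 < x" "x < 1" for x using that by (auto simp: b_def flat_exp_def)
  obtain F where F: "\<And>x. (F has_real_derivative b x) (at x)"
    by (rule ex_antideriv[OF smooth_continuous[OF b]]) blast
  have mono: "F x \<le> F y" if "x \<le> y" for x y
    using DERIV_nonneg_imp_nondecreasing[OF that, of F] F b0 by blast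
  have "F 0 < F 1"
    using DERIV_pos_imp_increasing_open[of 0 1 F] F bp
    by (metis DERIV_isCont continuous_at_imp_continuous_on zero_less_one)
  define c where "c = F 1 - F 0"
  have c: "c > 0" using \<open>F 0 < F 1\<close> by (simp add: c_def)
  have F0: "F x = F 0" if "x \<le> 0" for x
  proof (rule ccontr)
    assume "F x \<noteq> F 0"
    then have "x < 0" using that by (cases "x = 0") auto
    from MVT2[OF this, of F b] F obtain z where "z < 0" "F 0 - F x = (0 - x) * b z" by blast
    with bz[of z] \<open>F x \<noteq> F 0\<close> show False by auto
  qed
  have F1: "F x = F 1" if "x \<ge> 1" for x
  proof (rule ccontr)
    assume "F x \<noteq> F 1"
    then have "x > 1" using that by (cases "x = 1") auto
    from MVT2[OF this, of F b] F obtain z where "z > 1" "F x - F 1 = (x - 1) * b z" by blast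
    with bz[of z] \<open>F x \<noteq> F 1\<close> show False by auto
  qed
  define S where "S = (\<lambda>x. (F x - F 0) / c)"
  define \<eta> where "\<eta> = (\<lambda>x. (1 / c) * b x)"
  have S: "(S has_real_derivative \<eta> x) (at x)" for x
    unfolding S_def \<eta>_def using c by (auto intro!: derivative_eq_intros F)
  have \<eta>: "smooth \<eta>" unfolding \<eta>_def by (intro smooth_cmult b)
  show ?thesis
  proof (rule that[of \<eta> S])
    show "smooth S" by (rule smooth_antideriv[OF S \<eta>])
    show "\<eta> x \<ge> 0" for x using c b0 by (simp add: \<eta>_def)
    show "0 \<le> S x" for x
      using mono[of 0 x] F0[of x] c by (cases "x \<le> 0") (auto simp: S_def)
    show "S x \<le> 1" for x
      using mono[of x 1] F1[of x] c by (cases "x \<le> 1") (auto simp: S_def c_def)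
    show "smooth \<eta>" by (rule \<eta>)
    show "(S has_real_derivative \<eta> x) (at x)" for x by (rule S)
    show "\<eta> x = 0" if "x \<le> 0 \<or> x \<ge> 1" for x using bz[OF that] by (simp add: \<eta>_def)
    show "S x = 0" if "x \<le> 0" for x using F0[OF that] by (simp add: S_def)
    show "S x = 1" if "x \<ge> 1" for x using F1[OF that] c by (simp add: S_def c_def)
  qed
qed

text \<open>
  Test functions of product form separate the variables in the weak equation: the space factor is
  frozen and the time factor tests a scalar function of time.
\<close>

lemma test_function_product:
  fixes \<alpha> \<beta> :: "real \<Rightarrow> real"
  assumes "test_function \<alpha>" "test_function \<beta>"
  shows "test_function (\<lambda>z::real \<times> real. \<alpha> (fst z) * \<beta> (snd z))"
  unfolding test_function_def
proof
  have "times_cont_diff k (\<lambda>z. a (fst z) * b (snd z))" if "smooth a" "smooth b" for k and a b :: "real \<Rightarrow> real"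
    using that
  proof (induction k arbitrary: a b)
    case 0
    then show ?case
      by (auto intro!: continuous_intros continuous_on_compose2[OF smooth_continuous[of a UNIV]]
          continuous_on_compose2[OF smooth_continuous[of b UNIV]])
  next
    case (Suc k)
    have d: "((\<lambda>z. a (fst z) * b (snd z)) has_derivative
       (\<lambda>h. a (fst z) * (deriv b (snd z) * snd h) + (deriv a (fst z) * fst h) * b (snd z))) (at z)" for z
    proof (rule has_derivative_mult)
      have "(a has_derivative (*) (deriv a (fst z))) (at (fst z))"
        using smooth_has_deriv[OF Suc.prems(1)] by (simp add: has_field_derivative_def)
      from has_derivative_compose[OF bounded_linear_imp_has_derivative[OF bounded_linear_fst] this]
      show "((\<lambda>z. a (fst z)) has_derivative (\<lambda>h. deriv a (fst z) * fst h)) (at z)" by simp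
      have "(b has_derivative (*) (deriv b (snd z))) (at (snd z))"
        using smooth_has_deriv[OF Suc.prems(2)] by (simp add: has_field_derivative_def)
      from has_derivative_compose[OF bounded_linear_imp_has_derivative[OF bounded_linear_snd] this]
      show "((\<lambda>z. b (snd z)) has_derivative (\<lambda>h. deriv b (snd z) * snd h)) (at z)" by simp
    qed
    have e: "(\<lambda>z. frechet_derivative (\<lambda>z. a (fst z) * b (snd z)) (at z) h)
       = (\<lambda>z. snd h * (a (fst z) * deriv b (snd z)) + fst h * (deriv a (fst z) * b (snd z)))" for h
    proof
      show "frechet_derivative (\<lambda>z. a (fst z) * b (snd z)) (at z) h
        = snd h * (a (fst z) * deriv b (snd z)) + fst h * (deriv a (fst z) * b (snd z))" for z
        using fun_cong[OF frechet_derivative_at[OF d, symmetric], of z h] by (simp add: algebra_simps)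
    qed
    have "times_cont_diff k (\<lambda>z. snd h * (a (fst z) * deriv b (snd z)) + fst h * (deriv a (fst z) * b (snd z)))" for h
      by (intro times_cont_diff_add times_cont_diff_cmult Suc.IH smooth_deriv Suc.prems)
    moreover have "(\<lambda>z. a (fst z) * b (snd z)) differentiable (at z)" for z
      unfolding differentiable_def using d[of z] by blast
    ultimately show ?case by (simp only: times_cont_diff.simps(2) e) blast
  qed
  then show "smooth (\<lambda>z. \<alpha> (fst z) * \<beta> (snd z))"
    using assms by (simp add: smooth_def test_function_def)
  let ?A = "closure {z. \<alpha> z \<noteq> 0}" let ?B = "closure {z. \<beta> z \<noteq> 0}"
  have "compact (?A \<times> ?B)" using assms by (auto simp: test_function_def intro: compact_Times)
  moreover have "closure {z. \<alpha> (fst z) * \<beta> (snd z) \<noteq> 0} \<subseteq> ?A \<times> ?B"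
    by (rule closure_minimal) (use closure_subset in \<open>fastforce intro!: closed_Times\<close>)+
  ultimately have "compact ((?A \<times> ?B) \<inter> closure {z. \<alpha> (fst z) * \<beta> (snd z) \<noteq> 0})"
    by (intro compact_Int_closed) auto
  then show "compact (closure {z. \<alpha> (fst z) * \<beta> (snd z) \<noteq> 0})"
    using \<open>closure {z. \<alpha> (fst z) * \<beta> (snd z) \<noteq> 0} \<subseteq> ?A \<times> ?B\<close> by (simp add: Int_absorb1)
qed

lemma test_functionI:
  fixes \<psi> :: "real \<Rightarrow> real"
  assumes "smooth \<psi>" "\<And>x. x < a \<or> x > b \<Longrightarrow> \<psi> x = 0"
  shows "test_function \<psi>"
proof -
  have "{z. \<psi> z \<noteq> 0} \<subseteq> {a..b}" using assms(2) by force
  then have "bounded {z. \<psi> z \<noteq> 0}" using bounded_closed_interval bounded_subset by blast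
  with assms(1) show ?thesis by (simp add: test_function_def)
qed

lemma test_function_support:
  fixes \<psi> :: "real \<Rightarrow> real"
  assumes "test_function \<psi>"
  obtains R where "R > 0" "\<And>x. \<bar>x\<bar> \<ge> R \<Longrightarrow> \<psi> x = 0" "\<And>x. \<bar>x\<bar> \<ge> R \<Longrightarrow> deriv \<psi> x = 0"
proof -
  have "bounded {z. \<psi> z \<noteq> 0}" 
    using assms bounded_subset[OF compact_imp_bounded closure_subset] by (auto simp: test_function_def)
  then obtain r where r: "r > 0" "\<And>x. \<psi> x \<noteq> 0 \<Longrightarrow> \<bar>x\<bar> \<le> r" by (auto simp: bounded_pos)
  have "deriv \<psi> x = 0" if "\<bar>x\<bar> \<ge> r + 1" for x
  proof -
    have "(\<psi> has_real_derivative 0) (at x)"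
      by (rule has_field_derivative_transform_within_open[of "\<lambda>_. 0" _ _ "- {-r..r}"])
         (use r that in \<open>force+\<close>)
    then show ?thesis by (rule DERIV_imp_deriv)
  qed
  moreover have "\<psi> x = 0" if "\<bar>x\<bar> \<ge> r + 1" for x using r(2)[of x] that by auto
  ultimately show ?thesis using that[of "r + 1"] r by auto
qed

lemma test_function_deriv:
  fixes \<psi> :: "real \<Rightarrow> real"
  assumes "test_function \<psi>"
  shows "test_function (deriv \<psi>)"
proof -
  obtain R where "\<And>x. \<bar>x\<bar> \<ge> R \<Longrightarrow> deriv \<psi> x = 0" by (rule test_function_support[OF assms]) blast
  moreover have "smooth (deriv \<psi>)" using assms by (simp add: test_function_def smooth_deriv)
  ultimately show ?thesis using test_functionI[of "deriv \<psi>" "-R" R] by force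
qed

section \<open>Weak derivatives on the line\<close>

lemma locally_integrable_measurable:
  assumes "locally_integrable g"
  shows "g \<in> borel_measurable borel"
proof (rule borel_measurable_LIMSEQ_real)
  show "(\<lambda>x. indicator {- real n..real n} x * g x) \<in> borel_measurable borel" for n
  proof -
    have "set_integrable lborel {- real n..real n} g"
      using assms unfolding locally_integrable_def by blast
    then have "(\<lambda>x. indicator {- real n..real n} x * g x) \<in> borel_measurable lborel"
      unfolding set_integrable_def by (simp add: borel_measurable_integrable)
    then show ?thesis by simp
  qed
  show "(\<lambda>n. indicator {- real n..real n} x * g x) \<longlonglongrightarrow> g x" for x
  proof (rule tendsto_eventually)
    obtain N where "\<bar>x\<bar> \<le> real N" using real_arch_simple by blast
    then show "\<forall>\<^sub>F n in sequentially. indicator {- real n..real n} x * g x = g x"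
      by (intro eventually_sequentiallyI[of N]) (auto simp: indicator_def)
  qed
qed

lemma locally_integrable_continuous:
  "continuous_on UNIV f \<Longrightarrow> locally_integrable f"
  unfolding locally_integrable_def
  by (auto intro!: borel_integrable_atLeastAtMost' intro: continuous_on_subset)

lemma locally_integrable_add:
  "locally_integrable f \<Longrightarrow> locally_integrable g \<Longrightarrow> locally_integrable (\<lambda>x. f x + g x)"
  by (simp add: locally_integrable_def)

lemma locally_integrable_diff:
  "locally_integrable f \<Longrightarrow> locally_integrable g \<Longrightarrow> locally_integrable (\<lambda>x. f x - g x)"
  by (simp add: locally_integrable_def)

lemma locally_integrable_cmult:
  "locally_integrable f \<Longrightarrow> locally_integrable (\<lambda>x. c * f x)"
  by (simp add: locally_integrable_def)

lemma locally_integrable_abs: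
  "locally_integrable f \<Longrightarrow> locally_integrable (\<lambda>x. \<bar>f x\<bar>)"
  by (simp add: locally_integrable_def set_integrable_abs)

lemma integrable_imp_locally: "integrable lborel f \<Longrightarrow> locally_integrable f" for f :: "real \<Rightarrow> real"
  unfolding locally_integrable_def set_integrable_def by (intro allI integrable_mult_indicator) auto

lemma bounded_on_Icc:
  fixes f :: "real \<Rightarrow> real"
  assumes "continuous_on UNIV f"
  obtains K where "K > 0" "\<And>x. x \<in> {a..b} \<Longrightarrow> \<bar>f x\<bar> \<le> K"
proof -
  have "compact (f ` {a..b})"
    using assms by (intro compact_continuous_image) (auto intro: continuous_on_subset)
  then obtain K where "K > 0" "\<forall>y\<in>f ` {a..b}. norm y \<le> K"
    using compact_imp_bounded bounded_pos by metis
  then show ?thesis using that[of K] by auto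
qed

lemma locally_integrable_mult:
  assumes "continuous_on UNIV f" "locally_integrable g"
  shows "locally_integrable (\<lambda>x. f x * g x)"
  unfolding locally_integrable_def
proof (intro allI)
  fix a b :: real
  have [measurable]: "f \<in> borel_measurable borel" "g \<in> borel_measurable borel"
    using assms by (auto simp: locally_integrable_measurable borel_measurable_continuous_onI)
  obtain K where K: "\<And>x. x \<in> {a..b} \<Longrightarrow> \<bar>f x\<bar> \<le> K"
    using bounded_on_Icc[OF assms(1)] by metis
  have i: "integrable lborel (\<lambda>x. K * \<bar>indicator {a..b} x * g x\<bar>)"
    using assms(2) by (auto simp: locally_integrable_def set_integrable_def)
  have "integrable lborel (\<lambda>x. indicator {a..b} x * (f x * g x))"
  proof (rule Bochner_Integration.integrable_bound[OF i])
    show "AE x in lborel. norm (indicator {a..b} x * (f x * g x)) \<le> norm (K * \<bar>indicator {a..b} x * g x\<bar>)"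
    proof (rule AE_I2)
      fix x show "norm (indicator {a..b} x * (f x * g x)) \<le> norm (K * \<bar>indicator {a..b} x * g x\<bar>)"
        using mult_right_mono[OF K[of x] abs_ge_zero[of "g x"]] K[of x]
        by (cases "x \<in> {a..b}") (auto simp: abs_mult)
    qed
  qed simp
  then show "set_integrable lborel {a..b} (\<lambda>x. f x * g x)"
    by (simp add: set_integrable_def)
qed

lemma set_integral_Icc_split:
  fixes g :: "real \<Rightarrow> real"
  assumes "locally_integrable g" "a \<le> b" "b \<le> c"
  shows "(LBINT x:{a..c}. g x) = (LBINT x:{a..b}. g x) + (LBINT x:{b..c}. g x)"
proof -
  have "{a..c} = {a..b} \<union> {b..c}" using assms by auto
  moreover have "AE x in lborel. \<not> (x \<in> {a..b} \<and> x \<in> {b..c})"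
    using AE_lborel_singleton[of b] by eventually_elim auto
  ultimately show ?thesis
    using assms(1) set_integral_Un_AE[where A = "{a..b}" and B = "{b..c}" and M = lborel and f = g]
    by (simp add: locally_integrable_def)
qed

lemma abs_set_integral_le:
  fixes g :: "real \<Rightarrow> real"
  assumes "locally_integrable g"
  shows "\<bar>LBINT x:{a..b}. g x\<bar> \<le> (LBINT x:{a..b}. \<bar>g x\<bar>)"
  using integral_norm_bound[of lborel "\<lambda>x. indicator {a..b} x * g x"]
  by (simp add: set_lebesgue_integral_def abs_mult)

lemma set_integral_FTC:
  fixes F f :: "real \<Rightarrow> real"
  assumes "\<And>x. (F has_real_derivative f x) (at x)" "continuous_on UNIV f" "a \<le> b"
  shows "(LBINT x:{a..b}. f x) = F b - F a"
  unfolding set_lebesgue_integral_def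
  using assms by (intro integral_FTC_atLeastAtMost)
   (auto intro: continuous_on_subset has_field_derivative_at_within simp flip: has_real_derivative_iff_has_vector_derivative)

lemma integral_eq_set_integral:
  fixes f :: "real \<Rightarrow> real"
  assumes "\<And>x. x \<notin> {a..b} \<Longrightarrow> f x = 0"
  shows "integral\<^sup>L lborel f = (LBINT x:{a..b}. f x)"
  unfolding set_lebesgue_integral_def
  by (rule Bochner_Integration.integral_cong) (use assms in \<open>auto simp: indicator_def\<close>)

text \<open>
  \<open>ac f g\<close> says that \<open>f\<close> is locally absolutely continuous with density \<open>g\<close>.
\<close>

definition ac :: "(real \<Rightarrow> real) \<Rightarrow> (real \<Rightarrow> real) \<Rightarrow> bool" where
  "ac f g \<longleftrightarrow> continuous_on UNIV f \<and> locally_integrable g \<and>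
     (\<forall>a b. a \<le> b \<longrightarrow> f b - f a = (LBINT x:{a..b}. g x))"

lemma ac_cont: "ac f g \<Longrightarrow> continuous_on S f"
  unfolding ac_def by (auto intro: continuous_on_subset)

lemma ac_loc: "ac f g \<Longrightarrow> locally_integrable g"
  by (simp add: ac_def)

lemma ac_measurable: "ac f g \<Longrightarrow> f \<in> borel_measurable borel" "ac f g \<Longrightarrow> g \<in> borel_measurable borel"
  by (auto simp: ac_def locally_integrable_measurable borel_measurable_continuous_onI)

lemma ac_FTC: "ac f g \<Longrightarrow> a \<le> b \<Longrightarrow> f b - f a = (LBINT x:{a..b}. g x)"
  by (simp add: ac_def)

lemma ac_add: "ac f g \<Longrightarrow> ac f2 g2 \<Longrightarrow> ac (\<lambda>x. f x + f2 x) (\<lambda>x. g x + g2 x)"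
  by (auto simp: ac_def locally_integrable_add intro!: continuous_intros)
     (simp add: locally_integrable_def add_diff_add)

lemma ac_diff: "ac f g \<Longrightarrow> ac f2 g2 \<Longrightarrow> ac (\<lambda>x. f x - f2 x) (\<lambda>x. g x - g2 x)"
  by (auto simp: ac_def locally_integrable_diff intro!: continuous_intros)
     (simp add: locally_integrable_def diff_diff_eq2 algebra_simps)

lemma ac_cmult: "ac f g \<Longrightarrow> ac (\<lambda>x. c * f x) (\<lambda>x. c * g x)"
  by (auto simp: ac_def locally_integrable_cmult right_diff_distrib[symmetric] intro!: continuous_intros)

lemma ac_C1:
  assumes "\<And>x. (f has_real_derivative f' x) (at x)" "continuous_on UNIV f'"
  shows "ac f f'"
  unfolding ac_def using assms set_integral_FTC[OF assms]
  by (auto simp: locally_integrable_continuous intro!: continuous_at_imp_continuous_on DERIV_isCont)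

text \<open>
  The mean value theorem for \<open>W\<close> gives an intermediate value between \<open>f a\<close> and \<open>f b\<close>, which \<open>f\<close>
  attains on the interval.
\<close>

lemma chain_mvt:
  fixes f W w :: "real \<Rightarrow> real"
  assumes W: "\<And>y. (W has_real_derivative w y) (at y)" and f: "continuous_on UNIV f" and ab: "a \<le> b"
  obtains y where "a \<le> y" "y \<le> b" "W (f b) - W (f a) = w (f y) * (f b - f a)"
proof (cases "f a = f b")
  case True
  then show ?thesis using that[of a] ab by simp
next
  case False
  have *: "\<exists>z. min (f a) (f b) \<le> z \<and> z \<le> max (f a) (f b) \<and> W (f b) - W (f a) = w z * (f b - f a)"
  proof (cases "f a < f b")
    case True
    from MVT2[OF this, of W w] W obtain z where "f a < z" "z < f b" "W (f b) - W (f a) = (f b - f a) * w z" by blast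
    then show ?thesis by (intro exI[of _ z]) (auto simp: mult.commute)
  next
    case False
    then have "f b < f a" using \<open>f a \<noteq> f b\<close> by simp
    from MVT2[OF this, of W w] W obtain z where "f b < z" "z < f a" "W (f a) - W (f b) = (f a - f b) * w z" by blast
    then show ?thesis by (intro exI[of _ z]) (auto simp: algebra_simps)
  qed
  then obtain z where z: "min (f a) (f b) \<le> z" "z \<le> max (f a) (f b)" "W (f b) - W (f a) = w z * (f b - f a)"
    by blast
  have c: "continuous_on {a..b} f" using f continuous_on_subset by blast
  have "\<exists>y. a \<le> y \<and> y \<le> b \<and> f y = z"
    using IVT'[of f a z b] IVT2'[of f b z a] z c ab by (cases "f a \<le> f b") auto
  with z that show ?thesis by metis
qed

text \<open>
  On a short interval the increment of \<open>W \<circ> f\<close> is \<open>w (f y)\<close> times the integral of \<open>g\<close> for some \<open>y\<close> in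
  the interval, and \<open>w \<circ> f\<close> hardly varies there. So the error is at most \<open>e\<close> times the integral of \<open>\<bar>g\<bar>\<close>; such
  bounds add up over adjacent intervals, and \<open>e\<close> is arbitrary.
\<close>

lemma ac_chain:
  assumes W: "\<And>y. (W has_real_derivative w y) (at y)" and w: "continuous_on UNIV w" and fg: "ac f g"
  shows "ac (\<lambda>x. W (f x)) (\<lambda>x. w (f x) * g x)"
proof -
  have cf: "continuous_on UNIV f" and lg: "locally_integrable g" using fg by (auto simp: ac_def)
  have cW: "continuous_on UNIV W" using W by (intro continuous_at_imp_continuous_on ballI DERIV_isCont)
  have cwf: "continuous_on UNIV (\<lambda>x. w (f x))" by (rule continuous_on_compose2[OF w cf]) simp
  have lwg: "locally_integrable (\<lambda>x. w (f x) * g x)" by (rule locally_integrable_mult[OF cwf lg])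
  have lag: "locally_integrable (\<lambda>x. \<bar>g x\<bar>)" by (rule locally_integrable_abs[OF lg])
  have main: "\<bar>W (f b) - W (f a) - (LBINT x:{a..b}. w (f x) * g x)\<bar> \<le> e * (LBINT x:{a..b}. \<bar>g x\<bar>)"
    if "a \<le> b" "e > 0" for a b e
    using \<open>a \<le> b\<close>
  proof (induction rule: Bolzano)
    case (trans a b c)
    show ?case
      using trans set_integral_Icc_split[OF lwg trans(3,4)] set_integral_Icc_split[OF lag trans(3,4)]
      by (simp add: distrib_left)
  next
    case (local x)
    have "isCont (\<lambda>x. w (f x)) x" using cwf by (simp add: continuous_on_eq_continuous_at)
    then obtain d where d: "d > 0" "\<And>y. \<bar>y - x\<bar> < d \<Longrightarrow> \<bar>w (f y) - w (f x)\<bar> < e / 2"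
      using \<open>e > 0\<close> unfolding continuous_at_eps_delta dist_real_def by (meson half_gt_zero)
    show ?case
    proof (intro exI[of _ d] conjI allI impI)
      show "d > 0" by fact
      fix a b assume ab: "a \<le> x \<and> x \<le> b \<and> b - a < d"
      then have le: "a \<le> b" by simp
      obtain y where y: "a \<le> y" "y \<le> b" "W (f b) - W (f a) = w (f y) * (f b - f a)"
        by (rule chain_mvt[OF W cf le])
      have i: "set_integrable lborel {a..b} g" "set_integrable lborel {a..b} (\<lambda>x. w (f x) * g x)"
        "set_integrable lborel {a..b} (\<lambda>x. \<bar>g x\<bar>)"
        using lg lwg lag by (auto simp: locally_integrable_def)
      have "W (f b) - W (f a) - (LBINT x:{a..b}. w (f x) * g x)
         = (LBINT x:{a..b}. w (f y) * g x - w (f x) * g x)"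
        using i y(3) ac_FTC[OF fg le] by simp
      also have "\<bar>\<dots>\<bar> \<le> (LBINT x:{a..b}. \<bar>w (f y) * g x - w (f x) * g x\<bar>)"
        by (intro abs_set_integral_le locally_integrable_diff locally_integrable_cmult lg lwg)
      also have "\<dots> \<le> (LBINT x:{a..b}. e * \<bar>g x\<bar>)"
      proof (rule set_integral_mono)
        show "set_integrable lborel {a..b} (\<lambda>x. \<bar>w (f y) * g x - w (f x) * g x\<bar>)"
          using i by (intro set_integrable_abs set_integral_diff set_integrable_mult_right) auto
        fix z assume z: "z \<in> {a..b}"
        have "\<bar>w (f y) - w (f x)\<bar> < e / 2" "\<bar>w (f z) - w (f x)\<bar> < e / 2"
          by (rule d(2); use ab y z in auto)+
        then have "\<bar>w (f y) - w (f z)\<bar> \<le> e" by linarith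
        then show "\<bar>w (f y) * g z - w (f z) * g z\<bar> \<le> e * \<bar>g z\<bar>"
          by (simp add: abs_mult mult_right_mono flip: left_diff_distrib)
      qed (use i in auto)
      finally show "\<bar>W (f b) - W (f a) - (LBINT x:{a..b}. w (f x) * g x)\<bar> \<le> e * (LBINT x:{a..b}. \<bar>g x\<bar>)"
        by simp
    qed
  qed
  have "W (f b) - W (f a) = (LBINT x:{a..b}. w (f x) * g x)" if "a \<le> b" for a b
  proof (rule ccontr)
    let ?d = "\<bar>W (f b) - W (f a) - (LBINT x:{a..b}. w (f x) * g x)\<bar>"
    let ?I = "(LBINT x:{a..b}. \<bar>g x\<bar>)"
    assume "\<not> ?thesis"
    then have d: "?d > 0" by simp
    have I: "?I \<ge> 0" by (simp add: set_lebesgue_integral_def)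
    have "?d \<le> (?d / 2 / (?I + 1)) * ?I" by (rule main[OF that]) (use d I in \<open>simp add: field_simps\<close>)
    also have "\<dots> \<le> ?d / 2" using I d by (simp add: field_simps)
    finally show False using d by simp
  qed
  moreover have "continuous_on UNIV (\<lambda>x. W (f x))" by (rule continuous_on_compose2[OF cW cf]) simp
  ultimately show ?thesis using lwg by (simp add: ac_def)
qed

lemma ac_square: "ac f g \<Longrightarrow> ac (\<lambda>x. (f x)\<^sup>2) (\<lambda>x. 2 * f x * g x)"
  by (rule ac_chain[of "\<lambda>y. y\<^sup>2" "\<lambda>y. 2 * y"]) (auto intro!: derivative_eq_intros continuous_intros)

text \<open>
  Polarisation reduces products to squares, which are covered by the chain rule.
\<close>

lemma ac_mult:
  assumes "ac f g" "ac f2 g2"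
  shows "ac (\<lambda>x. f x * f2 x) (\<lambda>x. f x * g2 x + f2 x * g x)"
proof -
  have "ac (\<lambda>x. 1/4 * ((f x + f2 x)\<^sup>2 - (f x - f2 x)\<^sup>2))
     (\<lambda>x. 1/4 * (2 * (f x + f2 x) * (g x + g2 x) - 2 * (f x - f2 x) * (g x - g2 x)))"
    by (intro ac_cmult ac_diff ac_square ac_add assms)
  then show ?thesis
    by (simp add: power2_eq_square algebra_simps)
qed

lemma ac_smooth: "smooth f \<Longrightarrow> ac f (deriv f)"
  by (intro ac_C1 smooth_has_deriv smooth_continuous smooth_deriv)

lemma ac_imp_weak:
  assumes "ac f g"
  shows "has_weak_derivative f g"
  unfolding has_weak_derivative_def
proof (intro conjI allI impI)
  show "locally_integrable f" "locally_integrable g"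
    using assms by (auto simp: ac_def locally_integrable_continuous)
  fix \<psi> :: "real \<Rightarrow> real" assume \<psi>: "test_function \<psi>"
  obtain R where R: "R > 0" "\<And>x. \<bar>x\<bar> \<ge> R \<Longrightarrow> \<psi> x = 0" "\<And>x. \<bar>x\<bar> \<ge> R \<Longrightarrow> deriv \<psi> x = 0"
    using test_function_support[OF \<psi>] by metis
  have s: "smooth \<psi>" using \<psi> by (simp add: test_function_def)
  have l: "locally_integrable (\<lambda>x. f x * deriv \<psi> x)" "locally_integrable (\<lambda>x. \<psi> x * g x)"
    using assms s by (auto intro: locally_integrable_mult locally_integrable_continuous smooth_continuous smooth_deriv simp: ac_def)
  have "0 = f R * \<psi> R - f (-R) * \<psi> (-R)" using R by simp
  also have "\<dots> = (LBINT x:{-R..R}. f x * deriv \<psi> x + \<psi> x * g x)"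
    by (rule ac_FTC[OF ac_mult[OF assms ac_smooth[OF s]]]) (use R in simp)
  also have "\<dots> = (LBINT x:{-R..R}. f x * deriv \<psi> x) + (LBINT x:{-R..R}. \<psi> x * g x)"
    using l by (simp add: locally_integrable_def)
  also have "(LBINT x:{-R..R}. f x * deriv \<psi> x) = (LBINT x. f x * deriv \<psi> x)"
    by (rule integral_eq_set_integral[symmetric]) (use R in auto)
  also have "(LBINT x:{-R..R}. \<psi> x * g x) = (LBINT x. \<psi> x * g x)"
    by (rule integral_eq_set_integral[symmetric]) (use R in auto)
  finally show "(LBINT x. f x * deriv \<psi> x) = - (LBINT x. g x * \<psi> x)" by (simp add: mult.commute)
qed

text \<open>
  Smooth approximations of the indicator function of an interval. Their derivatives are differences of
  two approximate identities, which is what extracts point values in the next two lemmas.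
\<close>

lemma ex_cutoff:
  fixes a b :: real
  assumes ab: "a \<le> b"
  obtains \<psi> :: "nat \<Rightarrow> real \<Rightarrow> real" and \<eta> :: "real \<Rightarrow> real" where
    "\<And>n. test_function (\<psi> n)" "\<And>n x. \<bar>\<psi> n x\<bar> \<le> 1" "\<And>n x. x \<notin> {a..b+1} \<Longrightarrow> \<psi> n x = 0"
    "\<And>x. x \<noteq> a \<Longrightarrow> x \<noteq> b \<Longrightarrow> (\<lambda>n. \<psi> n x) \<longlonglongrightarrow> indicator {a..b} x"
    "\<And>n x. deriv (\<psi> n) x = real (Suc n) * \<eta> (real (Suc n) * (x - a)) - real (Suc n) * \<eta> (real (Suc n) * (x - b))"
    "smooth \<eta>" "\<And>x. x \<notin> {0..1} \<Longrightarrow> \<eta> x = 0" "(LBINT x. \<eta> x) = 1"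
proof -
  obtain \<eta> S :: "real \<Rightarrow> real" where b: "smooth \<eta>" "\<And>x. \<eta> x \<ge> 0" "\<And>x. x \<le> 0 \<or> x \<ge> 1 \<Longrightarrow> \<eta> x = 0"
    "smooth S" "\<And>x. (S has_real_derivative \<eta> x) (at x)" "\<And>x. x \<le> 0 \<Longrightarrow> S x = 0" "\<And>x. x \<ge> 1 \<Longrightarrow> S x = 1"
    "\<And>x. 0 \<le> S x" "\<And>x. S x \<le> 1" by (rule ex_smooth_step) blast
  define \<psi> where "\<psi> n x = S (real (Suc n) * x + (- real (Suc n) * a)) - S (real (Suc n) * x + (- real (Suc n) * b))" for n x
  have S0: "S (real (Suc n) * x + (- real (Suc n) * c)) = 0" if "x \<le> c" for x c n
  proof (rule b(6))
    have "real (Suc n) * x \<le> real (Suc n) * c" using that by (intro mult_left_mono) auto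
    then show "real (Suc n) * x + (- real (Suc n) * c) \<le> 0" by linarith
  qed
  have S1: "S (real (Suc n) * x + (- real (Suc n) * c)) = 1" if "x \<ge> c + 1" for x c n
  proof (rule b(7))
    have "1 * 1 \<le> real (Suc n) * (x - c)" using that by (intro mult_mono) auto
    then show "1 \<le> real (Suc n) * x + (- real (Suc n) * c)" by (simp only: right_diff_distrib)
  qed
  have S1l: "(\<lambda>n. S (real (Suc n) * x + (- real (Suc n) * c))) \<longlonglongrightarrow> 1" if "x > c" for x c
  proof -
    have "filterlim (\<lambda>n. (x - c) * real (Suc n)) at_top sequentially"
      using that by (intro filterlim_tendsto_pos_mult_at_top[OF tendsto_const] filterlim_compose[OF filterlim_real_sequentially filterlim_Suc]) auto
    then have "\<forall>\<^sub>F n in sequentially. (x - c) * real (Suc n) \<ge> 1" by (simp only: filterlim_at_top)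
    then have "\<forall>\<^sub>F n in sequentially. S (real (Suc n) * x + (- real (Suc n) * c)) = 1"
    proof eventually_elim
      case (elim n)
      then show ?case by (intro b(7)) (simp add: algebra_simps)
    qed
    then show ?thesis by (rule tendsto_eventually)
  qed
  have supp: "\<psi> n x = 0" if "x \<notin> {a..b+1}" for n x
    using that ab S0[of x a n] S0[of x b n] S1[of a x n] S1[of b x n]
    by (cases "x < a") (auto simp: \<psi>_def)
  have sm: "smooth (\<psi> n)" for n
    unfolding \<psi>_def by (intro smooth_diff smooth_affine b)
  show ?thesis
  proof (rule that[of \<psi> \<eta>])
    show "test_function (\<psi> n)" for n
      by (rule test_functionI[OF sm, of a "b+1"]) (use supp in auto)
    show "\<bar>\<psi> n x\<bar> \<le> 1" for n x
      unfolding \<psi>_def by (smt (verit) b(8,9))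
    show "(\<lambda>n. \<psi> n x) \<longlonglongrightarrow> indicator {a..b} x" if "x \<noteq> a" "x \<noteq> b" for x
    proof -
      have l: "(\<lambda>n. S (real (Suc n) * x + (- real (Suc n) * c))) \<longlonglongrightarrow> (if x > c then 1 else 0)" for c
        using S1l[of c x] S0[of x c] by (cases "x > c") auto
      have "indicator {a..b} x = (if x > a then 1 else 0) - (if x > b then 1 else 0 :: real)"
        using that ab by (auto simp: indicator_def)
      then show ?thesis unfolding \<psi>_def by (metis tendsto_diff[OF l[of a] l[of b]])
    qed
    show "deriv (\<psi> n) x = real (Suc n) * \<eta> (real (Suc n) * (x - a)) - real (Suc n) * \<eta> (real (Suc n) * (x - b))" for n x
    proof (rule DERIV_imp_deriv)
      have d: "((\<lambda>x. S (real (Suc n) * x + (- real (Suc n) * c))) has_real_derivative real (Suc n) * \<eta> (real (Suc n) * (x - c))) (at x)" for c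
      proof (rule DERIV_chain'[OF _ b(5), THEN DERIV_cong])
        show "((\<lambda>x. real (Suc n) * x + - real (Suc n) * c) has_real_derivative real (Suc n)) (at x)"
          by (auto intro!: derivative_eq_intros)
        show "\<eta> (real (Suc n) * x + - real (Suc n) * c) * real (Suc n) = real (Suc n) * \<eta> (real (Suc n) * (x - c))"
          by (simp add: algebra_simps)
      qed
      show "(\<psi> n has_real_derivative real (Suc n) * \<eta> (real (Suc n) * (x - a)) - real (Suc n) * \<eta> (real (Suc n) * (x - b))) (at x)"
        unfolding \<psi>_def by (rule DERIV_diff[OF d d])
    qed
    show "(LBINT x. \<eta> x) = 1"
    proof -
      have "(LBINT x. \<eta> x) = (LBINT x:{0..1}. \<eta> x)"
        by (rule integral_eq_set_integral) (use b(3) in force)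
      also have "\<dots> = S 1 - S 0"
        by (rule set_integral_FTC[OF b(5)]) (auto intro: smooth_continuous b)
      finally show ?thesis using b(6)[of 0] b(7)[of 1] by simp
    qed
  qed (use supp b in auto)
qed

lemma approximate_identity:
  fixes f \<eta> :: "real \<Rightarrow> real"
  assumes f: "continuous_on UNIV f" and e: "continuous_on UNIV \<eta>" "\<And>x. x \<notin> {0..1} \<Longrightarrow> \<eta> x = 0"
  shows "(\<lambda>n. LBINT x. f x * (real (Suc n) * \<eta> (real (Suc n) * (x - a)))) \<longlonglongrightarrow> f a * (LBINT x. \<eta> x)"
proof -
  have [measurable]: "f \<in> borel_measurable borel" "\<eta> \<in> borel_measurable borel"
    using f e by (auto intro: borel_measurable_continuous_onI)
  obtain K where K: "\<And>x. x \<in> {a..a+1} \<Longrightarrow> \<bar>f x\<bar> \<le> K"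
    using bounded_on_Icc[OF f] by metis
  obtain L where L: "\<And>x. x \<in> {0..1} \<Longrightarrow> \<bar>\<eta> x\<bar> \<le> L"
    using bounded_on_Icc[OF e(1)] by metis
  have eq: "(LBINT x. f x * (real (Suc n) * \<eta> (real (Suc n) * (x - a)))) = (LBINT y. f (a + (1 / real (Suc n)) * y) * \<eta> y)" for n
  proof -
    define N where "N = real (Suc n)"
    have N: "N > 0" by (simp add: N_def)
    have "(LBINT x. f x * (N * \<eta> (N * (x - a)))) = \<bar>1 / N\<bar> *\<^sub>R (LBINT y. f (a + 1 / N * y) * (N * \<eta> (N * (a + 1 / N * y - a))))"
      by (rule lborel_integral_real_affine) (use N in simp)
    also have "(\<lambda>y. f (a + 1 / N * y) * (N * \<eta> (N * (a + 1 / N * y - a)))) = (\<lambda>y. N * (f (a + 1 / N * y) * \<eta> y))"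
      using N by (auto simp: fun_eq_iff)
    finally have "(LBINT x. f x * (N * \<eta> (N * (x - a)))) = (LBINT y. f (a + (1 / N) * y) * \<eta> y)"
      using N by simp
    then show ?thesis unfolding N_def .
  qed
  have "(\<lambda>n. LBINT y. f (a + (1 / real (Suc n)) * y) * \<eta> y) \<longlonglongrightarrow> (LBINT y. f a * \<eta> y)"
  proof (rule integral_dominated_convergence[where w = "\<lambda>x. K * L * indicator {0..1} x"])
    show "integrable lborel (\<lambda>x. K * L * indicator {0..1::real} x)"
      by (intro integrable_mult_right integrable_real_indicator) auto
    have "isCont f a" using f by (simp add: continuous_on_eq_continuous_at)
    moreover have "(\<lambda>n. a + 1 / real (Suc n) * y) \<longlonglongrightarrow> a + 0 * y" for y
      by (intro tendsto_add tendsto_const tendsto_mult LIMSEQ_Suc lim_1_over_n)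
    ultimately have "(\<lambda>n. f (a + 1 / real (Suc n) * y)) \<longlonglongrightarrow> f a" for y
      by (auto intro: isCont_tendsto_compose)
    then show "AE y in lborel. (\<lambda>n. f (a + 1 / real (Suc n) * y) * \<eta> y) \<longlonglongrightarrow> f a * \<eta> y"
      by (intro AE_I2 tendsto_mult tendsto_const)
    show "AE y in lborel. norm (f (a + 1 / real (Suc n) * y) * \<eta> y) \<le> K * L * indicator {0..1} y" for n
    proof (rule AE_I2)
      fix y :: real
      show "norm (f (a + 1 / real (Suc n) * y) * \<eta> y) \<le> K * L * indicator {0..1} y"
      proof (cases "y \<in> {0..1}")
        case True
        then have "a + 1 / real (Suc n) * y \<in> {a..a+1}" by (auto simp: field_simps)
        from mult_mono[OF K[OF this] L[OF True]] True show ?thesis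
          using order_trans[OF abs_ge_zero K[OF \<open>a + 1 / real (Suc n) * y \<in> {a..a+1}\<close>]] by (simp add: abs_mult)
      qed (simp add: e)
    qed
  qed auto
  then show ?thesis unfolding eq by simp
qed

text \<open>
  Testing the weak derivative with smoothed indicator functions of \<open>[a, b]\<close> yields the increment of \<open>f\<close> on
  one side and the integral of \<open>g\<close> on the other.
\<close>

lemma weak_imp_ac:
  assumes f: "continuous_on UNIV f" and w: "has_weak_derivative f g"
  shows "ac f g"
  unfolding ac_def
proof (intro conjI allI impI)
  show lg: "locally_integrable g" using w by (simp add: has_weak_derivative_def)
  have [measurable]: "g \<in> borel_measurable borel" using lg by (rule locally_integrable_measurable)
  fix a b :: real assume ab: "a \<le> b"
  obtain \<psi> \<eta> where p: "\<And>n. test_function (\<psi> n)" "\<And>n x. \<bar>\<psi> n x\<bar> \<le> 1" "\<And>n x. x \<notin> {a..b+1} \<Longrightarrow> \<psi> n x = 0"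
    "\<And>x. x \<noteq> a \<Longrightarrow> x \<noteq> b \<Longrightarrow> (\<lambda>n. \<psi> n x) \<longlonglongrightarrow> indicator {a..b} x"
    "\<And>n x. deriv (\<psi> n) x = real (Suc n) * \<eta> (real (Suc n) * (x - a)) - real (Suc n) * \<eta> (real (Suc n) * (x - b))"
    and e: "smooth \<eta>" "\<And>x. x \<notin> {0..1} \<Longrightarrow> \<eta> x = 0" "(LBINT x. \<eta> x) = 1"
    using ex_cutoff[OF ab] by blast
  have ce: "continuous_on S \<eta>" for S using e(1) by (rule smooth_continuous)
  have int: "integrable lborel (\<lambda>x. f x * (real (Suc n) * \<eta> (real (Suc n) * (x - c))))" for n c
  proof -
    have c: "continuous_on {c..c+1} (\<lambda>x. f x * (real (Suc n) * \<eta> (real (Suc n) * (x - c))))"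
      by (intro continuous_intros continuous_on_subset[OF f] continuous_on_compose2[OF ce[of UNIV]]) auto
    have z: "\<eta> (real (Suc n) * (x - c)) = 0" if "x \<notin> {c..c+1}" for x
    proof (rule e(2))
      have "1 * 1 < real (Suc n) * (x - c)" if "x > c + 1"
        using that by (intro mult_le_less_imp_less) auto
      moreover have "real (Suc n) * (x - c) < 0" if "x < c" using that by (simp add: mult_pos_neg)
      ultimately show "real (Suc n) * (x - c) \<notin> {0..1}" using that by force
    qed
    have "integrable lborel (\<lambda>x. indicator {c..c+1} x *\<^sub>R (f x * (real (Suc n) * \<eta> (real (Suc n) * (x - c)))))"
      using borel_integrable_atLeastAtMost'[OF c] by (simp add: set_integrable_def)
    moreover have "(\<lambda>x. indicator {c..c+1} x *\<^sub>R (f x * (real (Suc n) * \<eta> (real (Suc n) * (x - c)))))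
       = (\<lambda>x. f x * (real (Suc n) * \<eta> (real (Suc n) * (x - c))))"
      using z by (fastforce simp: indicator_def)
    ultimately show ?thesis by simp
  qed
  have 1: "(\<lambda>n. LBINT x. f x * deriv (\<psi> n) x) \<longlonglongrightarrow> f a * 1 - f b * 1"
  proof -
    have "(LBINT x. f x * deriv (\<psi> n) x) = (LBINT x. f x * (real (Suc n) * \<eta> (real (Suc n) * (x - a))))
        - (LBINT x. f x * (real (Suc n) * \<eta> (real (Suc n) * (x - b))))" for n
      unfolding Bochner_Integration.integral_diff[OF int int, symmetric]
      by (rule Bochner_Integration.integral_cong) (simp_all only: p(5) right_diff_distrib[of "f _"])
    then show ?thesis
      unfolding e(3)[symmetric] by (simp only:) (intro tendsto_diff approximate_identity f ce e)
  qed
  have "(\<lambda>n. LBINT x. g x * \<psi> n x) \<longlonglongrightarrow> (LBINT x. g x * indicator {a..b} x)"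
  proof (rule integral_dominated_convergence[where w = "\<lambda>x. \<bar>indicator {a..b+1} x * g x\<bar>"])
    show "integrable lborel (\<lambda>x. \<bar>indicator {a..b+1} x * g x\<bar>)"
      using lg by (auto simp: locally_integrable_def set_integrable_def)
    show "AE x in lborel. (\<lambda>n. g x * \<psi> n x) \<longlonglongrightarrow> g x * indicator {a..b} x"
      using AE_lborel_singleton[of a] AE_lborel_singleton[of b]
      by eventually_elim (auto intro!: tendsto_mult p)
    show "AE x in lborel. norm (g x * \<psi> n x) \<le> \<bar>indicator {a..b+1} x * g x\<bar>" for n
    proof (rule AE_I2)
      fix x show "norm (g x * \<psi> n x) \<le> \<bar>indicator {a..b+1} x * g x\<bar>"
        using p(2)[of n x] p(3)[of x n] mult_left_mono[OF p(2)[of n x], of "\<bar>g x\<bar>"]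
        by (cases "x \<in> {a..b+1}") (auto simp: abs_mult)
    qed
    show "(\<lambda>x. g x * \<psi> n x) \<in> borel_measurable lborel" for n
    proof -
      have "smooth (\<psi> n)" using p(1)[of n] by (simp add: test_function_def)
      then have [measurable]: "\<psi> n \<in> borel_measurable borel"
        by (intro borel_measurable_continuous_onI smooth_continuous)
      show ?thesis by measurable
    qed
  qed auto
  then have 2: "(\<lambda>n. - (LBINT x. g x * \<psi> n x)) \<longlonglongrightarrow> - (LBINT x:{a..b}. g x)"
    by (intro tendsto_minus) (simp add: set_lebesgue_integral_def mult.commute)
  have "(LBINT x. f x * deriv (\<psi> n) x) = - (LBINT x. g x * \<psi> n x)" for n
    using w p(1)[of n] by (simp add: has_weak_derivative_def)
  with 1 have "(\<lambda>n. - (LBINT x. g x * \<psi> n x)) \<longlonglongrightarrow> f a * 1 - f b * 1" by simp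
  from LIMSEQ_unique[OF this 2] show "f b - f a = (LBINT x:{a..b}. g x)" by simp
qed fact

lemma borel_Icc_induct [consumes 1, case_names Icc compl union]:
  fixes A :: "real set"
  assumes "A \<in> sets borel"
    and Icc: "\<And>a b. P {a..b}"
    and compl: "\<And>A. A \<in> sets borel \<Longrightarrow> P A \<Longrightarrow> P (- A)"
    and union: "\<And>A. disjoint_family A \<Longrightarrow> range A \<subseteq> sets borel \<Longrightarrow> (\<And>i. P (A i)) \<Longrightarrow> P (\<Union>i::nat. A i)"
  shows "P A"
proof -
  let ?G = "range (\<lambda>(a, b). {a..b :: real})"
  have b: "sets borel = sigma_sets UNIV ?G" by (subst borel_eq_atLeastAtMost) simp
  have "Int_stable ?G" by (force simp: Int_stable_def)
  moreover have "?G \<subseteq> Pow UNIV" by simp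
  moreover have "A \<in> sigma_sets UNIV ?G" using assms(1) b by simp
  ultimately show ?thesis
  proof (induction rule: sigma_sets_induct_disjoint)
    case (basic A) then show ?case using Icc by auto
  next
    case empty show ?case using Icc[of 1 0] by simp
  next
    case (compl A) then show ?case using assms(3)[of A] b by (simp add: Compl_eq_Diff_UNIV)
  next
    case (union A) then show ?case using assms(4)[of A] b by simp
  qed
qed

text \<open>
  The Borel sets over which a truncation of \<open>g\<close> has integral zero form a Dynkin system that contains
  all intervals.
\<close>

lemma zero_integrals_imp_AE_zero:
  fixes g :: "real \<Rightarrow> real"
  assumes lg: "locally_integrable g" and z: "\<And>a b. a \<le> b \<Longrightarrow> (LBINT x:{a..b}. g x) = 0"
  shows "AE x in lborel. g x = 0"
proof -
  have "AE x in lborel. indicator {- real N..real N} x * g x = 0" for N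
  proof (rule sigma_finite_measure.density_zero[OF sigma_finite_lborel])
    let ?h = "\<lambda>x. indicator {- real N..real N} x * g x"
    show i: "integrable lborel ?h"
      using lg by (auto simp: locally_integrable_def set_integrable_def)
    have iA: "integrable lborel (\<lambda>x. indicator A x * ?h x)" if "A \<in> sets borel" for A
      using integrable_mult_indicator[OF _ i, of A] that by simp
    fix A :: "real set" assume "A \<in> sets lborel"
    then have "A \<in> sets borel" by simp
    then have "(LBINT x. indicator A x * ?h x) = 0"
    proof (induction rule: borel_Icc_induct)
      case (Icc a b)
      have "(LBINT x. indicator {a..b} x * ?h x) = (LBINT x:{max a (- real N)..min b (real N)}. g x)"
        unfolding set_lebesgue_integral_def
        by (rule Bochner_Integration.integral_cong) (auto simp: indicator_def)
      also have "\<dots> = 0"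
        using z[of "max a (- real N)" "min b (real N)"]
        by (cases "max a (- real N) \<le> min b (real N)") (simp_all add: set_lebesgue_integral_def del: max.bounded_iff min.bounded_iff)
      finally show ?case .
    next
      case (compl A)
      have "(LBINT x. ?h x) = (LBINT x. indicator A x * ?h x + indicator (-A) x * ?h x)"
        by (rule Bochner_Integration.integral_cong) (auto simp: indicator_def)
      also have "\<dots> = (LBINT x. indicator A x * ?h x) + (LBINT x. indicator (-A) x * ?h x)"
        using compl by (intro Bochner_Integration.integral_add iA) auto
      finally show ?case using compl z[of "- real N" "real N"] by (simp add: set_lebesgue_integral_def)
    next
      case (union A)
      have m: "A i \<in> sets borel" for i using union by auto
      have m2: "(\<Union>i<n. A i) \<in> sets borel" for n using m by auto
      have s: "(LBINT x. indicator (\<Union>i<n. A i) x * ?h x) = 0" for n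
      proof -
        have "(LBINT x. indicator (\<Union>i<n. A i) x * ?h x) = (LBINT x. (\<Sum>i<n. indicator (A i) x * ?h x))"
          using union(1) by (subst indicator_UN_disjoint) (auto simp: sum_distrib_right disjoint_family_on_def)
        also have "\<dots> = 0" using union m by (subst Bochner_Integration.integral_sum) (auto intro!: iA)
        finally show ?thesis .
      qed
      have "(\<lambda>n. LBINT x. indicator (\<Union>i<n. A i) x * ?h x) \<longlonglongrightarrow> (LBINT x. indicator (\<Union>i. A i) x * ?h x)"
      proof (rule integral_dominated_convergence[where w = "\<lambda>x. \<bar>?h x\<bar>"])
        show "AE x in lborel. (\<lambda>n. indicator (\<Union>i<n. A i) x * ?h x) \<longlonglongrightarrow> indicator (\<Union>i. A i) x * ?h x"
          by (intro AE_I2 tendsto_mult tendsto_const LIMSEQ_indicator_UN)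
        show "(\<lambda>x. indicator (\<Union>i<n. A i) x * ?h x) \<in> borel_measurable lborel" for n
          using iA[OF m2] by (rule borel_measurable_integrable)
        show "(\<lambda>x. indicator (\<Union>i. A i) x * ?h x) \<in> borel_measurable lborel"
          using m by (intro borel_measurable_integrable[OF iA]) auto
      qed (use i in \<open>auto simp: indicator_def\<close>)
      with s show ?case by (simp add: LIMSEQ_const_iff)
    qed
    then show "set_lebesgue_integral lborel A ?h = 0" by (simp add: set_lebesgue_integral_def)
  qed
  then have "AE x in lborel. \<forall>N. indicator {- real N..real N} x * g x = 0" by (intro AE_all_countable[THEN iffD2] allI)
  then show ?thesis
  proof eventually_elim
    case (elim x)
    obtain N where "\<bar>x\<bar> \<le> real N" using real_arch_simple by blast
    then show ?case using elim[rule_format, of N] by (auto simp: indicator_def abs_le_iff split: if_splits)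
  qed
qed

lemma ac_unique:
  assumes "ac f g1" "ac f g2"
  shows "AE x in lborel. g1 x = g2 x"
proof -
  have "AE x in lborel. g1 x - g2 x = 0"
  proof (rule zero_integrals_imp_AE_zero)
    show "locally_integrable (\<lambda>x. g1 x - g2 x)" using assms by (intro locally_integrable_diff ac_loc)
    show "(LBINT x:{a..b}. g1 x - g2 x) = 0" if "a \<le> b" for a b
      using ac_FTC[OF assms(1) that] ac_FTC[OF assms(2) that] assms
      by (simp add: ac_def locally_integrable_def)
  qed
  then show ?thesis by eventually_elim simp
qed

lemma ac_weak_deriv:
  assumes "continuous_on UNIV f" "has_weak_derivative f g"
  shows "ac f (weak_deriv f)"
  unfolding weak_deriv_def using assms by (metis someI weak_imp_ac)

lemma weak_deriv_AE:
  assumes "ac f g"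
  shows "AE x in lborel. weak_deriv f x = g x"
  using ac_unique[OF ac_weak_deriv[OF _ ac_imp_weak[OF assms]] assms] assms by (simp add: ac_def)

section \<open>Square-integrable functions and density of test functions\<close>

definition L2 :: "(real \<Rightarrow> real) \<Rightarrow> bool" where
  "L2 f \<longleftrightarrow> f \<in> borel_measurable borel \<and> integrable lborel (\<lambda>x. (f x)\<^sup>2)"

definition pairing :: "(real \<Rightarrow> real) \<Rightarrow> (real \<Rightarrow> real) \<Rightarrow> real" where
  "pairing f g = (LBINT x. f x * g x)"

definition sqnorm :: "(real \<Rightarrow> real) \<Rightarrow> real" where
  "sqnorm f = (LBINT x. (f x)\<^sup>2)"

lemma L2_measurable[measurable_dest]: "L2 f \<Longrightarrow> f \<in> borel_measurable borel"
  by (simp add: L2_def)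

lemma sqnorm_nonneg [simp]: "sqnorm f \<ge> 0"
  by (simp add: sqnorm_def)

lemma sqnorm_pairing: "sqnorm f = pairing f f"
  by (simp add: sqnorm_def pairing_def power2_eq_square)

text \<open>
  A bound by an integrable majorant is all that finite energy provides, so membership is usually
  established in this form.
\<close>

lemma L2_dominated:
  assumes "f \<in> borel_measurable borel" "integrable lborel w" "AE x in lborel. (f x)\<^sup>2 \<le> w x"
  shows "L2 f"
  unfolding L2_def
proof
  show "integrable lborel (\<lambda>x. (f x)\<^sup>2)"
  proof (rule Bochner_Integration.integrable_bound[OF assms(2)])
    show "AE x in lborel. norm ((f x)\<^sup>2) \<le> norm (w x)"
      using assms(3) by eventually_elim simp
  qed (use assms(1) in simp)
qed fact

lemma L2_mult_integrable:
  assumes "L2 f" "L2 g"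
  shows "integrable lborel (\<lambda>x. f x * g x)"
proof (rule Bochner_Integration.integrable_bound)
  note [measurable] = L2_measurable[OF assms(1)] L2_measurable[OF assms(2)]
  show "integrable lborel (\<lambda>x. (f x)\<^sup>2 + (g x)\<^sup>2)" using assms by (simp add: L2_def)
  show "(\<lambda>x. f x * g x) \<in> borel_measurable lborel" by measurable
  have "\<bar>a * b\<bar> \<le> a\<^sup>2 + b\<^sup>2" for a b :: real
    using sum_squares_bound[of "\<bar>a\<bar>" "\<bar>b\<bar>"] abs_ge_zero[of "a * b"]
    unfolding abs_mult power2_abs by linarith
  then show "AE x in lborel. norm (f x * g x) \<le> norm ((f x)\<^sup>2 + (g x)\<^sup>2)" by simp
qed

lemma square_add_le: "(a + b)\<^sup>2 \<le> 2 * a\<^sup>2 + 2 * b\<^sup>2" for a b :: real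
  using sum_squares_bound[of a b] by (simp add: power2_sum)

lemma L2_add: assumes "L2 f" "L2 g" shows "L2 (\<lambda>x. f x + g x)"
  using assms square_add_le by (intro L2_dominated[where w = "\<lambda>x. 2 * (f x)\<^sup>2 + 2 * (g x)\<^sup>2"]) (auto simp: L2_def)

lemma L2_cmult: "L2 f \<Longrightarrow> L2 (\<lambda>x. c * f x)"
  by (auto simp: L2_def power_mult_distrib intro: borel_measurable_times)

lemma L2_diff: assumes "L2 f" "L2 g" shows "L2 (\<lambda>x. f x - g x)"
  using L2_add[OF assms(1) L2_cmult[OF assms(2), of "-1"]] by simp

lemma pairing_commute: "pairing f g = pairing g f"
  by (simp add: pairing_def mult.commute)

lemma pairing_add_left: "L2 f \<Longrightarrow> L2 g \<Longrightarrow> L2 h \<Longrightarrow> pairing (\<lambda>x. f x + g x) h = pairing f h + pairing g h"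
  by (simp add: pairing_def distrib_right L2_mult_integrable)

lemma pairing_diff_left: "L2 f \<Longrightarrow> L2 g \<Longrightarrow> L2 h \<Longrightarrow> pairing (\<lambda>x. f x - g x) h = pairing f h - pairing g h"
  by (simp add: pairing_def left_diff_distrib L2_mult_integrable)

lemma pairing_cmult_left: "pairing (\<lambda>x. c * f x) h = c * pairing f h"
  by (simp add: pairing_def mult.assoc)

lemma pairing_diff_right: "L2 f \<Longrightarrow> L2 g \<Longrightarrow> L2 h \<Longrightarrow> pairing h (\<lambda>x. f x - g x) = pairing h f - pairing h g"
  by (simp add: pairing_diff_left pairing_commute[of h])

lemma sqnorm_cmult: "sqnorm (\<lambda>x. c * f x) = c\<^sup>2 * sqnorm f"
  by (simp add: sqnorm_def power_mult_distrib)

lemma sqnorm_mono: "L2 g \<Longrightarrow> L2 f \<Longrightarrow> (\<And>x. \<bar>f x\<bar> \<le> \<bar>g x\<bar>) \<Longrightarrow> sqnorm f \<le> sqnorm g"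
  unfolding sqnorm_def by (intro integral_mono) (auto simp: L2_def abs_le_square_iff)

lemma sqnorm_add_le: assumes "L2 f" "L2 g" shows "sqnorm (\<lambda>x. f x + g x) \<le> 2 * sqnorm f + 2 * sqnorm g"
proof -
  have "sqnorm (\<lambda>x. f x + g x) \<le> (LBINT x. 2 * (f x)\<^sup>2 + 2 * (g x)\<^sup>2)"
    unfolding sqnorm_def using assms L2_add[OF assms] square_add_le by (intro integral_mono) (auto simp: L2_def)
  then show ?thesis using assms by (simp add: sqnorm_def L2_def)
qed

lemma sqnorm_triangle:
  assumes "L2 f" "L2 g" "L2 h"
  shows "sqnorm (\<lambda>x. f x - h x) \<le> 2 * sqnorm (\<lambda>x. f x - g x) + 2 * sqnorm (\<lambda>x. g x - h x)"
  using sqnorm_add_le[OF L2_diff[OF assms(1,2)] L2_diff[OF assms(2,3)]] by simp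

lemma pairing_cauchy_schwarz:
  assumes "L2 f" "L2 g"
  shows "\<bar>pairing f g\<bar> \<le> sqrt (sqnorm f) * sqrt (sqnorm g)"
proof -
  have q: "0 \<le> sqnorm f - 2 * t * pairing f g + t\<^sup>2 * sqnorm g" for t
  proof -
    have "0 \<le> sqnorm (\<lambda>x. f x - t * g x)" by simp
    also have "\<dots> = sqnorm f - 2 * t * pairing f g + t\<^sup>2 * sqnorm g"
      unfolding sqnorm_pairing using assms
      by (simp add: pairing_diff_left pairing_diff_right pairing_cmult_left pairing_commute[of _ "\<lambda>x. t * g x"] L2_cmult L2_diff pairing_commute[of g f] power2_eq_square algebra_simps)
    finally show ?thesis .
  qed
  have "(pairing f g)\<^sup>2 \<le> sqnorm f * sqnorm g"
  proof (cases "sqnorm g = 0")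
    case True
    have "pairing f g = 0"
    proof (rule ccontr)
      assume n: "pairing f g \<noteq> 0"
      have "0 \<le> sqnorm f - 2 * ((sqnorm f + 1) / (2 * pairing f g)) * pairing f g" using q[of "(sqnorm f + 1) / (2 * pairing f g)"] True by simp
      also have "\<dots> = -1" using n by (simp add: field_simps)
      finally show False by simp
    qed
    then show ?thesis using True by simp
  next
    case False
    then have p: "sqnorm g > 0" using sqnorm_nonneg[of g] by linarith
    have "0 \<le> sqnorm f - 2 * (pairing f g / sqnorm g) * pairing f g + (pairing f g / sqnorm g)\<^sup>2 * sqnorm g" by (rule q)
    also have "\<dots> = sqnorm f - (pairing f g)\<^sup>2 / sqnorm g" using p by (simp add: power2_eq_square field_simps)
    finally show ?thesis using p by (simp add: field_simps)
  qed
  then have "sqrt ((pairing f g)\<^sup>2) \<le> sqrt (sqnorm f * sqnorm g)" by (rule real_sqrt_le_mono)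
  then show ?thesis by (simp add: real_sqrt_mult)
qed

text \<open>
  Joint continuity of the pairing, phrased with squared norms because these are what the topology of the
  energy space controls.
\<close>

lemma pairing_tendsto:
  assumes f: "\<And>s. L2 (f s)" "L2 f0" "((\<lambda>s. sqnorm (\<lambda>x. f s x - f0 x)) \<longlongrightarrow> 0) F"
    and g: "\<And>s. L2 (g s)" "L2 g0" "((\<lambda>s. sqnorm (\<lambda>x. g s x - g0 x)) \<longlongrightarrow> 0) F"
  shows "((\<lambda>s. pairing (f s) (g s)) \<longlongrightarrow> pairing f0 g0) F"
proof -
  let ?a = "\<lambda>s. sqrt (sqnorm (\<lambda>x. f s x - f0 x))" and ?b = "\<lambda>s. sqrt (sqnorm (\<lambda>x. g s x - g0 x))"
  have b: "\<bar>pairing (f s) (g s) - pairing f0 g0\<bar> \<le> ?a s * ?b s + ?a s * sqrt (sqnorm g0) + sqrt (sqnorm f0) * ?b s" for s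
  proof -
    have "pairing (f s) (g s) - pairing f0 g0 = pairing (\<lambda>x. f s x - f0 x) (\<lambda>x. g s x - g0 x)
       + pairing (\<lambda>x. f s x - f0 x) g0 + pairing f0 (\<lambda>x. g s x - g0 x)"
      using f g by (simp add: pairing_diff_left pairing_diff_right L2_diff)
    then show ?thesis
      using pairing_cauchy_schwarz[OF L2_diff[OF f(1)[of s] f(2)] L2_diff[OF g(1)[of s] g(2)]]
        pairing_cauchy_schwarz[OF L2_diff[OF f(1)[of s] f(2)] g(2)]
        pairing_cauchy_schwarz[OF f(2) L2_diff[OF g(1)[of s] g(2)]] by linarith
  qed
  have "((\<lambda>s. ?a s * ?b s + ?a s * sqrt (sqnorm g0) + sqrt (sqnorm f0) * ?b s) \<longlongrightarrow> sqrt 0 * sqrt 0 + sqrt 0 * sqrt (sqnorm g0) + sqrt (sqnorm f0) * sqrt 0) F"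
    by (intro tendsto_intros f g)
  then have "((\<lambda>s. ?a s * ?b s + ?a s * sqrt (sqnorm g0) + sqrt (sqnorm f0) * ?b s) \<longlongrightarrow> 0) F" by simp
  then have "((\<lambda>s. pairing (f s) (g s) - pairing f0 g0) \<longlongrightarrow> 0) F"
    by (rule Lim_null_comparison[rotated]) (use b in \<open>auto simp: real_norm_def\<close>)
  then show ?thesis by (simp add: LIM_zero_iff)
qed

lemma sqnorm_dominated_tendsto:
  assumes "L2 w" "\<And>n. u n \<in> borel_measurable borel" "\<And>n x. \<bar>u n x\<bar> \<le> \<bar>w x\<bar>" "AE x in lborel. (\<lambda>n. u n x) \<longlonglongrightarrow> 0"
  shows "(\<lambda>n. sqnorm (u n)) \<longlonglongrightarrow> 0"
proof -
  have "(\<lambda>n. sqnorm (u n)) \<longlonglongrightarrow> (LBINT x::real. 0)"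
    unfolding sqnorm_def
  proof (rule integral_dominated_convergence[where w = "\<lambda>x. (w x)\<^sup>2"])
    show "AE x in lborel. (\<lambda>n. (u n x)\<^sup>2) \<longlonglongrightarrow> 0"
      using assms(4) by eventually_elim (auto intro: tendsto_eq_intros)
  qed (use assms in \<open>auto simp: L2_def abs_le_square_iff\<close>)
  then show ?thesis by simp
qed

lemma L2_bounded_by: "L2 g \<Longrightarrow> f \<in> borel_measurable borel \<Longrightarrow> (\<And>x. \<bar>f x\<bar> \<le> \<bar>g x\<bar>) \<Longrightarrow> L2 f"
  by (intro L2_dominated[where w = "\<lambda>x. (g x)\<^sup>2"]) (auto simp: L2_def abs_le_square_iff)

lemma L2_indicator: "A \<in> sets borel \<Longrightarrow> emeasure lborel A < \<infinity> \<Longrightarrow> L2 (indicator A)"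
proof -
  assume "A \<in> sets borel" "emeasure lborel A < \<infinity>"
  moreover have "(\<lambda>x. (indicator A x)\<^sup>2) = (indicator A :: real \<Rightarrow> real)" by (auto simp: indicator_def)
  ultimately show ?thesis by (simp add: L2_def integrable_real_indicator)
qed

lemma L2_indicator_Icc: "L2 (indicator {a..b})"
  by (rule L2_indicator) (auto simp: emeasure_lborel_Icc_eq)

lemma sqnorm_indicator_Icc: "a \<le> b \<Longrightarrow> sqnorm (indicator {a..b}) = b - a"
proof -
  assume "a \<le> b"
  moreover have "(\<lambda>x. (indicator {a..b} x)\<^sup>2) = (indicator {a..b} :: real \<Rightarrow> real)" by (auto simp: indicator_def)
  ultimately show ?thesis by (simp add: sqnorm_def)
qed

lemma L2_compact_support:
  assumes "continuous_on UNIV f" "\<And>x. x \<notin> {a..b} \<Longrightarrow> f x = 0"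
  shows "L2 f"
proof -
  obtain K where K: "K > 0" "\<And>x. x \<in> {a..b} \<Longrightarrow> \<bar>f x\<bar> \<le> K" using bounded_on_Icc[OF assms(1)] by metis
  show ?thesis
    by (rule L2_bounded_by[OF L2_cmult[OF L2_indicator_Icc, of K a b]])
       (use assms K in \<open>auto simp: indicator_def intro: borel_measurable_continuous_onI\<close>)
qed

lemma test_function_smooth: "test_function \<psi> \<Longrightarrow> smooth \<psi>"
  by (simp add: test_function_def)

lemma L2_test: assumes "test_function \<psi>" shows "L2 \<psi>"
proof -
  obtain R where "\<And>x. \<bar>x\<bar> \<ge> R \<Longrightarrow> \<psi> x = 0" using test_function_support[OF assms] by metis
  then show ?thesis
    by (intro L2_compact_support[of _ "-R" R] smooth_continuous test_function_smooth assms) auto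
qed

lemma test_function_add:
  fixes f g :: "real \<Rightarrow> real"
  assumes "test_function f" "test_function g" shows "test_function (\<lambda>x. f x + g x)"
proof -
  obtain R1 where 1: "\<And>x. \<bar>x\<bar> \<ge> R1 \<Longrightarrow> f x = 0" using test_function_support[OF assms(1)] by metis
  obtain R2 where 2: "\<And>x. \<bar>x\<bar> \<ge> R2 \<Longrightarrow> g x = 0" using test_function_support[OF assms(2)] by metis
  show ?thesis
    by (rule test_functionI[of _ "- max R1 R2" "max R1 R2"])
       (use 1 2 assms in \<open>auto intro!: smooth_add simp: test_function_smooth\<close>)
qed

lemma test_function_cmult:
  fixes f :: "real \<Rightarrow> real"
  assumes "test_function f" shows "test_function (\<lambda>x. c * f x)"
proof -
  obtain R where 1: "\<And>x. \<bar>x\<bar> \<ge> R \<Longrightarrow> f x = 0" using test_function_support[OF assms(1)] by metis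
  show ?thesis
    by (rule test_functionI[of _ "- R" "R"])
       (use 1 assms in \<open>auto intro!: smooth_cmult simp: test_function_smooth\<close>)
qed

text \<open>
  The \<open>L\<^sup>2\<close> closure of the test functions. It turns out to be all of \<open>L\<^sup>2\<close> (\<open>test_approximable_L2\<close>).
\<close>

definition test_approximable :: "(real \<Rightarrow> real) \<Rightarrow> bool" where
  "test_approximable f \<longleftrightarrow> L2 f \<and> (\<forall>e>0. \<exists>\<psi>. test_function \<psi> \<and> sqnorm (\<lambda>x. f x - \<psi> x) < e)"

lemma test_approximable_lim:
  assumes "L2 f" "\<And>e. e > 0 \<Longrightarrow> \<exists>g. test_approximable g \<and> sqnorm (\<lambda>x. f x - g x) < e"
  shows "test_approximable f"
  unfolding test_approximable_def
proof (intro conjI allI impI)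
  fix e :: real assume e: "e > 0"
  obtain g where g: "test_approximable g" "sqnorm (\<lambda>x. f x - g x) < e / 4" using assms(2)[of "e/4"] e by auto
  obtain \<psi> where p: "test_function \<psi>" "sqnorm (\<lambda>x. g x - \<psi> x) < e / 4"
    using g(1) e unfolding test_approximable_def by (metis zero_less_divide_iff zero_less_numeral)
  have "sqnorm (\<lambda>x. f x - \<psi> x) \<le> 2 * sqnorm (\<lambda>x. f x - g x) + 2 * sqnorm (\<lambda>x. g x - \<psi> x)"
    using assms(1) g(1) p(1) by (intro sqnorm_triangle) (auto simp: test_approximable_def L2_test)
  then show "\<exists>\<psi>. test_function \<psi> \<and> sqnorm (\<lambda>x. f x - \<psi> x) < e" using g p by (intro exI[of _ \<psi>]) auto
qed fact

lemma test_approximable_seq: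
  assumes "L2 f" "\<And>n. test_approximable (g n)" "(\<lambda>n. sqnorm (\<lambda>x. f x - g n x)) \<longlonglongrightarrow> 0"
  shows "test_approximable f"
proof (rule test_approximable_lim[OF assms(1)])
  fix e :: real assume "e > 0"
  with assms(3) have "\<forall>\<^sub>F n in sequentially. sqnorm (\<lambda>x. f x - g n x) < e" by (rule order_tendstoD)
  then show "\<exists>g. test_approximable g \<and> sqnorm (\<lambda>x. f x - g x) < e"
    using assms(2) by (auto simp: eventually_sequentially)
qed

lemma test_approximable_add: assumes "test_approximable f" "test_approximable g" shows "test_approximable (\<lambda>x. f x + g x)"
  unfolding test_approximable_def
proof (intro conjI allI impI)
  show "L2 (\<lambda>x. f x + g x)" using assms by (auto simp: test_approximable_def intro: L2_add)
  fix e :: real assume "e > 0"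
  then have "e / 4 > 0" by simp
  then obtain \<psi> \<psi>' where p: "test_function \<psi>" "sqnorm (\<lambda>x. f x - \<psi> x) < e / 4" "test_function \<psi>'" "sqnorm (\<lambda>x. g x - \<psi>' x) < e / 4"
    using assms unfolding test_approximable_def by blast
  have "sqnorm (\<lambda>x. (f x - \<psi> x) + (g x - \<psi>' x)) \<le> 2 * sqnorm (\<lambda>x. f x - \<psi> x) + 2 * sqnorm (\<lambda>x. g x - \<psi>' x)"
    using assms p by (intro sqnorm_add_le L2_diff) (auto simp: test_approximable_def L2_test)
  then have "sqnorm (\<lambda>x. (f x + g x) - (\<psi> x + \<psi>' x)) < e" using p by (simp add: algebra_simps)
  then show "\<exists>\<psi>. test_function \<psi> \<and> sqnorm (\<lambda>x. f x + g x - \<psi> x) < e"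
    using test_function_add[OF p(1,3)] by (intro exI[of _ "\<lambda>x. \<psi> x + \<psi>' x"]) simp
qed

lemma test_approximable_test: "test_function \<psi> \<Longrightarrow> test_approximable \<psi>"
  unfolding test_approximable_def using L2_test by (auto intro!: exI[of _ \<psi>] simp: sqnorm_def)

lemma test_approximable_cmult: assumes "test_approximable f" shows "test_approximable (\<lambda>x. c * f x)"
proof (cases "c = 0")
  case True
  have "test_function (\<lambda>x::real. 0)" by (rule test_functionI) (auto simp: smooth_def times_cont_diff_const)
  then show ?thesis using True test_approximable_test by simp
next
  case False
  show ?thesis
    unfolding test_approximable_def
  proof (intro conjI allI impI)
    show "L2 (\<lambda>x. c * f x)" using assms by (auto simp: test_approximable_def intro: L2_cmult)
    fix e :: real assume "e > 0"
    then have "e / c\<^sup>2 > 0" using False by simp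
    then obtain \<psi> where p: "test_function \<psi>" "sqnorm (\<lambda>x. f x - \<psi> x) < e / c\<^sup>2" 
      using assms unfolding test_approximable_def by blast
    have "sqnorm (\<lambda>x. c * f x - c * \<psi> x) = c\<^sup>2 * sqnorm (\<lambda>x. f x - \<psi> x)"
      using sqnorm_cmult[of c "\<lambda>x. f x - \<psi> x"] by (simp add: right_diff_distrib)
    also have "\<dots> < e" using p(2) False by (simp add: field_simps)
    finally show "\<exists>\<psi>. test_function \<psi> \<and> sqnorm (\<lambda>x. c * f x - \<psi> x) < e"
      using test_function_cmult[OF p(1)] by blast
  qed
qed

lemma test_approximable_sum: "(\<And>i. i \<in> I \<Longrightarrow> test_approximable (f i)) \<Longrightarrow> test_approximable (\<lambda>x. \<Sum>i\<in>I. f i x)"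
proof (induction I rule: infinite_finite_induct)
  case (insert i I)
  then show ?case by (simp add: test_approximable_add)
qed (use test_approximable_test[OF test_function_cmult, of _ 0] ex_cutoff[of 0 0] in \<open>force+\<close>)

lemma test_approximable_Icc: "test_approximable (indicator {a..b})"
proof (cases "a \<le> b")
  case True
  obtain \<psi> where p: "\<And>n. test_function (\<psi> n)" "\<And>n x. \<bar>\<psi> n x\<bar> \<le> 1" "\<And>n x. x \<notin> {a..b+1} \<Longrightarrow> \<psi> n x = 0"
    "\<And>x. x \<noteq> a \<Longrightarrow> x \<noteq> b \<Longrightarrow> (\<lambda>n. \<psi> n x) \<longlonglongrightarrow> indicator {a..b} x"
    using ex_cutoff[OF True] by metis
  show ?thesis
  proof (rule test_approximable_seq[OF L2_indicator_Icc test_approximable_test[OF p(1)]])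
    show "(\<lambda>n. sqnorm (\<lambda>x. indicator {a..b} x - \<psi> n x)) \<longlonglongrightarrow> 0"
    proof (rule sqnorm_dominated_tendsto[OF L2_cmult[OF L2_indicator_Icc, of 2 a "b+1"]])
      show "(\<lambda>x. indicator {a..b} x - \<psi> n x) \<in> borel_measurable borel" for n
        using L2_measurable[OF L2_test[OF p(1)[of n]]] by measurable
      show "\<bar>indicator {a..b} x - \<psi> n x\<bar> \<le> \<bar>2 * indicator {a..b + 1} x\<bar>" for n x
        using p(2)[of n x] p(3)[of x n] by (auto simp: indicator_def)
      show "AE x in lborel. (\<lambda>n. indicator {a..b} x - \<psi> n x) \<longlonglongrightarrow> 0"
        using AE_lborel_singleton[of a] AE_lborel_singleton[of b]
      proof eventually_elim
        case (elim x)
        show ?case using tendsto_diff[OF tendsto_const[of "indicator {a..b} x"] p(4)[OF elim]] by simp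
      qed
    qed
  qed
next
  case False
  then have "indicator {a..b} = (\<lambda>x::real. 0::real)" by auto
  then show ?thesis using test_approximable_sum[of "{}"] by simp
qed

text \<open>
  Dynkin induction: the closure is a linear space, contains the indicator functions of intervals, and is
  closed under dominated limits.
\<close>

lemma test_approximable_bounded_borel:
  assumes "A \<in> sets borel"
  shows "test_approximable (\<lambda>x. indicator A x * indicator {-N..N} x)"
  using assms
proof (induction rule: borel_Icc_induct)
  case (Icc a b)
  have "(\<lambda>x. indicator {a..b} x * indicator {-N..N} x) = (indicator {max a (-N)..min b N} :: real \<Rightarrow> real)"
    by (auto simp: indicator_def)
  then show ?case by (simp add: test_approximable_Icc)
next
  case (compl A)
  have "(\<lambda>x. indicator (-A) x * indicator {-N..N} x) = (\<lambda>x. indicator {-N..N} x + (-1) * (indicator A x * indicator {-N..N} x) :: real)"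
    by (auto simp: indicator_def)
  then show ?case using test_approximable_add[OF test_approximable_Icc[of "-N" N] test_approximable_cmult[OF compl(2), of "-1"]] by simp
next
  case (union A)
  have m[measurable]: "A i \<in> sets borel" for i using union by auto
  have s: "test_approximable (\<lambda>x. indicator (\<Union>i<n. A i) x * indicator {-N..N} x)" for n
  proof -
    have "test_approximable (\<lambda>x. \<Sum>i<n. indicator (A i) x * indicator {-N..N} x)" by (rule test_approximable_sum) (rule union)
    moreover have "(\<Sum>i<n. indicator (A i) x * indicator {-N..N} x) = (indicator (\<Union>i<n. A i) x * indicator {-N..N} x :: real)" for x
      using union(1) by (subst indicator_UN_disjoint) (auto simp: sum_distrib_right disjoint_family_on_def)
    ultimately show ?thesis by simp
  qed
  have [measurable]: "(\<Union>i. A i) \<in> sets borel" "(\<Union>i<n. A i) \<in> sets borel" for n by auto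
  show ?case
  proof (rule test_approximable_seq[OF _ s])
    show "L2 (\<lambda>x. indicator (\<Union>i. A i) x * indicator {-N..N} x)"
      by (rule L2_bounded_by[OF L2_indicator_Icc[of "-N" N]]) (auto simp: indicator_def)
    show "(\<lambda>n. sqnorm (\<lambda>x. indicator (\<Union>i. A i) x * indicator {-N..N} x - indicator (\<Union>i<n. A i) x * indicator {-N..N} x)) \<longlonglongrightarrow> 0"
    proof (rule sqnorm_dominated_tendsto[OF L2_indicator_Icc[of "-N" N]])
      have "(\<lambda>n. indicator (\<Union>i. A i) x * indicator {-N..N} x - indicator (\<Union>i<n. A i) x * indicator {-N..N} x)
          \<longlonglongrightarrow> indicator (\<Union>i. A i) x * indicator {-N..N} x - indicator (\<Union>i. A i) x * (indicator {-N..N} x :: real)" for x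
        by (intro tendsto_diff tendsto_mult tendsto_const LIMSEQ_indicator_UN)
      then show "AE x in lborel. (\<lambda>n. indicator (\<Union>i. A i) x * indicator {-N..N} x - indicator (\<Union>i<n. A i) x * indicator {-N..N} x) \<longlonglongrightarrow> (0::real)"
        by simp
    qed (auto simp: indicator_def)
  qed
qed

lemma indicator_Icc_eventually: "(\<lambda>n. indicator {- real n..real n} x) \<longlonglongrightarrow> (1::real)"
proof (rule tendsto_eventually)
  obtain N where "\<bar>x\<bar> \<le> real N" using real_arch_simple by blast
  then show "\<forall>\<^sub>F n in sequentially. indicator {- real n..real n} x = (1::real)"
    by (intro eventually_sequentiallyI[of N]) (auto simp: indicator_def)
qed

text \<open>
  Simple functions with dominated convergence; a simple function that is square-integrable has level
  sets of finite measure away from the value zero.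
\<close>

lemma test_approximable_L2:
  assumes f: "L2 f"
  shows "test_approximable f"
proof -
  have fin: "test_approximable (indicator A)" if A[measurable]: "A \<in> sets borel" "emeasure lborel A < \<infinity>" for A
  proof (rule test_approximable_seq[OF L2_indicator[OF A] test_approximable_bounded_borel[OF A(1)]])
    show "(\<lambda>n. sqnorm (\<lambda>x. indicator A x - indicator A x * indicator {- real n..real n} x)) \<longlonglongrightarrow> 0"
    proof (rule sqnorm_dominated_tendsto[OF L2_indicator[OF A]])
      have "(\<lambda>n. indicator A x - indicator A x * indicator {- real n..real n} x) \<longlonglongrightarrow> indicator A x - indicator A x * (1::real)" for x
        by (intro tendsto_diff tendsto_mult tendsto_const indicator_Icc_eventually)
      then show "AE x in lborel. (\<lambda>n. indicator A x - indicator A x * indicator {- real n..real n} x) \<longlonglongrightarrow> (0::real)"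
        by simp
    qed (auto simp: indicator_def)
  qed
  have [measurable]: "f \<in> borel_measurable borel" using f by (rule L2_measurable)
  have "f \<in> borel_measurable lborel" by simp
  from borel_measurable_implies_sequence_metric[OF this, of 0]
  obtain s where s: "\<And>i. simple_function lborel (s i)" "\<And>x. (\<lambda>i. s i x) \<longlonglongrightarrow> f x"
    "\<And>i x. \<bar>s i x\<bar> \<le> 2 * \<bar>f x\<bar>" by (auto simp: dist_real_def)
  have ms[measurable]: "s i \<in> borel_measurable borel" for i
    using borel_measurable_simple_function[OF s(1)[of i]] by simp
  have L2s: "L2 (s i)" for i
    by (rule L2_bounded_by[OF L2_cmult[OF f, of 2] ms]) (use s(3) in \<open>simp add: abs_mult\<close>)
  show ?thesis
  proof (rule test_approximable_seq[OF f])
    show "test_approximable (s i)" for i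
    proof -
      have fr: "finite (range (s i))" using simple_functionD(1)[OF s(1)[of i]] by simp
      have rep: "s i x = (\<Sum>y\<in>range (s i). y * indicator (s i -` {y}) x)" for x
      proof -
        have "(\<Sum>y\<in>range (s i). y * indicator (s i -` {y}) x) = (\<Sum>y\<in>{s i x}. y * indicator (s i -` {y}) x)"
          by (rule sum.mono_neutral_right[OF fr]) (auto simp: indicator_def)
        then show ?thesis by simp
      qed
      have "test_approximable (\<lambda>x. y * indicator (s i -` {y}) x)" for y
      proof (cases "y = 0")
        case True
        then show ?thesis using test_approximable_sum[of "{}"] by simp
      next
        case False
        have m: "s i -` {y} \<in> sets borel" using measurable_sets[OF ms[of i], of "{y}"] by simp
        have "integrable lborel (\<lambda>x. indicator (s i -` {y}) x :: real)"
        proof (rule Bochner_Integration.integrable_bound)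
          show "integrable lborel (\<lambda>x. (1 / y\<^sup>2) * (s i x)\<^sup>2)" using L2s[of i] by (simp add: L2_def)
          show "AE x in lborel. norm (indicator (s i -` {y}) x :: real) \<le> norm (1 / y\<^sup>2 * (s i x)\<^sup>2)"
            using False by (auto simp: indicator_def)
        qed (use m in simp)
        then have "emeasure lborel (s i -` {y}) < \<infinity>" by (simp add: integrable_indicator_iff)
        then show ?thesis using fin[OF m] by (intro test_approximable_cmult) auto
      qed
      then have "test_approximable (\<lambda>x. \<Sum>y\<in>range (s i). y * indicator (s i -` {y}) x)" by (rule test_approximable_sum)
      moreover have "s i = (\<lambda>x. \<Sum>y\<in>range (s i). y * indicator (s i -` {y}) x)" by (rule ext) (rule rep)
      ultimately show ?thesis by (rule ssubst[rotated])
    qed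
    show "(\<lambda>n. sqnorm (\<lambda>x. f x - s n x)) \<longlonglongrightarrow> 0"
    proof (rule sqnorm_dominated_tendsto[OF L2_cmult[OF f, of 3]])
      show "\<bar>f x - s n x\<bar> \<le> \<bar>3 * f x\<bar>" for n x using s(3)[of n x] by (simp add: abs_mult)
      show "AE x in lborel. (\<lambda>n. f x - s n x) \<longlonglongrightarrow> 0"
      proof (rule AE_I2)
        show "(\<lambda>n. f x - s n x) \<longlonglongrightarrow> 0" for x
          using tendsto_diff[OF tendsto_const[of "f x"] s(2)[of x]] by simp
      qed
    qed simp
  qed
qed

lemma abs_set_integral_le_sqnorm:
  assumes "L2 f" "a \<le> b"
  shows "\<bar>LBINT x:{a..b}. f x\<bar> \<le> sqrt (b - a) * sqrt (sqnorm f)"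
  using pairing_cauchy_schwarz[OF L2_indicator_Icc[of a b] assms(1)] sqnorm_indicator_Icc[OF assms(2)]
  by (simp add: pairing_def set_lebesgue_integral_def)

lemma test_dense_L2:
  assumes "L2 f" "e > 0"
  obtains \<psi> where "test_function \<psi>" "sqnorm (\<lambda>x. f x - \<psi> x) < e"
  using test_approximable_L2[OF assms(1)] assms(2) unfolding test_approximable_def by blast

lemma constant_on_interval:
  fixes F :: "real \<Rightarrow> real"
  assumes "\<And>x. (F has_real_derivative f x) (at x)" "\<And>x. a \<le> x \<Longrightarrow> x \<le> b \<Longrightarrow> f x = 0" "a \<le> b"
  shows "F a = F b"
proof (cases "a = b")
  case False
  then have "a < b" using assms(3) by simp
  from MVT2[OF this, of F f] assms(1) obtain z where "a < z" "z < b" "F b - F a = (b - a) * f z" by blast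
  then show ?thesis using assms(2)[of z] by simp
qed simp

text \<open>
  It is enough to approximate the derivative in \<open>L\<^sup>2\<close> by test functions supported in a fixed interval
  and to integrate. The approximation is first cut off, and then corrected by a multiple of a bump so
  that its integral vanishes; otherwise the primitive would not have compact support. The integral that
  is removed is small because the derivative itself has integral zero.
\<close>

lemma test_dense_H1_compact:
  assumes ac: "ac f g" and L: "L2 f" "L2 g" and R: "R > 0"
    and supp: "\<And>x. \<bar>x\<bar> \<ge> R \<Longrightarrow> f x = 0" "\<And>x. \<bar>x\<bar> \<ge> R \<Longrightarrow> g x = 0" and e: "e > 0"
  obtains \<psi> where "test_function \<psi>" "sqnorm (\<lambda>x. f x - \<psi> x) < e" "sqnorm (\<lambda>x. g x - deriv \<psi> x) < e"
proof -
  obtain \<eta> S :: "real \<Rightarrow> real" where b: "smooth \<eta>" "\<And>x. x \<le> 0 \<or> x \<ge> 1 \<Longrightarrow> \<eta> x = 0"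
    "smooth S" "\<And>x. (S has_real_derivative \<eta> x) (at x)" "\<And>x. x \<le> 0 \<Longrightarrow> S x = 0" "\<And>x. x \<ge> 1 \<Longrightarrow> S x = 1"
    "\<And>x. 0 \<le> S x" "\<And>x. S x \<le> 1" by (rule ex_smooth_step) blast
  have t\<eta>: "test_function \<eta>" by (rule test_functionI[of _ 0 1]) (use b in auto)
  (* The length of the interval that contains all supports, and the loss in the derivative. *)
  define l where "l = 2 * R + 2"
  define M where "M = 2 + 2 * l * sqnorm \<eta>"
  have M: "M \<ge> 2" "l > 0" using R by (auto simp: M_def l_def)
  define d where "d = e / (2 * M * (1 + l\<^sup>2))"
  have d: "d > 0" using e M by (auto simp: d_def intro!: divide_pos_pos mult_pos_pos add_pos_nonneg)
  obtain \<psi>0 where \<psi>0: "test_function \<psi>0" "sqnorm (\<lambda>x. g x - \<psi>0 x) < d" using test_dense_L2[OF L(2) d] by metis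
  define \<theta> where "\<theta> x = S (1 * x + (R + 1)) - S (1 * x + (- R))" for x
  have \<theta>s: "smooth \<theta>" unfolding \<theta>_def by (intro smooth_diff smooth_affine b)
  have \<theta>1: "\<bar>\<theta> x\<bar> \<le> 1" for x unfolding \<theta>_def by (smt (verit) b(7,8))
  have \<theta>2: "\<theta> x = 1" if "\<bar>x\<bar> \<le> R" for x using that b(5)[of "x - R"] b(6)[of "x + (R + 1)"] by (simp add: \<theta>_def)
  have \<theta>3: "\<theta> x = 0" if "\<bar>x\<bar> \<ge> R + 1" for x
    using that R b(5)[of "x - R"] b(5)[of "x + (R + 1)"] b(6)[of "x - R"] b(6)[of "x + (R + 1)"]
    by (cases "x \<ge> 0") (auto simp: \<theta>_def)
  (* The cutoff does not enlarge the error because the derivative vanishes outside the interval. *)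
  define \<kappa> where "\<kappa> x = \<theta> x * \<psi>0 x" for x
  have \<kappa>t: "test_function \<kappa>"
    by (rule test_functionI[of _ "-R-1" "R+1"]) (use \<theta>s \<psi>0 \<theta>3 in \<open>auto simp: \<kappa>_def[abs_def] test_function_smooth intro!: smooth_mult\<close>)
  have L2s: "L2 \<kappa>" "L2 \<psi>0" "L2 \<eta>" using \<kappa>t \<psi>0 t\<eta> by (auto intro: L2_test)
  have g\<kappa>: "g x - \<kappa> x = \<theta> x * (g x - \<psi>0 x)" for x
    using supp(2)[of x] \<theta>2[of x] by (cases "\<bar>x\<bar> \<ge> R") (auto simp: \<kappa>_def algebra_simps)
  have n1: "sqnorm (\<lambda>x. g x - \<kappa> x) < d"
  proof -
    have "sqnorm (\<lambda>x. g x - \<kappa> x) \<le> sqnorm (\<lambda>x. g x - \<psi>0 x)"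
      using L L2s mult_right_mono[OF \<theta>1 abs_ge_zero] by (intro sqnorm_mono L2_diff) (auto simp: g\<kappa> abs_mult)
    then show ?thesis using \<psi>0(2) by simp
  qed
  define c where "c = (LBINT x:{-R-1..R+1}. \<kappa> x)"
  have int: "set_integrable lborel {-R-1..R+1} \<kappa>" "set_integrable lborel {-R-1..R+1} \<eta>"
    by (auto intro!: borel_integrable_atLeastAtMost' smooth_continuous test_function_smooth \<kappa>t b)
  have "c\<^sup>2 \<le> l * d"
  proof -
    have "0 = (LBINT x:{-R-1..R+1}. g x)"
      using ac_FTC[OF ac, of "-R-1" "R+1"] supp(1)[of "-R-1"] supp(1)[of "R+1"] R by simp
    then have "- c = (LBINT x:{-R-1..R+1}. g x - \<kappa> x)"
      unfolding c_def using int ac_loc[OF ac] by (simp add: locally_integrable_def)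
    moreover have "\<bar>LBINT x:{-R-1..R+1}. g x - \<kappa> x\<bar> \<le> sqrt l * sqrt (sqnorm (\<lambda>x. g x - \<kappa> x))"
      using abs_set_integral_le_sqnorm[OF L2_diff[OF L(2) L2s(1)], of "-R-1" "R+1"] R by (simp add: l_def)
    ultimately have "\<bar>c\<bar> \<le> sqrt l * sqrt (sqnorm (\<lambda>x. g x - \<kappa> x))" by linarith
    then have "c\<^sup>2 \<le> l * sqnorm (\<lambda>x. g x - \<kappa> x)"
      using power_mono[of "\<bar>c\<bar>" _ 2] M by (fastforce simp: power_mult_distrib)
    also have "\<dots> \<le> l * d" using n1 M by simp
    finally show ?thesis .
  qed
  define \<psi>' where "\<psi>' x = \<kappa> x + (-c) * \<eta> x" for x
  have t': "test_function \<psi>'" unfolding \<psi>'_def[abs_def] by (intro test_function_add test_function_cmult \<kappa>t t\<eta>)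
  have s': "smooth \<psi>'" using t' by (rule test_function_smooth)
  have z': "\<psi>' x = 0" if "\<bar>x\<bar> \<ge> R + 1" for x
  proof -
    have "x \<le> 0 \<or> x \<ge> 1" using that R by linarith
    then show ?thesis using \<theta>3[OF that] b(2)[of x] by (simp add: \<psi>'_def \<kappa>_def)
  qed
  obtain F where F: "\<And>x. (F has_real_derivative \<psi>' x) (at x)"
    by (rule ex_antideriv[OF smooth_continuous[OF s']]) blast
  define \<psi> where "\<psi> x = F x - F (-R-1)" for x
  have \<psi>d: "(\<psi> has_real_derivative \<psi>' x) (at x)" for x
    unfolding \<psi>_def by (auto intro!: derivative_eq_intros F)
  have dv: "deriv \<psi> = \<psi>'" using \<psi>d DERIV_imp_deriv by blast
  have "\<psi> (R+1) = 0"
  proof -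
    have "\<psi> (R + 1) = (LBINT x:{-R-1..R+1}. \<psi>' x)"
      unfolding \<psi>_def using R by (subst set_integral_FTC[OF F]) (auto intro: smooth_continuous s')
    also have "\<dots> = c + (-c) * (LBINT x:{-R-1..R+1}. \<eta> x)"
      unfolding \<psi>'_def using int by (simp add: c_def)
    also have "(LBINT x:{-R-1..R+1}. \<eta> x) = S (R+1) - S (-R-1)"
      using R by (subst set_integral_FTC[OF b(4)]) (auto intro: smooth_continuous b)
    also have "\<dots> = 1" using R b(5)[of "-R-1"] b(6)[of "R+1"] by simp
    finally show ?thesis by simp
  qed
  have \<psi>z: "\<psi> x = 0" if "\<bar>x\<bar> \<ge> R + 1" for x
  proof (cases "x \<ge> 0")
    case True
    then show ?thesis using constant_on_interval[OF \<psi>d, of "R+1" x] z' that \<open>\<psi> (R+1) = 0\<close> R by simp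
  next
    case False
    then show ?thesis using constant_on_interval[OF \<psi>d, of x "-R-1"] z' that R by (simp add: \<psi>_def)
  qed
  have \<psi>t: "test_function \<psi>"
    by (rule test_functionI[of _ "-R-1" "R+1"]) (use \<psi>z smooth_antideriv[OF \<psi>d s'] in auto)
  have L2': "L2 \<psi>'" "L2 \<psi>" using t' \<psi>t by (auto intro: L2_test)
  have n2: "sqnorm (\<lambda>x. g x - \<psi>' x) \<le> M * d"
  proof -
    have "sqnorm (\<lambda>x. (g x - \<kappa> x) + c * \<eta> x) \<le> 2 * sqnorm (\<lambda>x. g x - \<kappa> x) + 2 * sqnorm (\<lambda>x. c * \<eta> x)"
      using L L2s by (intro sqnorm_add_le L2_diff L2_cmult)
    also have "\<dots> = 2 * sqnorm (\<lambda>x. g x - \<kappa> x) + 2 * (c\<^sup>2 * sqnorm \<eta>)" by (simp add: sqnorm_cmult)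
    also have "\<dots> \<le> 2 * d + 2 * ((l * d) * sqnorm \<eta>)"
      using n1 \<open>c\<^sup>2 \<le> l * d\<close> by (intro add_mono mult_left_mono mult_right_mono) auto
    also have "\<dots> = M * d" by (simp add: M_def algebra_simps)
    finally show ?thesis by (simp add: \<psi>'_def algebra_simps)
  qed
  have n3: "sqnorm (\<lambda>x. f x - \<psi> x) \<le> l\<^sup>2 * (M * d)"
  proof -
    let ?K = "sqrt l * sqrt (sqnorm (\<lambda>x. g x - \<psi>' x))"
    have "\<bar>f x - \<psi> x\<bar> \<le> ?K" if "x \<in> {-R-1..R+1}" for x
    proof -
      have le: "-R-1 \<le> x" using that by simp
      have "f x - \<psi> x = (LBINT x:{-R-1..x}. g x - \<psi>' x)"
        using ac_FTC[OF ac_diff[OF ac ac_C1[OF \<psi>d smooth_continuous[OF s']]] le] supp(1)[of "-R-1"] R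
        by (simp add: \<psi>_def)
      also have "\<bar>\<dots>\<bar> \<le> sqrt (x - (-R-1)) * sqrt (sqnorm (\<lambda>x. g x - \<psi>' x))"
        by (rule abs_set_integral_le_sqnorm[OF L2_diff[OF L(2) L2'(1)] le])
      also have "\<dots> \<le> ?K" using that by (intro mult_right_mono) (auto simp: l_def)
      finally show ?thesis .
    qed
    moreover have "f x - \<psi> x = 0" if "x \<notin> {-R-1..R+1}" for x
    proof -
      have "\<bar>x\<bar> \<ge> R + 1" using that by auto
      then show ?thesis using supp(1)[of x] \<psi>z[of x] by simp
    qed
    ultimately have "sqnorm (\<lambda>x. f x - \<psi> x) \<le> sqnorm (\<lambda>x. ?K * indicator {-R-1..R+1} x)"
      using L L2' M by (intro sqnorm_mono L2_diff L2_cmult L2_indicator_Icc) (auto simp: indicator_def abs_mult)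
    also have "\<dots> = ?K\<^sup>2 * l"
      using R by (simp add: sqnorm_cmult sqnorm_indicator_Icc l_def)
    also have "?K\<^sup>2 = l * sqnorm (\<lambda>x. g x - \<psi>' x)" using M by (simp add: power_mult_distrib)
    also have "l * sqnorm (\<lambda>x. g x - \<psi>' x) * l = l\<^sup>2 * sqnorm (\<lambda>x. g x - \<psi>' x)" by (simp add: power2_eq_square)
    also have "\<dots> \<le> l\<^sup>2 * (M * d)" using n2 by (intro mult_left_mono) auto
    finally show ?thesis .
  qed
  have E: "2 * (M * d) * (1 + l\<^sup>2) = e"
  proof -
    have "1 + l\<^sup>2 > 0" by (rule add_pos_nonneg) auto
    moreover have "2 * (M * (e / (2 * M * k))) * k = e" if "k > 0" for k
      using that M by simp
    ultimately show ?thesis unfolding d_def by blast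
  qed
  have "M * d > 0" using M d by simp
  then have "M * d * l\<^sup>2 \<ge> 0" by simp
  with E \<open>M * d > 0\<close> have "M * d < e" "l\<^sup>2 * (M * d) < e" by (simp_all add: algebra_simps)
  then show ?thesis using that[OF \<psi>t] n2 n3 dv by simp
qed

text \<open>
  Multiplication by wide smooth cutoffs reduces this to compact support.
\<close>

lemma test_dense_H1:
  assumes ac: "ac f g" and L: "L2 f" "L2 g" and e: "e > 0"
  obtains \<psi> where "test_function \<psi>" "sqnorm (\<lambda>x. f x - \<psi> x) < e" "sqnorm (\<lambda>x. g x - deriv \<psi> x) < e"
proof -
  obtain \<eta> S :: "real \<Rightarrow> real" where b: "smooth \<eta>" "\<And>x. x \<le> 0 \<or> x \<ge> 1 \<Longrightarrow> \<eta> x = 0"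
    "smooth S" "\<And>x. (S has_real_derivative \<eta> x) (at x)" "\<And>x. x \<le> 0 \<Longrightarrow> S x = 0" "\<And>x. x \<ge> 1 \<Longrightarrow> S x = 1"
    "\<And>x. 0 \<le> S x" "\<And>x. S x \<le> 1" by (rule ex_smooth_step) blast
  obtain K where K: "K > 0" "\<And>x. x \<in> {0..1} \<Longrightarrow> \<bar>\<eta> x\<bar> \<le> K"
    using bounded_on_Icc[OF smooth_continuous[OF b(1)]] by metis
  have K': "\<bar>\<eta> x\<bar> \<le> K" for x using K b(2)[of x] by (cases "x \<in> {0..1}") auto
  define \<theta> where "\<theta> n x = S (1 * x + (real n + 1)) - S (1 * x + (- real n))" for n x
  define \<theta>' where "\<theta>' n x = \<eta> (1 * x + (real n + 1)) - \<eta> (1 * x + (- real n))" for n x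
  have \<theta>s: "smooth (\<theta> n)" for n unfolding \<theta>_def by (intro smooth_diff smooth_affine b)
  have \<theta>'s: "smooth (\<theta>' n)" for n unfolding \<theta>'_def by (intro smooth_diff smooth_affine b)
  have \<theta>d: "(\<theta> n has_real_derivative \<theta>' n x) (at x)" for n x
    unfolding \<theta>_def \<theta>'_def
    by (rule DERIV_diff; rule DERIV_chain'[OF _ b(4), THEN DERIV_cong]) (auto intro!: derivative_eq_intros)
  have \<theta>1: "\<bar>\<theta> n x\<bar> \<le> 1" for n x unfolding \<theta>_def by (smt (verit) b(7,8))
  have \<theta>'1: "\<bar>\<theta>' n x\<bar> \<le> 2 * K" for n x
    using K'[of "1 * x + (real n + 1)"] K'[of "1 * x + (- real n)"] unfolding \<theta>'_def by linarith
  have \<theta>2: "\<theta> n x = 1" "\<theta>' n x = 0" if "\<bar>x\<bar> \<le> n" for n x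
    using that b(5)[of "x - real n"] b(6)[of "x + (real n + 1)"] b(2)[of "x - real n"] b(2)[of "x + (real n + 1)"] by (auto simp: \<theta>_def \<theta>'_def abs_le_iff algebra_simps)
  have \<theta>3: "\<theta> n x = 0" "\<theta>' n x = 0" if "\<bar>x\<bar> \<ge> real n + 1" for n x
  proof -
    consider "x - real n \<ge> 1" "x + (real n + 1) \<ge> 1" | "x - real n \<le> 0" "x + (real n + 1) \<le> 0"
      using \<open>\<bar>x\<bar> \<ge> real n + 1\<close> by linarith
    then show "\<theta> n x = 0" "\<theta>' n x = 0"
      by (cases; simp add: \<theta>_def \<theta>'_def b)+
  qed
  define f' where "f' n x = \<theta> n x * f x" for n x
  define g' where "g' n x = \<theta> n x * g x + f x * \<theta>' n x" for n x
  have ac': "ac (f' n) (g' n)" for n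
    unfolding f'_def g'_def by (rule ac_mult[OF ac_C1[OF \<theta>d smooth_continuous[OF \<theta>'s]] ac])
  note [measurable] = ac_measurable[OF ac]
  have m[measurable]: "f' n \<in> borel_measurable borel" "g' n \<in> borel_measurable borel" for n
    using ac_measurable[OF ac'] by auto
  have ev: "\<forall>\<^sub>F n in sequentially. \<theta> n x = 1 \<and> \<theta>' n x = 0" for x
  proof -
    obtain N where "\<bar>x\<bar> \<le> real N" using real_arch_simple by blast
    then show ?thesis by (intro eventually_sequentiallyI[of N]) (auto intro!: \<theta>2)
  qed
  have bf: "\<bar>f' n x\<bar> \<le> \<bar>f x\<bar>" for n x
    using mult_right_mono[OF \<theta>1[of n x] abs_ge_zero[of "f x"]] by (simp add: f'_def abs_mult)
  have bg: "\<bar>g' n x\<bar> \<le> \<bar>g x\<bar> + 2 * K * \<bar>f x\<bar>" for n x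
  proof -
    have "\<bar>g' n x\<bar> \<le> \<bar>\<theta> n x\<bar> * \<bar>g x\<bar> + \<bar>f x\<bar> * \<bar>\<theta>' n x\<bar>"
      unfolding g'_def abs_mult[symmetric] by (rule abs_triangle_ineq)
    also have "\<dots> \<le> 1 * \<bar>g x\<bar> + \<bar>f x\<bar> * (2 * K)" by (intro add_mono mult_mono \<theta>1 \<theta>'1) auto
    finally show ?thesis by (simp add: algebra_simps)
  qed
  define w where "w x = 2 * \<bar>g x\<bar> + 2 * K * \<bar>f x\<bar>" for x
  have L2abs: "L2 (\<lambda>x. \<bar>f x\<bar>)" "L2 (\<lambda>x. \<bar>g x\<bar>)" using L by (auto simp: L2_def)
  have w: "L2 w" unfolding w_def by (intro L2_add L2_cmult L2abs)
  have w0: "w x \<ge> 2 * \<bar>g x\<bar> + 2 * K * \<bar>f x\<bar>" for x by (simp add: w_def)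
  have w1: "w x \<ge> 0" for x using K by (simp add: w_def)
  have L': "L2 (f' n)" "L2 (g' n)" for n
    using L2_bounded_by[OF L(1) m(1) bf, of n] L2_bounded_by[OF w m(2)] bg w0 w1
    by (auto, smt (verit))
  have c1: "(\<lambda>n. sqnorm (\<lambda>x. f x - f' n x)) \<longlonglongrightarrow> 0"
  proof (rule sqnorm_dominated_tendsto[OF L2_cmult[OF L(1), of 2]])
    show "\<bar>f x - f' n x\<bar> \<le> \<bar>2 * f x\<bar>" for n x using bf[of n x] by (simp add: abs_mult)
    show "AE x in lborel. (\<lambda>n. f x - f' n x) \<longlonglongrightarrow> 0"
    proof (rule AE_I2, rule tendsto_eventually)
      fix x show "\<forall>\<^sub>F n in sequentially. f x - f' n x = 0"
        using ev[of x] by eventually_elim (simp add: f'_def)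
    qed
  qed simp
  have c2: "(\<lambda>n. sqnorm (\<lambda>x. g x - g' n x)) \<longlonglongrightarrow> 0"
  proof (rule sqnorm_dominated_tendsto[OF w])
    show "\<bar>g x - g' n x\<bar> \<le> \<bar>w x\<bar>" for n x using bg[of n x] w0[of x] by simp
    show "AE x in lborel. (\<lambda>n. g x - g' n x) \<longlonglongrightarrow> 0"
    proof (rule AE_I2, rule tendsto_eventually)
      fix x show "\<forall>\<^sub>F n in sequentially. g x - g' n x = 0"
        using ev[of x] by eventually_elim (simp add: g'_def)
    qed
  qed simp
  have "\<forall>\<^sub>F n in sequentially. sqnorm (\<lambda>x. f x - f' n x) < e/4 \<and> sqnorm (\<lambda>x. g x - g' n x) < e/4"
    using order_tendstoD(2)[OF c1, of "e/4"] order_tendstoD(2)[OF c2, of "e/4"] e by (auto elim: eventually_elim2)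
  then obtain n where n: "sqnorm (\<lambda>x. f x - f' n x) < e/4" "sqnorm (\<lambda>x. g x - g' n x) < e/4"
    by (auto simp: eventually_sequentially)
  obtain \<psi> where p: "test_function \<psi>" "sqnorm (\<lambda>x. f' n x - \<psi> x) < e/4" "sqnorm (\<lambda>x. g' n x - deriv \<psi> x) < e/4"
    by (rule test_dense_H1_compact[OF ac'[of n] L'(1)[of n] L'(2)[of n], of "real n + 1" "e/4"])
       (use e in \<open>auto simp: f'_def g'_def \<theta>3\<close>)
  show ?thesis
  proof (rule that[OF p(1)])
    show "sqnorm (\<lambda>x. f x - \<psi> x) < e"
      using sqnorm_triangle[OF L(1) L'(1)[of n] L2_test[OF p(1)]] n p by simp
    show "sqnorm (\<lambda>x. g x - deriv \<psi> x) < e"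
      using sqnorm_triangle[OF L(2) L'(2)[of n] L2_test[OF test_function_deriv[OF p(1)]]] n p by simp
  qed
qed

section \<open>The double-well potential and states of finite energy\<close>

text \<open>
  The increment of \<open>h\<^sup>2\<close> is at most the integral of \<open>h\<^sup>2 + g\<^sup>2\<close>. If the bound failed at \<open>x\<close>, then \<open>h\<^sup>2\<close>
  would stay above a positive constant to the left of \<open>x\<close> and could not be integrable.
\<close>

lemma sobolev_bound:
  assumes ac: "ac h g" and L: "L2 h" "L2 g"
  shows "(h x)\<^sup>2 \<le> sqnorm h + sqnorm g"
proof (rule ccontr)
  assume neg: "\<not> (h x)\<^sup>2 \<le> sqnorm h + sqnorm g"
  define c where "c = (h x)\<^sup>2 - (sqnorm h + sqnorm g)"
  have c: "c > 0" using neg by (simp add: c_def)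
  note [measurable] = L2_measurable[OF L(1)] L2_measurable[OF L(2)]
  have int: "integrable lborel (\<lambda>x. (h x)\<^sup>2 + (g x)\<^sup>2)" using L by (simp add: L2_def)
  have low: "c \<le> (h y)\<^sup>2" if "y \<le> x" for y
  proof -
    have "(h x)\<^sup>2 - (h y)\<^sup>2 = (LBINT z:{y..x}. 2 * h z * g z)" by (rule ac_FTC[OF ac_square[OF ac] that])
    also have "\<dots> \<le> (LBINT z:{y..x}. (h z)\<^sup>2 + (g z)\<^sup>2)"
    proof (rule set_integral_mono)
      show "set_integrable lborel {y..x} (\<lambda>z. 2 * h z * g z)"
        using ac_loc[OF ac_square[OF ac]] by (simp add: locally_integrable_def)
      show "set_integrable lborel {y..x} (\<lambda>z. (h z)\<^sup>2 + (g z)\<^sup>2)"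
        unfolding set_integrable_def by (rule integrable_mult_indicator[OF _ int]) simp
    qed (rule sum_squares_bound)
    also have "\<dots> \<le> (LBINT z. (h z)\<^sup>2 + (g z)\<^sup>2)"
      unfolding set_lebesgue_integral_def
      by (intro integral_mono integrable_mult_indicator int) (auto simp: indicator_def)
    also have "\<dots> = sqnorm h + sqnorm g" using L by (simp add: sqnorm_def L2_def)
    finally show ?thesis by (simp add: c_def)
  qed
  obtain n :: nat where n: "sqnorm h / c < real n" using reals_Archimedean2 by blast
  have "c * real n = (LBINT z. c * indicator {x - real n..x} z)" by simp
  also have "\<dots> \<le> sqnorm h"
    unfolding sqnorm_def
  proof (rule integral_mono)
    show "integrable lborel (\<lambda>z. c * indicator {x - real n..x} z)"
      by (intro integrable_mult_right integrable_real_indicator) (auto simp: emeasure_lborel_Icc_eq)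
    show "c * indicator {x - real n..x} z \<le> (h z)\<^sup>2" for z
      using low[of z] by (auto simp: indicator_def)
  qed (use L in \<open>simp add: L2_def\<close>)
  finally show False using n c by (simp add: field_simps)
qed

lemma bounded_with_limits:
  fixes f :: "real \<Rightarrow> real"
  assumes "continuous_on UNIV f" "(f \<longlongrightarrow> l) at_bot" "(f \<longlongrightarrow> r) at_top"
  obtains K where "K > 0" "\<And>x. \<bar>f x\<bar> \<le> K"
proof -
  have "\<forall>\<^sub>F x in at_bot. \<bar>f x - l\<bar> < 1" "\<forall>\<^sub>F x in at_top. \<bar>f x - r\<bar> < 1"
    using tendstoD[OF assms(2), of 1] tendstoD[OF assms(3), of 1] by (auto simp: dist_real_def)
  then obtain a b where ab: "\<And>x. x \<le> a \<Longrightarrow> \<bar>f x - l\<bar> < 1" "\<And>x. x \<ge> b \<Longrightarrow> \<bar>f x - r\<bar> < 1"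
    unfolding eventually_at_bot_linorder eventually_at_top_linorder by blast
  obtain K where K: "K > 0" "\<And>x. x \<in> {a..b} \<Longrightarrow> \<bar>f x\<bar> \<le> K" using bounded_on_Icc[OF assms(1)] by metis
  have "\<bar>f x\<bar> \<le> K + \<bar>l\<bar> + \<bar>r\<bar> + 1" for x
  proof -
    consider "x \<le> a" | "x \<ge> b" | "x \<in> {a..b}" by fastforce
    then show ?thesis
    proof cases
      case 1 then show ?thesis using ab(1)[of x] K(1) by linarith
    next
      case 2 then show ?thesis using ab(2)[of x] K(1) by linarith
    next
      case 3 then show ?thesis using K(2)[of x] by linarith
    qed
  qed
  then show ?thesis using that[of "K + \<bar>l\<bar> + \<bar>r\<bar> + 1"] K(1) by auto
qed

locale double_well =
  fixes U :: "real \<Rightarrow> real"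
  assumes U_smooth: "smooth U"
    and U_nonneg: "\<And>y. U y \<ge> 0"
    and U_even: "\<And>y. U (- y) = U y"
    and U_pos: "\<And>y. y \<in> {-1<..<1} \<Longrightarrow> U y > 0"
    and U_1: "U 1 = 0"
    and U2_1: "(deriv ^^ 2) U 1 = 1"
begin

lemma U_m1: "U (-1) = 0" using U_even[of 1] U_1 by simp

lemma U_deriv: "(U has_real_derivative deriv U y) (at y)"
  by (rule smooth_has_deriv[OF U_smooth])

lemma U'_deriv: "(deriv U has_real_derivative deriv (deriv U) y) (at y)"
  by (rule smooth_has_deriv[OF smooth_deriv[OF U_smooth]])

lemma U_cont: "continuous_on S U" "continuous_on S (deriv U)" "continuous_on S (deriv (deriv U))"
  by (intro smooth_continuous smooth_deriv U_smooth)+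

lemma U_measurable [measurable]: "U \<in> borel_measurable borel" "deriv U \<in> borel_measurable borel"
  by (intro borel_measurable_continuous_onI U_cont)+

lemma U''_1: "deriv (deriv U) 1 = 1"
  using U2_1 by (simp add: numeral_2_eq_2)

lemma U'_1: "deriv U 1 = 0"
  by (rule DERIV_local_min[OF U_deriv, of 1]) (use U_nonneg U_1 in \<open>auto intro: zero_less_one\<close>)

text \<open>
  One constant that serves for all the Taylor estimates of \<open>U\<close> on a compact interval.
\<close>

lemma derivative_bounds:
  obtains M where "M > 0"
    "\<And>y. \<bar>y\<bar> \<le> K \<Longrightarrow> \<bar>deriv U y\<bar> \<le> M"
    "\<And>x y. \<bar>x\<bar> \<le> K \<Longrightarrow> \<bar>y\<bar> \<le> K \<Longrightarrow> \<bar>deriv U y - deriv U x\<bar> \<le> M * \<bar>y - x\<bar>"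
    "\<And>x y. \<bar>x\<bar> \<le> K \<Longrightarrow> \<bar>y\<bar> \<le> K \<Longrightarrow> \<bar>U y - U x\<bar> \<le> M * \<bar>y - x\<bar>"
    "\<And>x y. \<bar>x\<bar> \<le> K \<Longrightarrow> \<bar>y\<bar> \<le> K \<Longrightarrow> \<bar>U y - U x - deriv U x * (y - x)\<bar> \<le> M * (y - x)\<^sup>2"
proof -
  obtain A where A: "A > 0" "\<And>x. x \<in> {-K..K} \<Longrightarrow> \<bar>deriv U x\<bar> \<le> A"
    using bounded_on_Icc[OF U_cont(2)] by metis
  obtain B where B: "B > 0" "\<And>x. x \<in> {-K..K} \<Longrightarrow> \<bar>deriv (deriv U) x\<bar> \<le> B"
    using bounded_on_Icc[OF U_cont(3)] by metis
  define M where "M = max A B"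
  have mvt: "\<exists>z. \<bar>z\<bar> \<le> K \<and> \<bar>z - x\<bar> \<le> \<bar>y - x\<bar> \<and> F y - F x = (y - x) * F' z"
    if F: "\<And>y. (F has_real_derivative F' y) (at y)" and xy: "\<bar>x\<bar> \<le> K" "\<bar>y\<bar> \<le> K" for F F' :: "real \<Rightarrow> real" and x y
  proof -
    consider "x = y" | "x < y" | "y < x" by linarith
    then show ?thesis
    proof cases
      case 1 then show ?thesis using xy by auto
    next
      case 2
      from MVT2[OF 2, of F F'] F obtain z where "x < z" "z < y" "F y - F x = (y - x) * F' z" by blast
      then show ?thesis using xy by (intro exI[of _ z]) auto
    next
      case 3
      from MVT2[OF 3, of F F'] F obtain z where "y < z" "z < x" "F x - F y = (x - y) * F' z" by blast
      then show ?thesis using xy by (intro exI[of _ z]) (auto simp: algebra_simps)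
    qed
  qed
  have M: "M > 0" using A by (simp add: M_def)
  have 1: "\<bar>deriv U y\<bar> \<le> M" if "\<bar>y\<bar> \<le> K" for y using A(2)[of y] that by (auto simp: M_def abs_le_iff)
  have 2: "\<bar>deriv (deriv U) y\<bar> \<le> M" if "\<bar>y\<bar> \<le> K" for y using B(2)[of y] that by (auto simp: M_def abs_le_iff)
  have 3: "\<bar>deriv U y - deriv U x\<bar> \<le> M * \<bar>y - x\<bar>" if xy: "\<bar>x\<bar> \<le> K" "\<bar>y\<bar> \<le> K" for x y
  proof -
    obtain z where z: "\<bar>z\<bar> \<le> K" "deriv U y - deriv U x = (y - x) * deriv (deriv U) z" using mvt[OF U'_deriv xy] by blast
    then show ?thesis using mult_right_mono[OF 2[OF z(1)] abs_ge_zero[of "y - x"]] by (simp add: abs_mult mult.commute)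
  qed
  have 4: "\<bar>U y - U x\<bar> \<le> M * \<bar>y - x\<bar>" if xy: "\<bar>x\<bar> \<le> K" "\<bar>y\<bar> \<le> K" for x y
  proof -
    obtain z where z: "\<bar>z\<bar> \<le> K" "U y - U x = (y - x) * deriv U z" using mvt[OF U_deriv xy] by blast
    then show ?thesis using mult_right_mono[OF 1[OF z(1)] abs_ge_zero[of "y - x"]] by (simp add: abs_mult mult.commute)
  qed
  have 5: "\<bar>U y - U x - deriv U x * (y - x)\<bar> \<le> M * (y - x)\<^sup>2" if xy: "\<bar>x\<bar> \<le> K" "\<bar>y\<bar> \<le> K" for x y
  proof -
    obtain z where z: "\<bar>z\<bar> \<le> K" "\<bar>z - x\<bar> \<le> \<bar>y - x\<bar>" "U y - U x = (y - x) * deriv U z" using mvt[OF U_deriv xy] by blast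
    have "\<bar>U y - U x - deriv U x * (y - x)\<bar> = \<bar>deriv U z - deriv U x\<bar> * \<bar>y - x\<bar>"
      by (simp add: z(3) algebra_simps flip: abs_mult)
    also have "\<dots> \<le> (M * \<bar>y - x\<bar>) * \<bar>y - x\<bar>"
      using order_trans[OF 3[OF xy(1) z(1)] mult_left_mono[OF z(2), of M]] M by (intro mult_right_mono) auto
    finally show ?thesis by (simp add: power2_eq_square mult.assoc flip: abs_mult)
  qed
  show ?thesis by (rule that[OF M 1 3 4 5])
qed

text \<open>
  A nonnegative function with bounded second derivative satisfies this bound: otherwise a step of length
  \<open>\<bar>U' y\<bar> / (2 * M)\<close> downhill would make it negative.
\<close>

lemma deriv_square_le:
  obtains C where "C > 0" "\<And>y. \<bar>y\<bar> \<le> K \<Longrightarrow> (deriv U y)\<^sup>2 \<le> C * U y"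
proof -
  obtain M where M: "M > 0" "\<And>y. \<bar>y\<bar> \<le> K + 1 \<Longrightarrow> \<bar>deriv U y\<bar> \<le> M"
    "\<And>x y. \<bar>x\<bar> \<le> K + 1 \<Longrightarrow> \<bar>y\<bar> \<le> K + 1 \<Longrightarrow> \<bar>U y - U x - deriv U x * (y - x)\<bar> \<le> M * (y - x)\<^sup>2"
    using derivative_bounds[of "K + 1"] by metis
  have "(deriv U y)\<^sup>2 \<le> (4 * M) * U y" if "\<bar>y\<bar> \<le> K" for y
  proof -
    (* The step that minimises the quadratic upper bound with second derivative 2 * M. *)
    define h where "h = - deriv U y / (2 * M)"
    have "\<bar>h\<bar> \<le> 1" using M(2)[of y] that M(1) by (simp add: h_def field_simps)
    then have "\<bar>y + h\<bar> \<le> K + 1" using that by linarith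
    from M(3)[OF _ this, of y] that have "U (y + h) - U y - deriv U y * h \<le> M * h\<^sup>2" by simp
    moreover have "deriv U y * h = - 2 * M * h\<^sup>2" using M(1) by (simp add: h_def power2_eq_square field_simps)
    ultimately have "M * h\<^sup>2 \<le> U y" using U_nonneg[of "y + h"] by linarith
    moreover have "(deriv U y)\<^sup>2 = (4 * M) * (M * h\<^sup>2)" using M(1) by (simp add: h_def power2_eq_square field_simps)
    ultimately show ?thesis using M(1) by simp
  qed
  then show ?thesis using that[of "4 * M"] M(1) by simp
qed

text \<open>
  Since \<open>U''\<close> is \<open>1\<close> at the vacua, \<open>U - (\<cdot> - \<iota>)\<^sup>2 / 4\<close> is convex nearby with a critical zero at \<open>\<iota>\<close>. This is
  how smallness of energy becomes closeness to a vacuum.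
\<close>

lemma coercive:
  obtains d where "0 < d" "d \<le> 1"
    "\<And>\<iota> y. \<iota> \<in> {-1, 1} \<Longrightarrow> \<bar>y - \<iota>\<bar> \<le> d \<Longrightarrow> (y - \<iota>)\<^sup>2 \<le> 4 * U y"
proof -
  have "isCont (deriv (deriv U)) 1" using U_cont(3)[of UNIV] by (simp add: continuous_on_eq_continuous_at)
  then obtain e where e: "e > 0" "\<And>y. \<bar>y - 1\<bar> < e \<Longrightarrow> \<bar>deriv (deriv U) y - 1\<bar> < 1 / 2"
    unfolding continuous_at_eps_delta dist_real_def U''_1 by (meson half_gt_zero zero_less_one)
  define k k' k'' where "k y = U y - (y - 1)\<^sup>2 / 4" and "k' y = deriv U y - (y - 1) / 2" and "k'' y = deriv (deriv U) y - 1 / 2" for y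
  have k: "(k has_real_derivative k' y) (at y)" "(k' has_real_derivative k'' y) (at y)" for y
    unfolding k_def k'_def k''_def by (auto intro!: derivative_eq_intros U_deriv U'_deriv)
  have kp: "k y \<ge> 0" if "\<bar>y - 1\<bar> < e" for y
  proof -
    consider "y = 1" | "1 < y" | "y < 1" by linarith
    then show ?thesis
    proof cases
      case 1 then show ?thesis by (simp add: k_def U_1)
    next
      case 2
      from MVT2[OF 2, of k k'] k obtain z where z: "1 < z" "z < y" "k y - k 1 = (y - 1) * k' z" by blast
      from MVT2[OF z(1), of k' k''] k obtain w where w: "1 < w" "w < z" "k' z - k' 1 = (z - 1) * k'' w" by blast
      have "k'' w \<ge> 0" using e(2)[of w] w z that unfolding k''_def by linarith
      then have "k' z \<ge> 0" using w z by (simp add: k'_def U'_1)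
      then show ?thesis using z by (simp add: k_def U_1)
    next
      case 3
      from MVT2[OF 3, of k k'] k obtain z where z: "y < z" "z < 1" "k 1 - k y = (1 - y) * k' z" by blast
      from MVT2[OF z(2), of k' k''] k obtain w where w: "z < w" "w < 1" "k' 1 - k' z = (1 - z) * k'' w" by blast
      have "k'' w \<ge> 0" using e(2)[of w] w z that unfolding k''_def by linarith
      then have "(1 - z) * k'' w \<ge> 0" using z by simp
      moreover have "k' 1 = 0" by (simp add: k'_def U'_1)
      ultimately have "k' z \<le> 0" using w by linarith
      then have "(1 - y) * k' z \<le> 0" using z 3 by (simp add: mult_nonneg_nonpos)
      then show ?thesis using z by (simp add: k_def U_1)
    qed
  qed
  define d where "d = min 1 (e / 2)"
  have d: "0 < d" "d \<le> 1" "d < e" using e(1) by (auto simp: d_def)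
  have 1: "(y - 1)\<^sup>2 \<le> 4 * U y" if "\<bar>y - 1\<bar> \<le> d" for y using kp[of y] that d by (simp add: k_def)
  show ?thesis
  proof (rule that[OF d(1,2)])
    fix \<iota> y :: real assume "\<iota> \<in> {-1, 1}" and y: "\<bar>y - \<iota>\<bar> \<le> d"
    then consider "\<iota> = 1" | "\<iota> = -1" by blast
    then show "(y - \<iota>)\<^sup>2 \<le> 4 * U y"
    proof cases
      case 2
      have "(- y - 1)\<^sup>2 \<le> 4 * U (- y)" using y 2 by (intro 1) auto
      then show ?thesis using 2 by (simp add: U_even power2_eq_square algebra_simps)
    qed (use 1 y in simp)
  qed
qed

text \<open>
  What finite energy means without reference to the choices made in the definition of
  \<^const>\<open>weak_deriv\<close>.
\<close>

lemma sector_facts: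
  assumes u: "u \<in> energy_sector U l r"
  shows sector_ac: "ac (fst u) (weak_deriv (fst u))"
    and sector_L2: "L2 (weak_deriv (fst u))" "L2 (snd u)"
    and sector_potential: "integrable lborel (\<lambda>x. U (fst u x))"
    and sector_energy: "energy U u = ennreal (sqnorm (weak_deriv (fst u)) / 2 + (LBINT x. U (fst u x)) + sqnorm (snd u) / 2)"
proof -
  show ac: "ac (fst u) (weak_deriv (fst u))"
    using u ac_weak_deriv by (auto simp: energy_sector_def)
  note [measurable] = ac_measurable[OF ac]
  have [measurable]: "snd u \<in> borel_measurable borel" using u by (simp add: energy_sector_def)
  have fin: "energy U u < \<infinity>" using u by (simp add: energy_sector_def)
  let ?e = "\<lambda>x. (weak_deriv (fst u) x)\<^sup>2 / 2 + U (fst u x)"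
  have i1: "integrable lborel ?e"
    using fin U_nonneg by (intro integrableI_nonneg) (auto simp: energy_def potential_energy_def)
  have i2: "integrable lborel (\<lambda>x. (snd u x)\<^sup>2 / 2)"
    using fin by (intro integrableI_nonneg) (auto simp: energy_def)
  have "integrable lborel (\<lambda>x. 2 * ((snd u x)\<^sup>2 / 2))" using i2 by (intro integrable_mult_right)
  then show L2p: "L2 (snd u)" by (simp add: L2_def)
  show L2D: "L2 (weak_deriv (fst u))"
    using U_nonneg by (intro L2_dominated[where w = "\<lambda>x. 2 * ?e x"] integrable_mult_right i1) auto
  show iU: "integrable lborel (\<lambda>x. U (fst u x))"
    by (rule Bochner_Integration.integrable_bound[OF i1]) (use U_nonneg in auto)
  have "potential_energy U (fst u) = ennreal (LBINT x. ?e x)"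
    unfolding potential_energy_def by (rule nn_integral_eq_integral[OF i1]) (use U_nonneg in auto)
  also have "(LBINT x. ?e x) = sqnorm (weak_deriv (fst u)) / 2 + (LBINT x. U (fst u x))"
    using L2D iU by (simp add: sqnorm_def L2_def)
  finally have 1: "potential_energy U (fst u) = ennreal (sqnorm (weak_deriv (fst u)) / 2 + (LBINT x. U (fst u x)))" .
  have "(\<integral>\<^sup>+x. ennreal ((snd u x)\<^sup>2 / 2) \<partial>lborel) = ennreal (LBINT x. (snd u x)\<^sup>2 / 2)"
    by (rule nn_integral_eq_integral[OF i2]) auto
  also have "(LBINT x. (snd u x)\<^sup>2 / 2) = sqnorm (snd u) / 2" by (simp add: sqnorm_def)
  finally have 2: "(\<integral>\<^sup>+x. ennreal ((snd u x)\<^sup>2 / 2) \<partial>lborel) = ennreal (sqnorm (snd u) / 2)" .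
  have "(LBINT x. U (fst u x)) \<ge> 0" using U_nonneg by (simp add: integral_nonneg_AE)
  then show "energy U u = ennreal (sqnorm (weak_deriv (fst u)) / 2 + (LBINT x. U (fst u x)) + sqnorm (snd u) / 2)"
    unfolding energy_def 1 2 by (simp flip: ennreal_plus)
qed

lemma sector_bounded:
  assumes "u \<in> energy_sector U l r"
  obtains K where "K > 0" "\<And>x. \<bar>fst u x\<bar> \<le> K"
  using bounded_with_limits assms unfolding energy_sector_def by blast

text \<open>
  A sector is an affine space over \<open>H\<^sup>1 \<times> L\<^sup>2\<close>: near the ends both states are close to the same vacuum, where
  the squared distance to it is dominated by the potential.
\<close>

lemma sector_diff_L2:
  assumes u: "u \<in> energy_sector U l r" "v \<in> energy_sector U l r" and lr: "l \<in> {-1, 1}" "r \<in> {-1, 1}"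
  shows "L2 (\<lambda>x. fst u x - fst v x)"
proof -
  obtain d where d: "0 < d" "\<And>\<iota> y. \<iota> \<in> {-1, 1} \<Longrightarrow> \<bar>y - \<iota>\<bar> \<le> d \<Longrightarrow> (y - \<iota>)\<^sup>2 \<le> 4 * U y"
    using coercive by metis
  obtain K1 where K1: "\<And>x. \<bar>fst u x\<bar> \<le> K1" using sector_bounded[OF u(1)] by metis
  obtain K2 where K2: "\<And>x. \<bar>fst v x\<bar> \<le> K2" using sector_bounded[OF u(2)] by metis
  note [measurable] = ac_measurable[OF sector_ac[OF u(1)]] ac_measurable[OF sector_ac[OF u(2)]]
  have "\<forall>\<^sub>F x in at_bot. \<bar>fst u x - l\<bar> < d \<and> \<bar>fst v x - l\<bar> < d" "\<forall>\<^sub>F x in at_top. \<bar>fst u x - r\<bar> < d \<and> \<bar>fst v x - r\<bar> < d"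
    using u d(1) unfolding energy_sector_def tendsto_iff dist_real_def eventually_conj_iff by auto
  then obtain a b where ab: "\<And>x. x \<le> a \<Longrightarrow> \<bar>fst u x - l\<bar> < d \<and> \<bar>fst v x - l\<bar> < d"
    "\<And>x. x \<ge> b \<Longrightarrow> \<bar>fst u x - r\<bar> < d \<and> \<bar>fst v x - r\<bar> < d"
    unfolding eventually_at_bot_linorder eventually_at_top_linorder by blast
  have key: "(y - z)\<^sup>2 \<le> 8 * (U y + U z)" if "\<iota> \<in> {-1, 1}" "\<bar>y - \<iota>\<bar> < d" "\<bar>z - \<iota>\<bar> < d" for \<iota> y z
  proof -
    have "(y - z)\<^sup>2 \<le> 2 * (y - \<iota>)\<^sup>2 + 2 * (z - \<iota>)\<^sup>2"
      using square_add_le[of "y - \<iota>" "\<iota> - z"] by (simp add: power2_commute[of \<iota> z])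
    then show ?thesis using d(2)[of \<iota> y] d(2)[of \<iota> z] that by simp
  qed
  show ?thesis
  proof (rule L2_dominated[where w = "\<lambda>x. 8 * (U (fst u x) + U (fst v x)) + (K1 + K2)\<^sup>2 * indicator {a..b} x"])
    show "integrable lborel (\<lambda>x. 8 * (U (fst u x) + U (fst v x)) + (K1 + K2)\<^sup>2 * indicator {a..b} x)"
      using sector_potential[OF u(1)] sector_potential[OF u(2)]
      by (intro Bochner_Integration.integrable_add integrable_mult_right integrable_real_indicator) (auto simp: emeasure_lborel_Icc_eq)
    show "AE x in lborel. (fst u x - fst v x)\<^sup>2 \<le> 8 * (U (fst u x) + U (fst v x)) + (K1 + K2)\<^sup>2 * indicator {a..b} x"
    proof (rule AE_I2)
      fix x
      have nn: "0 \<le> 8 * (U (fst u x) + U (fst v x))" "0 \<le> (K1 + K2)\<^sup>2 * indicator {a..b} x"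
        using U_nonneg by (simp_all add: indicator_def)
      show "(fst u x - fst v x)\<^sup>2 \<le> 8 * (U (fst u x) + U (fst v x)) + (K1 + K2)\<^sup>2 * indicator {a..b} x"
      proof (cases "x \<in> {a..b}")
        case True
        have "\<bar>fst u x - fst v x\<bar> \<le> K1 + K2" using K1[of x] K2[of x] by linarith
        then have "(fst u x - fst v x)\<^sup>2 \<le> (K1 + K2)\<^sup>2" by (metis abs_ge_zero power2_abs power_mono)
        then show ?thesis using True nn by simp
      next
        case False
        then have "x \<le> a \<or> x \<ge> b" by auto
        then have "(fst u x - fst v x)\<^sup>2 \<le> 8 * (U (fst u x) + U (fst v x))"
          using key[OF lr(1), of "fst u x" "fst v x"] key[OF lr(2), of "fst u x" "fst v x"] ab[of x] by blast
        then show ?thesis using nn by linarith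
      qed
    qed
  qed simp
qed

lemma sector_force_L2:
  assumes u: "u \<in> energy_sector U l r"
  shows "L2 (\<lambda>x. deriv U (fst u x))"
proof -
  obtain K where K: "\<And>x. \<bar>fst u x\<bar> \<le> K" using sector_bounded[OF u] by metis
  obtain C where C: "\<And>y. \<bar>y\<bar> \<le> K \<Longrightarrow> (deriv U y)\<^sup>2 \<le> C * U y" using deriv_square_le[of K] by metis
  note [measurable] = ac_measurable[OF sector_ac[OF u]]
  show ?thesis
    by (rule L2_dominated[where w = "\<lambda>x. C * U (fst u x)"]) (use C K sector_potential[OF u] in auto)
qed

end

section \<open>Solutions as curves of square-integrable functions\<close>

lemma sqnorm_HL_eq:
  assumes ac: "ac f g" and L: "L2 f" "L2 g" "L2 p"
  shows "sqnorm_HL (f, p) = ennreal (sqnorm f + sqnorm g + sqnorm p)"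
proof -
  have "(\<integral>\<^sup>+x. ennreal ((f x)\<^sup>2 + (weak_deriv f x)\<^sup>2) \<partial>lborel) = (\<integral>\<^sup>+x. ennreal ((f x)\<^sup>2 + (g x)\<^sup>2) \<partial>lborel)"
    by (rule nn_integral_cong_AE) (use weak_deriv_AE[OF ac] in eventually_elim, simp)
  also have "\<dots> = ennreal (LBINT x. (f x)\<^sup>2 + (g x)\<^sup>2)"
    by (rule nn_integral_eq_integral) (use L in \<open>auto simp: L2_def\<close>)
  also have "(LBINT x. (f x)\<^sup>2 + (g x)\<^sup>2) = sqnorm f + sqnorm g" using L by (simp add: sqnorm_def L2_def)
  finally have 1: "(\<integral>\<^sup>+x. ennreal ((f x)\<^sup>2 + (weak_deriv f x)\<^sup>2) \<partial>lborel) = ennreal (sqnorm f + sqnorm g)" .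
  have 2: "(\<integral>\<^sup>+x. ennreal ((p x)\<^sup>2) \<partial>lborel) = ennreal (sqnorm p)"
    unfolding sqnorm_def by (rule nn_integral_eq_integral) (use L in \<open>auto simp: L2_def\<close>)
  show ?thesis unfolding sqnorm_HL_def fst_conv snd_conv 1 2 by (simp flip: ennreal_plus)
qed

text \<open>
  Continuity of a curve in \<open>L\<^sup>2\<close>, for chosen representatives at each time.
\<close>

definition L2_curve :: "(real \<Rightarrow> real \<Rightarrow> real) \<Rightarrow> bool" where
  "L2_curve c \<longleftrightarrow> (\<forall>t. L2 (c t)) \<and> (\<forall>t. ((\<lambda>s. sqnorm (\<lambda>x. c s x - c t x)) \<longlongrightarrow> 0) (at t))"

lemma L2_curve_L2: "L2_curve c \<Longrightarrow> L2 (c t)"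
  by (simp add: L2_curve_def)

lemma L2_curve_tendsto:
  assumes "L2_curve c" "(\<sigma> \<longlongrightarrow> \<tau>) F"
  shows "((\<lambda>s. sqnorm (\<lambda>x. c (\<sigma> s) x - c \<tau> x)) \<longlongrightarrow> 0) F"
proof -
  have "isCont (\<lambda>s. sqnorm (\<lambda>x. c s x - c \<tau> x)) \<tau>"
    using assms(1) by (simp add: L2_curve_def isCont_def sqnorm_def)
  from isCont_tendsto_compose[OF this assms(2)] show ?thesis by (simp add: sqnorm_def)
qed

lemma pairing_curve_tendsto:
  assumes "L2_curve c" "L2_curve d" "(\<sigma> \<longlongrightarrow> \<tau>) F" "(\<rho> \<longlongrightarrow> \<upsilon>) F"
  shows "((\<lambda>s. pairing (c (\<sigma> s)) (d (\<rho> s))) \<longlongrightarrow> pairing (c \<tau>) (d \<upsilon>)) F"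
  by (rule pairing_tendsto) (use assms in \<open>auto intro: L2_curve_L2 L2_curve_tendsto\<close>)

lemma L2_curve_const: "L2 f \<Longrightarrow> L2_curve (\<lambda>_. f)"
  by (simp add: L2_curve_def sqnorm_def)

lemma pairing_curve_continuous:
  assumes "L2_curve c" "L2_curve d"
  shows "continuous_on S (\<lambda>t. pairing (c t) (d t))"
  by (intro continuous_at_imp_continuous_on ballI)
     (auto simp: isCont_def intro!: pairing_curve_tendsto[OF assms] tendsto_ident_at)

lemma sqnorm_curve_continuous: "L2_curve c \<Longrightarrow> continuous_on S (\<lambda>t. sqnorm (c t))"
  unfolding sqnorm_pairing by (rule pairing_curve_continuous)

lemma pairing_curve_continuous1:
  assumes "L2_curve c" "L2 f"
  shows "continuous_on S (\<lambda>t. pairing (c t) f)"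
  using pairing_curve_continuous[OF assms(1) L2_curve_const[OF assms(2)]] .

lemma ac_has_deriv:
  assumes "ac m m'" "continuous_on UNIV m'"
  shows "(m has_real_derivative m' t) (at t)"
proof -
  obtain F where F: "\<And>x. (F has_real_derivative m' x) (at x)"
    by (rule ex_antideriv[OF assms(2)]) blast
  have eq: "m b - m a = F b - F a" if "a \<le> b" for a b
    using ac_FTC[OF assms(1) that] set_integral_FTC[OF F assms(2) that] by simp
  then have "m x = F x + (m 0 - F 0)" for x
  proof (cases "x \<ge> 0")
    case True
    from eq[OF this] show ?thesis by linarith
  next
    case False
    then have "x \<le> 0" by simp
    from eq[OF this] show ?thesis by linarith
  qed
  then have m: "m = (\<lambda>x. F x + (m 0 - F 0))" by (rule ext)
  have "((\<lambda>x. F x + (m 0 - F 0)) has_real_derivative m' t) (at t)"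
    by (auto intro!: derivative_eq_intros F)
  then show ?thesis by (subst m)
qed

lemma abs_set_integral_bound:
  fixes h :: "real \<Rightarrow> real"
  assumes "locally_integrable h" "\<And>x. x \<in> {a..b} \<Longrightarrow> \<bar>h x\<bar> \<le> B" "a \<le> b"
  shows "\<bar>LBINT x:{a..b}. h x\<bar> \<le> B * (b - a)"
proof -
  have "\<bar>LBINT x:{a..b}. h x\<bar> \<le> (LBINT x:{a..b}. \<bar>h x\<bar>)" by (rule abs_set_integral_le[OF assms(1)])
  also have "\<dots> \<le> (LBINT x:{a..b}. B)"
    using locally_integrable_abs[OF assms(1)] locally_integrable_continuous[of "\<lambda>_. B"] assms(2)
    by (intro set_integral_mono) (auto simp: locally_integrable_def)
  also have "\<dots> = B * (b - a)" using assms(3) by (simp add: set_lebesgue_integral_def)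
  finally show ?thesis .
qed

lemma zero_if_le_sqrt:
  assumes "\<And>e. e > 0 \<Longrightarrow> \<bar>d\<bar> \<le> C * sqrt e" "C \<ge> 0"
  shows "d = (0::real)"
proof (rule ccontr)
  assume "d \<noteq> 0"
  then have "(\<bar>d\<bar> / (2 * (C + 1)))\<^sup>2 > 0" using assms(2) by auto
  from assms(1)[OF this] have "\<bar>d\<bar> \<le> C * (\<bar>d\<bar> / (2 * (C + 1)))" using assms(2) by simp
  also have "\<dots> = (C / (C + 1)) * (\<bar>d\<bar> / 2)" using assms(2) by (simp add: field_simps)
  also have "\<dots> \<le> 1 * (\<bar>d\<bar> / 2)" using assms(2) by (intro mult_right_mono) auto
  finally show False using \<open>d \<noteq> 0\<close> by simp
qed

text \<open>
  Only weak differentiability of \<open>d\<close> is available. The mean value theorem, applied to the pairing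
  of \<open>d\<close> with the fixed vector \<open>c (\<tau> + h + a)\<close>, replaces the difference quotient by a value of the
  weak derivative at an intermediate time; joint continuity of the pairing then gives the limit.
\<close>

lemma pairing_product_rule:
  assumes c: "L2_curve c" and d: "L2_curve d" "L2_curve d'"
    and der: "\<And>\<beta> t. L2 \<beta> \<Longrightarrow> ((\<lambda>t. pairing \<beta> (d t)) has_real_derivative pairing \<beta> (d' t)) (at t)"
    and E: "((\<lambda>s. pairing (c (s + a)) (d (\<tau> + b))) has_real_derivative E) (at \<tau>)"
  shows "((\<lambda>s. pairing (c (s + a)) (d (s + b))) has_real_derivative E + pairing (c (\<tau> + a)) (d' (\<tau> + b))) (at \<tau>)"
proof -
  have "\<exists>\<sigma>. \<bar>\<sigma>\<bar> \<le> \<bar>h\<bar> \<and> (pairing (c (\<tau> + h + a)) (d (\<tau> + h + b)) - pairing (c (\<tau> + h + a)) (d (\<tau> + b))) / h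
      = pairing (c (\<tau> + h + a)) (d' (\<tau> + \<sigma> + b))" if "h \<noteq> 0" for h
  proof -
    let ?f = "\<lambda>u. pairing (c (\<tau> + h + a)) (d u)" and ?f' = "\<lambda>u. pairing (c (\<tau> + h + a)) (d' u)"
    have D: "(?f has_real_derivative ?f' u) (at u)" for u by (rule der[OF L2_curve_L2[OF c]])
    show ?thesis
    proof (cases "h > 0")
      case True
      then have "\<tau> + b < \<tau> + h + b" by simp
      from MVT2[OF this, of ?f ?f'] D obtain z where z: "\<tau> + b < z" "z < \<tau> + h + b"
        "?f (\<tau> + h + b) - ?f (\<tau> + b) = (\<tau> + h + b - (\<tau> + b)) * ?f' z" by blast
      then show ?thesis using True by (intro exI[of _ "z - \<tau> - b"]) auto
    next
      case False
      then have "\<tau> + h + b < \<tau> + b" using that by simp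
      from MVT2[OF this, of ?f ?f'] D obtain z where z: "\<tau> + h + b < z" "z < \<tau> + b"
        "?f (\<tau> + b) - ?f (\<tau> + h + b) = (\<tau> + b - (\<tau> + h + b)) * ?f' z" by blast
      then have "?f (\<tau> + h + b) - ?f (\<tau> + b) = h * ?f' z" by (simp add: algebra_simps)
      then show ?thesis using z that by (intro exI[of _ "z - \<tau> - b"]) auto
    qed
  qed
  then obtain \<sigma> where \<sigma>: "\<And>h. h \<noteq> 0 \<Longrightarrow> \<bar>\<sigma> h\<bar> \<le> \<bar>h\<bar>"
    "\<And>h. h \<noteq> 0 \<Longrightarrow> (pairing (c (\<tau> + h + a)) (d (\<tau> + h + b)) - pairing (c (\<tau> + h + a)) (d (\<tau> + b))) / h
      = pairing (c (\<tau> + h + a)) (d' (\<tau> + \<sigma> h + b))"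
    by metis
  have "((\<lambda>h. \<bar>h\<bar>) \<longlongrightarrow> \<bar>0\<bar>) (at (0::real))" by (intro tendsto_rabs tendsto_ident_at)
  then have s0: "(\<sigma> \<longlongrightarrow> 0) (at 0)"
    by (intro Lim_null_comparison[of \<sigma> "\<lambda>h. \<bar>h\<bar>"]) (auto simp: eventually_at_filter \<sigma>(1))
  have "((\<lambda>h. pairing (c (\<tau> + h + a)) (d' (\<tau> + \<sigma> h + b))) \<longlongrightarrow> pairing (c (\<tau> + 0 + a)) (d' (\<tau> + 0 + b))) (at 0)"
    by (intro pairing_curve_tendsto c d tendsto_intros s0)
  then have "((\<lambda>h. pairing (c (\<tau> + h + a)) (d' (\<tau> + \<sigma> h + b))) \<longlongrightarrow> pairing (c (\<tau> + a)) (d' (\<tau> + b))) (at 0)" by simp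
  then have 1: "((\<lambda>h. (pairing (c (\<tau> + h + a)) (d (\<tau> + h + b)) - pairing (c (\<tau> + h + a)) (d (\<tau> + b))) / h) \<longlongrightarrow> pairing (c (\<tau> + a)) (d' (\<tau> + b))) (at 0)"
    by (rule Lim_transform_eventually) (auto simp: eventually_at_filter \<sigma>(2))
  have 2: "((\<lambda>h. (pairing (c (\<tau> + h + a)) (d (\<tau> + b)) - pairing (c (\<tau> + a)) (d (\<tau> + b))) / h) \<longlongrightarrow> E) (at 0)"
    using E by (simp add: DERIV_def)
  show ?thesis
    unfolding DERIV_def using tendsto_add[OF 2 1] by (simp add: diff_divide_distrib)
qed

lemma continuous_test_integrable:
  fixes f \<beta> :: "real \<Rightarrow> real"
  assumes "continuous_on UNIV f" "test_function \<beta>"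
  shows "integrable lborel (\<lambda>x. f x * \<beta> x)"
proof -
  obtain R where R: "\<And>x. \<bar>x\<bar> \<ge> R \<Longrightarrow> \<beta> x = 0" using test_function_support[OF assms(2)] by metis
  have "set_integrable lborel {-R..R} (\<lambda>x. f x * \<beta> x)"
    by (intro borel_integrable_atLeastAtMost' continuous_intros continuous_on_subset[OF assms(1)] smooth_continuous test_function_smooth assms) auto
  moreover have "(\<lambda>x. indicator {-R..R} x *\<^sub>R (f x * \<beta> x)) = (\<lambda>x. f x * \<beta> x)"
    using R by (force simp: indicator_def)
  ultimately show ?thesis by (simp add: set_integrable_def)
qed

text \<open>
  A solution stays in one sector, so its boundary values are fixed once and for all.
\<close>

locale wave = double_well +
  fixes \<phi> :: "real \<Rightarrow> state" and l r :: real
  assumes lr: "l \<in> {-1, 1}" "r \<in> {-1, 1}"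
    and in_sector: "\<And>t. \<phi> t \<in> energy_sector U l r"
    and continuous_curve: "\<And>t. ((\<lambda>s. sqnorm_HL (\<phi> s - \<phi> t)) \<longlongrightarrow> 0) (at t)"
    and weak: "weak_solution U \<phi>"
begin

abbreviation "pos t \<equiv> fst (\<phi> t)"
abbreviation "vel t \<equiv> snd (\<phi> t)"
abbreviation "slope t \<equiv> weak_deriv (fst (\<phi> t))"
abbreviation "force t \<equiv> (\<lambda>x. deriv U (fst (\<phi> t) x))"
abbreviation "disp t \<equiv> (\<lambda>x. fst (\<phi> t) x - fst (\<phi> 0) x)"

lemmas pos_ac = sector_ac[OF in_sector]
lemmas slope_L2 = sector_L2(1)[OF in_sector]
lemmas vel_L2 = sector_L2(2)[OF in_sector]
lemmas force_L2 = sector_force_L2[OF in_sector]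
lemmas pos_diff_L2 = sector_diff_L2[OF in_sector in_sector lr]

lemma solution_sqnorm_diff:
  "sqnorm_HL (\<phi> s - \<phi> t) = ennreal (sqnorm (\<lambda>x. pos s x - pos t x) + sqnorm (\<lambda>x. slope s x - slope t x) + sqnorm (\<lambda>x. vel s x - vel t x))"
proof -
  have "\<phi> s - \<phi> t = (\<lambda>x. pos s x - pos t x, \<lambda>x. vel s x - vel t x)"
    by (simp add: prod_eq_iff fun_diff_def)
  then show ?thesis
    using sqnorm_HL_eq[OF ac_diff[OF pos_ac pos_ac] pos_diff_L2 L2_diff[OF slope_L2 slope_L2] L2_diff[OF vel_L2 vel_L2]] by simp
qed

lemma curve_limits:
  "((\<lambda>s. sqnorm (\<lambda>x. pos s x - pos t x)) \<longlongrightarrow> 0) (at t)"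
  "((\<lambda>s. sqnorm (\<lambda>x. slope s x - slope t x)) \<longlongrightarrow> 0) (at t)"
  "((\<lambda>s. sqnorm (\<lambda>x. vel s x - vel t x)) \<longlongrightarrow> 0) (at t)"
proof -
  have *: "((\<lambda>s. sqnorm (\<lambda>x. pos s x - pos t x) + sqnorm (\<lambda>x. slope s x - slope t x) + sqnorm (\<lambda>x. vel s x - vel t x)) \<longlongrightarrow> 0) (at t)"
    using continuous_curve[of t] unfolding solution_sqnorm_diff
    by (subst (asm) ennreal_0[symmetric], subst (asm) tendsto_ennreal_iff) auto
  have s: "(f \<longlongrightarrow> 0) (at t)" if "\<And>s. 0 \<le> f s" "\<And>s. f s \<le> sqnorm (\<lambda>x. pos s x - pos t x) + sqnorm (\<lambda>x. slope s x - slope t x) + sqnorm (\<lambda>x. vel s x - vel t x)" for f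
    by (rule tendsto_sandwich[OF _ _ tendsto_const *]) (use that in auto)
  show "((\<lambda>s. sqnorm (\<lambda>x. pos s x - pos t x)) \<longlongrightarrow> 0) (at t)"
    "((\<lambda>s. sqnorm (\<lambda>x. slope s x - slope t x)) \<longlongrightarrow> 0) (at t)"
    "((\<lambda>s. sqnorm (\<lambda>x. vel s x - vel t x)) \<longlongrightarrow> 0) (at t)"
    using s[of "\<lambda>s. sqnorm (\<lambda>x. pos s x - pos t x)"] s[of "\<lambda>s. sqnorm (\<lambda>x. slope s x - slope t x)"]
      s[of "\<lambda>s. sqnorm (\<lambda>x. vel s x - vel t x)"] by simp_all
qed

lemma vel_curve: "L2_curve vel" and slope_curve: "L2_curve slope" and disp_curve: "L2_curve disp"
  using curve_limits vel_L2 slope_L2 pos_diff_L2 by (auto simp: L2_curve_def)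

text \<open>
  The displacement is bounded in \<open>H\<^sup>1\<close> on compact time intervals, hence uniformly bounded. This makes the
  smooth nonlinearity Lipschitz along the solution.
\<close>

lemma pos_locally_bounded:
  obtains K where "K > 0" "\<And>t x. t \<in> {a..b} \<Longrightarrow> \<bar>pos t x\<bar> \<le> K"
proof -
  have "L2_curve (\<lambda>t x. slope t x - slope 0 x)"
    using slope_curve by (auto simp: L2_curve_def intro: L2_diff)
  then have c: "continuous_on UNIV (\<lambda>t. sqnorm (disp t) + sqnorm (\<lambda>x. slope t x - slope 0 x))"
    by (intro continuous_intros sqnorm_curve_continuous disp_curve)
  obtain B where B: "B > 0" "\<And>t. t \<in> {a..b} \<Longrightarrow> \<bar>sqnorm (disp t) + sqnorm (\<lambda>x. slope t x - slope 0 x)\<bar> \<le> B"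
    by (rule bounded_on_Icc[OF c, of a b]) blast
  obtain K0 where K0: "K0 > 0" "\<And>x. \<bar>pos 0 x\<bar> \<le> K0" using sector_bounded[OF in_sector] by metis
  have "\<bar>pos t x\<bar> \<le> K0 + sqrt B" if "t \<in> {a..b}" for t x
  proof -
    have "(disp t x)\<^sup>2 \<le> sqnorm (disp t) + sqnorm (\<lambda>x. slope t x - slope 0 x)"
      by (rule sobolev_bound[OF ac_diff[OF pos_ac pos_ac] pos_diff_L2 L2_diff[OF slope_L2 slope_L2]])
    also have "\<dots> \<le> B" using B(2)[OF that] by linarith
    finally have "\<bar>disp t x\<bar> \<le> sqrt B" using real_le_rsqrt by fastforce
    then show ?thesis using K0(2)[of x] by linarith
  qed
  then show ?thesis using that[of "K0 + sqrt B"] K0(1) B(1) by (simp add: add_pos_nonneg)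
qed

lemma force_curve: "L2_curve force"
  unfolding L2_curve_def
proof (intro conjI allI)
  fix t
  obtain K where K: "\<And>s x. s \<in> {t-1..t+1} \<Longrightarrow> \<bar>pos s x\<bar> \<le> K" using pos_locally_bounded by metis
  obtain M where M: "M > 0" "\<And>x y. \<bar>x\<bar> \<le> K \<Longrightarrow> \<bar>y\<bar> \<le> K \<Longrightarrow> \<bar>deriv U y - deriv U x\<bar> \<le> M * \<bar>y - x\<bar>"
    using derivative_bounds[of K] by metis
  have "sqnorm (\<lambda>x. force s x - force t x) \<le> M\<^sup>2 * sqnorm (\<lambda>x. pos s x - pos t x)" if "s \<in> {t-1..t+1}" for s
  proof -
    have "sqnorm (\<lambda>x. force s x - force t x) \<le> sqnorm (\<lambda>x. M * (pos s x - pos t x))"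
      by (intro sqnorm_mono L2_diff L2_cmult force_L2 pos_diff_L2) (use M K[OF that] K[of t] in \<open>simp add: abs_mult\<close>)
    then show ?thesis using sqnorm_cmult[of M "\<lambda>x. pos s x - pos t x"] by simp
  qed
  moreover have "\<forall>\<^sub>F s in at t. s \<in> {t-1..t+1}"
    unfolding eventually_at by (rule exI[of _ 1]) (auto simp: dist_real_def)
  ultimately have ev: "\<forall>\<^sub>F s in at t. sqnorm (\<lambda>x. force s x - force t x) \<le> M\<^sup>2 * sqnorm (\<lambda>x. pos s x - pos t x)"
    by (auto elim: eventually_mono)
  have "((\<lambda>s. M\<^sup>2 * sqnorm (\<lambda>x. pos s x - pos t x)) \<longlongrightarrow> M\<^sup>2 * 0) (at t)" by (intro tendsto_intros curve_limits)
  then show "((\<lambda>s. sqnorm (\<lambda>x. force s x - force t x)) \<longlongrightarrow> 0) (at t)"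
    by (intro tendsto_sandwich[OF _ ev tendsto_const]) auto
qed (rule force_L2)

text \<open>
  The first equation, tested with a product \<open>\<alpha> t * \<beta> x\<close>, says that the pairing with \<open>\<beta>\<close> has a weak time
  derivative. Subtracting the initial profile changes the pairing by a constant only and makes it a pairing
  of square-integrable functions.
\<close>

lemma disp_test_ac:
  assumes \<beta>: "test_function \<beta>"
  shows "ac (\<lambda>t. pairing (disp t) \<beta>) (\<lambda>t. pairing (vel t) \<beta>)"
proof (rule weak_imp_ac)
  have L: "L2 \<beta>" using \<beta> by (rule L2_test)
  show c: "continuous_on UNIV (\<lambda>t. pairing (disp t) \<beta>)" by (rule pairing_curve_continuous1[OF disp_curve L])
  have c2: "continuous_on UNIV (\<lambda>t. pairing (vel t) \<beta>)" by (rule pairing_curve_continuous1[OF vel_curve L])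
  show "has_weak_derivative (\<lambda>t. pairing (disp t) \<beta>) (\<lambda>t. pairing (vel t) \<beta>)"
    unfolding has_weak_derivative_def
  proof (intro conjI allI impI locally_integrable_continuous c c2)
    fix \<alpha> :: "real \<Rightarrow> real" assume \<alpha>: "test_function \<alpha>"
    (* The constant by which the pairing with the position exceeds that with the displacement. *)
    let ?m0 = "LBINT x. pos 0 x * \<beta> x"
    have m: "(LBINT x. pos t x * \<beta> x) = pairing (disp t) \<beta> + ?m0" for t
      unfolding pairing_def left_diff_distrib
      by (subst Bochner_Integration.integral_diff) (auto intro!: continuous_test_integrable ac_cont[OF pos_ac] \<beta>)
    have d1: "deriv (\<lambda>s. \<alpha> s * \<beta> x) t = deriv \<alpha> t * \<beta> x" for t x
      using smooth_has_deriv[OF test_function_smooth[OF \<alpha>]] by (intro DERIV_imp_deriv DERIV_cmult_right)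
    have "- (LBINT t. LBINT x. pos t x * (deriv \<alpha> t * \<beta> x)) = (LBINT t. LBINT x. vel t x * (\<alpha> t * \<beta> x))"
      using weak test_function_product[OF \<alpha> \<beta>] unfolding weak_solution_def by (fastforce simp: d1)
    moreover have "(LBINT x. pos t x * (deriv \<alpha> t * \<beta> x)) = (pairing (disp t) \<beta> + ?m0) * deriv \<alpha> t" for t
      unfolding m[symmetric] by (subst integral_mult_left_zero[symmetric]) (simp add: mult_ac)
    moreover have "(LBINT x. vel t x * (\<alpha> t * \<beta> x)) = pairing (vel t) \<beta> * \<alpha> t" for t
      unfolding pairing_def by (subst integral_mult_left_zero[symmetric]) (simp add: mult_ac)
    ultimately have "(LBINT t. (pairing (disp t) \<beta> + ?m0) * deriv \<alpha> t) = - (LBINT t. pairing (vel t) \<beta> * \<alpha> t)"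
      by simp
    moreover have "(LBINT t. (pairing (disp t) \<beta> + ?m0) * deriv \<alpha> t) = (LBINT t. pairing (disp t) \<beta> * deriv \<alpha> t) + (LBINT t. ?m0 * deriv \<alpha> t)"
      unfolding distrib_right
      by (intro Bochner_Integration.integral_add continuous_test_integrable test_function_deriv \<alpha> c continuous_intros)
    moreover have "(LBINT t. ?m0 * deriv \<alpha> t) = 0"
    proof -
      have "has_weak_derivative (\<lambda>t. ?m0) (\<lambda>t. 0)"
        by (rule ac_imp_weak, rule ac_C1) (auto intro!: derivative_eq_intros)
      then show ?thesis using \<alpha> by (simp add: has_weak_derivative_def)
    qed
    ultimately show "(LBINT t. pairing (disp t) \<beta> * deriv \<alpha> t) = - (LBINT t. pairing (vel t) \<beta> * \<alpha> t)" by linarith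
  qed
qed

text \<open>
  The second equation, tested in the same way; one spatial derivative is moved back from the test function
  to the solution.
\<close>

lemma vel_test_ac:
  assumes \<beta>: "test_function \<beta>"
  shows "ac (\<lambda>t. pairing (vel t) \<beta>) (\<lambda>t. - (pairing (slope t) (deriv \<beta>) + pairing (force t) \<beta>))"
proof (rule weak_imp_ac)
  note \<beta>' = test_function_deriv[OF \<beta>]
  have L: "L2 \<beta>" "L2 (deriv \<beta>)" using \<beta> \<beta>' by (auto intro: L2_test)
  show c: "continuous_on UNIV (\<lambda>t. pairing (vel t) \<beta>)" by (rule pairing_curve_continuous1[OF vel_curve L(1)])
  have c2: "continuous_on UNIV (\<lambda>t. - (pairing (slope t) (deriv \<beta>) + pairing (force t) \<beta>))"
    by (intro continuous_intros pairing_curve_continuous1 slope_curve force_curve L)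
  show "has_weak_derivative (\<lambda>t. pairing (vel t) \<beta>) (\<lambda>t. - (pairing (slope t) (deriv \<beta>) + pairing (force t) \<beta>))"
    unfolding has_weak_derivative_def
  proof (intro conjI allI impI locally_integrable_continuous c c2)
    fix \<alpha> :: "real \<Rightarrow> real" assume \<alpha>: "test_function \<alpha>"
    have d1: "deriv (\<lambda>s. \<alpha> s * \<beta> x) t = deriv \<alpha> t * \<beta> x" for t x
      using smooth_has_deriv[OF test_function_smooth[OF \<alpha>]] by (intro DERIV_imp_deriv DERIV_cmult_right)
    have d2: "deriv (\<lambda>y. \<alpha> t * b y) = (\<lambda>x. \<alpha> t * deriv b x)" if "test_function b" for t b
      using smooth_has_deriv[OF test_function_smooth[OF that]] by (intro ext DERIV_imp_deriv DERIV_cmult)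
    have d3: "(deriv ^^ 2) (\<lambda>y. \<alpha> t * \<beta> y) x = \<alpha> t * deriv (deriv \<beta>) x" for t x
      by (simp add: numeral_2_eq_2 d2[OF \<beta>] d2[OF \<beta>'])
    have "- (LBINT t. LBINT x. vel t x * (deriv \<alpha> t * \<beta> x))
        = (LBINT t. LBINT x. pos t x * (\<alpha> t * deriv (deriv \<beta>) x) - deriv U (pos t x) * (\<alpha> t * \<beta> x))"
      using weak[unfolded weak_solution_def, rule_format, OF test_function_product[OF \<alpha> \<beta>]] by (simp add: d1 d3)
    moreover have "(LBINT x. vel t x * (deriv \<alpha> t * \<beta> x)) = pairing (vel t) \<beta> * deriv \<alpha> t" for t
      unfolding pairing_def by (subst integral_mult_left_zero[symmetric]) (simp add: mult_ac)
    moreover have "(LBINT x. pos t x * (\<alpha> t * deriv (deriv \<beta>) x) - deriv U (pos t x) * (\<alpha> t * \<beta> x))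
        = - (pairing (slope t) (deriv \<beta>) + pairing (force t) \<beta>) * \<alpha> t" for t
    proof -
      have "(LBINT x. pos t x * (\<alpha> t * deriv (deriv \<beta>) x) - deriv U (pos t x) * (\<alpha> t * \<beta> x))
        = (LBINT x. (pos t x * deriv (deriv \<beta>) x - force t x * \<beta> x) * \<alpha> t)"
        by (rule Bochner_Integration.integral_cong) (auto simp: algebra_simps)
      also have "\<dots> = ((LBINT x. pos t x * deriv (deriv \<beta>) x) - pairing (force t) \<beta>) * \<alpha> t"
        unfolding pairing_def integral_mult_left_zero
        by (subst Bochner_Integration.integral_diff)
           (auto intro: continuous_test_integrable[OF ac_cont[OF pos_ac] test_function_deriv[OF \<beta>']] L2_mult_integrable[OF force_L2 L(1)])
      also have "(LBINT x. pos t x * deriv (deriv \<beta>) x) = - pairing (slope t) (deriv \<beta>)"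
        using ac_imp_weak[OF pos_ac] \<beta>' by (simp add: has_weak_derivative_def pairing_def)
      finally show ?thesis by (simp add: algebra_simps)
    qed
    ultimately show "(LBINT t. pairing (vel t) \<beta> * deriv \<alpha> t) = - (LBINT t. - (pairing (slope t) (deriv \<beta>) + pairing (force t) \<beta>) * \<alpha> t)"
      by simp
  qed
qed

lemma curve_bound:
  assumes "L2_curve c"
  obtains P where "P > 0" "\<And>t. t \<in> {a..b} \<Longrightarrow> sqnorm (c t) \<le> P"
proof -
  obtain P where "P > 0" "\<And>t. t \<in> {a..b} \<Longrightarrow> \<bar>sqnorm (c t)\<bar> \<le> P"
    using bounded_on_Icc[OF sqnorm_curve_continuous[OF assms]] by metis
  then show ?thesis using that by fastforce
qed

text \<open>
  Density of test functions: both sides depend on \<open>\<beta>\<close> continuously in \<open>L\<^sup>2\<close>, with constants that are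
  uniform on compact time intervals.
\<close>

lemma disp_ac:
  assumes \<beta>: "L2 \<beta>"
  shows "ac (\<lambda>t. pairing (disp t) \<beta>) (\<lambda>t. pairing (vel t) \<beta>)"
  unfolding ac_def
proof (intro conjI allI impI)
  show "continuous_on UNIV (\<lambda>t. pairing (disp t) \<beta>)" by (rule pairing_curve_continuous1[OF disp_curve \<beta>])
  show li: "locally_integrable (\<lambda>t. pairing (vel t) \<beta>)"
    by (intro locally_integrable_continuous pairing_curve_continuous1[OF vel_curve \<beta>])
  fix a b :: real assume ab: "a \<le> b"
  obtain P where P: "P > 0" "\<And>t. t \<in> {a..b} \<Longrightarrow> sqnorm (vel t) \<le> P" using curve_bound[OF vel_curve] by metis
  let ?C = "sqrt (sqnorm (disp b)) + sqrt (sqnorm (disp a)) + sqrt P * (b - a)"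
  have "pairing (disp b) \<beta> - pairing (disp a) \<beta> - (LBINT t:{a..b}. pairing (vel t) \<beta>) = 0" (is "?D = 0")
  proof (rule zero_if_le_sqrt[where C = ?C])
    fix e :: real assume e: "e > 0"
    obtain \<psi> where \<psi>: "test_function \<psi>" "sqnorm (\<lambda>x. \<beta> x - \<psi> x) < e" using test_dense_L2[OF \<beta> e] by metis
    let ?h = "\<lambda>x. \<beta> x - \<psi> x"
    have L: "L2 \<psi>" "L2 ?h" using \<psi> \<beta> by (auto intro: L2_test L2_diff)
    have se: "sqrt (sqnorm ?h) \<le> sqrt e" using \<psi> by simp
    have b1: "\<bar>pairing f ?h\<bar> \<le> sqrt (sqnorm f) * sqrt e" if "L2 f" for f
      using order_trans[OF pairing_cauchy_schwarz[OF that L(2)] mult_left_mono[OF se]] by simp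
    have z: "pairing (disp b) \<psi> - pairing (disp a) \<psi> = (LBINT t:{a..b}. pairing (vel t) \<psi>)"
      by (rule ac_FTC[OF disp_test_ac[OF \<psi>(1)] ab])
    have dv: "pairing f ?h = pairing f \<beta> - pairing f \<psi>" if "L2 f" for f
      by (rule pairing_diff_right) (use that \<beta> L in auto)
    have lh: "locally_integrable (\<lambda>t. pairing (vel t) ?h)" "locally_integrable (\<lambda>t. pairing (vel t) \<psi>)"
      by (intro locally_integrable_continuous pairing_curve_continuous1 vel_curve L)+
    have "(LBINT t:{a..b}. pairing (vel t) ?h) = (LBINT t:{a..b}. pairing (vel t) \<beta>) - (LBINT t:{a..b}. pairing (vel t) \<psi>)"
      using li lh by (simp add: dv vel_L2 locally_integrable_def)
    moreover have "\<bar>LBINT t:{a..b}. pairing (vel t) ?h\<bar> \<le> (sqrt P * sqrt e) * (b - a)"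
    proof (rule abs_set_integral_bound[OF lh(1) _ ab])
      fix t assume "t \<in> {a..b}"
      from order_trans[OF b1[OF vel_L2] mult_right_mono[OF real_sqrt_le_mono[OF P(2)[OF this]]]]
      show "\<bar>pairing (vel t) ?h\<bar> \<le> sqrt P * sqrt e" using e by simp
    qed
    ultimately have "\<bar>?D\<bar> \<le> sqrt (sqnorm (disp b)) * sqrt e + sqrt (sqnorm (disp a)) * sqrt e + (sqrt P * sqrt e) * (b - a)"
      using b1[OF pos_diff_L2, of b 0] b1[OF pos_diff_L2, of a 0] z dv[OF pos_diff_L2, of b 0] dv[OF pos_diff_L2, of a 0]
      by linarith
    then show "\<bar>?D\<bar> \<le> ?C * sqrt e" by (simp add: algebra_simps)
  qed (use P ab in simp)
  then show "pairing (disp b) \<beta> - pairing (disp a) \<beta> = (LBINT t:{a..b}. pairing (vel t) \<beta>)" by simp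
qed

text \<open>
  As for the displacement, but \<open>\<beta>\<close> has to be approximated in \<open>H\<^sup>1\<close> because its derivative occurs.
\<close>

lemma vel_ac:
  assumes \<beta>: "ac \<beta> \<gamma>" "L2 \<beta>" "L2 \<gamma>"
  shows "ac (\<lambda>t. pairing (vel t) \<beta>) (\<lambda>t. - (pairing (slope t) \<gamma> + pairing (force t) \<beta>))"
  unfolding ac_def
proof (intro conjI allI impI)
  show "continuous_on UNIV (\<lambda>t. pairing (vel t) \<beta>)" by (rule pairing_curve_continuous1[OF vel_curve \<beta>(2)])
  show li: "locally_integrable (\<lambda>t. - (pairing (slope t) \<gamma> + pairing (force t) \<beta>))"
    by (intro locally_integrable_continuous continuous_intros pairing_curve_continuous1 slope_curve force_curve \<beta>)
  fix a b :: real assume ab: "a \<le> b"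
  obtain P where P: "P > 0" "\<And>t. t \<in> {a..b} \<Longrightarrow> sqnorm (slope t) \<le> P" using curve_bound[OF slope_curve] by metis
  obtain Q where Q: "Q > 0" "\<And>t. t \<in> {a..b} \<Longrightarrow> sqnorm (force t) \<le> Q" using curve_bound[OF force_curve] by metis
  let ?C = "sqrt (sqnorm (vel b)) + sqrt (sqnorm (vel a)) + (sqrt P + sqrt Q) * (b - a)"
  have "pairing (vel b) \<beta> - pairing (vel a) \<beta> - (LBINT t:{a..b}. - (pairing (slope t) \<gamma> + pairing (force t) \<beta>)) = 0" (is "?D = 0")
  proof (rule zero_if_le_sqrt[where C = ?C])
    fix e :: real assume e: "e > 0"
    obtain \<psi> where \<psi>: "test_function \<psi>" "sqnorm (\<lambda>x. \<beta> x - \<psi> x) < e" "sqnorm (\<lambda>x. \<gamma> x - deriv \<psi> x) < e"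
      using test_dense_H1[OF \<beta> e] by metis
    let ?h = "\<lambda>x. \<beta> x - \<psi> x" and ?k = "\<lambda>x. \<gamma> x - deriv \<psi> x"
    have L: "L2 \<psi>" "L2 ?h" "L2 (deriv \<psi>)" "L2 ?k" using L2_test[OF \<psi>(1)] L2_test[OF test_function_deriv[OF \<psi>(1)]] \<beta> by (auto intro: L2_diff)
    have se: "sqrt (sqnorm ?h) \<le> sqrt e" "sqrt (sqnorm ?k) \<le> sqrt e" using \<psi> by simp_all
    have b1: "\<bar>pairing f ?h\<bar> \<le> sqrt (sqnorm f) * sqrt e" if "L2 f" for f
      using order_trans[OF pairing_cauchy_schwarz[OF that L(2)] mult_left_mono[OF se(1)]] by simp
    have b2: "\<bar>pairing f ?k\<bar> \<le> sqrt (sqnorm f) * sqrt e" if "L2 f" for f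
      using order_trans[OF pairing_cauchy_schwarz[OF that L(4)] mult_left_mono[OF se(2)]] by simp
    have z: "pairing (vel b) \<psi> - pairing (vel a) \<psi> = (LBINT t:{a..b}. - (pairing (slope t) (deriv \<psi>) + pairing (force t) \<psi>))"
      by (rule ac_FTC[OF vel_test_ac[OF \<psi>(1)] ab])
    have dv: "pairing f ?h = pairing f \<beta> - pairing f \<psi>" "pairing f ?k = pairing f \<gamma> - pairing f (deriv \<psi>)" if "L2 f" for f
      by (rule pairing_diff_right; use that \<beta> L in auto)+
    have lh: "locally_integrable (\<lambda>t. - (pairing (slope t) ?k + pairing (force t) ?h))" "locally_integrable (\<lambda>t. - (pairing (slope t) (deriv \<psi>) + pairing (force t) \<psi>))"
      by (intro locally_integrable_continuous continuous_intros pairing_curve_continuous1 slope_curve force_curve L)+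
    have "(LBINT t:{a..b}. - (pairing (slope t) ?k + pairing (force t) ?h))
      = (LBINT t:{a..b}. - (pairing (slope t) \<gamma> + pairing (force t) \<beta>) - - (pairing (slope t) (deriv \<psi>) + pairing (force t) \<psi>))"
      by (simp add: dv slope_L2 force_L2 algebra_simps)
    also have "\<dots> = (LBINT t:{a..b}. - (pairing (slope t) \<gamma> + pairing (force t) \<beta>)) - (LBINT t:{a..b}. - (pairing (slope t) (deriv \<psi>) + pairing (force t) \<psi>))"
      using li lh by (intro set_integral_diff) (auto simp: locally_integrable_def)
    finally have e1: "(LBINT t:{a..b}. - (pairing (slope t) ?k + pairing (force t) ?h)) = \<dots>" .
    have e2: "\<bar>LBINT t:{a..b}. - (pairing (slope t) ?k + pairing (force t) ?h)\<bar> \<le> (sqrt P * sqrt e + sqrt Q * sqrt e) * (b - a)"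
    proof (rule abs_set_integral_bound[OF lh(1) _ ab])
      fix t assume t: "t \<in> {a..b}"
      have "\<bar>pairing (slope t) ?k\<bar> \<le> sqrt P * sqrt e"
        using order_trans[OF b2[OF slope_L2] mult_right_mono[OF real_sqrt_le_mono[OF P(2)[OF t]]]] e by simp
      moreover have "\<bar>pairing (force t) ?h\<bar> \<le> sqrt Q * sqrt e"
        using order_trans[OF b1[OF force_L2] mult_right_mono[OF real_sqrt_le_mono[OF Q(2)[OF t]]]] e by simp
      ultimately show "\<bar>- (pairing (slope t) ?k + pairing (force t) ?h)\<bar> \<le> sqrt P * sqrt e + sqrt Q * sqrt e" by linarith
    qed
    have "\<bar>?D\<bar> \<le> sqrt (sqnorm (vel b)) * sqrt e + sqrt (sqnorm (vel a)) * sqrt e + (sqrt P * sqrt e + sqrt Q * sqrt e) * (b - a)"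
      using e1 e2 b1[OF vel_L2, of b] b1[OF vel_L2, of a] z dv(1)[OF vel_L2, of b] dv(1)[OF vel_L2, of a]
      by linarith
    then show "\<bar>?D\<bar> \<le> ?C * sqrt e" by (simp add: algebra_simps)
  qed (use P Q ab in simp)
  then show "pairing (vel b) \<beta> - pairing (vel a) \<beta> = (LBINT t:{a..b}. - (pairing (slope t) \<gamma> + pairing (force t) \<beta>))" by simp
qed

section \<open>Conservation of energy\<close>

lemma disp_deriv:
  assumes "L2 \<beta>"
  shows "((\<lambda>t. pairing \<beta> (disp t)) has_real_derivative pairing \<beta> (vel t)) (at t)"
  using ac_has_deriv[OF disp_ac[OF assms] pairing_curve_continuous1[OF vel_curve assms]] by (simp add: pairing_commute[of \<beta>])

lemma vel_deriv:
  assumes "ac \<beta> \<gamma>" "L2 \<beta>" "L2 \<gamma>"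
  shows "((\<lambda>t. pairing (vel t) \<beta>) has_real_derivative - (pairing (slope t) \<gamma> + pairing (force t) \<beta>)) (at t)"
  by (rule ac_has_deriv[OF vel_ac[OF assms]])
     (intro continuous_intros pairing_curve_continuous1 slope_curve force_curve assms)

text \<open>
  The pairing of the velocity at one time with the displacement at another, along the diagonal direction.
  The displacement at a frozen time belongs to \<open>H\<^sup>1\<close> and is thus admissible in the equation for the velocity;
  the velocity at a frozen time is admissible in the equation for the displacement.
\<close>

lemma two_time_pairing_deriv:
  "((\<lambda>s. pairing (vel (s + a)) (disp (s + b))) has_real_derivative
     - (pairing (slope (\<tau> + a)) (\<lambda>x. slope (\<tau> + b) x - slope 0 x) + pairing (force (\<tau> + a)) (disp (\<tau> + b)))
     + pairing (vel (\<tau> + a)) (vel (\<tau> + b))) (at \<tau>)"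
proof (rule pairing_product_rule[OF vel_curve disp_curve vel_curve disp_deriv])
  show "((\<lambda>s. pairing (vel (s + a)) (disp (\<tau> + b))) has_real_derivative
     - (pairing (slope (\<tau> + a)) (\<lambda>x. slope (\<tau> + b) x - slope 0 x) + pairing (force (\<tau> + a)) (disp (\<tau> + b)))) (at \<tau>)"
    using vel_deriv[OF ac_diff[OF pos_ac pos_ac] pos_diff_L2 L2_diff[OF slope_L2 slope_L2], of "\<tau> + b" 0 "\<tau> + a"]
    by (simp add: DERIV_shift)
qed

definition "pot_energy t = (LBINT x. U (fst (\<phi> t) x))"

text \<open>
  The trapezoidal rule for \<open>U\<close>, integrated over space. The error is quadratic in the displacement, hence of
  second order in the time step.
\<close>

lemma pot_energy_trapezoid:
  assumes K: "\<And>x. \<bar>pos s x\<bar> \<le> K" "\<And>x. \<bar>pos t x\<bar> \<le> K"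
    and M: "M > 0"
      "\<And>x y. \<bar>x\<bar> \<le> K \<Longrightarrow> \<bar>y\<bar> \<le> K \<Longrightarrow> \<bar>deriv U y - deriv U x\<bar> \<le> M * \<bar>y - x\<bar>"
      "\<And>x y. \<bar>x\<bar> \<le> K \<Longrightarrow> \<bar>y\<bar> \<le> K \<Longrightarrow> \<bar>U y - U x - deriv U x * (y - x)\<bar> \<le> M * (y - x)\<^sup>2"
  shows "\<bar>pot_energy t - pot_energy s - pairing (\<lambda>x. force t x + force s x) (\<lambda>x. pos t x - pos s x) / 2\<bar>
    \<le> 2 * M * sqnorm (\<lambda>x. pos t x - pos s x)"
proof -
  let ?h = "\<lambda>x. pos t x - pos s x" and ?F = "\<lambda>x. force t x + force s x"
  have i: "integrable lborel (\<lambda>x. ?F x * ?h x)" "integrable lborel (\<lambda>x. U (pos t x))" "integrable lborel (\<lambda>x. U (pos s x))"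
    by (intro L2_mult_integrable L2_add force_L2 pos_diff_L2 sector_potential[OF in_sector])+
  have eq: "pot_energy t - pot_energy s - pairing ?F ?h / 2 = (LBINT x. U (pos t x) - U (pos s x) - ?F x * ?h x / 2)"
    using i by (simp add: pot_energy_def pairing_def)
  have i2: "integrable lborel (\<lambda>x. U (pos t x) - U (pos s x) - ?F x * ?h x / 2)"
    using i by (intro Bochner_Integration.integrable_diff integrable_divide) auto
  have "\<bar>LBINT x. U (pos t x) - U (pos s x) - ?F x * ?h x / 2\<bar> \<le> (LBINT x. \<bar>U (pos t x) - U (pos s x) - ?F x * ?h x / 2\<bar>)"
    by (rule integral_abs_bound)
  also have "\<dots> \<le> (LBINT x. 2 * M * (?h x)\<^sup>2)"
  proof (rule integral_mono)
    fix x
    have 1: "\<bar>U (pos t x) - U (pos s x) - force s x * ?h x\<bar> \<le> M * (?h x)\<^sup>2" by (rule M(3)[OF K])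
    have "\<bar>force t x - force s x\<bar> * \<bar>?h x\<bar> \<le> (M * \<bar>?h x\<bar>) * \<bar>?h x\<bar>" by (rule mult_right_mono[OF M(2)[OF K]]) simp
    moreover have "(M * \<bar>y\<bar>) * \<bar>y\<bar> = M * y\<^sup>2" for y by (simp add: power2_eq_square mult.assoc)
    ultimately have 2: "\<bar>(force t x - force s x) * ?h x\<bar> \<le> M * (?h x)\<^sup>2"
      by (simp only: abs_mult)
    have "U (pos t x) - U (pos s x) - ?F x * ?h x / 2
      = (U (pos t x) - U (pos s x) - force s x * ?h x) - (force t x - force s x) * ?h x / 2"
      by (simp add: field_simps)
    then show "\<bar>U (pos t x) - U (pos s x) - ?F x * ?h x / 2\<bar> \<le> 2 * M * (?h x)\<^sup>2"
      using 1 2 by linarith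
  qed (use i2 pos_diff_L2 in \<open>auto simp: L2_def\<close>)
  also have "\<dots> = 2 * M * sqnorm ?h" by (simp add: sqnorm_def)
  finally show ?thesis unfolding eq .
qed

lemma pot_energy_continuous: "continuous_on UNIV pot_energy"
proof (intro continuous_at_imp_continuous_on ballI)
  fix s
  obtain K where K: "\<And>t x. t \<in> {s-1..s+1} \<Longrightarrow> \<bar>pos t x\<bar> \<le> K" using pos_locally_bounded by metis
  obtain M where M: "M > 0"
      "\<And>x y. \<bar>x\<bar> \<le> K \<Longrightarrow> \<bar>y\<bar> \<le> K \<Longrightarrow> \<bar>deriv U y - deriv U x\<bar> \<le> M * \<bar>y - x\<bar>"
      "\<And>x y. \<bar>x\<bar> \<le> K \<Longrightarrow> \<bar>y\<bar> \<le> K \<Longrightarrow> \<bar>U y - U x - deriv U x * (y - x)\<bar> \<le> M * (y - x)\<^sup>2"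
    using derivative_bounds[of K] by metis
  let ?g = "\<lambda>t. pairing (\<lambda>x. force t x + force s x) (\<lambda>x. pos t x - pos s x)"
  let ?N = "\<lambda>t. sqnorm (\<lambda>x. pos t x - pos s x)"
  have ev: "\<forall>\<^sub>F t in at s. \<bar>pot_energy t - pot_energy s\<bar> \<le> \<bar>?g t / 2\<bar> + 2 * M * ?N t"
  proof -
    have "\<forall>\<^sub>F t in at s. t \<in> {s-1..s+1}"
      unfolding eventually_at by (rule exI[of _ 1]) (auto simp: dist_real_def)
    then show ?thesis
    proof eventually_elim
      case (elim t)
      from pot_energy_trapezoid[OF K[of s] K[OF elim] M] show ?case by simp
    qed
  qed
  have "((\<lambda>t. sqnorm (\<lambda>x. (force t x + force s x) - (force s x + force s x))) \<longlongrightarrow> 0) (at s)"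
    using force_curve by (simp add: L2_curve_def)
  moreover have "((\<lambda>t. sqnorm (\<lambda>x. (pos t x - pos s x) - (pos s x - pos s x))) \<longlongrightarrow> 0) (at s)"
    using curve_limits(1) by simp
  ultimately have "(?g \<longlongrightarrow> pairing (\<lambda>x. force s x + force s x) (\<lambda>x. pos s x - pos s x)) (at s)"
    by (intro pairing_tendsto[of "\<lambda>t x. force t x + force s x"] L2_add force_L2 pos_diff_L2)
  then have "(?g \<longlongrightarrow> 0) (at s)" by (simp add: pairing_def)
  then have "((\<lambda>t. \<bar>?g t / 2\<bar> + 2 * M * ?N t) \<longlongrightarrow> \<bar>0 / 2\<bar> + 2 * M * 0) (at s)"
    by (intro tendsto_intros curve_limits) simp_all
  then have "((\<lambda>t. \<bar>?g t / 2\<bar> + 2 * M * ?N t) \<longlongrightarrow> 0) (at s)" by simp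
  then have "((\<lambda>t. pot_energy t - pot_energy s) \<longlongrightarrow> 0) (at s)"
    by (rule Lim_null_comparison[rotated]) (use ev in simp)
  then show "isCont pot_energy s" by (simp add: isCont_def LIM_zero_iff)
qed

text \<open>
  Testing the first equation with the increment itself bounds its norm by the time step times the largest
  norm of the velocity.
\<close>

lemma pos_lipschitz:
  assumes P: "\<And>t. t \<in> {a..b} \<Longrightarrow> sqnorm (vel t) \<le> P" and st: "a \<le> s" "s \<le> t" "t \<le> b"
  shows "sqnorm (\<lambda>x. pos t x - pos s x) \<le> P * (t - s)\<^sup>2"
proof -
  let ?h = "\<lambda>x. pos t x - pos s x"
  let ?N = "sqnorm ?h"
  have L: "L2 ?h" by (rule pos_diff_L2)
  have P0: "P \<ge> 0" using order_trans[OF sqnorm_nonneg P[of s]] st by simp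
  have "?N = pairing (disp t) ?h - pairing (disp s) ?h"
    unfolding sqnorm_pairing using pairing_diff_left[OF pos_diff_L2[of t 0] pos_diff_L2[of s 0] L] by simp
  also have "\<dots> = (LBINT \<tau>:{s..t}. pairing (vel \<tau>) ?h)" by (rule ac_FTC[OF disp_ac[OF L] st(2)])
  also have "\<bar>\<dots>\<bar> \<le> (sqrt P * sqrt ?N) * (t - s)"
  proof (rule abs_set_integral_bound[OF _ _ st(2)])
    show "locally_integrable (\<lambda>\<tau>. pairing (vel \<tau>) ?h)"
      by (intro locally_integrable_continuous pairing_curve_continuous1 vel_curve L)
    fix \<tau> assume "\<tau> \<in> {s..t}"
    then have "\<tau> \<in> {a..b}" using st by auto
    from order_trans[OF pairing_cauchy_schwarz[OF vel_L2 L] mult_right_mono[OF real_sqrt_le_mono[OF P[OF this]]]]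
    show "\<bar>pairing (vel \<tau>) ?h\<bar> \<le> sqrt P * sqrt ?N" by simp
  qed
  finally have le: "?N \<le> (sqrt P * sqrt ?N) * (t - s)" by simp
  have "sqrt ?N \<le> sqrt P * (t - s)"
  proof (cases "?N = 0")
    case True then show ?thesis using st P0 by simp
  next
    case False
    then have "sqrt ?N > 0" using sqnorm_nonneg[of ?h] by (simp add: order_less_le)
    moreover have "sqrt ?N * sqrt ?N \<le> (sqrt P * (t - s)) * sqrt ?N" using le by (simp add: mult_ac)
    ultimately show ?thesis by (rule mult_right_le_imp_le[rotated])
  qed
  then have "(sqrt ?N)\<^sup>2 \<le> (sqrt P * (t - s))\<^sup>2" by (rule power_mono) simp
  then show ?thesis using P0 by (simp add: power_mult_distrib)
qed

definition "twice_energy t = sqnorm (snd (\<phi> t)) + sqnorm (weak_deriv (fst (\<phi> t))) + 2 * pot_energy t"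

text \<open>
  For fixed \<open>h\<close> the function \<open>q h\<close> is a difference quotient of the antisymmetrised two-time pairing,
  corrected by primitives of \<open>n\<close> and of the potential energy. It tends to twice the energy as \<open>h\<close> tends to \<open>0\<close>.
  In its derivative all pairings of slopes and velocities cancel, and what remains is the error of the
  trapezoidal rule divided by \<open>h\<close>, which is \<open>O(h)\<close>.
\<close>

lemma twice_energy_step:
  assumes ab: "a < b"
  shows "twice_energy b = twice_energy a"
proof -
  obtain K where K: "\<And>t x. t \<in> {a..b+1} \<Longrightarrow> \<bar>pos t x\<bar> \<le> K" using pos_locally_bounded by metis
  obtain M where M: "M > 0"
      "\<And>x y. \<bar>x\<bar> \<le> K \<Longrightarrow> \<bar>y\<bar> \<le> K \<Longrightarrow> \<bar>deriv U y - deriv U x\<bar> \<le> M * \<bar>y - x\<bar>"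
      "\<And>x y. \<bar>x\<bar> \<le> K \<Longrightarrow> \<bar>y\<bar> \<le> K \<Longrightarrow> \<bar>U y - U x - deriv U x * (y - x)\<bar> \<le> M * (y - x)\<^sup>2"
    using derivative_bounds[of K] by metis
  obtain P where P: "P > 0" "\<And>t. t \<in> {a..b+1} \<Longrightarrow> sqnorm (vel t) \<le> P" using curve_bound[OF vel_curve] by metis
  (* The diagonal values of the terms in the partial derivatives other than the energy itself. *)
  define n where "n t = pairing (force t) (disp t) - pairing (slope t) (slope 0)" for t
  have nc: "continuous_on UNIV n"
    unfolding n_def by (intro continuous_intros pairing_curve_continuous force_curve disp_curve pairing_curve_continuous1 slope_curve slope_L2)
  obtain J where J: "\<And>x. (J has_real_derivative n x) (at x)" by (rule ex_antideriv[OF nc]) blast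
  obtain I where I: "\<And>x. (I has_real_derivative pot_energy x) (at x)" by (rule ex_antideriv[OF pot_energy_continuous]) blast
  define D where "D h \<tau> = pairing (vel (\<tau> + 0)) (disp (\<tau> + h)) - pairing (vel (\<tau> + h)) (disp (\<tau> + 0))" for h \<tau>
  define q where "q h \<tau> = D h \<tau> / h - (J (\<tau> + h) - J \<tau>) / h + 2 * ((I (\<tau> + h) - I \<tau>) / h)" for h \<tau>
  have main: "\<bar>q h b - q h a\<bar> \<le> 4 * M * P * (b - a) * h" if h: "0 < h" "h \<le> 1" for h
  proof -
    define q' where "q' \<tau> = ((- (pairing (slope (\<tau> + 0)) (\<lambda>x. slope (\<tau> + h) x - slope 0 x) + pairing (force (\<tau> + 0)) (disp (\<tau> + h))) + pairing (vel (\<tau> + 0)) (vel (\<tau> + h)))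
       - (- (pairing (slope (\<tau> + h)) (\<lambda>x. slope (\<tau> + 0) x - slope 0 x) + pairing (force (\<tau> + h)) (disp (\<tau> + 0))) + pairing (vel (\<tau> + h)) (vel (\<tau> + 0)))) / h
       - (n (\<tau> + h) - n \<tau>) / h + 2 * ((pot_energy (\<tau> + h) - pot_energy \<tau>) / h)" for \<tau>
    have JI: "((\<lambda>\<tau>. J (\<tau> + h)) has_real_derivative n (\<tau> + h)) (at \<tau>)"
      "((\<lambda>\<tau>. I (\<tau> + h)) has_real_derivative pot_energy (\<tau> + h)) (at \<tau>)" for \<tau>
      by (rule DERIV_shift[THEN iffD1, OF J], rule DERIV_shift[THEN iffD1, OF I])
    have der: "(q h has_real_derivative q' \<tau>) (at \<tau>)" for \<tau>
      unfolding q_def D_def q'_def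
      by (intro DERIV_add DERIV_diff DERIV_cdivide DERIV_cmult two_time_pairing_deriv J I JI)
    from MVT2[OF ab, of "q h" q'] der obtain \<tau> where \<tau>: "a < \<tau>" "\<tau> < b" "q h b - q h a = (b - a) * q' \<tau>" by blast
    have q'_eq: "q' \<tau> = 2 / h * (pot_energy (\<tau> + h) - pot_energy \<tau> - pairing (\<lambda>x. force (\<tau> + h) x + force \<tau> x) (\<lambda>x. pos (\<tau> + h) x - pos \<tau> x) / 2)"
    proof -
      have e1: "(\<lambda>x. pos (\<tau> + h) x - pos \<tau> x) = (\<lambda>x. disp (\<tau> + h) x - disp \<tau> x)" by auto
      have "pairing (\<lambda>x. force (\<tau> + h) x + force \<tau> x) (\<lambda>x. pos (\<tau> + h) x - pos \<tau> x)
          = pairing (force (\<tau> + h)) (disp (\<tau> + h)) - pairing (force (\<tau> + h)) (disp \<tau>)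
            + pairing (force \<tau>) (disp (\<tau> + h)) - pairing (force \<tau>) (disp \<tau>)"
        unfolding e1 using pairing_add_left[OF force_L2[of "\<tau> + h"] force_L2[of \<tau>] L2_diff[OF pos_diff_L2[of "\<tau> + h" 0] pos_diff_L2[of \<tau> 0]]]
          pairing_diff_right[OF pos_diff_L2[of "\<tau> + h" 0] pos_diff_L2[of \<tau> 0] force_L2[of \<tau>]]
          pairing_diff_right[OF pos_diff_L2[of "\<tau> + h" 0] pos_diff_L2[of \<tau> 0] force_L2[of "\<tau> + h"]]
        by linarith
      then have XY: "((- (pairing (slope \<tau>) (\<lambda>x. slope (\<tau> + h) x - slope 0 x) + pairing (force \<tau>) (disp (\<tau> + h))) + pairing (vel \<tau>) (vel (\<tau> + h)))
          - (- (pairing (slope (\<tau> + h)) (\<lambda>x. slope \<tau> x - slope 0 x) + pairing (force (\<tau> + h)) (disp \<tau>)) + pairing (vel (\<tau> + h)) (vel \<tau>)))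
          - (n (\<tau> + h) - n \<tau>) = - pairing (\<lambda>x. force (\<tau> + h) x + force \<tau> x) (\<lambda>x. pos (\<tau> + h) x - pos \<tau> x)" (is "?X - ?Y = - ?S")
        using pairing_diff_right[OF slope_L2[of "\<tau> + h"] slope_L2[of 0] slope_L2[of \<tau>]]
          pairing_diff_right[OF slope_L2[of \<tau>] slope_L2[of 0] slope_L2[of "\<tau> + h"]]
          pairing_commute[of "vel (\<tau> + h)" "vel \<tau>"] pairing_commute[of "slope (\<tau> + h)" "slope \<tau>"]
        unfolding n_def by linarith
      have "x / h - y / h + 2 * (z / h) = 2 / h * (z - s / 2)" if "x - y = - s" for x y z s
      proof -
        have "x / h - y / h + 2 * (z / h) = (x - y) / h + 2 * (z / h)" by (simp add: diff_divide_distrib)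
        then show ?thesis unfolding that using h by (simp add: field_simps)
      qed
      from this[OF XY, of "pot_energy (\<tau> + h) - pot_energy \<tau>"] show ?thesis unfolding q'_def by simp
    qed
    have t: "\<tau> \<in> {a..b+1}" "\<tau> + h \<in> {a..b+1}" using \<tau> h by auto
    have "\<bar>q' \<tau>\<bar> \<le> 2 / h * (2 * M * sqnorm (\<lambda>x. pos (\<tau> + h) x - pos \<tau> x))"
      unfolding q'_eq abs_mult using h by (intro mult_mono pot_energy_trapezoid[OF K[OF t(1)] K[OF t(2)] M]) auto
    also have "\<dots> \<le> 2 / h * (2 * M * (P * (\<tau> + h - \<tau>)\<^sup>2))"
      using h M(1) \<tau> by (intro mult_left_mono pos_lipschitz[of a "b+1"] P) auto
    also have "\<dots> = 4 * M * P * h" using h by (simp add: power2_eq_square)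
    finally have "(b - a) * \<bar>q' \<tau>\<bar> \<le> (b - a) * (4 * M * P * h)" using ab by (intro mult_left_mono) auto
    then show ?thesis using \<tau>(3) ab by (simp add: abs_mult mult_ac)
  qed
  have lim: "((\<lambda>h. q h \<tau>) \<longlongrightarrow> twice_energy \<tau>) (at_right 0)" for \<tau>
  proof -
    have 1: "((\<lambda>h. pairing (vel \<tau>) (disp (h + \<tau>))) has_real_derivative pairing (vel \<tau>) (vel \<tau>)) (at 0)"
      using disp_deriv[OF vel_L2[of \<tau>], of \<tau>] DERIV_shift[of "\<lambda>t. pairing (vel \<tau>) (disp t)" _ 0 \<tau>] by simp
    have 2: "((\<lambda>h. pairing (vel (h + \<tau>)) (disp \<tau>)) has_real_derivative - (pairing (slope \<tau>) (\<lambda>x. slope \<tau> x - slope 0 x) + pairing (force \<tau>) (disp \<tau>))) (at 0)"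
      using vel_deriv[OF ac_diff[OF pos_ac pos_ac] pos_diff_L2 L2_diff[OF slope_L2 slope_L2], of \<tau> 0 \<tau>]
        DERIV_shift[of "\<lambda>t. pairing (vel t) (disp \<tau>)" _ 0 \<tau>] by simp
    have D0: "((\<lambda>h. D h \<tau> / h) \<longlongrightarrow> pairing (vel \<tau>) (vel \<tau>) + (pairing (slope \<tau>) (\<lambda>x. slope \<tau> x - slope 0 x) + pairing (force \<tau>) (disp \<tau>))) (at 0)"
      using DERIV_diff[OF 1 2] by (simp add: DERIV_def D_def add.commute diff_diff_eq2 algebra_simps)
    have J0: "((\<lambda>h. (J (\<tau> + h) - J \<tau>) / h) \<longlongrightarrow> n \<tau>) (at 0)" using J[of \<tau>] by (simp add: DERIV_def)
    have I0: "((\<lambda>h. (I (\<tau> + h) - I \<tau>) / h) \<longlongrightarrow> pot_energy \<tau>) (at 0)" using I[of \<tau>] by (simp add: DERIV_def)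
    have "((\<lambda>h. q h \<tau>) \<longlongrightarrow> pairing (vel \<tau>) (vel \<tau>) + (pairing (slope \<tau>) (\<lambda>x. slope \<tau> x - slope 0 x) + pairing (force \<tau>) (disp \<tau>)) - n \<tau> + 2 * pot_energy \<tau>) (at 0)"
      unfolding q_def by (intro tendsto_intros D0 J0 I0)
    moreover have "pairing (vel \<tau>) (vel \<tau>) + (pairing (slope \<tau>) (\<lambda>x. slope \<tau> x - slope 0 x) + pairing (force \<tau>) (disp \<tau>)) - n \<tau> + 2 * pot_energy \<tau> = twice_energy \<tau>"
      by (simp add: twice_energy_def n_def sqnorm_pairing pairing_diff_right[OF slope_L2[of \<tau>] slope_L2[of 0] slope_L2[of \<tau>]])
    ultimately show ?thesis by (simp add: filterlim_at_split)
  qed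
  have "((\<lambda>h. q h b - q h a) \<longlongrightarrow> twice_energy b - twice_energy a) (at_right 0)" by (intro tendsto_diff lim)
  moreover have "((\<lambda>h. q h b - q h a) \<longlongrightarrow> 0) (at_right 0)"
  proof (rule Lim_null_comparison)
    have "\<forall>\<^sub>F h in at_right (0::real). h \<in> {0<..1}"
      unfolding eventually_at_right_field by (rule exI[of _ 1]) auto
    then show "\<forall>\<^sub>F h in at_right 0. norm (q h b - q h a) \<le> 4 * M * P * (b - a) * h"
      by eventually_elim (use main in auto)
    show "((\<lambda>h. 4 * M * P * (b - a) * h) \<longlongrightarrow> 0) (at_right 0)"
      by (rule tendsto_mult_right_zero) (rule tendsto_ident_at)
  qed
  ultimately have "twice_energy b - twice_energy a = 0" by (rule tendsto_unique[rotated]) simp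
  then show ?thesis by simp
qed

lemma twice_energy_const: "twice_energy t = twice_energy s"
  using twice_energy_step[of s t] twice_energy_step[of t s] by (cases s t rule: linorder_cases) auto

lemma energy_eq_twice_energy: "energy U (\<phi> t) = ennreal (twice_energy t / 2)"
  unfolding sector_energy[OF in_sector] twice_energy_def pot_energy_def by (simp add: add_divide_distrib add_ac)

theorem energy_conserved: "energy U (\<phi> t) = energy U (\<phi> s)"
  unfolding energy_eq_twice_energy using twice_energy_const[of t s] by simp

end

context double_well begin

section \<open>The kink\<close>

text \<open>
  The slope of the kink where it has height \<open>y\<close>, that is, the right-hand side of its first-order equation.
\<close>

definition "kink_slope y = sqrt (2 * U y)"

lemma kink_slope_nonneg [simp]: "kink_slope y \<ge> 0"
  using U_nonneg by (simp add: kink_slope_def)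

lemma kink_slope_square: "(kink_slope y)\<^sup>2 = 2 * U y"
  using U_nonneg by (simp add: kink_slope_def)

lemma kink_slope_even: "kink_slope (- y) = kink_slope y"
  by (simp add: kink_slope_def U_even)

lemma kink_slope_pos: "-1 < y \<Longrightarrow> y < 1 \<Longrightarrow> kink_slope y > 0"
  using U_pos by (simp add: kink_slope_def)

lemma kink_slope_1: "kink_slope 1 = 0" "kink_slope (-1) = 0"
  using U_1 U_m1 by (auto simp: kink_slope_def)

lemma kink_slope_cont: "continuous_on S kink_slope"
  unfolding kink_slope_def by (intro continuous_intros U_cont)

lemma kink_slope_measurable [measurable]: "kink_slope \<in> borel_measurable borel"
  by (intro borel_measurable_continuous_onI kink_slope_cont)

text \<open>
  The derivative \<open>U' / sqrt (2 * U)\<close> is bounded because \<open>U'\<^sup>2\<close> is dominated by \<open>U\<close>. Adding \<open>e > 0\<close> under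
  the root avoids the zeros of \<open>U\<close>.
\<close>

lemma kink_slope_lipschitz:
  obtains \<Lambda> where "\<Lambda> > 0" "\<And>x y. \<bar>x\<bar> \<le> K \<Longrightarrow> \<bar>y\<bar> \<le> K \<Longrightarrow> \<bar>kink_slope y - kink_slope x\<bar> \<le> \<Lambda> * \<bar>y - x\<bar>"
proof -
  obtain C where C: "C > 0" "\<And>y. \<bar>y\<bar> \<le> K \<Longrightarrow> (deriv U y)\<^sup>2 \<le> C * U y" using deriv_square_le[of K] by metis
  have ordered: "\<bar>kink_slope y - kink_slope x\<bar> \<le> sqrt C * \<bar>y - x\<bar>" if xy: "\<bar>x\<bar> \<le> K" "\<bar>y\<bar> \<le> K" "x < y" for x y
  proof -
    have e: "\<bar>sqrt (2 * U y + e) - sqrt (2 * U x + e)\<bar> \<le> sqrt C * \<bar>y - x\<bar>" if "e > 0" for e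
    proof -
      have p: "2 * U z + e > 0" for z using U_nonneg[of z] \<open>e > 0\<close> by linarith
      have "((\<lambda>z. sqrt (2 * U z + e)) has_real_derivative deriv U z / sqrt (2 * U z + e)) (at z)" for z
        using p[of z] by (auto intro!: derivative_eq_intros U_deriv simp: field_simps)
      from MVT2[OF xy(3) this] obtain z where z: "x < z" "z < y"
        "sqrt (2 * U y + e) - sqrt (2 * U x + e) = (y - x) * (deriv U z / sqrt (2 * U z + e))" by blast
      have "(deriv U z)\<^sup>2 \<le> C * U z" using z xy by (intro C(2)) auto
      also have "\<dots> \<le> C * (2 * U z + e)" using C(1) U_nonneg[of z] \<open>e > 0\<close> by (intro mult_left_mono) auto
      finally have "sqrt ((deriv U z)\<^sup>2) \<le> sqrt (C * (2 * U z + e))" by (rule real_sqrt_le_mono)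
      then have "\<bar>deriv U z\<bar> \<le> sqrt C * sqrt (2 * U z + e)" by (simp add: real_sqrt_mult)
      then have "\<bar>deriv U z / sqrt (2 * U z + e)\<bar> \<le> sqrt C" using p[of z] by (simp add: field_simps)
      then have "\<bar>deriv U z / sqrt (2 * U z + e)\<bar> * \<bar>y - x\<bar> \<le> sqrt C * \<bar>y - x\<bar>" by (rule mult_right_mono) simp
      then show ?thesis unfolding z(3) abs_mult by (simp add: mult.commute)
    qed
    have "(\<lambda>n. \<bar>sqrt (2 * U y + 1 / real (Suc n)) - sqrt (2 * U x + 1 / real (Suc n))\<bar>) \<longlonglongrightarrow> \<bar>sqrt (2 * U y + 0) - sqrt (2 * U x + 0)\<bar>"
      by (intro tendsto_intros LIMSEQ_Suc lim_1_over_n)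
    then have "(\<lambda>n. \<bar>sqrt (2 * U y + 1 / real (Suc n)) - sqrt (2 * U x + 1 / real (Suc n))\<bar>) \<longlonglongrightarrow> \<bar>kink_slope y - kink_slope x\<bar>"
      by (simp add: kink_slope_def)
    then show ?thesis by (rule LIMSEQ_le_const2) (use e in auto)
  qed
  have "\<bar>kink_slope y - kink_slope x\<bar> \<le> sqrt C * \<bar>y - x\<bar>" if "\<bar>x\<bar> \<le> K" "\<bar>y\<bar> \<le> K" for x y
    using ordered[of x y] ordered[of y x] that by (cases x y rule: linorder_cases) (auto simp: abs_minus_commute)
  then show ?thesis using that[of "sqrt C"] C(1) by simp
qed

text \<open>
  The antiderivative is fixed up to a constant, and only its increments matter.
\<close>

definition "W = (SOME F. \<forall>x. (F has_real_derivative kink_slope x) (at x))"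

lemma W_deriv: "(W has_real_derivative kink_slope x) (at x)"
proof -
  obtain F where "\<And>x. (F has_real_derivative kink_slope x) (at x)" using ex_antideriv[OF kink_slope_cont] by blast
  then have "\<exists>F. \<forall>x. (F has_real_derivative kink_slope x) (at x)" by blast
  from someI_ex[OF this] show ?thesis by (simp add: W_def)
qed

lemma W_cont: "isCont W x"
  by (rule DERIV_isCont[OF W_deriv])

lemma W_mono: "x \<le> y \<Longrightarrow> W x \<le> W y"
  using W_deriv kink_slope_nonneg by (meson DERIV_nonneg_imp_nondecreasing)

lemma W_strict: assumes "x < y" "\<And>z. x < z \<Longrightarrow> z < y \<Longrightarrow> U z > 0" shows "W x < W y"
proof (rule DERIV_pos_imp_increasing_open[OF assms(1)])
  show "\<exists>d. (W has_real_derivative d) (at z) \<and> 0 < d" if "x < z" "z < y" for z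
    using W_deriv[of z] assms(2)[OF that] by (intro exI[of _ "kink_slope z"]) (auto simp: kink_slope_def)
  show "continuous_on {x..y} W" by (intro continuous_at_imp_continuous_on ballI W_cont)
qed

text \<open>
  This is the potential energy of the kink by \<open>potential_energy_kink\<close>.
\<close>

definition "kink_energy = W 1 - W (-1)"

lemma kink_energy_pos: "kink_energy > 0"
  using W_strict[of "-1" 1] U_pos by (auto simp: kink_energy_def)

abbreviation "H \<equiv> kink U"
abbreviation "G \<equiv> kink_inv U"

lemma G_0: "G 0 = 0"
  by (simp add: kink_inv_def interval_lebesgue_integral_def set_lebesgue_integral_def zero_ereal_def)

lemma G_deriv:
  assumes "-1 < p" "p < 1"
  shows "(G has_real_derivative 1 / kink_slope p) (at p)"
proof -
  (* A compact subinterval of (-1, 1) around 0 and p, on which the integrand is continuous. *)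
  define m where "m = (\<bar>p\<bar> + 1) / 2"
  have m: "\<bar>p\<bar> < m" "m < 1" using assms by (auto simp: m_def)
  have c: "continuous_on {-m..m} (\<lambda>y. 1 / sqrt (2 * U y))"
  proof (intro continuous_intros U_cont ballI)
    fix y assume "y \<in> {-m..m}"
    then have "kink_slope y > 0" using m by (intro kink_slope_pos) auto
    then show "sqrt (2 * U y) \<noteq> 0" by (simp add: kink_slope_def)
  qed
  have "((\<lambda>u. LBINT y=0..u. 1 / sqrt (2 * U y)) has_vector_derivative 1 / sqrt (2 * U p)) (at p within {-m..m})"
    using interval_integral_FTC2[OF _ _ c, of 0 p] m by (simp add: zero_ereal_def abs_less_iff)
  moreover have "(\<lambda>u. LBINT y=ereal 0..ereal u. 1 / sqrt (2 * U y)) = G"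
    by (simp add: kink_inv_def[abs_def] zero_ereal_def)
  ultimately have "(G has_real_derivative 1 / kink_slope p) (at p within {-m..m})"
    by (simp add: has_real_derivative_iff_has_vector_derivative kink_slope_def zero_ereal_def)
  moreover have "at p within {-m..m} = at p"
    by (rule at_within_interior) (use m in \<open>simp add: abs_less_iff\<close>)
  ultimately show ?thesis by simp
qed

lemma G_strict_mono:
  assumes "-1 < p" "p < q" "q < 1"
  shows "G p < G q"
proof (rule DERIV_pos_imp_increasing[OF assms(2)])
  fix x assume "p \<le> x" "x \<le> q"
  then have "-1 < x" "x < 1" using assms by auto
  then show "\<exists>y. (G has_real_derivative y) (at x) \<and> 0 < y"
    using G_deriv kink_slope_pos by (intro exI[of _ "1 / kink_slope x"]) auto
qed

text \<open>
  The integrand of \<open>G\<close> is at least that of a logarithm near \<open>\<plusminus>1\<close>, since the slope vanishes there at least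
  linearly. So \<open>G\<close> is unbounded on both sides and the kink is defined on the whole line.
\<close>

lemma G_bounds:
  obtains \<Lambda> where "\<Lambda> > 0" "\<And>p. 0 \<le> p \<Longrightarrow> p < 1 \<Longrightarrow> - ln (1 - p) / \<Lambda> \<le> G p"
    "\<And>p. -1 < p \<Longrightarrow> p \<le> 0 \<Longrightarrow> G p \<le> ln (1 + p) / \<Lambda>"
proof -
  obtain \<Lambda> where L: "\<Lambda> > 0" "\<And>x y. \<bar>x\<bar> \<le> 1 \<Longrightarrow> \<bar>y\<bar> \<le> 1 \<Longrightarrow> \<bar>kink_slope y - kink_slope x\<bar> \<le> \<Lambda> * \<bar>y - x\<bar>"
    using kink_slope_lipschitz[of 1] by metis
  have b: "kink_slope y \<le> \<Lambda> * (1 - y)" "kink_slope y \<le> \<Lambda> * (1 + y)" if "-1 < y" "y < 1" for y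
    using L(2)[of 1 y] L(2)[of "-1" y] that by (auto simp: kink_slope_1 abs_le_iff add.commute)
  show ?thesis
  proof (rule that[OF L(1)])
    fix p :: real assume p: "0 \<le> p" "p < 1"
    have "G 0 - (- ln (1 - 0) / \<Lambda>) \<le> G p - (- ln (1 - p) / \<Lambda>)"
    proof (rule DERIV_nonneg_imp_nondecreasing[OF p(1)])
      fix x assume x: "0 \<le> x" "x \<le> p"
      have "((\<lambda>p. G p - (- ln (1 - p) / \<Lambda>)) has_real_derivative (1 / kink_slope x - 1 / (\<Lambda> * (1 - x)))) (at x)"
      proof (rule DERIV_diff[OF G_deriv])
        show "((\<lambda>p. - ln (1 - p) / \<Lambda>) has_real_derivative 1 / (\<Lambda> * (1 - x))) (at x)"
          using x p L(1) by (auto intro!: derivative_eq_intros simp: field_simps)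
      qed (use x p in auto)
      moreover have "1 / (\<Lambda> * (1 - x)) \<le> 1 / kink_slope x"
        using x p L(1) b(1)[of x] kink_slope_pos[of x] by (intro divide_left_mono) auto
      ultimately show "\<exists>y. ((\<lambda>p. G p - (- ln (1 - p) / \<Lambda>)) has_real_derivative y) (at x) \<and> 0 \<le> y" by fastforce
    qed
    then show "- ln (1 - p) / \<Lambda> \<le> G p" by (simp add: G_0)
  next
    fix p :: real assume p: "-1 < p" "p \<le> 0"
    have "G p - ln (1 + p) / \<Lambda> \<le> G 0 - ln (1 + 0) / \<Lambda>"
    proof (rule DERIV_nonneg_imp_nondecreasing[OF p(2)])
      fix x assume x: "p \<le> x" "x \<le> 0"
      have "((\<lambda>p. G p - ln (1 + p) / \<Lambda>) has_real_derivative (1 / kink_slope x - 1 / (\<Lambda> * (1 + x)))) (at x)"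
      proof (rule DERIV_diff[OF G_deriv])
        have "((\<lambda>p. ln (1 + p)) has_real_derivative 1 / (1 + x)) (at x)"
          using x p by (auto intro!: derivative_eq_intros)
        from DERIV_cdivide[OF this, of \<Lambda>]
        show "((\<lambda>p. ln (1 + p) / \<Lambda>) has_real_derivative 1 / (\<Lambda> * (1 + x))) (at x)"
          by (simp add: mult.commute)
      qed (use x p in auto)
      moreover have "1 / (\<Lambda> * (1 + x)) \<le> 1 / kink_slope x"
        using x p L(1) b(2)[of x] kink_slope_pos[of x] by (intro divide_left_mono) auto
      ultimately show "\<exists>y. ((\<lambda>p. G p - ln (1 + p) / \<Lambda>) has_real_derivative y) (at x) \<and> 0 \<le> y" by fastforce
    qed
    then show "G p \<le> ln (1 + p) / \<Lambda>" by (simp add: G_0)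
  qed
qed

lemma G_surj:
  obtains p where "-1 < p" "p < 1" "G p = x"
proof -
  obtain \<Lambda> where L: "\<Lambda> > 0" "\<And>p. 0 \<le> p \<Longrightarrow> p < 1 \<Longrightarrow> - ln (1 - p) / \<Lambda> \<le> G p"
    "\<And>p. -1 < p \<Longrightarrow> p \<le> 0 \<Longrightarrow> G p \<le> ln (1 + p) / \<Lambda>" using G_bounds by metis
  define p where "p = 1 - exp (- (\<Lambda> * \<bar>x\<bar>))"
  have p: "0 \<le> p" "p < 1" using L(1) by (auto simp: p_def)
  have ln: "ln (1 - p) = - (\<Lambda> * \<bar>x\<bar>)" "ln (1 + - p) = - (\<Lambda> * \<bar>x\<bar>)" by (simp_all add: p_def)
  have "\<bar>x\<bar> \<le> G p" using L(2)[OF p] L(1) by (simp add: ln)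
  moreover have "G (- p) \<le> - \<bar>x\<bar>" using L(3)[of "- p"] p L(1) ln(2) by simp
  moreover have "continuous_on {-p..p} G"
  proof (intro continuous_at_imp_continuous_on ballI)
    fix y assume "y \<in> {-p..p}"
    then have "-1 < y" "y < 1" using p by auto
    from DERIV_isCont[OF G_deriv[OF this]] show "isCont G y" .
  qed
  ultimately obtain z where "-p \<le> z" "z \<le> p" "G z = x"
    using IVT'[of G "-p" x p] p by (smt (verit))
  then show ?thesis using that[of z] p by auto
qed

lemma G_bij: "bij_betw G {-1<..<1} UNIV"
  unfolding bij_betw_def
proof
  have "strict_mono_on {-1<..<1} G" by (auto simp: strict_mono_on_def intro: G_strict_mono)
  then show "inj_on G {-1<..<1}" by (rule strict_mono_on_imp_inj_on)
  show "G ` {-1<..<1} = UNIV"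
  proof (intro equalityI subset_UNIV subsetI)
    fix x obtain p where "-1 < p" "p < 1" "G p = x" by (rule G_surj)
    then show "x \<in> G ` {-1<..<1}" by (intro image_eqI[of _ _ p]) auto
  qed
qed

lemma H_G: "-1 < p \<Longrightarrow> p < 1 \<Longrightarrow> H (G p) = p"
  unfolding kink_def using G_bij by (intro inv_into_f_f) (auto simp: bij_betw_def)

lemma G_H: "G (H x) = x"
  unfolding kink_def using G_bij by (intro f_inv_into_f) (auto simp: bij_betw_def)

lemma H_range: "-1 < H x" "H x < 1"
proof -
  have "H x \<in> {-1<..<1}" unfolding kink_def using G_bij by (intro inv_into_into) (auto simp: bij_betw_def)
  then show "-1 < H x" "H x < 1" by auto
qed

lemma H_0: "H 0 = 0" using H_G[of 0] G_0 by simp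

lemma H_deriv: "(H has_real_derivative kink_slope (H x)) (at x)"
proof -
  define a b where "a = (-1 + H x) / 2" and "b = (1 + H x) / 2"
  have ab: "-1 < a" "a < H x" "H x < b" "b < 1" using H_range[of x] by (auto simp: a_def b_def)
  have "isCont H (G (H x))"
  proof (rule isCont_inverse_function2[OF ab(2,3)])
    fix z assume "a \<le> z" "z \<le> b"
    then have z: "-1 < z" "z < 1" using ab by auto
    show "H (G z) = z" by (rule H_G[OF z])
    show "isCont G z" by (rule DERIV_isCont[OF G_deriv[OF z]])
  qed
  then have c: "isCont H x" by (simp add: G_H)
  have "(H has_real_derivative inverse (1 / kink_slope (H x))) (at x)"
    by (rule DERIV_inverse_function[where f = G and a = "x - 1" and b = "x + 1"])
       (use c G_deriv[OF H_range, of x] kink_slope_pos[OF H_range, of x] in \<open>auto simp: G_H\<close>)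
  then show ?thesis by simp
qed

lemma H_cont: "continuous_on S H" "isCont H x"
  using DERIV_isCont[OF H_deriv] by (auto intro: continuous_at_imp_continuous_on)

lemma H'_cont: "continuous_on S (\<lambda>x. kink_slope (H x))"
  by (intro continuous_on_compose2[OF kink_slope_cont H_cont(1)]) auto

lemma H_measurable [measurable]: "H \<in> borel_measurable borel"
  by (intro borel_measurable_continuous_onI H_cont)

lemma H_strict_mono: "x < y \<Longrightarrow> H x < H y"
  using H_deriv kink_slope_pos[OF H_range] by (meson DERIV_pos_imp_increasing)

lemma H_mono: "x \<le> y \<Longrightarrow> H x \<le> H y"
  using H_strict_mono[of x y] by (cases "x = y") auto

lemma H_at_top: "(H \<longlongrightarrow> 1) at_top"
proof (rule order_tendstoI)
  fix y :: real assume "y < 1"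
  define p where "p = max y 0"
  define p' where "p' = (p + 1) / 2"
  have p: "-1 < p'" "p' < 1" "y < p'" using \<open>y < 1\<close> by (auto simp: p'_def p_def)
  have "y < H x" if "x \<ge> G p'" for x using H_mono[OF that] H_G[OF p(1,2)] p(3) by simp
  then show "\<forall>\<^sub>F x in at_top. y < H x" unfolding eventually_at_top_linorder by blast
next
  fix y :: real assume "1 < y"
  then have "H x < y" for x using H_range[of x] by simp
  then show "\<forall>\<^sub>F x in at_top. H x < y" by simp
qed

lemma H_at_bot: "(H \<longlongrightarrow> -1) at_bot"
proof (rule order_tendstoI)
  fix y :: real assume "-1 < y"
  define p where "p = min y 0"
  define p' where "p' = (p - 1) / 2"
  have p: "-1 < p'" "p' < 1" "p' < y" using \<open>-1 < y\<close> by (auto simp: p'_def p_def)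
  have "H x < y" if "x \<le> G p'" for x using H_mono[OF that] H_G[OF p(1,2)] p(3) by simp
  then show "\<forall>\<^sub>F x in at_bot. H x < y" unfolding eventually_at_bot_linorder by blast
next
  fix y :: real assume "y < -1"
  then have "y < H x" for x using H_range[of x] by simp
  then show "\<forall>\<^sub>F x in at_bot. y < H x" by simp
qed

text \<open>
  The integrand is the derivative of \<open>W \<circ> H\<close>.
\<close>

lemma H'_square: "integrable lborel (\<lambda>x. (kink_slope (H x))\<^sup>2)" "(LBINT x. (kink_slope (H x))\<^sup>2) = kink_energy"
proof -
  have d: "((\<lambda>x. W (H x)) has_real_derivative (kink_slope (H x))\<^sup>2) (at x)" for x
    using DERIV_chain'[OF H_deriv W_deriv] by (simp only: power2_eq_square)
  have c: "isCont (\<lambda>x. (kink_slope (H x))\<^sup>2) x" for x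
    using H'_cont[of UNIV] by (intro continuous_intros) (simp add: continuous_on_eq_continuous_at)
  have l: "((\<lambda>x. W (H x)) \<longlongrightarrow> W (-1)) at_bot" "((\<lambda>x. W (H x)) \<longlongrightarrow> W 1) at_top"
    by (rule isCont_tendsto_compose[OF W_cont H_at_bot], rule isCont_tendsto_compose[OF W_cont H_at_top])
  have l': "(((\<lambda>x. W (H x)) \<circ> real_of_ereal) \<longlongrightarrow> W (-1)) (at_right (-\<infinity>))" "(((\<lambda>x. W (H x)) \<circ> real_of_ereal) \<longlongrightarrow> W 1) (at_left \<infinity>)"
    using l by (simp_all add: ereal_tendsto_simps1 ereal_tendsto_simps)
  have *: "set_integrable lborel (einterval (-\<infinity>) \<infinity>) (\<lambda>x. (kink_slope (H x))\<^sup>2)" "(LBINT x=-\<infinity>..\<infinity>. (kink_slope (H x))\<^sup>2) = W 1 - W (-1)"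
    by (rule interval_integral_FTC_nonneg[OF _ d c _ l']; simp)+
  show "integrable lborel (\<lambda>x. (kink_slope (H x))\<^sup>2)" using *(1) by (simp add: set_integrable_def einterval_def)
  show "(LBINT x. (kink_slope (H x))\<^sup>2) = kink_energy"
    using *(2) by (simp add: kink_energy_def interval_lebesgue_integral_def set_lebesgue_integral_def einterval_def)
qed

lemma UH_integral: "integrable lborel (\<lambda>x. U (H x))" "(LBINT x. U (H x)) = kink_energy / 2"
  using H'_square by (simp_all add: kink_slope_square)

lemma potential_energy_kink: "potential_energy U H = ennreal kink_energy"
proof -
  have ac: "ac H (\<lambda>x. kink_slope (H x))" by (rule ac_C1[OF H_deriv H'_cont])
  have "potential_energy U H = (\<integral>\<^sup>+x. ennreal ((kink_slope (H x))\<^sup>2) \<partial>lborel)"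
    unfolding potential_energy_def
  proof (rule nn_integral_cong_AE)
    show "AE x in lborel. ennreal ((weak_deriv H x)\<^sup>2 / 2 + U (H x)) = ennreal ((kink_slope (H x))\<^sup>2)"
      using weak_deriv_AE[OF ac] by eventually_elim (simp add: kink_slope_square)
  qed
  also have "\<dots> = ennreal (LBINT x. (kink_slope (H x))\<^sup>2)" by (rule nn_integral_eq_integral[OF H'_square(1)]) simp
  finally show ?thesis by (simp only: H'_square(2))
qed

text \<open>
  The distance of the kink from the vacuum on its side of the centre, with sign.
\<close>

definition "kink_tail x = H x - (if x \<ge> 0 then 1 else -1)"

text \<open>
  The squared \<open>H\<^sup>1\<close> norm of the kink, measured from its vacua, at distance at least \<open>R\<close> from its centre. All
  interactions between kinks are estimated by this quantity, without decay rates.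
\<close>

definition "tail_mass R = (LBINT x. indicator {x. \<bar>x\<bar> \<ge> R} x * ((kink_tail x)\<^sup>2 + (kink_slope (H x))\<^sup>2))"

lemma kink_tail_measurable [measurable]: "kink_tail \<in> borel_measurable borel"
  unfolding kink_tail_def by measurable

lemma kink_tail_bound: "\<bar>kink_tail x\<bar> \<le> 1"
  using H_range[of x] H_mono[of 0 x] H_mono[of x 0] H_0 by (auto simp: kink_tail_def)

lemma kink_tail_small:
  assumes "e > 0"
  obtains R where "R > 0" "\<And>x. \<bar>x\<bar> \<ge> R \<Longrightarrow> \<bar>kink_tail x\<bar> < e"
proof -
  have "\<forall>\<^sub>F x in at_top. \<bar>H x - 1\<bar> < e" "\<forall>\<^sub>F x in at_bot. \<bar>H x - (-1)\<bar> < e"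
    using tendstoD[OF H_at_top assms] tendstoD[OF H_at_bot assms] by (auto simp: dist_real_def)
  then obtain a b where ab: "\<And>x. x \<ge> a \<Longrightarrow> \<bar>H x - 1\<bar> < e" "\<And>x. x \<le> b \<Longrightarrow> \<bar>H x - (-1)\<bar> < e"
    unfolding eventually_at_bot_linorder eventually_at_top_linorder by blast
  show ?thesis
  proof (rule that[of "\<bar>a\<bar> + \<bar>b\<bar> + 1"])
    show "\<bar>kink_tail x\<bar> < e" if "\<bar>x\<bar> \<ge> \<bar>a\<bar> + \<bar>b\<bar> + 1" for x
    proof (cases "x \<ge> 0")
      case True then show ?thesis using ab(1)[of x] that by (simp add: kink_tail_def)
    next
      case False then show ?thesis using ab(2)[of x] that by (simp add: kink_tail_def)
    qed
  qed simp
qed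

lemma kink_tail_L2: "L2 kink_tail"
proof -
  obtain d where d: "0 < d" "\<And>\<iota> y. \<iota> \<in> {-1, 1} \<Longrightarrow> \<bar>y - \<iota>\<bar> \<le> d \<Longrightarrow> (y - \<iota>)\<^sup>2 \<le> 4 * U y"
    using coercive by metis
  obtain R where R: "R > 0" "\<And>x. \<bar>x\<bar> \<ge> R \<Longrightarrow> \<bar>kink_tail x\<bar> < d" using kink_tail_small[OF d(1)] by metis
  show ?thesis
  proof (rule L2_dominated[where w = "\<lambda>x. indicator {-R..R} x + 4 * U (H x)"])
    show "integrable lborel (\<lambda>x. indicator {-R..R} x + 4 * U (H x))"
      using UH_integral by (intro Bochner_Integration.integrable_add integrable_mult_right integrable_real_indicator) (auto simp: emeasure_lborel_Icc_eq)
    show "AE x in lborel. (kink_tail x)\<^sup>2 \<le> indicator {-R..R} x + 4 * U (H x)"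
    proof (rule AE_I2)
      fix x
      have 1: "(kink_tail x)\<^sup>2 \<le> 1" using kink_tail_bound[of x] by (simp add: abs_square_le_1)
      show "(kink_tail x)\<^sup>2 \<le> indicator {-R..R} x + 4 * U (H x)"
      proof (cases "x \<in> {-R..R}")
        case True then show ?thesis using 1 U_nonneg[of "H x"] by simp
      next
        case False
        then have "\<bar>x\<bar> \<ge> R" by auto
        then show ?thesis using d(2)[of "if x \<ge> 0 then 1 else -1" "H x"] R(2)[of x] False by (auto simp: kink_tail_def)
      qed
    qed
  qed simp
qed

lemma tail_mass_integrable: "integrable lborel (\<lambda>x. indicator {x. \<bar>x\<bar> \<ge> R} x * ((kink_tail x)\<^sup>2 + (kink_slope (H x))\<^sup>2))"
proof -
  have "integrable lborel (\<lambda>x. (kink_tail x)\<^sup>2 + (kink_slope (H x))\<^sup>2)"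
    using kink_tail_L2 H'_square(1) by (intro Bochner_Integration.integrable_add) (auto simp: L2_def)
  from integrable_mult_indicator[OF _ this, of "{x. \<bar>x\<bar> \<ge> R}"] show ?thesis by simp
qed

lemma tail_mass_nonneg: "tail_mass R \<ge> 0"
  unfolding tail_mass_def by (rule integral_nonneg_AE) auto

lemma tail_mass_mono: "R \<le> S \<Longrightarrow> tail_mass S \<le> tail_mass R"
  unfolding tail_mass_def by (intro integral_mono tail_mass_integrable) (auto simp: indicator_def)

lemma tail_mass_small:
  assumes "e > 0"
  obtains R where "R > 0" "\<And>S. S \<ge> R \<Longrightarrow> tail_mass S < e"
proof -
  have "(\<lambda>n. tail_mass (real n)) \<longlonglongrightarrow> (LBINT x::real. 0)"
    unfolding tail_mass_def
  proof (rule integral_dominated_convergence[where w = "\<lambda>x. indicator {x. \<bar>x\<bar> \<ge> 0} x * ((kink_tail x)\<^sup>2 + (kink_slope (H x))\<^sup>2)"])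
    show "AE x in lborel. (\<lambda>n. indicator {x. real n \<le> \<bar>x\<bar>} x * ((kink_tail x)\<^sup>2 + (kink_slope (H x))\<^sup>2)) \<longlonglongrightarrow> 0"
    proof (rule AE_I2, rule tendsto_eventually)
      fix x :: real
      obtain N where "\<bar>x\<bar> < real N" using reals_Archimedean2 by blast
      then show "\<forall>\<^sub>F n in sequentially. indicator {x. real n \<le> \<bar>x\<bar>} x * ((kink_tail x)\<^sup>2 + (kink_slope (H x))\<^sup>2) = 0"
        by (intro eventually_sequentiallyI[of N]) (auto simp: indicator_def)
    qed
  qed (use tail_mass_integrable[of 0] in \<open>auto simp: indicator_def\<close>)
  then have "\<forall>\<^sub>F n in sequentially. tail_mass (real n) < e" using assms by (simp add: order_tendstoD)
  then obtain n where n: "tail_mass (real n) < e" by (auto simp: eventually_sequentially)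
  show ?thesis
  proof (rule that[of "real n + 1"])
    fix S assume "S \<ge> real n + 1"
    then have "tail_mass S \<le> tail_mass (real n)" by (intro tail_mass_mono) simp
    then show "tail_mass S < e" using n by simp
  qed simp
qed

end

section \<open>Multikinks\<close>

lemma sqnorm_HL_finite:
  assumes ac: "ac f g" and p: "p \<in> borel_measurable borel" and fin: "sqnorm_HL (f, p) < \<infinity>"
  shows "L2 f" "L2 g" "L2 p"
proof -
  note [measurable] = ac_measurable[OF ac] p
  have "(\<integral>\<^sup>+x. ennreal ((f x)\<^sup>2 + (weak_deriv f x)\<^sup>2) \<partial>lborel) = (\<integral>\<^sup>+x. ennreal ((f x)\<^sup>2 + (g x)\<^sup>2) \<partial>lborel)"
    by (rule nn_integral_cong_AE) (use weak_deriv_AE[OF ac] in eventually_elim, simp)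
  then have fin1: "(\<integral>\<^sup>+x. ennreal ((f x)\<^sup>2 + (g x)\<^sup>2) \<partial>lborel) < \<infinity>" and fin2: "(\<integral>\<^sup>+x. ennreal ((p x)\<^sup>2) \<partial>lborel) < \<infinity>"
    using fin by (auto simp: sqnorm_HL_def)
  have i: "integrable lborel (\<lambda>x. (f x)\<^sup>2 + (g x)\<^sup>2)" using fin1 by (intro integrableI_nonneg) auto
  show "L2 f" "L2 g" by (rule L2_dominated[OF _ i]; simp)+
  have "integrable lborel (\<lambda>x. (p x)\<^sup>2)" using fin2 by (intro integrableI_nonneg) auto
  then show "L2 p" using p by (simp add: L2_def)
qed

lemma lorentz_bounds:
  assumes "\<bar>v\<bar> < 1"
  shows "lorentz v \<ge> 1" "(lorentz v)\<^sup>2 = 1 / (1 - v\<^sup>2)"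
proof -
  have v: "v\<^sup>2 < 1" using assms by (simp add: abs_square_less_1)
  show "lorentz v \<ge> 1" using v by (simp add: lorentz_def)
  show "(lorentz v)\<^sup>2 = 1 / (1 - v\<^sup>2)" using v by (simp add: lorentz_def power_divide)
qed

lemma lorentz_le:
  assumes "v\<^sup>2 \<le> d / 2" "d \<le> 1" "d \<ge> 0"
  shows "\<bar>v\<bar> < 1" "lorentz v \<le> 1 + d"
proof -
  have v: "v\<^sup>2 \<le> 1 / 2" using assms by simp
  then show av: "\<bar>v\<bar> < 1" by (simp add: abs_square_less_1[symmetric])
  have "lorentz v \<le> (lorentz v)\<^sup>2" using self_le_power[OF lorentz_bounds(1)[OF av], of 2] by simp
  also have "\<dots> = 1 / (1 - v\<^sup>2)" by (rule lorentz_bounds(2)[OF av])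
  also have "\<dots> \<le> 1 + d"
  proof -
    have "v\<^sup>2 * d \<le> v\<^sup>2 * 1" using assms by (intro mult_left_mono) auto
    then have "1 \<le> (1 + d) * (1 - v\<^sup>2)" using assms v by (simp add: algebra_simps)
    then show ?thesis using v by (simp add: field_simps)
  qed
  finally show "lorentz v \<le> 1 + d" .
qed

text \<open>
  Cauchy--Schwarz for alternating sums of at most \<open>n\<close> terms.
\<close>

lemma sum_square_le:
  fixes c :: "nat \<Rightarrow> real"
  assumes "I \<subseteq> {1..n}" "\<And>j. j \<in> I \<Longrightarrow> (c j)\<^sup>2 \<le> t j" "\<And>j. j \<in> {1..n} \<Longrightarrow> t j \<ge> 0"
  shows "(\<Sum>j\<in>I. (-1) ^ j * c j)\<^sup>2 \<le> real n * (\<Sum>j=1..n. t j)"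
proof -
  have ci: "card I \<le> n" using card_mono[OF _ assms(1)] by simp
  have "(\<Sum>j\<in>I. (-1) ^ j * c j)\<^sup>2 \<le> (\<Sum>j\<in>I. ((-1) ^ j * c j)\<^sup>2) * real (card I)"
    by (rule sum_squared_le_sum_of_squares)
  also have "(\<Sum>j\<in>I. ((-1) ^ j * c j)\<^sup>2) = (\<Sum>j\<in>I. (c j)\<^sup>2)"
    by (rule sum.cong) (auto simp: power_mult_distrib simp flip: power_mult)
  also have "(\<Sum>j\<in>I. (c j)\<^sup>2) * real (card I) \<le> (\<Sum>j=1..n. t j) * real n"
  proof (rule mult_mono)
    have "(\<Sum>j\<in>I. (c j)\<^sup>2) \<le> (\<Sum>j\<in>I. t j)" by (rule sum_mono) (rule assms(2))
    also have "\<dots> \<le> (\<Sum>j=1..n. t j)" using assms by (intro sum_mono2) auto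
    finally show "(\<Sum>j\<in>I. (c j)\<^sup>2) \<le> (\<Sum>j=1..n. t j)" .
  qed (use ci assms in \<open>auto intro: sum_nonneg\<close>)
  finally show ?thesis by (simp add: mult.commute)
qed

lemma gap_le:
  fixes a :: "nat \<Rightarrow> real"
  assumes gap: "\<And>k. k \<in> {1..<n} \<Longrightarrow> d \<le> a (Suc k) - a k" and d: "d \<ge> 0"
    and ij: "1 \<le> i" "i < j" "j \<le> n"
  shows "d \<le> a j - a i"
  using ij(2,3)
proof (induction j)
  case (Suc j)
  have g: "d \<le> a (Suc j) - a j" using gap[of j] Suc.prems ij(1) by simp
  show ?case
  proof (cases "i = j")
    case False
    then have "d \<le> a j - a i" using Suc by simp
    then show ?thesis using g d by simp
  qed (use g in simp)
qed simp

lemma last_index: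
  fixes a :: "nat \<Rightarrow> real"
  assumes gap: "\<And>k. k \<in> {1..<n} \<Longrightarrow> a k \<le> a (Suc k)"
  obtains m where "m \<le> n" "\<And>j. j \<in> {1..n} \<Longrightarrow> a j \<le> x \<longleftrightarrow> j \<le> m"
proof -
  let ?S = "{j \<in> {1..n}. a j \<le> x}"
  show ?thesis
  proof (cases "?S = {}")
    case True
    then show ?thesis by (intro that[of 0]) auto
  next
    case False
    have fin: "finite ?S" by simp
    have M: "Max ?S \<in> ?S" using False by (intro Max_in) auto
    have "a j \<le> x \<longleftrightarrow> j \<le> Max ?S" if j: "j \<in> {1..n}" for j
    proof
      assume "a j \<le> x" then show "j \<le> Max ?S" using j fin by (intro Max_ge) auto
    next
      assume le: "j \<le> Max ?S"
      have "0 \<le> a (Max ?S) - a j" if "j < Max ?S"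
        by (rule gap_le[where n = n and a = a]) (use gap j M that in auto)
      then show "a j \<le> x" using M le by (cases "j = Max ?S") auto
    qed
    moreover have "Max ?S \<le> n" using M by simp
    ultimately show ?thesis using that by blast
  qed
qed

context double_well begin

text \<open>
  The linear term of the Taylor expansion is split by Young's inequality; \<open>U'\<^sup>2\<close> is dominated by \<open>U\<close>.
\<close>

lemma U_perturb:
  assumes "\<delta> > 0"
  obtains C where "C > 0" "\<And>y e. \<bar>y\<bar> \<le> 1 \<Longrightarrow> \<bar>e\<bar> \<le> K \<Longrightarrow> U (y + e) \<le> (1 + \<delta>) * U y + C * e\<^sup>2"
proof -
  obtain M where M: "M > 0"
    "\<And>x y. \<bar>x\<bar> \<le> \<bar>K\<bar> + 1 \<Longrightarrow> \<bar>y\<bar> \<le> \<bar>K\<bar> + 1 \<Longrightarrow> \<bar>U y - U x - deriv U x * (y - x)\<bar> \<le> M * (y - x)\<^sup>2"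
    using derivative_bounds[of "\<bar>K\<bar> + 1"] by metis
  obtain C where C: "C > 0" "\<And>y. \<bar>y\<bar> \<le> 1 \<Longrightarrow> (deriv U y)\<^sup>2 \<le> C * U y" using deriv_square_le[of 1] by metis
  have "U (y + e) \<le> (1 + \<delta>) * U y + (M + C / (4 * \<delta>)) * e\<^sup>2" if ye: "\<bar>y\<bar> \<le> 1" "\<bar>e\<bar> \<le> K" for y e
  proof -
    have "\<bar>y\<bar> \<le> \<bar>K\<bar> + 1" "\<bar>y + e\<bar> \<le> \<bar>K\<bar> + 1" using ye by linarith+
    from M(2)[OF this] have "U (y + e) - U y - deriv U y * e \<le> M * e\<^sup>2" by simp
    moreover have "deriv U y * e \<le> \<delta> * U y + (C / (4 * \<delta>)) * e\<^sup>2"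
    proof -
      have "0 \<le> (deriv U y * (2 * \<delta>) - C * e)\<^sup>2 / (4 * \<delta> * C)" using C(1) assms by simp
      also have "\<dots> = (\<delta> / C) * (deriv U y)\<^sup>2 - deriv U y * e + (C / (4 * \<delta>)) * e\<^sup>2"
        using C(1) assms by (simp add: power2_diff field_simps power2_eq_square)
      finally have "deriv U y * e \<le> (\<delta> / C) * (deriv U y)\<^sup>2 + (C / (4 * \<delta>)) * e\<^sup>2" by linarith
      moreover have "(\<delta> / C) * (deriv U y)\<^sup>2 \<le> (\<delta> / C) * (C * U y)"
        using C ye assms by (intro mult_left_mono) auto
      ultimately show ?thesis using C(1) by simp
    qed
    ultimately show ?thesis by (simp add: algebra_simps)
  qed
  then show ?thesis using that[of "M + C / (4 * \<delta>)"] M(1) C(1) assms by (simp add: add_pos_pos)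
qed

definition "boosted_slope a v x = lorentz v * kink_slope (boosted_kink U a v x)"

lemma boosted_kink_deriv: "(boosted_kink U a v has_real_derivative boosted_slope a v x) (at x)"
proof -
  have "((\<lambda>x. H (lorentz v * (x - a))) has_real_derivative kink_slope (H (lorentz v * (x - a))) * lorentz v) (at x)"
    by (rule DERIV_chain'[OF _ H_deriv, THEN DERIV_cong]) (auto intro!: derivative_eq_intros)
  then show ?thesis by (simp add: boosted_kink_def[abs_def] boosted_slope_def mult.commute)
qed

lemma boosted_slope_cont: "continuous_on S (boosted_slope a v)"
  unfolding boosted_slope_def boosted_kink_def
  by (intro continuous_intros continuous_on_compose2[OF H'_cont[of UNIV]]) auto

lemma boosted_kink_cont: "continuous_on S (boosted_kink U a v)"
  using DERIV_isCont[OF boosted_kink_deriv] by (intro continuous_at_imp_continuous_on) auto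

lemma boosted_kink_measurable [measurable]: "boosted_kink U a v \<in> borel_measurable borel" "boosted_slope a v \<in> borel_measurable borel"
  by (intro borel_measurable_continuous_onI boosted_kink_cont boosted_slope_cont)+

definition "multikink_slope n a v x = (\<Sum>k=1..n. (-1) ^ k * boosted_slope (a k) (v k) x)"

lemma snd_multikink: "snd (multikink U n a v) x = (\<Sum>k=1..n. (-1) ^ k * (- v k * boosted_slope (a k) (v k) x))"
  using DERIV_imp_deriv[OF boosted_kink_deriv] by (simp add: multikink_def)

lemma multikink_ac: "ac (fst (multikink U n a v)) (multikink_slope n a v)"
proof (rule ac_C1)
  show "(fst (multikink U n a v) has_real_derivative multikink_slope n a v x) (at x)" for x
    unfolding multikink_def fst_conv multikink_slope_def
    by (auto intro!: derivative_eq_intros boosted_kink_deriv simp: mult.commute)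
  show "continuous_on UNIV (multikink_slope n a v)"
    unfolding multikink_slope_def by (intro continuous_intros boosted_slope_cont)
qed

lemma snd_multikink_measurable [measurable]: "snd (multikink U n a v) \<in> borel_measurable borel"
proof -
  have "snd (multikink U n a v) = (\<lambda>x. \<Sum>k=1..n. (-1) ^ k * (- v k * boosted_slope (a k) (v k) x))"
    by (rule ext) (rule snd_multikink)
  then show ?thesis by simp
qed

text \<open>
  A change of variables in the integrals of the kink at rest. Contraction multiplies the integral of the
  squared slope by \<^term>\<open>lorentz v\<close> and divides that of \<open>U\<close> by it; the common upper bound tends to the
  value at rest as \<open>v\<close> tends to \<open>0\<close>.
\<close>

lemma boosted_slope_square:
  assumes "\<bar>v\<bar> < 1"
  shows "L2 (boosted_slope a v)" "sqnorm (boosted_slope a v) = lorentz v * kink_energy"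
    "integrable lborel (\<lambda>x. U (boosted_kink U a v x))" "(LBINT x. U (boosted_kink U a v x)) \<le> lorentz v * kink_energy / 2"
proof -
  note g = lorentz_bounds(1)[OF assms]
  let ?g = "lorentz v"
  have e: "?g * (x - a) = - ?g * a + ?g * x" for x by (simp add: algebra_simps)
  define h where "h x = (kink_slope (H (- ?g * a + ?g * x)))\<^sup>2" for x
  have i: "integrable lborel h"
    unfolding h_def using g by (intro lborel_integrable_real_affine[OF H'_square(1)]) auto
  have "kink_energy = \<bar>?g\<bar> *\<^sub>R (LBINT x. h x)"
    unfolding h_def H'_square(2)[symmetric] by (rule lborel_integral_real_affine) (use g in simp)
  then have v: "(LBINT x. h x) = kink_energy / ?g" using g by (simp add: field_simps)
  have sq: "(boosted_slope a v x)\<^sup>2 = ?g\<^sup>2 * h x" for x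
    unfolding boosted_slope_def boosted_kink_def e h_def by (simp only: power_mult_distrib)
  have "integrable lborel (\<lambda>x. (boosted_slope a v x)\<^sup>2)" unfolding sq by (intro integrable_mult_right i)
  then show "L2 (boosted_slope a v)" by (simp add: L2_def)
  show "sqnorm (boosted_slope a v) = ?g * kink_energy"
    unfolding sqnorm_def sq using g by (simp add: v power2_eq_square)
  have uq: "U (boosted_kink U a v x) = (1 / 2) * h x" for x
    unfolding boosted_kink_def e h_def by (simp add: kink_slope_square)
  show "integrable lborel (\<lambda>x. U (boosted_kink U a v x))" unfolding uq by (intro integrable_mult_right i)
  have "kink_energy / ?g \<le> ?g * kink_energy"
  proof -
    have "kink_energy / ?g \<le> kink_energy / 1" using g kink_energy_pos by (intro divide_left_mono) auto
    also have "\<dots> \<le> ?g * kink_energy" using g kink_energy_pos by simp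
    finally show ?thesis .
  qed
  then show "(LBINT x. U (boosted_kink U a v x)) \<le> ?g * kink_energy / 2" unfolding uq by (simp add: v)
qed

text \<open>
  The tail of a boosted kink, restricted to distance at least \<open>R\<close> from its centre.
\<close>

definition "tail_density R a v x = indicator {x. R \<le> \<bar>x - a\<bar>} x * ((kink_tail (lorentz v * (x - a)))\<^sup>2 + (boosted_slope a v x)\<^sup>2)"

lemma tail_density_nonneg [simp]: "tail_density R a v x \<ge> 0"
  by (simp add: tail_density_def indicator_def)

lemma tail_density_integral:
  assumes v: "\<bar>v\<bar> < 1" and R: "R \<ge> 0"
  shows "integrable lborel (tail_density R a v)" "(LBINT x. tail_density R a v x) \<le> lorentz v * tail_mass R"
proof -
  note g = lorentz_bounds(1)[OF v]
  let ?g = "lorentz v"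
  let ?Q = "\<lambda>x. indicator {x. \<bar>x\<bar> \<ge> R} x * ((kink_tail x)\<^sup>2 + (kink_slope (H x))\<^sup>2)"
  have i: "integrable lborel (\<lambda>x. ?g\<^sup>2 * ?Q (- ?g * a + ?g * x))"
    using g by (intro integrable_mult_right lborel_integrable_real_affine[OF tail_mass_integrable]) auto
  have "tail_mass R = \<bar>?g\<bar> *\<^sub>R (LBINT x. ?Q (- ?g * a + ?g * x))"
    unfolding tail_mass_def using lborel_integral_real_affine[of ?g ?Q "- ?g * a"] g by simp
  then have val: "(LBINT x. ?g\<^sup>2 * ?Q (- ?g * a + ?g * x)) = ?g * tail_mass R" using g by (simp add: power2_eq_square)
  have le: "tail_density R a v x \<le> ?g\<^sup>2 * ?Q (- ?g * a + ?g * x)" for x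
  proof (cases "R \<le> \<bar>x - a\<bar>")
    case False
    then show ?thesis by (simp add: tail_density_def indicator_def)
  next
    case True
    have e: "- ?g * a + ?g * x = ?g * (x - a)" by (simp add: algebra_simps)
    have "\<bar>x - a\<bar> * 1 \<le> \<bar>x - a\<bar> * ?g" using g by (intro mult_left_mono) auto
    then have "R \<le> \<bar>?g * (x - a)\<bar>" using True g by (simp add: abs_mult mult.commute)
    moreover have "1 * (kink_tail (?g * (x - a)))\<^sup>2 \<le> ?g\<^sup>2 * (kink_tail (?g * (x - a)))\<^sup>2"
      using g by (intro mult_right_mono) (auto simp: one_le_power)
    ultimately show ?thesis
      unfolding e using True by (simp add: tail_density_def boosted_slope_def boosted_kink_def power_mult_distrib distrib_left)
  qed
  show 1: "integrable lborel (tail_density R a v)"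
  proof (rule Bochner_Integration.integrable_bound[OF i])
    show "tail_density R a v \<in> borel_measurable lborel" unfolding tail_density_def by measurable
    show "AE x in lborel. norm (tail_density R a v x) \<le> norm (?g\<^sup>2 * ?Q (- ?g * a + ?g * x))"
      using le order_trans[OF tail_density_nonneg le] by (intro AE_I2) simp
  qed
  have "(LBINT x. tail_density R a v x) \<le> (LBINT x. ?g\<^sup>2 * ?Q (- ?g * a + ?g * x))"
    by (intro integral_mono 1 i le)
  then show "(LBINT x. tail_density R a v x) \<le> ?g * tail_mass R" using val by simp
qed

lemma alternating_steps: "(\<Sum>j=1..m. 2 * (-1) ^ j) = (-1) ^ m - (1::real)"
  by (induction m) auto

text \<open>
  Each kink is a step function plus its tail, and the steps to the left of \<open>x\<close> add up to the vacuum \<open>(-1) ^ m\<close>.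
\<close>

lemma multikink_tails:
  assumes m: "m \<le> n" "\<And>j. j \<in> {1..n} \<Longrightarrow> a j \<le> x \<longleftrightarrow> j \<le> m" and v: "\<And>j. j \<in> {1..n} \<Longrightarrow> \<bar>v j\<bar> < 1"
  shows "fst (multikink U n a v) x = (-1) ^ m + (\<Sum>j=1..n. (-1) ^ j * kink_tail (lorentz (v j) * (x - a j)))"
proof -
  have t: "(-1) ^ j * (boosted_kink U (a j) (v j) x + 1)
     = (if j \<le> m then 2 * (-1) ^ j else 0) + (-1) ^ j * kink_tail (lorentz (v j) * (x - a j))" if j: "j \<in> {1..n}" for j
  proof -
    have "lorentz (v j) > 0" using lorentz_bounds(1)[OF v[OF j]] by simp
    then have "lorentz (v j) * (x - a j) \<ge> 0 \<longleftrightarrow> j \<le> m" using m(2)[OF j] by (simp add: zero_le_mult_iff)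
    then show ?thesis by (auto simp: boosted_kink_def kink_tail_def algebra_simps)
  qed
  have "(\<Sum>j=1..n. if j \<le> m then 2 * (-1) ^ j else 0) = (\<Sum>j=1..m. 2 * (-1) ^ j :: real)"
    using m(1) by (intro sum.mono_neutral_cong_right) auto
  then have "(\<Sum>j=1..n. if j \<le> m then 2 * (-1) ^ j else 0) = (-1) ^ m - (1::real)" by (simp only: alternating_steps)
  then show ?thesis by (simp add: multikink_def t sum.distrib)
qed

text \<open>
  Away from all centres a multikink is a vacuum up to tails.
\<close>

lemma multikink_far:
  assumes "m \<le> n" "\<And>j. j \<in> {1..n} \<Longrightarrow> a j \<le> x \<longleftrightarrow> j \<le> m" and v: "\<And>j. j \<in> {1..n} \<Longrightarrow> \<bar>v j\<bar> < 1"
    and far: "\<And>j. j \<in> {1..n} \<Longrightarrow> R \<le> \<bar>x - a j\<bar>"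
  shows "(fst (multikink U n a v) x - (-1) ^ m)\<^sup>2 \<le> n * (\<Sum>j=1..n. tail_density R (a j) (v j) x)"
    "(multikink_slope n a v x)\<^sup>2 \<le> n * (\<Sum>j=1..n. tail_density R (a j) (v j) x)"
proof -
  have t: "(kink_tail (lorentz (v j) * (x - a j)))\<^sup>2 \<le> tail_density R (a j) (v j) x" "(boosted_slope (a j) (v j) x)\<^sup>2 \<le> tail_density R (a j) (v j) x" if "j \<in> {1..n}" for j
    using far[OF that] by (simp_all add: tail_density_def)
  show "(fst (multikink U n a v) x - (-1) ^ m)\<^sup>2 \<le> n * (\<Sum>j=1..n. tail_density R (a j) (v j) x)"
  proof -
    have "fst (multikink U n a v) x = (-1) ^ m + (\<Sum>j=1..n. (-1) ^ j * kink_tail (lorentz (v j) * (x - a j)))"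
      by (rule multikink_tails) (use assms in auto)
    then have "fst (multikink U n a v) x - (-1) ^ m = (\<Sum>j=1..n. (-1) ^ j * kink_tail (lorentz (v j) * (x - a j)))"
      by linarith
    then show ?thesis by (simp only:) (rule sum_square_le, use t in auto)
  qed
  show "(multikink_slope n a v x)\<^sup>2 \<le> n * (\<Sum>j=1..n. tail_density R (a j) (v j) x)"
    unfolding multikink_slope_def using sum_square_le[of "{1..n}" n "\<lambda>j. boosted_slope (a j) (v j) x" "\<lambda>j. tail_density R (a j) (v j) x"] t by simp
qed

text \<open>
  Within distance \<open>R\<close> of one centre a multikink is that kink up to the tails of the others, whose centres are
  at distance at least \<open>R\<close>.
\<close>

lemma multikink_near:
  assumes gap: "\<And>k. k \<in> {1..<n} \<Longrightarrow> 2 * R \<le> a (Suc k) - a k" and R: "R > 0"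
    and v: "\<And>j. j \<in> {1..n} \<Longrightarrow> \<bar>v j\<bar> < 1"
    and k: "k \<in> {1..n}" "\<bar>x - a k\<bar> \<le> R"
  shows "(fst (multikink U n a v) x - (-1) ^ k * boosted_kink U (a k) (v k) x)\<^sup>2 \<le> n * (\<Sum>j=1..n. tail_density R (a j) (v j) x)"
    "(multikink_slope n a v x - (-1) ^ k * boosted_slope (a k) (v k) x)\<^sup>2 \<le> n * (\<Sum>j=1..n. tail_density R (a j) (v j) x)"
    "j \<in> {1..n} \<Longrightarrow> j \<noteq> k \<Longrightarrow> R \<le> \<bar>x - a j\<bar>"
proof -
  have far: "R \<le> \<bar>x - a j\<bar>" "j < k \<Longrightarrow> a j < x" "k < j \<Longrightarrow> x < a j" if "j \<in> {1..n}" "j \<noteq> k" for j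
  proof -
    have "j < k \<Longrightarrow> 2 * R \<le> a k - a j" "k < j \<Longrightarrow> 2 * R \<le> a j - a k"
      using that k R by (auto intro!: gap_le[where n = n and a = a] gap)
    then show "R \<le> \<bar>x - a j\<bar>" "j < k \<Longrightarrow> a j < x" "k < j \<Longrightarrow> x < a j"
      using that k R by (cases "j < k"; auto)+
  qed
  show "j \<in> {1..n} \<Longrightarrow> j \<noteq> k \<Longrightarrow> R \<le> \<bar>x - a j\<bar>" by (rule far)
  have t: "(kink_tail (lorentz (v j) * (x - a j)))\<^sup>2 \<le> tail_density R (a j) (v j) x" "(boosted_slope (a j) (v j) x)\<^sup>2 \<le> tail_density R (a j) (v j) x" if "j \<in> {1..n} - {k}" for j
    using far(1)[of j] that by (simp_all add: tail_density_def)
  define m where "m = (if a k \<le> x then k else k - 1)"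
  have m: "m \<le> n" "a j \<le> x \<longleftrightarrow> j \<le> m" if "j \<in> {1..n}" for j
    using k far(2,3)[of j] that by (cases j k rule: linorder_cases; auto simp: m_def)+
  have m0: "m \<le> n" using k by (auto simp: m_def)
  have rem: "(\<Sum>j=1..n. f j) = f k + (\<Sum>j\<in>{1..n}-{k}. f j)" for f :: "nat \<Rightarrow> real"
    using k by (intro sum.remove) auto
  have g: "lorentz (v k) > 0" using lorentz_bounds(1)[OF v[OF k(1)]] by simp
  have "(-1) ^ m + (-1) ^ k * kink_tail (lorentz (v k) * (x - a k)) = (-1) ^ k * boosted_kink U (a k) (v k) x"
  proof (cases "a k \<le> x")
    case True
    then have "0 \<le> lorentz (v k) * (x - a k)" using g by simp
    then show ?thesis using True by (simp add: m_def kink_tail_def boosted_kink_def algebra_simps)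
  next
    case False
    then have "lorentz (v k) * (x - a k) < 0" using g by (simp add: mult_pos_neg)
    moreover have "(-1::real) ^ k = - ((-1) ^ (k - 1))" using k by (cases k) auto
    ultimately show ?thesis using False by (simp add: m_def kink_tail_def boosted_kink_def algebra_simps)
  qed
  moreover have "fst (multikink U n a v) x = (-1) ^ m + ((-1) ^ k * kink_tail (lorentz (v k) * (x - a k)) + (\<Sum>j\<in>{1..n}-{k}. (-1) ^ j * kink_tail (lorentz (v j) * (x - a j))))"
  proof -
    have "fst (multikink U n a v) x = (-1) ^ m + (\<Sum>j=1..n. (-1) ^ j * kink_tail (lorentz (v j) * (x - a j)))"
      by (rule multikink_tails[OF m0 m(2) v])
    then show ?thesis by (simp only: rem)
  qed
  ultimately have "fst (multikink U n a v) x - (-1) ^ k * boosted_kink U (a k) (v k) x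
    = (\<Sum>j\<in>{1..n}-{k}. (-1) ^ j * kink_tail (lorentz (v j) * (x - a j)))" by linarith
  then show "(fst (multikink U n a v) x - (-1) ^ k * boosted_kink U (a k) (v k) x)\<^sup>2 \<le> n * (\<Sum>j=1..n. tail_density R (a j) (v j) x)"
    using sum_square_le[of "{1..n}-{k}" n "\<lambda>j. kink_tail (lorentz (v j) * (x - a j))" "\<lambda>j. tail_density R (a j) (v j) x"] t by simp
  have "multikink_slope n a v x - (-1) ^ k * boosted_slope (a k) (v k) x = (\<Sum>j\<in>{1..n}-{k}. (-1) ^ j * boosted_slope (a j) (v j) x)"
    unfolding multikink_slope_def rem by simp
  then show "(multikink_slope n a v x - (-1) ^ k * boosted_slope (a k) (v k) x)\<^sup>2 \<le> n * (\<Sum>j=1..n. tail_density R (a j) (v j) x)"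
    using sum_square_le[of "{1..n}-{k}" n "\<lambda>j. boosted_slope (a j) (v j) x" "\<lambda>j. tail_density R (a j) (v j) x"] t by simp
qed

text \<open>
  The two previous cases in a common form that can be integrated over the line without a partition: the
  height and the slope are those of a single kink or of a vacuum, up to tails.
\<close>

lemma multikink_decomposition:
  assumes gap: "\<And>k. k \<in> {1..<n} \<Longrightarrow> 2 * R \<le> a (Suc k) - a k" and R: "R > 0"
    and v: "\<And>j. j \<in> {1..n} \<Longrightarrow> \<bar>v j\<bar> < 1"
  obtains Y Y' where "\<bar>Y\<bar> \<le> 1" "U Y \<le> (\<Sum>j=1..n. U (boosted_kink U (a j) (v j) x))" "Y'\<^sup>2 \<le> (\<Sum>j=1..n. (boosted_slope (a j) (v j) x)\<^sup>2)"
    "(fst (multikink U n a v) x - Y)\<^sup>2 \<le> n * (\<Sum>j=1..n. tail_density R (a j) (v j) x)"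
    "(multikink_slope n a v x - Y')\<^sup>2 \<le> n * (\<Sum>j=1..n. tail_density R (a j) (v j) x)"
proof (cases "\<exists>k\<in>{1..n}. \<bar>x - a k\<bar> \<le> R")
  case True
  then obtain k where k: "k \<in> {1..n}" "\<bar>x - a k\<bar> \<le> R" by blast
  let ?s = "(-1) ^ k :: real"
  have s: "?s = 1 \<or> ?s = -1" by (cases "even k") auto
  show ?thesis
  proof (rule that[of "?s * boosted_kink U (a k) (v k) x" "?s * boosted_slope (a k) (v k) x"])
    show "\<bar>?s * boosted_kink U (a k) (v k) x\<bar> \<le> 1"
      using H_range[of "lorentz (v k) * (x - a k)"] by (simp add: abs_mult boosted_kink_def)
    have "U (?s * boosted_kink U (a k) (v k) x) = U (boosted_kink U (a k) (v k) x)" using s by (auto simp: U_even)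
    also have "\<dots> \<le> (\<Sum>j=1..n. U (boosted_kink U (a j) (v j) x))" using k(1) U_nonneg by (intro member_le_sum) auto
    finally show "U (?s * boosted_kink U (a k) (v k) x) \<le> (\<Sum>j=1..n. U (boosted_kink U (a j) (v j) x))" .
    have "(?s * boosted_slope (a k) (v k) x)\<^sup>2 = (boosted_slope (a k) (v k) x)\<^sup>2" using s by (auto simp: power_mult_distrib)
    also have "\<dots> \<le> (\<Sum>j=1..n. (boosted_slope (a j) (v j) x)\<^sup>2)" using k(1) by (intro member_le_sum) auto
    finally show "(?s * boosted_slope (a k) (v k) x)\<^sup>2 \<le> (\<Sum>j=1..n. (boosted_slope (a j) (v j) x)\<^sup>2)" .
  qed (use multikink_near[OF gap R v k] in auto)
next
  case False
  then have far: "\<And>j. j \<in> {1..n} \<Longrightarrow> R \<le> \<bar>x - a j\<bar>" by force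
  have "a k \<le> a (Suc k)" if "k \<in> {1..<n}" for k using gap[OF that] R by simp
  from last_index[where n = n and a = a and x = x, OF this] obtain m where m: "m \<le> n" "\<And>j. j \<in> {1..n} \<Longrightarrow> a j \<le> x \<longleftrightarrow> j \<le> m" by blast
  have s: "(-1) ^ m = (1::real) \<or> (-1) ^ m = (-1::real)" by (cases "even m") auto
  show ?thesis
  proof (rule that[of "(-1) ^ m" 0])
    show "U ((-1) ^ m) \<le> (\<Sum>j=1..n. U (boosted_kink U (a j) (v j) x))"
      using s U_1 U_m1 by (auto intro!: sum_nonneg U_nonneg)
    show "0\<^sup>2 \<le> (\<Sum>j=1..n. (boosted_slope (a j) (v j) x)\<^sup>2)" by (simp add: sum_nonneg)
  qed (use multikink_far[OF m v far] in auto)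
qed

end

section \<open>The energy near a multikink\<close>

lemma interaction_terms:
  assumes "interaction n a v < \<eta>"
  shows "k \<in> {1..n} \<Longrightarrow> (v k)\<^sup>2 < \<eta>" "k \<in> {1..<n} \<Longrightarrow> exp (- (a (Suc k) - a k)) < \<eta>" "(\<Sum>k=1..n. (v k)\<^sup>2) < \<eta>"
proof -
  have 1: "(\<Sum>k\<in>{1..<n}. exp (- (a (Suc k) - a k))) \<ge> 0" "(\<Sum>k=1..n. (v k)\<^sup>2) \<ge> 0"
    by (auto intro: sum_nonneg)
  then show s: "(\<Sum>k=1..n. (v k)\<^sup>2) < \<eta>" using assms by (simp add: interaction_def)
  show "(v k)\<^sup>2 < \<eta>" if "k \<in> {1..n}"
    using member_le_sum[OF that, of "\<lambda>k. (v k)\<^sup>2"] s by simp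
  show "exp (- (a (Suc k) - a k)) < \<eta>" if "k \<in> {1..<n}"
    using member_le_sum[OF that, of "\<lambda>k. exp (- (a (Suc k) - a k))"] 1 assms by (simp add: interaction_def)
qed

lemma interaction_nonneg: "interaction n a v \<ge> 0"
  by (auto simp: interaction_def intro!: add_nonneg_nonneg sum_nonneg)

lemma sqnorm_as_integral: "integral\<^sup>L lborel (\<lambda>x. (f x)\<^sup>2) = sqnorm f"
  by (simp add: sqnorm_def)

context double_well begin

lemma multikink_diff:
  assumes u: "u \<in> energy_sector U l r" and fin: "sqnorm_HL (u - multikink U n a v) < \<infinity>"
  defines "w \<equiv> \<lambda>x. fst u x - fst (multikink U n a v) x"
    and "w' \<equiv> \<lambda>x. weak_deriv (fst u) x - multikink_slope n a v x"
    and "p \<equiv> \<lambda>x. snd u x - snd (multikink U n a v) x"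
  shows "ac w w'" "L2 w" "L2 w'" "L2 p" "sqnorm_HL (u - multikink U n a v) = ennreal (sqnorm w + sqnorm w' + sqnorm p)"
proof -
  have e: "u - multikink U n a v = (w, p)" by (simp add: prod_eq_iff fun_diff_def w_def p_def)
  show ac: "ac w w'" unfolding w_def w'_def by (rule ac_diff[OF sector_ac[OF u] multikink_ac])
  have [measurable]: "snd u \<in> borel_measurable borel" using u by (simp add: energy_sector_def)
  have "p \<in> borel_measurable borel" unfolding p_def by measurable
  from sqnorm_HL_finite[OF ac this] fin show L: "L2 w" "L2 w'" "L2 p" by (simp_all add: e)
  show "sqnorm_HL (u - multikink U n a v) = ennreal (sqnorm w + sqnorm w' + sqnorm p)"
    unfolding e by (rule sqnorm_HL_eq[OF ac L])
qed

lemma multikink_bounded: "\<bar>fst (multikink U n a v) x\<bar> \<le> 1 + 2 * real n"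
proof -
  have "\<bar>\<Sum>k=1..n. (-1) ^ k * (boosted_kink U (a k) (v k) x + 1)\<bar> \<le> (\<Sum>k=1..n. \<bar>(-1) ^ k * (boosted_kink U (a k) (v k) x + 1)\<bar>)"
    by (rule sum_abs)
  also have "\<dots> \<le> (\<Sum>k=1..n. 2)"
  proof (rule sum_mono)
    fix k show "\<bar>(-1) ^ k * (boosted_kink U (a k) (v k) x + 1)\<bar> \<le> 2"
      using H_range[of "lorentz (v k) * (x - a k)"] by (simp add: abs_mult boosted_kink_def)
  qed
  also have "\<dots> = 2 * real n" by simp
  finally show ?thesis by (simp add: multikink_def)
qed

text \<open>
  At every point the state differs from a kink or a vacuum by \<open>w\<close> and the tails. Young's inequality with
  parameter \<open>\<delta>\<close> makes the leading part \<open>1 + \<delta>\<close> times the energy of the kinks and the rest quadratic in the errors.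
\<close>

lemma energy_upper_bound:
  assumes u: "u \<in> energy_sector U l r" and fin: "sqnorm_HL (u - multikink U n a v) < \<infinity>"
    and gap: "\<And>k. k \<in> {1..<n} \<Longrightarrow> 2 * R \<le> a (Suc k) - a k" and R: "R > 0"
    and v: "\<And>j. j \<in> {1..n} \<Longrightarrow> \<bar>v j\<bar> < 1" "\<And>j. j \<in> {1..n} \<Longrightarrow> lorentz (v j) \<le> g"
    and S: "sqnorm_HL (u - multikink U n a v) \<le> ennreal S" "0 \<le> S" "S \<le> 1"
    and \<delta>: "\<delta> > 0" and C: "C > 0" "\<And>y e. \<bar>y\<bar> \<le> 1 \<Longrightarrow> \<bar>e\<bar> \<le> 2 * real n + 3 \<Longrightarrow> U (y + e) \<le> (1 + \<delta>) * U y + C * e\<^sup>2"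
  shows "sqnorm (weak_deriv (fst u)) / 2 + (LBINT x. U (fst u x)) + sqnorm (snd u) / 2
    \<le> (1 + \<delta>) * (real n * (g * kink_energy)) + (2 + 1 / \<delta> + 2 * C) * (S + real n * (real n * (g * tail_mass R)))
      + real n * (g * kink_energy) * (\<Sum>j=1..n. (v j)\<^sup>2)"
proof -
  define w w' p where "w x = fst u x - fst (multikink U n a v) x"
    and "w' x = weak_deriv (fst u) x - multikink_slope n a v x"
    and "p x = snd u x - snd (multikink U n a v) x" for x
  note d = multikink_diff[OF u fin, folded w_def[abs_def] w'_def[abs_def] p_def[abs_def]]
  have S': "sqnorm w + sqnorm w' + sqnorm p \<le> S" using S(1) unfolding d(5) ennreal_le_iff[OF S(2)] .
  have wb: "\<bar>w x\<bar> \<le> 1" for x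
  proof -
    have "(w x)\<^sup>2 \<le> sqnorm w + sqnorm w'" by (rule sobolev_bound[OF d(1-3)])
    also have "\<dots> \<le> 1" using S' S(3) sqnorm_nonneg[of p] by linarith
    finally show ?thesis by (simp add: abs_square_le_1)
  qed
  define A where "A x = (\<Sum>j=1..n. (boosted_slope (a j) (v j) x)\<^sup>2)" for x
  define V where "V x = (\<Sum>j=1..n. U (boosted_kink U (a j) (v j) x))" for x
  define B where "B x = (\<Sum>j=1..n. tail_density R (a j) (v j) x)" for x
  define Q where "Q x = (\<Sum>j=1..n. (v j)\<^sup>2 * (boosted_slope (a j) (v j) x)\<^sup>2)" for x
  have gE: "lorentz (v j) * kink_energy \<le> g * kink_energy" "lorentz (v j) * tail_mass R \<le> g * tail_mass R" if "j \<in> {1..n}" for j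
    using v(2)[OF that] kink_energy_pos tail_mass_nonneg by (auto intro: mult_right_mono)
  have iA: "integrable lborel A" and vA: "(LBINT x. A x) \<le> real n * (g * kink_energy)"
  proof -
    have i: "integrable lborel (\<lambda>x. (boosted_slope (a j) (v j) x)\<^sup>2)" if "j \<in> {1..n}" for j
      using boosted_slope_square(1)[OF v(1)[OF that]] by (simp add: L2_def)
    then show "integrable lborel A" unfolding A_def by (intro Bochner_Integration.integrable_sum)
    have "(LBINT x. A x) = (\<Sum>j=1..n. lorentz (v j) * kink_energy)"
      unfolding A_def using i boosted_slope_square(2)[OF v(1)] by (simp add: sqnorm_as_integral)
    also have "\<dots> \<le> (\<Sum>j=1..n. g * kink_energy)" by (rule sum_mono) (rule gE)
    finally show "(LBINT x. A x) \<le> real n * (g * kink_energy)" by simp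
  qed
  have iV: "integrable lborel V" and vV: "(LBINT x. V x) \<le> real n * (g * kink_energy) / 2"
  proof -
    have i: "integrable lborel (\<lambda>x. U (boosted_kink U (a j) (v j) x))" if "j \<in> {1..n}" for j
      using boosted_slope_square(3)[OF v(1)[OF that]] .
    then show "integrable lborel V" unfolding V_def by (intro Bochner_Integration.integrable_sum)
    have "(LBINT x. V x) = (\<Sum>j=1..n. LBINT x. U (boosted_kink U (a j) (v j) x))"
      unfolding V_def using i by (intro Bochner_Integration.integral_sum)
    also have "\<dots> \<le> (\<Sum>j=1..n. g * kink_energy / 2)"
    proof (rule sum_mono)
      fix j assume j: "j \<in> {1..n}"
      show "(LBINT x. U (boosted_kink U (a j) (v j) x)) \<le> g * kink_energy / 2"
        using boosted_slope_square(4)[OF v(1)[OF j], of "a j"] gE(1)[OF j] by linarith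
    qed
    finally show "(LBINT x. V x) \<le> real n * (g * kink_energy) / 2" by simp
  qed
  have iB: "integrable lborel B" and vB: "(LBINT x. B x) \<le> real n * (g * tail_mass R)"
  proof -
    have i: "integrable lborel (tail_density R (a j) (v j))" if "j \<in> {1..n}" for j
      using tail_density_integral(1)[OF v(1)[OF that]] R by simp
    then show "integrable lborel B" unfolding B_def by (intro Bochner_Integration.integrable_sum)
    have "(LBINT x. B x) = (\<Sum>j=1..n. LBINT x. tail_density R (a j) (v j) x)"
      unfolding B_def using i by (intro Bochner_Integration.integral_sum)
    also have "\<dots> \<le> (\<Sum>j=1..n. g * tail_mass R)"
    proof (rule sum_mono)
      fix j assume j: "j \<in> {1..n}"
      show "(LBINT x. tail_density R (a j) (v j) x) \<le> g * tail_mass R"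
        using tail_density_integral(2)[OF v(1)[OF j], of R "a j"] gE(2)[OF j] R by linarith
    qed
    finally show "(LBINT x. B x) \<le> real n * (g * tail_mass R)" by simp
  qed
  have iQ: "integrable lborel Q" and vQ: "(LBINT x. Q x) \<le> (g * kink_energy) * (\<Sum>j=1..n. (v j)\<^sup>2)"
  proof -
    have i: "integrable lborel (\<lambda>x. (v j)\<^sup>2 * (boosted_slope (a j) (v j) x)\<^sup>2)" if "j \<in> {1..n}" for j
      using boosted_slope_square(1)[OF v(1)[OF that]] by (simp add: L2_def)
    then show "integrable lborel Q" unfolding Q_def by (intro Bochner_Integration.integrable_sum)
    have "(LBINT x. Q x) = (\<Sum>j=1..n. (v j)\<^sup>2 * (lorentz (v j) * kink_energy))"
      unfolding Q_def using i boosted_slope_square(2)[OF v(1)] by (simp add: sqnorm_as_integral)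
    also have "\<dots> \<le> (\<Sum>j=1..n. (v j)\<^sup>2 * (g * kink_energy))" by (intro sum_mono mult_left_mono gE) auto
    finally show "(LBINT x. Q x) \<le> (g * kink_energy) * (\<Sum>j=1..n. (v j)\<^sup>2)" by (simp add: sum_distrib_left mult.commute)
  qed
  have iw: "integrable lborel (\<lambda>x. (w x)\<^sup>2)" "integrable lborel (\<lambda>x. (w' x)\<^sup>2)" "integrable lborel (\<lambda>x. (p x)\<^sup>2)"
    using d by (auto simp: L2_def)
  have pw: "(weak_deriv (fst u) x)\<^sup>2 \<le> (1 + \<delta>) * A x + (1 + 1 / \<delta>) * (2 * (w' x)\<^sup>2 + 2 * n * B x)"
    "U (fst u x) \<le> (1 + \<delta>) * V x + C * (2 * (w x)\<^sup>2 + 2 * n * B x)" for x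
  proof -
    obtain Y Y' where Y: "\<bar>Y\<bar> \<le> 1" "U Y \<le> V x" "Y'\<^sup>2 \<le> A x"
      "(fst (multikink U n a v) x - Y)\<^sup>2 \<le> n * B x" "(multikink_slope n a v x - Y')\<^sup>2 \<le> n * B x"
      unfolding A_def B_def V_def
      by (rule multikink_decomposition[where n = n and R = R and a = a and v = v and x = x, OF gap R v(1)]) blast+
    let ?e' = "(multikink_slope n a v x - Y') + w' x" and ?e = "(fst (multikink U n a v) x - Y) + w x"
    have e2: "?e'\<^sup>2 \<le> 2 * (w' x)\<^sup>2 + 2 * n * B x" "?e\<^sup>2 \<le> 2 * (w x)\<^sup>2 + 2 * n * B x"
      using square_add_le[of "multikink_slope n a v x - Y'" "w' x"] square_add_le[of "fst (multikink U n a v) x - Y" "w x"] Y by linarith+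
    have D: "weak_deriv (fst u) x = Y' + ?e'" by (simp add: w'_def)
    have b: "(Y' + ?e')\<^sup>2 \<le> (1 + \<delta>) * Y'\<^sup>2 + (1 + 1 / \<delta>) * ?e'\<^sup>2"
    proof -
      have "0 \<le> (\<delta> * y - e)\<^sup>2 / \<delta>" for y e using \<delta> by simp
      moreover have "(\<delta> * y - e)\<^sup>2 / \<delta> = \<delta> * y\<^sup>2 - 2 * y * e + 1 / \<delta> * e\<^sup>2" for y e
        using \<delta> by (simp add: power2_eq_square field_simps)
      ultimately have "0 \<le> \<delta> * y\<^sup>2 - 2 * y * e + 1 / \<delta> * e\<^sup>2" for y e by metis
      from this[of Y' ?e'] show ?thesis unfolding power2_sum[of Y' ?e'] distrib_right by linarith
    qed
    have c: "(1 + \<delta>) * Y'\<^sup>2 \<le> (1 + \<delta>) * A x" "(1 + 1 / \<delta>) * ?e'\<^sup>2 \<le> (1 + 1 / \<delta>) * (2 * (w' x)\<^sup>2 + 2 * n * B x)"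
      using mult_left_mono[OF Y(3), of "1 + \<delta>"] mult_left_mono[OF e2(1), of "1 + 1 / \<delta>"] \<delta> by simp_all
    show "(weak_deriv (fst u) x)\<^sup>2 \<le> (1 + \<delta>) * A x + (1 + 1 / \<delta>) * (2 * (w' x)\<^sup>2 + 2 * n * B x)"
      unfolding D using b c by linarith
    have "\<bar>?e\<bar> \<le> 2 * real n + 3" using multikink_bounded[of n a v x] Y(1) wb[of x] by linarith
    from C(2)[OF Y(1) this] have "U (fst u x) \<le> (1 + \<delta>) * U Y + C * ?e\<^sup>2" by (simp add: w_def)
    moreover have "(1 + \<delta>) * U Y \<le> (1 + \<delta>) * V x" "C * ?e\<^sup>2 \<le> C * (2 * (w x)\<^sup>2 + 2 * n * B x)"
      using mult_left_mono[OF Y(2), of "1 + \<delta>"] mult_left_mono[OF e2(2), of C] \<delta> C(1) by simp_all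
    ultimately show "U (fst u x) \<le> (1 + \<delta>) * V x + C * (2 * (w x)\<^sup>2 + 2 * n * B x)" by linarith
  qed
  have pp: "(snd u x)\<^sup>2 \<le> 2 * (p x)\<^sup>2 + 2 * n * Q x" for x
  proof -
    have "(snd (multikink U n a v) x)\<^sup>2 \<le> n * Q x"
      unfolding snd_multikink Q_def
      by (rule sum_square_le) (auto simp: power_mult_distrib)
    then show ?thesis using square_add_le[of "p x" "snd (multikink U n a v) x"] by (simp add: p_def)
  qed
  have "sqnorm (weak_deriv (fst u)) \<le> (LBINT x. (1 + \<delta>) * A x + (1 + 1 / \<delta>) * (2 * (w' x)\<^sup>2 + 2 * n * B x))"
    unfolding sqnorm_def using iA iw iB sector_L2[OF u] pw(1) by (intro integral_mono) (auto simp: L2_def)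
  also have "\<dots> = (1 + \<delta>) * (LBINT x. A x) + (1 + 1 / \<delta>) * (2 * sqnorm w' + 2 * n * (LBINT x. B x))"
    using iA iw iB by (simp add: sqnorm_as_integral)
  finally have 1: "sqnorm (weak_deriv (fst u)) \<le> (1 + \<delta>) * (LBINT x. A x) + (1 + 1 / \<delta>) * (2 * sqnorm w' + 2 * n * (LBINT x. B x))" .
  have "(LBINT x. U (fst u x)) \<le> (LBINT x. (1 + \<delta>) * V x + C * (2 * (w x)\<^sup>2 + 2 * n * B x))"
    using iV iw iB sector_potential[OF u] pw(2) by (intro integral_mono) auto
  also have "\<dots> = (1 + \<delta>) * (LBINT x. V x) + C * (2 * sqnorm w + 2 * n * (LBINT x. B x))"
    using iV iw iB by (simp add: sqnorm_as_integral)
  finally have 2: "(LBINT x. U (fst u x)) \<le> (1 + \<delta>) * (LBINT x. V x) + C * (2 * sqnorm w + 2 * n * (LBINT x. B x))" .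
  have "sqnorm (snd u) \<le> (LBINT x. 2 * (p x)\<^sup>2 + 2 * n * Q x)"
    unfolding sqnorm_def using iQ iw sector_L2[OF u] pp by (intro integral_mono) (auto simp: L2_def)
  also have "\<dots> = 2 * sqnorm p + 2 * n * (LBINT x. Q x)" using iQ iw by (simp add: sqnorm_as_integral)
  finally have 3: "sqnorm (snd u) \<le> 2 * sqnorm p + 2 * n * (LBINT x. Q x)" .
  let ?G = "real n * (g * kink_energy)" and ?B = "real n * (real n * (g * tail_mass R))"
  have B0: "(LBINT x. B x) \<ge> 0" unfolding B_def by (intro integral_nonneg_AE AE_I2 sum_nonneg) simp
  have nB: "n * (LBINT x. B x) \<le> ?B" using vB by (intro mult_left_mono) auto
  have B0': "?B \<ge> 0" using nB B0 by (meson mult_nonneg_nonneg of_nat_0_le_iff order_trans)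
  have s: "sqnorm w \<le> S" "sqnorm w' \<le> S" "sqnorm p \<le> S"
    using S' sqnorm_nonneg[of w] sqnorm_nonneg[of w'] sqnorm_nonneg[of p] by linarith+
  have t1: "(1 + \<delta>) * (LBINT x. A x) \<le> (1 + \<delta>) * ?G" "(1 + \<delta>) * (LBINT x. V x) \<le> (1 + \<delta>) * (?G / 2)"
    using \<delta> vA vV by (auto intro!: mult_left_mono)
  have t2: "(1 + 1 / \<delta>) * (2 * sqnorm w' + 2 * n * (LBINT x. B x)) \<le> (1 + 1 / \<delta>) * (2 * (S + ?B))"
    using \<delta> s nB by (intro mult_left_mono) auto
  have t3: "C * (2 * sqnorm w + 2 * n * (LBINT x. B x)) \<le> C * (2 * (S + ?B))"
    using C(1) s nB by (intro mult_left_mono) auto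
  have t4: "n * (LBINT x. Q x) \<le> n * ((g * kink_energy) * (\<Sum>j=1..n. (v j)\<^sup>2))" using vQ by (intro mult_left_mono) auto
  have "sqnorm (weak_deriv (fst u)) / 2 + (LBINT x. U (fst u x)) + sqnorm (snd u) / 2
    \<le> (1 + \<delta>) * ?G + ((1 + 1 / \<delta>) * (S + ?B) + C * (2 * (S + ?B)) + S) + n * ((g * kink_energy) * (\<Sum>j=1..n. (v j)\<^sup>2))"
    using 1 2 3 t1 t2 t3 t4 s by linarith
  also have "(1 + 1 / \<delta>) * (S + ?B) + C * (2 * (S + ?B)) + S \<le> (2 + 1 / \<delta> + 2 * C) * (S + ?B)"
    using B0' by (simp add: algebra_simps)
  finally show ?thesis by (simp add: mult.assoc)
qed

text \<open>
  A small interaction forces small velocities, hence Lorentz factors near \<open>1\<close>, and gaps of at least \<open>2 * R\<close>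
  between the centres, hence small tails.
\<close>

lemma energy_near_multikink:
  assumes \<epsilon>: "\<epsilon> > 0"
  obtains \<eta> where "\<eta> > 0"
    "\<And>u l r a v. u \<in> energy_sector U l r \<Longrightarrow> sqnorm_HL (u - multikink U n a v) + ennreal (interaction n a v) < ennreal \<eta>
      \<Longrightarrow> energy U u \<le> ennreal (real n * kink_energy + \<epsilon>)"
proof -
  let ?N = "real n" 
  define \<delta> where "\<delta> = min 1 (\<epsilon> / (8 * (?N * kink_energy + 1)))"
  have NE: "?N * kink_energy \<ge> 0" using kink_energy_pos by simp
  have \<delta>: "0 < \<delta>" "\<delta> \<le> 1" using \<epsilon> NE by (auto simp: \<delta>_def)
  have \<delta>N: "\<delta> * (?N * kink_energy) \<le> \<epsilon> / 8"
  proof -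
    have "\<delta> * (?N * kink_energy) \<le> \<epsilon> / (8 * (?N * kink_energy + 1)) * (?N * kink_energy)" using NE by (intro mult_right_mono) (auto simp: \<delta>_def)
    also have "\<dots> = \<epsilon> / 8 * ((?N * kink_energy) / (?N * kink_energy + 1))" by simp
    also have "\<dots> \<le> \<epsilon> / 8 * 1" using \<epsilon> NE by (intro mult_left_mono) auto
    finally show ?thesis by simp
  qed
  obtain C where C: "C > 0" "\<And>y e. \<bar>y\<bar> \<le> 1 \<Longrightarrow> \<bar>e\<bar> \<le> 2 * real n + 3 \<Longrightarrow> U (y + e) \<le> (1 + \<delta>) * U y + C * e\<^sup>2"
    using U_perturb[OF \<delta>(1), of "2 * real n + 3"] by metis
  define A where "A = 2 + 1 / \<delta> + 2 * C"
  have A: "A > 0" using \<delta> C by (simp add: A_def add_pos_pos)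
  obtain R where R: "R > 0" "tail_mass R < \<epsilon> / (16 * A * (?N * ?N + 1))"
    using tail_mass_small[of "\<epsilon> / (16 * A * (?N * ?N + 1))"] \<epsilon> A by (metis add_nonneg_pos divide_pos_pos mult_nonneg_nonneg mult_pos_pos of_nat_0_le_iff order_refl zero_less_numeral zero_less_one)
  define \<eta> where "\<eta> = Min {\<delta> / 2, \<epsilon> / (8 * A), exp (- (2 * R)), \<epsilon> / (16 * (?N * kink_energy + 1))}"
  have \<eta>: "\<eta> > 0" "\<eta> \<le> \<delta> / 2" "\<eta> \<le> \<epsilon> / (8 * A)" "\<eta> \<le> exp (- (2 * R))" "\<eta> \<le> \<epsilon> / (16 * (?N * kink_energy + 1))"
  proof -
    show "\<eta> > 0" using \<delta> \<epsilon> A NE by (auto simp: \<eta>_def)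
  qed (unfold \<eta>_def, (rule Min_le; simp)+)
  show ?thesis
  proof (rule that[OF \<eta>(1)])
    fix u l r a v
    assume u: "u \<in> energy_sector U l r" and small: "sqnorm_HL (u - multikink U n a v) + ennreal (interaction n a v) < ennreal \<eta>"
    have s: "sqnorm_HL (u - multikink U n a v) < ennreal \<eta>" by (rule le_less_trans[OF _ small]) (simp add: add_increasing2)
    have "ennreal (interaction n a v) < ennreal \<eta>" by (rule le_less_trans[OF _ small]) (simp add: add_increasing)
    then have i: "interaction n a v < \<eta>" using interaction_nonneg[of n a v] by (simp add: ennreal_less_iff)
    note t = interaction_terms[OF i]
    have v: "\<bar>v j\<bar> < 1" "lorentz (v j) \<le> 1 + \<delta>" if "j \<in> {1..n}" for j
      using lorentz_le[of "v j" \<delta>] t(1)[OF that] \<eta>(2) \<delta> by auto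
    have gap: "2 * R \<le> a (Suc k) - a k" if "k \<in> {1..<n}" for k
    proof -
      have "exp (- (a (Suc k) - a k)) < exp (- (2 * R))" by (rule less_le_trans[OF t(2)[OF that] \<eta>(4)])
      then show ?thesis by simp
    qed
    have \<eta>1: "\<eta> \<le> 1" using \<eta>(2) \<delta> by simp
    let ?E = "sqnorm (weak_deriv (fst u)) / 2 + (LBINT x. U (fst u x)) + sqnorm (snd u) / 2"
    have "?E \<le> (1 + \<delta>) * (?N * ((1 + \<delta>) * kink_energy)) + A * (\<eta> + ?N * (?N * ((1 + \<delta>) * tail_mass R)))
      + ?N * ((1 + \<delta>) * kink_energy) * (\<Sum>j=1..n. (v j)\<^sup>2)"
      unfolding A_def
    proof (rule energy_upper_bound[where n = n and a = a and v = v and R = R, OF u _ gap R(1) v _ _ _ \<delta>(1) C])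
      show "sqnorm_HL (u - multikink U n a v) < \<infinity>" using s by (metis ennreal_less_top infinity_ennreal_def less_trans)
    qed (use s \<eta>(1) \<eta>1 in auto)
    also have "(1 + \<delta>) * (?N * ((1 + \<delta>) * kink_energy)) \<le> ?N * kink_energy + 3 * (\<epsilon> / 8)"
    proof -
      have "\<delta> * \<delta> \<le> \<delta> * 1" using \<delta> by (intro mult_left_mono) auto
      then have "(\<delta> * \<delta>) * (?N * kink_energy) \<le> \<delta> * (?N * kink_energy)" using NE by (intro mult_right_mono) auto
      moreover have "(1 + \<delta>) * (?N * ((1 + \<delta>) * kink_energy)) = ?N * kink_energy + 2 * (\<delta> * (?N * kink_energy)) + (\<delta> * \<delta>) * (?N * kink_energy)"
        by (simp add: algebra_simps)
      ultimately show ?thesis using \<delta>N by linarith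
    qed
    also have "A * (\<eta> + ?N * (?N * ((1 + \<delta>) * tail_mass R))) \<le> \<epsilon> / 4"
    proof -
      have "A * \<eta> \<le> \<epsilon> / 8" using \<eta>(3) A by (simp add: field_simps)
      moreover have "?N * (?N * ((1 + \<delta>) * tail_mass R)) \<le> (?N * ?N + 1) * (2 * tail_mass R)"
      proof -
        have "(?N * ?N) * ((1 + \<delta>) * tail_mass R) \<le> (?N * ?N + 1) * (2 * tail_mass R)"
          using \<delta> tail_mass_nonneg by (intro mult_mono) auto
        then show ?thesis by (simp add: mult.assoc)
      qed
      moreover have "A * ((?N * ?N + 1) * (2 * tail_mass R)) \<le> \<epsilon> / 8"
      proof -
        have p: "16 * A * (?N * ?N + 1) > 0" using A by (simp add: add_nonneg_pos)
        have "tail_mass R * (16 * A * (?N * ?N + 1)) \<le> \<epsilon>" using R(2) p by (simp add: pos_less_divide_eq)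
        then show ?thesis by (simp add: algebra_simps)
      qed
      ultimately show ?thesis using A mult_left_mono[of "?N * (?N * ((1 + \<delta>) * tail_mass R))" "(?N * ?N + 1) * (2 * tail_mass R)" A]
        unfolding distrib_left by linarith
    qed
    also have "?N * ((1 + \<delta>) * kink_energy) * (\<Sum>j=1..n. (v j)\<^sup>2) \<le> \<epsilon> / 8"
    proof -
      have "?N * ((1 + \<delta>) * kink_energy) * (\<Sum>j=1..n. (v j)\<^sup>2) \<le> (2 * (?N * kink_energy)) * \<eta>"
      proof (rule mult_mono)
        have "(1 + \<delta>) * (?N * kink_energy) \<le> 2 * (?N * kink_energy)" using \<delta> NE by (intro mult_right_mono) auto
        then show "?N * ((1 + \<delta>) * kink_energy) \<le> 2 * (?N * kink_energy)" by (simp add: algebra_simps)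
      qed (use t(3) NE in \<open>auto intro: sum_nonneg\<close>)
      also have "\<dots> \<le> (2 * (?N * kink_energy)) * (\<epsilon> / (16 * (?N * kink_energy + 1)))" using NE by (intro mult_left_mono \<eta>(5)) auto
      also have "\<dots> = \<epsilon> / 8 * ((?N * kink_energy) / (?N * kink_energy + 1))"
      proof -
        have "2 * y * (\<epsilon> / (16 * z)) = \<epsilon> / 8 * (y / z)" for y z by simp
        then show ?thesis .
      qed
      also have "\<dots> \<le> \<epsilon> / 8 * 1" using \<epsilon> NE by (intro mult_left_mono) auto
      finally show ?thesis by simp
    qed
    finally have "?E \<le> ?N * kink_energy + \<epsilon>" using \<epsilon> by simp
    then show "energy U u \<le> ennreal (?N * kink_energy + \<epsilon>)" unfolding sector_energy[OF u] by (rule ennreal_leI)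
  qed
qed

end

section \<open>States near a multikink form a cluster\<close>

text \<open>
  Half way between neighbouring centres, and at distance \<open>L\<close> beyond the outermost ones.
\<close>

definition cluster_point :: "nat \<Rightarrow> (nat \<Rightarrow> real) \<Rightarrow> real \<Rightarrow> nat \<Rightarrow> real" where
  "cluster_point n a L k = (if n = 0 then 0 else if k = 0 then a 1 - L else if n \<le> k then a n + L else (a k + a (Suc k)) / 2)"

lemma cluster_point_mono:
  assumes a: "\<And>k. k \<in> {1..<n} \<Longrightarrow> a k \<le> a (Suc k)" and L: "L \<ge> 0" and k: "k < n"
  shows "cluster_point n a L k \<le> cluster_point n a L (Suc k)"
proof (cases k)
  case 0
  then show ?thesis using a[of 1] L k by (cases "n = 1") (auto simp: cluster_point_def)
next
  case (Suc i)
  then show ?thesis using a[of k] a[of "Suc k"] L k by (cases "Suc k = n") (auto simp: cluster_point_def)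
qed

lemma cluster_point_far:
  assumes gap: "\<And>k. k \<in> {1..<n} \<Longrightarrow> 2 * R \<le> a (Suc k) - a k" and R: "R > 0" "R \<le> L" and k: "k \<le> n" and j: "j \<in> {1..n}"
  shows "j \<le> k \<Longrightarrow> R \<le> cluster_point n a L k - a j" "k < j \<Longrightarrow> R \<le> a j - cluster_point n a L k"
proof -
  have mono: "a i \<le> a j" if "1 \<le> i" "i \<le> j" "j \<le> n" for i j
  proof (cases "i = j")
    case False
    have "2 * R \<le> a j - a i"
    proof (rule gap_le[where n = n and a = a])
      show "2 * R \<le> a (Suc k) - a k" if "k \<in> {1..<n}" for k using gap[OF that] .
    qed (use that R False in auto)
    then show ?thesis using R by simp
  qed simp
  show "R \<le> cluster_point n a L k - a j" if jk: "j \<le> k"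
  proof (cases "k = n")
    case True
    then show ?thesis using mono[of j n] j R by (simp add: cluster_point_def)
  next
    case False
    then show ?thesis using mono[of j k] gap[of k] jk j k by (simp add: cluster_point_def field_simps)
  qed
  show "R \<le> a j - cluster_point n a L k" if jk: "k < j"
  proof (cases "k = 0")
    case True
    then show ?thesis using mono[of 1 j] j R by (simp add: cluster_point_def)
  next
    case False
    then show ?thesis using mono[of "Suc k" j] gap[of k] jk j k by (simp add: cluster_point_def field_simps)
  qed
qed

context double_well begin

lemma value_at_cluster_point:
  assumes \<epsilon>: "\<epsilon> > 0"
  obtains \<eta> R where "\<eta> > 0" "R > 0"
    "\<And>u l r a v k L. u \<in> energy_sector U l r \<Longrightarrow> sqnorm_HL (u - multikink U n a v) + ennreal (interaction n a v) < ennreal \<eta>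
      \<Longrightarrow> R \<le> L \<Longrightarrow> k \<le> n \<Longrightarrow> \<bar>fst u (cluster_point n a L k) - (-1) ^ k\<bar> < \<epsilon>"
proof -
  define e where "e = \<epsilon> / (2 * (real n + 1))"
  have e: "e > 0" using \<epsilon> by (simp add: e_def)
  obtain R where R: "R > 0" "\<And>x. \<bar>x\<bar> \<ge> R \<Longrightarrow> \<bar>kink_tail x\<bar> < e" using kink_tail_small[OF e] by metis
  define \<eta> where "\<eta> = Min {1 / 2, exp (- (2 * R)), (\<epsilon> / 2)\<^sup>2}"
  have \<eta>: "\<eta> > 0" "\<eta> \<le> 1 / 2" "\<eta> \<le> exp (- (2 * R))" "\<eta> \<le> (\<epsilon> / 2)\<^sup>2"
  proof -
    show "\<eta> > 0" using \<epsilon> by (auto simp: \<eta>_def)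
  qed (unfold \<eta>_def, (rule Min_le; simp)+)
  show ?thesis
  proof (rule that[OF \<eta>(1) R(1)])
    fix u l r a v k L
    assume u: "u \<in> energy_sector U l r" and small: "sqnorm_HL (u - multikink U n a v) + ennreal (interaction n a v) < ennreal \<eta>"
      and L: "R \<le> L" and k: "k \<le> n"
    have s: "sqnorm_HL (u - multikink U n a v) < ennreal \<eta>" by (rule le_less_trans[OF _ small]) (simp add: add_increasing2)
    have "ennreal (interaction n a v) < ennreal \<eta>" by (rule le_less_trans[OF _ small]) (simp add: add_increasing)
    then have i: "interaction n a v < \<eta>" using interaction_nonneg[of n a v] by (simp add: ennreal_less_iff)
    note t = interaction_terms[OF i]
    have v: "\<bar>v j\<bar> < 1" if "j \<in> {1..n}" for j
      using lorentz_le(1)[of "v j" 1] t(1)[OF that] \<eta>(2) by auto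
    have gap: "2 * R \<le> a (Suc k) - a k" if "k \<in> {1..<n}" for k
    proof -
      have "exp (- (a (Suc k) - a k)) < exp (- (2 * R))" by (rule less_le_trans[OF t(2)[OF that] \<eta>(3)])
      then show ?thesis by simp
    qed
    let ?x = "cluster_point n a L k"
    have far: "j \<le> k \<Longrightarrow> R \<le> ?x - a j" "k < j \<Longrightarrow> R \<le> a j - ?x" if "j \<in> {1..n}" for j
      using cluster_point_far[where n = n and R = R and a = a and L = L and k = k and j = j] gap R(1) L k that by blast+
    have m: "fst (multikink U n a v) ?x = (-1) ^ k + (\<Sum>j=1..n. (-1) ^ j * kink_tail (lorentz (v j) * (?x - a j)))"
    proof (rule multikink_tails[OF k _ v])
      show "a j \<le> ?x \<longleftrightarrow> j \<le> k" if "j \<in> {1..n}" for j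
        using far[OF that] R(1) by (cases "j \<le> k") auto
    qed
    have "\<bar>\<Sum>j=1..n. (-1) ^ j * kink_tail (lorentz (v j) * (?x - a j))\<bar> \<le> (\<Sum>j=1..n. \<bar>(-1) ^ j * kink_tail (lorentz (v j) * (?x - a j))\<bar>)"
      by (rule sum_abs)
    also have "\<dots> \<le> (\<Sum>j=1..n. e)"
    proof (rule sum_mono)
      fix j assume j: "j \<in> {1..n}"
      have "R * 1 \<le> \<bar>?x - a j\<bar> * lorentz (v j)"
        using far[OF j] R(1) lorentz_bounds(1)[OF v[OF j]] by (intro mult_mono) (cases "j \<le> k"; auto)+
      then have "\<bar>lorentz (v j) * (?x - a j)\<bar> \<ge> R"
        using lorentz_bounds(1)[OF v[OF j]] by (simp add: abs_mult mult.commute)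
      then show "\<bar>(-1) ^ j * kink_tail (lorentz (v j) * (?x - a j))\<bar> \<le> e" using R(2) by (fastforce simp: abs_mult)
    qed
    also have "\<dots> < \<epsilon> / 2" using \<epsilon> by (simp add: e_def field_simps)
    finally have 1: "\<bar>fst (multikink U n a v) ?x - (-1) ^ k\<bar> < \<epsilon> / 2" by (simp add: m)
    have fin: "sqnorm_HL (u - multikink U n a v) < \<infinity>" using s by (metis ennreal_less_top infinity_ennreal_def less_trans)
    define w w' p where "w x = fst u x - fst (multikink U n a v) x"
      and "w' x = weak_deriv (fst u) x - multikink_slope n a v x"
      and "p x = snd u x - snd (multikink U n a v) x" for x
    note d = multikink_diff[OF u fin, folded w_def[abs_def] w'_def[abs_def] p_def[abs_def]]
    have "sqnorm w + sqnorm w' + sqnorm p < \<eta>" using s unfolding d(5) by (simp add: ennreal_less_iff del: ennreal_plus)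
    then have "(w ?x)\<^sup>2 < (\<epsilon> / 2)\<^sup>2"
      using sobolev_bound[OF d(1-3), of ?x] \<eta>(4) sqnorm_nonneg[of p] by linarith
    then have "\<bar>w ?x\<bar> < \<epsilon> / 2" using \<epsilon> by (metis abs_of_pos half_gt_zero power2_less_imp_less power2_abs abs_ge_zero less_imp_le)
    then show "\<bar>fst u ?x - (-1) ^ k\<bar> < \<epsilon>" using 1 unfolding w_def by linarith
  qed
qed

end

text \<open>
  Parameters that nearly attain the infimum. They are ordered in any case, so that the cluster points of
  a trajectory are ordered at all times, also when the distance is large or infinite.
\<close>

lemma multikink_dist_approx:
  obtains a v where "\<And>k. k \<in> {1..<n} \<Longrightarrow> a k \<le> a (Suc k)"
    "multikink_dist U n u < ennreal \<eta> \<Longrightarrow> sqnorm_HL (u - multikink U n a v) + ennreal (interaction n a v) < ennreal \<eta>"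
proof (cases "multikink_dist U n u < ennreal \<eta>")
  case True
  then obtain a v where "\<forall>k\<in>{1..<n}. a k \<le> a (Suc k)"
    "sqnorm_HL (u - multikink U n a v) + ennreal (interaction n a v) < ennreal \<eta>"
    unfolding multikink_dist_def INF_less_iff by (auto split: prod.splits)
  then show ?thesis using that by blast
next
  case False
  then show ?thesis using that[of "\<lambda>_. 0"] by simp
qed

context wave begin

text \<open>
  The energy is constant in time and at most \<open>n\<close> kink energies plus an error that vanishes as the distance
  does; the cluster points of nearly optimal parameters, with \<open>L = \<bar>t\<bar>\<close>, see the alternating vacua.
\<close>

lemma small_dist_imp_cluster:
  assumes d: "((\<lambda>t. multikink_dist U n (\<phi> t)) \<longlongrightarrow> 0) at_top"
  shows "kink_cluster U n \<phi>"
  unfolding kink_cluster_def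
proof
  have ev: "\<forall>\<^sub>F t in at_top. multikink_dist U n (\<phi> t) < ennreal \<eta>" if "\<eta> > 0" for \<eta>
    using order_tendstoD(2)[OF d] that by simp
  have "twice_energy 0 / 2 \<le> real n * kink_energy + \<epsilon>" if \<epsilon>: "\<epsilon> > 0" for \<epsilon>
  proof -
    obtain \<eta> where \<eta>: "\<eta> > 0"
      "\<And>u l r a v. u \<in> energy_sector U l r \<Longrightarrow> sqnorm_HL (u - multikink U n a v) + ennreal (interaction n a v) < ennreal \<eta>
      \<Longrightarrow> energy U u \<le> ennreal (real n * kink_energy + \<epsilon>)"
      using energy_near_multikink[OF \<epsilon>, of n] by metis
    obtain t where t: "multikink_dist U n (\<phi> t) < ennreal \<eta>"
      using ev[OF \<eta>(1)] eventually_happens[of _ at_top] by (metis trivial_limit_at_top_linorder)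
    obtain a v where "sqnorm_HL (\<phi> t - multikink U n a v) + ennreal (interaction n a v) < ennreal \<eta>"
      using multikink_dist_approx t by metis
    from \<eta>(2)[OF in_sector this] have "energy U (\<phi> 0) \<le> ennreal (real n * kink_energy + \<epsilon>)"
      using energy_conserved[of t 0] by simp
    then show ?thesis unfolding energy_eq_twice_energy using kink_energy_pos \<epsilon> by (subst (asm) ennreal_le_iff) auto
  qed
  then have "twice_energy 0 / 2 \<le> real n * kink_energy" by (rule field_le_epsilon)
  then have "energy U (\<phi> 0) \<le> ennreal (real n * kink_energy)" unfolding energy_eq_twice_energy by (rule ennreal_leI)
  also have "ennreal (real n * kink_energy) = of_nat n * potential_energy U (kink U)"
    using kink_energy_pos by (simp add: potential_energy_kink ennreal_mult ennreal_of_nat_eq_real_of_nat)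
  finally show "energy U (\<phi> 0) \<le> of_nat n * potential_energy U (kink U)" .
  have "\<exists>a v. (\<forall>k\<in>{1..<n}. a k \<le> a (Suc k)) \<and>
     (multikink_dist U n (\<phi> t) < \<infinity> \<longrightarrow> sqnorm_HL (\<phi> t - multikink U n a v) + ennreal (interaction n a v)
        < ennreal (enn2real (multikink_dist U n (\<phi> t)) + 1 / (1 + \<bar>t\<bar>)))" for t
  proof -
    (* The slack 1 / (1 + abs t) is positive and vanishes as t tends to infinity. *)
    let ?\<eta> = "enn2real (multikink_dist U n (\<phi> t)) + 1 / (1 + \<bar>t\<bar>)"
    obtain a v where av: "\<And>k. k \<in> {1..<n} \<Longrightarrow> a k \<le> a (Suc k)"
      "multikink_dist U n (\<phi> t) < ennreal ?\<eta> \<Longrightarrow> sqnorm_HL (\<phi> t - multikink U n a v) + ennreal (interaction n a v) < ennreal ?\<eta>"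
      by (rule multikink_dist_approx[of n U "\<phi> t" ?\<eta>]) blast
    have "multikink_dist U n (\<phi> t) < ennreal ?\<eta>" if "multikink_dist U n (\<phi> t) < \<infinity>"
    proof -
      have "multikink_dist U n (\<phi> t) = ennreal (enn2real (multikink_dist U n (\<phi> t)))" using that by simp
      also have "\<dots> < ennreal ?\<eta>" by (intro ennreal_lessI) (auto intro: add_nonneg_pos)
      finally show ?thesis .
    qed
    then show ?thesis using av by blast
  qed
  then obtain a v where a: "\<And>t k. k \<in> {1..<n} \<Longrightarrow> a t k \<le> a t (Suc k)"
    and av: "\<And>t. multikink_dist U n (\<phi> t) < \<infinity> \<Longrightarrow> sqnorm_HL (\<phi> t - multikink U n (a t) (v t)) + ennreal (interaction n (a t) (v t))
        < ennreal (enn2real (multikink_dist U n (\<phi> t)) + 1 / (1 + \<bar>t\<bar>))"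
    by metis
  have ev2: "\<forall>\<^sub>F t in at_top. sqnorm_HL (\<phi> t - multikink U n (a t) (v t)) + ennreal (interaction n (a t) (v t)) < ennreal \<eta>"
    if "\<eta> > 0" for \<eta>
  proof -
    have "\<forall>\<^sub>F t in at_top. multikink_dist U n (\<phi> t) < ennreal (\<eta> / 2)" using ev that by simp
    moreover have "\<forall>\<^sub>F t in at_top. t > 2 / \<eta>" by (rule eventually_gt_at_top)
    ultimately show ?thesis
    proof eventually_elim
      case (elim t)
      have fin: "multikink_dist U n (\<phi> t) < \<infinity>" using elim(1) by (metis ennreal_less_top infinity_ennreal_def less_trans)
      then have "enn2real (multikink_dist U n (\<phi> t)) < \<eta> / 2"
        using elim(1) ennreal_less_iff[of "enn2real (multikink_dist U n (\<phi> t))" "\<eta> / 2"] by simp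
      moreover have "1 / (1 + \<bar>t\<bar>) < \<eta> / 2"
      proof -
        have "2 / \<eta> < 1 + \<bar>t\<bar>" using elim(2) by simp
        then have "2 < (1 + \<bar>t\<bar>) * \<eta>" using that by (simp add: pos_divide_less_eq)
        then show ?thesis by (simp add: pos_divide_less_eq mult.commute)
      qed
      ultimately have "enn2real (multikink_dist U n (\<phi> t)) + 1 / (1 + \<bar>t\<bar>) \<le> \<eta>" by simp
      then have "ennreal (enn2real (multikink_dist U n (\<phi> t)) + 1 / (1 + \<bar>t\<bar>)) \<le> ennreal \<eta>" by (rule ennreal_leI)
      with av[OF fin] show ?case by (rule less_le_trans)
    qed
  qed
  show "\<exists>x::nat \<Rightarrow> real \<Rightarrow> real. (\<forall>t. \<forall>k<n. x k t \<le> x (Suc k) t) \<and> (\<forall>k\<le>n. ((\<lambda>t. fst (\<phi> t) (x k t)) \<longlongrightarrow> (-1) ^ k) at_top)"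
  proof (intro exI[of _ "\<lambda>k t. cluster_point n (a t) \<bar>t\<bar> k"] conjI allI impI)
    show "cluster_point n (a t) \<bar>t\<bar> k \<le> cluster_point n (a t) \<bar>t\<bar> (Suc k)" if "k < n" for t k
      by (rule cluster_point_mono[where n = n and a = "a t"]) (use a that in auto)
    fix k assume k: "k \<le> n"
    show "((\<lambda>t. fst (\<phi> t) (cluster_point n (a t) \<bar>t\<bar> k)) \<longlongrightarrow> (-1) ^ k) at_top"
    proof (rule tendstoI)
      fix \<epsilon> :: real assume \<epsilon>: "\<epsilon> > 0"
      obtain \<eta> R where \<eta>: "\<eta> > 0" "R > 0"
        "\<And>u l r a v k L. u \<in> energy_sector U l r \<Longrightarrow> sqnorm_HL (u - multikink U n a v) + ennreal (interaction n a v) < ennreal \<eta>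
      \<Longrightarrow> R \<le> L \<Longrightarrow> k \<le> n \<Longrightarrow> \<bar>fst u (cluster_point n a L k) - (-1) ^ k\<bar> < \<epsilon>"
        by (rule value_at_cluster_point[OF \<epsilon>, of n]) blast
      show "\<forall>\<^sub>F t in at_top. dist (fst (\<phi> t) (cluster_point n (a t) \<bar>t\<bar> k)) ((-1) ^ k) < \<epsilon>"
        using ev2[OF \<eta>(1)] eventually_ge_at_top[of R]
      proof eventually_elim
        case (elim t)
        then show ?case using \<eta>(3)[OF in_sector elim(1) _ k, of "\<bar>t\<bar>"] by (simp add: dist_real_def)
      qed
    qed
  qed
qed

end

section \<open>Transitions with nearly minimal energy\<close>

lemma exp_integral_right:
  assumes "a \<le> (z::real)" "L > 0"
  shows "(LBINT s:{a..z}. exp (2 * L * (s - a))) \<le> exp (2 * L * (z - a)) / (2 * L)"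
proof -
  have "(LBINT s:{a..z}. exp (2 * L * (s - a))) = exp (2 * L * (z - a)) / (2 * L) - exp (2 * L * (a - a)) / (2 * L)"
    by (rule set_integral_FTC) (use assms in \<open>auto intro!: derivative_eq_intros continuous_intros\<close>)
  then show ?thesis using assms by simp
qed

lemma exp_integral_left:
  assumes "z \<le> (a::real)" "L > 0"
  shows "(LBINT s:{z..a}. exp (2 * L * (a - s))) \<le> exp (2 * L * (a - z)) / (2 * L)"
proof -
  have "(LBINT s:{z..a}. exp (2 * L * (a - s))) = (- exp (2 * L * (a - a)) / (2 * L)) - (- exp (2 * L * (a - z)) / (2 * L))"
    by (rule set_integral_FTC) (use assms in \<open>auto intro!: derivative_eq_intros continuous_intros\<close>)
  then show ?thesis using assms by simp
qed

lemma set_integral_subset_mono: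
  fixes h :: "real \<Rightarrow> real"
  assumes "locally_integrable h" "\<And>x. h x \<ge> 0" "p \<le> p'" "q' \<le> q"
  shows "(LBINT x:{p'..q'}. h x) \<le> (LBINT x:{p..q}. h x)"
  unfolding set_lebesgue_integral_def
  by (rule integral_mono) (use assms in \<open>auto simp: locally_integrable_def set_integrable_def indicator_def\<close>)

text \<open>
  A version on both sides of the point \<open>a\<close> at once: at a maximum of \<open>\<bar>d z\<bar> * exp (- 2 * L * \<bar>z - a\<bar>)\<close> the integral
  of the linear term is at most half of that maximum, which can be absorbed.
\<close>

lemma gronwall:
  assumes ac: "ac d g" and a: "p \<le> a" "a \<le> q" "d a = 0" and L: "L > 0"
    and b: "locally_integrable b" "\<And>z. b z \<ge> 0" "(LBINT z:{p..q}. b z) \<le> c"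
    and g: "\<And>z. z \<in> {p..q} \<Longrightarrow> \<bar>g z\<bar> \<le> L * \<bar>d z\<bar> + b z"
    and z: "z \<in> {p..q}"
  shows "\<bar>d z\<bar> \<le> 2 * c * exp (2 * L * (q - p))"
proof -
  define m where "m z = \<bar>d z\<bar> * exp (- (2 * L * \<bar>z - a\<bar>))" for z
  have cd: "continuous_on S d" for S using ac by (rule ac_cont)
  have "continuous_on {p..q} m" unfolding m_def by (intro continuous_intros cd)
  then obtain z0 where z0: "z0 \<in> {p..q}" "\<And>z. z \<in> {p..q} \<Longrightarrow> m z \<le> m z0"
    using continuous_attains_sup[of "{p..q}" m] a by auto
  let ?M = "m z0"
  have M0: "?M \<ge> 0" by (simp add: m_def)
  have dM: "\<bar>d z\<bar> \<le> ?M * exp (2 * L * \<bar>z - a\<bar>)" if "z \<in> {p..q}" for z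
  proof -
    have "\<bar>d z\<bar> = m z * exp (2 * L * \<bar>z - a\<bar>)" by (simp add: m_def mult.assoc flip: exp_add)
    also have "\<dots> \<le> ?M * exp (2 * L * \<bar>z - a\<bar>)" using z0(2)[OF that] by (intro mult_right_mono) auto
    finally show ?thesis .
  qed
  have key: "(LBINT s:{x..y}. \<bar>g s\<bar>) \<le> L * ?M * (LBINT s:{x..y}. exp (2 * L * \<bar>s - a\<bar>)) + c" if xy: "p \<le> x" "y \<le> q" for x y
  proof -
    have li: "locally_integrable (\<lambda>s. exp (2 * L * \<bar>s - a\<bar>))" by (intro locally_integrable_continuous continuous_intros)
    have "(LBINT s:{x..y}. \<bar>g s\<bar>) \<le> (LBINT s:{x..y}. (L * ?M) * exp (2 * L * \<bar>s - a\<bar>) + b s)"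
    proof (rule set_integral_mono)
      show "set_integrable lborel {x..y} (\<lambda>s. \<bar>g s\<bar>)" using ac_loc[OF ac] by (simp add: locally_integrable_def set_integrable_abs)
      show "set_integrable lborel {x..y} (\<lambda>s. (L * ?M) * exp (2 * L * \<bar>s - a\<bar>) + b s)"
        using locally_integrable_add[OF locally_integrable_cmult[OF li] b(1)] by (simp add: locally_integrable_def)
      fix s assume "s \<in> {x..y}"
      then have s: "s \<in> {p..q}" using xy by auto
      show "\<bar>g s\<bar> \<le> (L * ?M) * exp (2 * L * \<bar>s - a\<bar>) + b s"
      proof -
        have "L * \<bar>d s\<bar> \<le> L * (?M * exp (2 * L * \<bar>s - a\<bar>))" by (rule mult_left_mono[OF dM[OF s]]) (use L in simp)
        then show ?thesis using g[OF s] unfolding mult.assoc[of L ?M] by linarith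
      qed
    qed
    also have "\<dots> = (LBINT s:{x..y}. (L * ?M) * exp (2 * L * \<bar>s - a\<bar>)) + (LBINT s:{x..y}. b s)"
      using locally_integrable_cmult[OF li, of "L * ?M"] b(1) by (intro set_integral_add) (auto simp: locally_integrable_def)
    also have "(LBINT s:{x..y}. b s) \<le> c" using set_integral_subset_mono[OF b(1,2) xy] b(3) by simp
    finally show ?thesis by simp
  qed
  have "\<bar>d z0\<bar> \<le> ?M / 2 * exp (2 * L * \<bar>z0 - a\<bar>) + c"
  proof (cases "a \<le> z0")
    case True
    have "\<bar>d z0\<bar> = \<bar>LBINT s:{a..z0}. g s\<bar>" using ac_FTC[OF ac True] a(3) by simp
    also have "\<dots> \<le> (LBINT s:{a..z0}. \<bar>g s\<bar>)" by (rule abs_set_integral_le[OF ac_loc[OF ac]])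
    also have "\<dots> \<le> L * ?M * (LBINT s:{a..z0}. exp (2 * L * \<bar>s - a\<bar>)) + c" using a z0 by (intro key) auto
    also have "(LBINT s:{a..z0}. exp (2 * L * \<bar>s - a\<bar>)) = (LBINT s:{a..z0}. exp (2 * L * (s - a)))"
      by (rule set_lebesgue_integral_cong) auto
    also have "L * ?M * (LBINT s:{a..z0}. exp (2 * L * (s - a))) \<le> L * ?M * (exp (2 * L * (z0 - a)) / (2 * L))"
      using exp_integral_right[OF True L] L M0 by (intro mult_left_mono) auto
    finally show ?thesis using L True by simp
  next
    case False
    then have le: "z0 \<le> a" by simp
    have "\<bar>d z0\<bar> = \<bar>LBINT s:{z0..a}. g s\<bar>" using ac_FTC[OF ac le] a(3) by simp
    also have "\<dots> \<le> (LBINT s:{z0..a}. \<bar>g s\<bar>)" by (rule abs_set_integral_le[OF ac_loc[OF ac]])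
    also have "\<dots> \<le> L * ?M * (LBINT s:{z0..a}. exp (2 * L * \<bar>s - a\<bar>)) + c" using a z0 by (intro key) auto
    also have "(LBINT s:{z0..a}. exp (2 * L * \<bar>s - a\<bar>)) = (LBINT s:{z0..a}. exp (2 * L * (a - s)))"
      by (rule set_lebesgue_integral_cong) auto
    also have "L * ?M * (LBINT s:{z0..a}. exp (2 * L * (a - s))) \<le> L * ?M * (exp (2 * L * (a - z0)) / (2 * L))"
      using exp_integral_left[OF le L] L M0 by (intro mult_left_mono) auto
    finally show ?thesis using L le by simp
  qed
  then have "?M \<le> (?M / 2 * exp (2 * L * \<bar>z0 - a\<bar>) + c) * exp (- (2 * L * \<bar>z0 - a\<bar>))"
    unfolding m_def by (intro mult_right_mono) auto
  also have "\<dots> = ?M / 2 + c * exp (- (2 * L * \<bar>z0 - a\<bar>))"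
    by (simp add: distrib_right mult.assoc flip: exp_add)
  also have "c * exp (- (2 * L * \<bar>z0 - a\<bar>)) \<le> c * 1"
  proof (rule mult_left_mono)
    have "0 \<le> (LBINT z:{p..q}. b z)" unfolding set_lebesgue_integral_def by (rule integral_nonneg_AE) (use b in auto)
    then show "0 \<le> c" using b(3) by simp
  qed (use L in simp)
  finally have M2: "?M \<le> 2 * c" by simp
  have "\<bar>d z\<bar> \<le> ?M * exp (2 * L * \<bar>z - a\<bar>)" by (rule dM[OF z])
  also have "\<dots> \<le> 2 * c * exp (2 * L * (q - p))"
    using M2 M0 z a L by (intro mult_mono) auto
  finally show ?thesis .
qed

context double_well begin

definition "energy_density u x = (weak_deriv (fst u) x)\<^sup>2 / 2 + U (fst u x)"

text \<open>
  The defect in the first-order equation of an increasing (\<open>s = 1\<close>) or decreasing (\<open>s = -1\<close>) kink.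
\<close>

definition "defect s u x = weak_deriv (fst u) x - s * kink_slope (fst u x)"

lemma energy_density_nonneg [simp]: "energy_density u x \<ge> 0"
  using U_nonneg by (simp add: energy_density_def)

lemma energy_density_integrable:
  assumes "u \<in> energy_sector U l r"
  shows "integrable lborel (energy_density u)" "energy U u = ennreal ((LBINT x. energy_density u x) + sqnorm (snd u) / 2)"
proof -
  show i: "integrable lborel (energy_density u)"
    unfolding energy_density_def using sector_L2[OF assms] sector_potential[OF assms] by (simp add: L2_def)
  have "(LBINT x. energy_density u x) = sqnorm (weak_deriv (fst u)) / 2 + (LBINT x. U (fst u x))"
    unfolding energy_density_def using sector_L2[OF assms] sector_potential[OF assms] by (simp add: L2_def sqnorm_def)
  then show "energy U u = ennreal ((LBINT x. energy_density u x) + sqnorm (snd u) / 2)"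
    unfolding sector_energy[OF assms] by simp
qed

lemma defect_L2:
  assumes "u \<in> energy_sector U l r"
  shows "L2 (defect s u)"
  unfolding defect_def
proof (intro L2_diff L2_cmult sector_L2[OF assms])
  note [measurable] = ac_measurable[OF sector_ac[OF assms]]
  show "L2 (\<lambda>x. kink_slope (fst u x))"
    using sector_potential[OF assms] by (simp add: L2_def kink_slope_square)
qed

text \<open>
  Completion of the square in the energy density; the cross term is the derivative of \<open>W \<circ> f\<close>.
\<close>

lemma bogomolny:
  assumes u: "u \<in> energy_sector U l r" and s: "s \<in> {-1, 1}" and xy: "x \<le> y"
  shows "(LBINT z:{x..y}. energy_density u z) = s * (W (fst u y) - W (fst u x)) + (LBINT z:{x..y}. (defect s u z)\<^sup>2) / 2"
proof -
  have ac: "ac (\<lambda>z. W (fst u z)) (\<lambda>z. kink_slope (fst u z) * weak_deriv (fst u) z)"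
    by (rule ac_chain[OF W_deriv kink_slope_cont sector_ac[OF u]])
  have L: "locally_integrable (\<lambda>z. (defect s u z)\<^sup>2)"
    using defect_L2[OF u] by (intro integrable_imp_locally) (auto simp: L2_def)
  have s2: "s\<^sup>2 = 1" using s by auto
  have "energy_density u z = s * (kink_slope (fst u z) * weak_deriv (fst u) z) + (defect s u z)\<^sup>2 / 2" for z
    using s2 kink_slope_square[of "fst u z"] by (simp add: energy_density_def defect_def power2_diff power_mult_distrib field_simps)
  then have "(LBINT z:{x..y}. energy_density u z) = (LBINT z:{x..y}. s * (kink_slope (fst u z) * weak_deriv (fst u) z) + (defect s u z)\<^sup>2 / 2)" by simp
  also have "\<dots> = s * (LBINT z:{x..y}. kink_slope (fst u z) * weak_deriv (fst u) z) + (LBINT z:{x..y}. (defect s u z)\<^sup>2) / 2"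
    using L ac_loc[OF ac] by (subst set_integral_add) (auto simp: locally_integrable_def)
  also have "(LBINT z:{x..y}. kink_slope (fst u z) * weak_deriv (fst u) z) = W (fst u y) - W (fst u x)"
    using ac_FTC[OF ac xy] by simp
  finally show ?thesis .
qed

lemma bogomolny_le:
  assumes u: "u \<in> energy_sector U l r" and xy: "x \<le> y"
  shows "\<bar>W (fst u y) - W (fst u x)\<bar> \<le> (LBINT z:{x..y}. energy_density u z)"
proof -
  have "(LBINT z:{x..y}. (defect s u z)\<^sup>2) \<ge> 0" for s
    unfolding set_lebesgue_integral_def by (rule integral_nonneg_AE) auto
  from this[of 1] this[of "-1"] bogomolny[OF u _ xy, of 1] bogomolny[OF u _ xy, of "-1"] show ?thesis by simp
qed

lemma energy_density_split:
  assumes "u \<in> energy_sector U l r" "x \<le> y" "y \<le> z"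
  shows "(LBINT t:{x..z}. energy_density u t) = (LBINT t:{x..y}. energy_density u t) + (LBINT t:{y..z}. energy_density u t)"
  by (rule set_integral_Icc_split[OF integrable_imp_locally[OF energy_density_integrable(1)[OF assms(1)]] assms(2,3)])

lemma W_near:
  assumes "\<omega> > 0"
  obtains \<delta> where "\<delta> > 0" "\<And>\<iota> y. \<iota> \<in> {-1, 1} \<Longrightarrow> \<bar>y - \<iota>\<bar> < \<delta> \<Longrightarrow> \<bar>W y - W \<iota>\<bar> \<le> \<omega>"
proof -
  have "\<exists>d>0. \<forall>y. \<bar>y - \<iota>\<bar> < d \<longrightarrow> \<bar>W y - W \<iota>\<bar> < \<omega>" for \<iota>
    using W_cont[of \<iota>] assms unfolding continuous_at_eps_delta dist_real_def by blast
  then obtain d1 d2 where "d1 > 0" "\<forall>y. \<bar>y - 1\<bar> < d1 \<longrightarrow> \<bar>W y - W 1\<bar> < \<omega>"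
    "d2 > 0" "\<forall>y. \<bar>y - (-1)\<bar> < d2 \<longrightarrow> \<bar>W y - W (-1)\<bar> < \<omega>" by meson
  then show ?thesis by (intro that[of "min d1 d2"]) fastforce+
qed

text \<open>
  Near the vacua \<open>U\<close> vanishes only at the vacuum itself. So moving from within \<open>d / 2\<close> of a vacuum to distance \<open>d\<close> from
  it changes \<open>W\<close>, and thus costs energy, by at least a fixed amount \<open>g\<close>.
\<close>

lemma W_gap:
  obtains d g where "0 < d" "d \<le> 1/2" "g > 0"
    "\<And>\<iota> y. \<iota> \<in> {-1, 1} \<Longrightarrow> \<bar>y - \<iota>\<bar> \<le> d \<Longrightarrow> (y - \<iota>)\<^sup>2 \<le> 4 * U y"
    "\<And>\<iota> y z. \<iota> \<in> {-1, 1} \<Longrightarrow> \<bar>y - \<iota>\<bar> \<le> d / 2 \<Longrightarrow> \<bar>z - \<iota>\<bar> = d \<Longrightarrow> g \<le> \<bar>W z - W y\<bar>"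
    "W 1 + g \<le> W (1 + d)" "W (-1 - d) \<le> W (-1) - g"
proof -
  obtain d0 where d0: "0 < d0" "d0 \<le> 1"
    "\<And>\<iota> y. \<iota> \<in> {-1, 1} \<Longrightarrow> \<bar>y - \<iota>\<bar> \<le> d0 \<Longrightarrow> (y - \<iota>)\<^sup>2 \<le> 4 * U y" using coercive by metis
  define d where "d = d0 / 2"
  have d: "0 < d" "d \<le> 1/2" "d \<le> d0" using d0 by (auto simp: d_def)
  have co: "(y - \<iota>)\<^sup>2 \<le> 4 * U y" if "\<iota> \<in> {-1, 1}" "\<bar>y - \<iota>\<bar> \<le> d" for \<iota> y
    using d0(3)[OF that(1), of y] that d by simp
  have pos: "U y > 0" if "\<iota> \<in> {-1, 1}" "\<bar>y - \<iota>\<bar> \<le> d" "y \<noteq> \<iota>" for \<iota> y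
  proof -
    have "(y - \<iota>)\<^sup>2 > 0" using that by simp
    then show ?thesis using co[OF that(1,2)] by linarith
  qed
  have s: "W (\<iota> + d / 2) < W (\<iota> + d)" "W (\<iota> - d) < W (\<iota> - d / 2)" if "\<iota> \<in> {-1, 1}" for \<iota>
    by (rule W_strict; use d pos[OF that] in auto)+
  define g where "g = Min {W (1 + d) - W (1 + d / 2), W (1 - d / 2) - W (1 - d), W (-1 + d) - W (-1 + d / 2), W (-1 - d / 2) - W (-1 - d)}"
  have g: "g > 0" using s[of 1] s[of "-1"] by (auto simp: g_def)
  have gs: "g \<le> W (1 + d) - W (1 + d / 2)" "g \<le> W (1 - d / 2) - W (1 - d)" "g \<le> W (-1 + d) - W (-1 + d / 2)" "g \<le> W (-1 - d / 2) - W (-1 - d)"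
    unfolding g_def by (rule Min_le; simp)+
  have g2: "g \<le> W (\<iota> + d) - W (\<iota> + d / 2)" "g \<le> W (\<iota> - d / 2) - W (\<iota> - d)" if "\<iota> \<in> {-1, 1}" for \<iota>
    using that gs by auto
  show ?thesis
  proof (rule that[OF d(1,2) g co])
    fix \<iota> y z :: real assume i: "\<iota> \<in> {-1, 1}" and y: "\<bar>y - \<iota>\<bar> \<le> d / 2" and z: "\<bar>z - \<iota>\<bar> = d"
    from z consider "z = \<iota> + d" | "z = \<iota> - d" by linarith
    then show "g \<le> \<bar>W z - W y\<bar>"
    proof cases
      case 1
      have "y \<le> \<iota> + d / 2" using y by linarith
      from W_mono[OF this] g2(1)[OF i] show ?thesis unfolding 1 by linarith
    next
      case 2
      have "\<iota> - d / 2 \<le> y" using y by linarith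
      from W_mono[OF this] g2(2)[OF i] show ?thesis unfolding 2 by linarith
    qed
  next
    have "W 1 \<le> W (1 + d / 2)" by (rule W_mono) (use d in simp)
    then show "W 1 + g \<le> W (1 + d)" using gs(1) by linarith
    have "W (-1 - d / 2) \<le> W (-1)" by (rule W_mono) (use d in simp)
    then show "W (-1 - d) \<le> W (-1) - g" using gs(4) by linarith
  qed
qed

text \<open>
  The excess energy bounds the defect. It also confines the state to \<open>[-2, 2]\<close>, since an excursion beyond \<open>\<plusminus>(1 + d)\<close>
  and back would cost an additional \<open>2 * g\<close>; there the slope of the kink is Lipschitz and Gronwall's inequality
  compares the state with the kink centred at one of its zeros \<open>a\<close>. The interval extends beyond the window
  \<open>[a - R, a + R]\<close> because at its ends the state is closer to the vacua than the kink is inside the window.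
\<close>

lemma transition:
  assumes R: "R > 0" and \<theta>: "\<theta> > 0"
  obtains \<eta> \<delta> where "\<eta> > 0" "\<delta> > 0"
    "\<And>u l r s x y. u \<in> energy_sector U l r \<Longrightarrow> s \<in> {-1, 1} \<Longrightarrow> x \<le> y \<Longrightarrow> \<bar>fst u x + s\<bar> < \<delta> \<Longrightarrow> \<bar>fst u y - s\<bar> < \<delta>
      \<Longrightarrow> (LBINT z:{x..y}. energy_density u z) \<le> kink_energy + \<eta> \<Longrightarrow>
      \<exists>a. x < a - R \<and> a + R < y \<and> (\<forall>z\<in>{a-R..a+R}. \<bar>fst u z - s * H (z - a)\<bar> \<le> \<theta>) \<and> (LBINT z:{a-R..a+R}. (defect s u z)\<^sup>2) \<le> \<theta>"
proof -
  obtain d g where dg: "0 < d" "d \<le> 1/2" "g > 0" "W 1 + g \<le> W (1 + d)" "W (-1 - d) \<le> W (-1) - g"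
    by (rule W_gap) blast
  obtain L where L: "L > 0" "\<And>x y. \<bar>x\<bar> \<le> 2 \<Longrightarrow> \<bar>y\<bar> \<le> 2 \<Longrightarrow> \<bar>kink_slope y - kink_slope x\<bar> \<le> L * \<bar>y - x\<bar>"
    using kink_slope_lipschitz[of 2] by metis
  (* The distance that the kink keeps from both vacua on the window. *)
  define \<kappa> where "\<kappa> = min (1 - H R) (1 + H (-R))"
  have \<kappa>: "\<kappa> > 0" "H R \<le> 1 - \<kappa>" "- H (-R) \<le> 1 - \<kappa>" using H_range[of R] H_range[of "-R"] by (auto simp: \<kappa>_def)
  define \<theta>' where "\<theta>' = min \<theta> (\<kappa> / 3)"
  have \<theta>': "\<theta>' > 0" "\<theta>' \<le> \<theta>" "\<theta>' \<le> \<kappa> / 3" using \<theta> \<kappa>(1) by (auto simp: \<theta>'_def)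
  define X where "X = exp (2 * L * (2 * R))"
  have X: "X > 0" by (simp add: X_def)
  (* The three bounds serve the confinement, the defect and Gronwall's inequality, in this order. *)
  define \<eta> where "\<eta> = Min {g / 3, \<theta> / 6, (\<theta>' / (2 * X))\<^sup>2 / (12 * R)}"
  have \<eta>: "\<eta> > 0" "\<eta> \<le> g / 3" "\<eta> \<le> \<theta> / 6" "\<eta> \<le> (\<theta>' / (2 * X))\<^sup>2 / (12 * R)"
  proof -
    have "(\<theta>' / (2 * X))\<^sup>2 > 0" using \<theta>' X by simp
    then show "\<eta> > 0" using dg \<theta> R by (auto simp: \<eta>_def)
  qed (unfold \<eta>_def, (rule Min_le; simp)+)
  obtain \<delta>0 where \<delta>0: "\<delta>0 > 0" "\<And>\<iota> y. \<iota> \<in> {-1, 1} \<Longrightarrow> \<bar>y - \<iota>\<bar> < \<delta>0 \<Longrightarrow> \<bar>W y - W \<iota>\<bar> \<le> \<eta>" using W_near[OF \<eta>(1)] by metis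
  define \<delta> where "\<delta> = Min {\<delta>0, \<kappa> / 3, 1 / 2}"
  have \<delta>: "\<delta> > 0" "\<delta> \<le> \<delta>0" "\<delta> \<le> \<kappa> / 3" "\<delta> \<le> 1 / 2"
  proof -
    show "\<delta> > 0" using \<delta>0 \<kappa> by (auto simp: \<delta>_def)
  qed (unfold \<delta>_def, (rule Min_le; simp)+)
  show ?thesis
  proof (rule that[OF \<eta>(1) \<delta>(1)])
    fix u l r s x y
    assume u: "u \<in> energy_sector U l r" and s: "s \<in> {-1, 1}" and xy: "x \<le> y"
      and fx: "\<bar>fst u x + s\<bar> < \<delta>" and fy: "\<bar>fst u y - s\<bar> < \<delta>" and E: "(LBINT z:{x..y}. energy_density u z) \<le> kink_energy + \<eta>"
    let ?f = "fst u" and ?b = "defect s u"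
    have cf: "continuous_on S ?f" for S by (rule ac_cont[OF sector_ac[OF u]])
    have s': "s = 1 \<or> s = -1" using s by auto
    have Wx: "\<bar>W (?f x) - W (- s)\<bar> \<le> \<eta>" "\<bar>W (?f y) - W s\<bar> \<le> \<eta>"
      by (rule \<delta>0(2); use s fx fy \<delta> in auto)+
    have sW: "s * (W s - W (- s)) = kink_energy" using s' by (auto simp: kink_energy_def)
    have "s * (W (?f y) - W (?f x)) \<ge> kink_energy - 2 * \<eta>" using Wx s' sW by auto
    with bogomolny[OF u s xy] E have B: "(LBINT z:{x..y}. (?b z)\<^sup>2) \<le> 6 * \<eta>" by linarith
    have range: "\<bar>?f z\<bar> \<le> 2" if z: "z \<in> {x..y}" for z
    proof (rule ccontr)
      assume big: "\<not> \<bar>?f z\<bar> \<le> 2"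
      have sums: "\<bar>W (?f z') - W (?f x)\<bar> + \<bar>W (?f y) - W (?f z')\<bar> \<le> kink_energy + \<eta>" if "z' \<in> {x..y}" for z'
        using energy_density_split[OF u, of x z' y] bogomolny_le[OF u, of x z'] bogomolny_le[OF u, of z' y] that E by auto
      have Ws: "W (?f x) + W (?f y) \<le> W 1 + W (-1) + 2 * \<eta>" "W (?f x) + W (?f y) \<ge> W 1 + W (-1) - 2 * \<eta>"
        using Wx s' by auto
      show False
      proof (cases "?f z > 0")
        case True
        then have fz: "1 + d \<le> ?f z" using big dg by linarith
        have "W (1 + d) \<le> W (?f z)" by (rule W_mono[OF fz])
        then show False using sums[OF z] Ws \<eta> dg unfolding kink_energy_def by linarith
      next
        case False
        then have fz: "?f z \<le> -1 - d" using big dg by linarith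
        have "W (?f z) \<le> W (-1 - d)" by (rule W_mono[OF fz])
        then show False using sums[OF z] Ws \<eta> dg unfolding kink_energy_def by linarith
      qed
    qed
    (* The centre is a zero of the state. *)
    obtain a where a: "x \<le> a" "a \<le> y" "?f a = 0"
    proof (cases "s = 1")
      case True
      then have "?f x \<le> 0" "0 \<le> ?f y" using fx fy \<delta>(4) by auto
      then show ?thesis using IVT'[of ?f x 0 y] xy cf that by blast
    next
      case False
      then have "?f y \<le> 0" "0 \<le> ?f x" using s' fx fy \<delta>(4) by auto
      then show ?thesis using IVT2'[of ?f y 0 x] xy cf that by blast
    qed
    (* Gronwall is applied on the part of the window inside the interval; that it is the whole window
       is a consequence of the estimate. *)
    define p q where "p = max x (a - R)" and "q = min y (a + R)"
    have pq: "p \<le> a" "a \<le> q" "x \<le> p" "q \<le> y" "q - p \<le> 2 * R" "p \<le> q" using a R by (auto simp: p_def q_def)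
    have acd: "ac (\<lambda>z. ?f z - s * H (z - a)) (\<lambda>z. weak_deriv ?f z - s * kink_slope (H (z - a)))"
    proof (intro ac_diff ac_cmult sector_ac[OF u] ac_C1)
      show "((\<lambda>z. H (z - a)) has_real_derivative kink_slope (H (z - a))) (at z)" for z
        by (rule DERIV_chain'[OF _ H_deriv, THEN DERIV_cong]) (auto intro!: derivative_eq_intros)
      show "continuous_on UNIV (\<lambda>z. kink_slope (H (z - a)))"
        by (intro continuous_on_compose2[OF H'_cont[of UNIV]] continuous_intros) auto
    qed
    have L2b: "L2 ?b" by (rule defect_L2[OF u])
    have lib: "locally_integrable (\<lambda>z. (?b z)\<^sup>2)" using L2b by (intro integrable_imp_locally) (simp add: L2_def)
    have lib1: "locally_integrable ?b"
      unfolding defect_def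
      by (rule locally_integrable_diff[OF ac_loc[OF sector_ac[OF u]] locally_integrable_cmult[OF locally_integrable_continuous]])
         (auto intro: continuous_on_compose2[OF kink_slope_cont[of UNIV] cf])
    have Bpq: "(LBINT z:{p..q}. (?b z)\<^sup>2) \<le> 6 * \<eta>"
      using set_integral_subset_mono[OF lib _ pq(3,4)] B by simp
    have bint: "(LBINT z:{p..q}. \<bar>?b z\<bar>) \<le> sqrt (2 * R) * sqrt (6 * \<eta>)"
    proof -
      have Lh: "L2 (\<lambda>z. indicator {p..q} z * \<bar>?b z\<bar>)"
        using L2b by (intro L2_bounded_by[OF L2b]) (auto simp: indicator_def L2_def)
      have "(LBINT z:{p..q}. \<bar>?b z\<bar>) = (LBINT z:{p..q}. indicator {p..q} z * \<bar>?b z\<bar>)"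
        by (rule set_lebesgue_integral_cong) auto
      also have "\<bar>\<dots>\<bar> \<le> sqrt (q - p) * sqrt (sqnorm (\<lambda>z. indicator {p..q} z * \<bar>?b z\<bar>))"
        by (rule abs_set_integral_le_sqnorm[OF Lh pq(6)])
      also have "sqnorm (\<lambda>z. indicator {p..q} z * \<bar>?b z\<bar>) = (LBINT z:{p..q}. (?b z)\<^sup>2)"
        unfolding sqnorm_def set_lebesgue_integral_def
        by (rule Bochner_Integration.integral_cong) (auto simp: indicator_def)
      also have "sqrt (q - p) * sqrt (LBINT z:{p..q}. (?b z)\<^sup>2) \<le> sqrt (2 * R) * sqrt (6 * \<eta>)"
        using pq Bpq by (intro mult_mono real_sqrt_le_mono) (auto simp: set_lebesgue_integral_def intro!: integral_nonneg_AE)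
      finally show ?thesis by linarith
    qed
    have close: "\<bar>?f z - s * H (z - a)\<bar> \<le> \<theta>'" if z: "z \<in> {p..q}" for z
    proof -
      have "\<bar>?f z - s * H (z - a)\<bar> \<le> 2 * (sqrt (2 * R) * sqrt (6 * \<eta>)) * exp (2 * L * (q - p))"
      proof (rule gronwall[OF acd pq(1,2) _ L(1) locally_integrable_abs[OF lib1] _ bint _ z])
        show "?f a - s * H (a - a) = 0" using a H_0 by simp
        fix z assume z: "z \<in> {p..q}"
        then have zx: "z \<in> {x..y}" using pq by auto
        have h1: "\<bar>s * H (z - a)\<bar> \<le> 2" using s' H_range[of "z - a"] by auto
        have sq: "kink_slope (s * H (z - a)) = kink_slope (H (z - a))" using s' kink_slope_even by auto
        have "\<bar>kink_slope (?f z) - kink_slope (s * H (z - a))\<bar> \<le> L * \<bar>?f z - s * H (z - a)\<bar>"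
          by (rule L(2)[OF h1 range[OF zx]])
        moreover have "weak_deriv ?f z - s * kink_slope (H (z - a)) = ?b z + s * (kink_slope (?f z) - kink_slope (s * H (z - a)))"
          by (simp add: defect_def sq algebra_simps)
        moreover have "\<bar>s * (kink_slope (?f z) - kink_slope (s * H (z - a)))\<bar> = \<bar>kink_slope (?f z) - kink_slope (s * H (z - a))\<bar>" using s' by auto
        ultimately show "\<bar>weak_deriv ?f z - s * kink_slope (H (z - a))\<bar> \<le> L * \<bar>?f z - s * H (z - a)\<bar> + \<bar>?b z\<bar>" by linarith
      qed simp
      also have "\<dots> \<le> 2 * (sqrt (2 * R) * sqrt (6 * \<eta>)) * X"
        using pq L R \<eta> by (intro mult_left_mono) (auto simp: X_def)
      also have "sqrt (2 * R) * sqrt (6 * \<eta>) \<le> \<theta>' / (2 * X)"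
      proof -
        have "12 * R * \<eta> \<le> (\<theta>' / (2 * X))\<^sup>2" using \<eta>(4) R by (simp add: pos_le_divide_eq mult.commute)
        then have "sqrt (12 * R * \<eta>) \<le> sqrt ((\<theta>' / (2 * X))\<^sup>2)" by (rule real_sqrt_le_mono)
        then show ?thesis using \<theta>' X by (simp add: mult_ac flip: real_sqrt_mult)
      qed
      finally show ?thesis using X by simp
    qed
    have right: "a + R < y"
    proof (rule ccontr)
      assume "\<not> a + R < y"
      then have q: "q = y" "y - a \<le> R" by (auto simp: q_def)
      have "\<bar>H (y - a)\<bar> \<le> 1 - \<kappa>" using H_mono[OF q(2)] H_mono[of 0 "y - a"] H_0 a \<kappa> by auto
      moreover have "\<bar>?f y - s * H (y - a)\<bar> \<le> \<kappa> / 3" using close[of y] q pq \<theta>' by auto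
      moreover have "\<bar>?f y - s\<bar> < \<kappa> / 3" using fy \<delta> by simp
      moreover have "\<bar>s\<bar> = 1" "\<bar>s * H (y - a)\<bar> = \<bar>H (y - a)\<bar>" using s' by auto
      ultimately show False using \<kappa>(1) by linarith
    qed
    have left: "x < a - R"
    proof (rule ccontr)
      assume "\<not> x < a - R"
      then have p: "p = x" "- R \<le> x - a" by (auto simp: p_def)
      have "\<bar>H (x - a)\<bar> \<le> 1 - \<kappa>" using H_mono[OF p(2)] H_mono[of "x - a" 0] H_0 a \<kappa> by auto
      moreover have "\<bar>?f x - s * H (x - a)\<bar> \<le> \<kappa> / 3" using close[of x] p pq \<theta>' by auto
      moreover have "\<bar>?f x + s\<bar> < \<kappa> / 3" using fx \<delta> by simp
      moreover have "\<bar>s\<bar> = 1" "\<bar>s * H (x - a)\<bar> = \<bar>H (x - a)\<bar>" using s' by auto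
      ultimately show False using \<kappa>(1) by linarith
    qed
    have pq': "p = a - R" "q = a + R" using left right by (auto simp: p_def q_def)
    show "\<exists>a. x < a - R \<and> a + R < y \<and> (\<forall>z\<in>{a-R..a+R}. \<bar>?f z - s * H (z - a)\<bar> \<le> \<theta>) \<and> (LBINT z:{a-R..a+R}. (?b z)\<^sup>2) \<le> \<theta>"
      using left right close Bpq \<eta>(3) \<theta>'(2) unfolding pq' by (intro exI[of _ a]) force
  qed
qed

section \<open>Clusters are close to multikinks\<close>

lemma W_lipschitz:
  obtains M where "M > 0" "\<And>y z. \<bar>y\<bar> \<le> K \<Longrightarrow> \<bar>z\<bar> \<le> K \<Longrightarrow> \<bar>W y - W z\<bar> \<le> M * \<bar>y - z\<bar>"
proof -
  obtain M where M: "M > 0" "\<And>x. x \<in> {-K..K} \<Longrightarrow> \<bar>kink_slope x\<bar> \<le> M" using bounded_on_Icc[OF kink_slope_cont] by metis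
  have *: "\<bar>W y - W z\<bar> \<le> M * \<bar>y - z\<bar>" if "\<bar>y\<bar> \<le> K" "\<bar>z\<bar> \<le> K" "y < z" for y z
  proof -
    from MVT2[OF that(3), of W kink_slope] W_deriv obtain t where t: "y < t" "t < z" "W z - W y = (z - y) * kink_slope t" by blast
    have "\<bar>kink_slope t\<bar> \<le> M" using t that by (intro M(2)) auto
    then have "(z - y) * kink_slope t \<le> (z - y) * M" using t by (intro mult_left_mono) auto
    moreover have "(z - y) * kink_slope t \<ge> 0" using t by simp
    ultimately have "\<bar>W y - W z\<bar> \<le> (z - y) * M" using t(3) by linarith
    moreover have "\<bar>y - z\<bar> = z - y" using that(3) by simp
    ultimately show ?thesis by (simp add: mult.commute)
  qed
  have "\<bar>W y - W z\<bar> \<le> M * \<bar>y - z\<bar>" if "\<bar>y\<bar> \<le> K" "\<bar>z\<bar> \<le> K" for y z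
    using *[of y z] *[of z y] that by (cases y z rule: linorder_cases) (auto simp: abs_minus_commute)
  then show ?thesis using that M(1) by blast
qed

text \<open>
  The derivative of \<open>W\<close> is even. So decreasing kinks cost as much as increasing ones.
\<close>

lemma W_odd: "W (- y) = 2 * W 0 - W y"
proof -
  have d: "((\<lambda>y. W (- y) + W y) has_real_derivative 0) (at x)" for x
  proof -
    have "((\<lambda>y. W (- y)) has_real_derivative kink_slope (- x) * - 1) (at x)"
      by (rule DERIV_chain'[OF _ W_deriv]) (auto intro!: derivative_eq_intros)
    from DERIV_add[OF this W_deriv[of x]] show ?thesis by (simp add: kink_slope_even)
  qed
  have "(W (- a) + W a) = (W (- b) + W b)" if "a \<le> b" for a b
    by (rule constant_on_interval[OF d]) (use that in auto)
  then have "W (- y) + W y = W (- 0) + W 0" by (metis linear)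
  then show ?thesis by simp
qed

lemma kink_transition_limit:
  assumes "e > 0"
  obtains R0 where "\<And>R. R \<ge> R0 \<Longrightarrow> W (H R) - W (H (- R)) > kink_energy - e"
proof -
  have l: "((\<lambda>x. W (H x)) \<longlongrightarrow> W 1) at_top"
    by (rule isCont_tendsto_compose[OF W_cont H_at_top])
  have "((\<lambda>x. W (H (- x))) \<longlongrightarrow> W (-1)) at_top"
    by (rule isCont_tendsto_compose[OF W_cont]) (rule filterlim_compose[OF H_at_bot filterlim_uminus_at_bot_at_top])
  from tendsto_diff[OF l this] have "((\<lambda>x. W (H x) - W (H (- x))) \<longlongrightarrow> kink_energy) at_top" by (simp add: kink_energy_def)
  from order_tendstoD(1)[OF this, of "kink_energy - e"] assms show ?thesis
    unfolding eventually_at_top_linorder using that by auto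
qed

text \<open>
  The parameters are chosen in this order: the energy \<open>\<eta>2\<close> that may be missing from a window, the half-width
  \<open>R\<close> of the windows, the accuracy \<open>\<theta>\<close> on the windows, and at last the accuracy \<open>\<delta>\<close> at the given points. The
  difference to the multikink is bounded pointwise by a sum of three parts: the accuracy and the defect on
  the windows, the energy density outside of them, and the tails.
\<close>

lemma cluster_near_multikink:
  assumes \<epsilon>: "\<epsilon> > 0"
  obtains \<delta> where "\<delta> > 0"
    "\<And>u l r x. u \<in> energy_sector U l r \<Longrightarrow> l \<in> {-1, 1} \<Longrightarrow> r \<in> {-1, 1} \<Longrightarrow> energy U u \<le> ennreal (real n * kink_energy)
      \<Longrightarrow> (\<And>k. k < n \<Longrightarrow> x k \<le> x (Suc k)) \<Longrightarrow> (\<And>k. k \<le> n \<Longrightarrow> \<bar>fst u (x k) - (-1) ^ k\<bar> < \<delta>)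
      \<Longrightarrow> l = 1 \<and> r = (-1) ^ n \<and> multikink_dist U n u < ennreal \<epsilon>"
proof -
  let ?N = "real n"
  obtain d g where dg: "0 < d" "d \<le> 1/2" "g > 0"
    "\<And>\<iota> y. \<iota> \<in> {-1, 1} \<Longrightarrow> \<bar>y - \<iota>\<bar> \<le> d \<Longrightarrow> (y - \<iota>)\<^sup>2 \<le> 4 * U y"
    "\<And>\<iota> y z. \<iota> \<in> {-1, 1} \<Longrightarrow> \<bar>y - \<iota>\<bar> \<le> d / 2 \<Longrightarrow> \<bar>z - \<iota>\<bar> = d \<Longrightarrow> g \<le> \<bar>W z - W y\<bar>"
    by (rule W_gap) blast
  define \<eta>2 where "\<eta>2 = min (g / (2 * (?N + 1))) (\<epsilon> / (48 * (?N + 1)))"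
  have \<eta>2: "\<eta>2 > 0" "?N * \<eta>2 < g" "?N * \<eta>2 \<le> \<epsilon> / 48"
  proof -
    show p: "\<eta>2 > 0" using dg \<epsilon> by (simp add: \<eta>2_def)
    have "\<eta>2 \<le> g / (2 * (?N + 1))" "\<eta>2 \<le> \<epsilon> / (48 * (?N + 1))" by (auto simp: \<eta>2_def)
    then have "(?N + 1) * \<eta>2 \<le> g / 2" "(?N + 1) * \<eta>2 \<le> \<epsilon> / 48" by (simp_all add: field_simps)
    then show "?N * \<eta>2 < g" "?N * \<eta>2 \<le> \<epsilon> / 48" using p dg by (simp_all add: algebra_simps)
  qed
  obtain R1 where R1: "R1 > 0" "\<And>S. S \<ge> R1 \<Longrightarrow> tail_mass S < \<epsilon> / (16 * (?N * ?N + 1))"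
    using tail_mass_small[of "\<epsilon> / (16 * (?N * ?N + 1))"] \<epsilon> by (metis add_nonneg_pos divide_pos_pos mult_nonneg_nonneg mult_pos_pos of_nat_0_le_iff zero_less_numeral zero_less_one)
  obtain R2 where R2: "\<And>R. R \<ge> R2 \<Longrightarrow> W (H R) - W (H (- R)) > kink_energy - \<eta>2 / 2"
    using kink_transition_limit[of "\<eta>2 / 2"] \<eta>2 by auto
  (* Gaps of at least 2 * R3 make the interaction small. *)
  define R3 where "R3 = - ln (\<epsilon> / (8 * (?N + 1))) / 2"
  define R where "R = max R1 (max R2 R3)"
  have R: "R > 0" "W (H R) - W (H (- R)) > kink_energy - \<eta>2 / 2" "R \<ge> R3" using R1 R2[of R] by (auto simp: R_def)
  have Rtail: "?N * (?N * tail_mass R) \<le> \<epsilon> / 16"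
  proof -
    have "tail_mass R < \<epsilon> / (16 * (?N * ?N + 1))" using R1(2)[of R] by (simp add: R_def)
    moreover have p: "16 * (?N * ?N + 1) > 0" by (simp add: add_nonneg_pos)
    ultimately have "tail_mass R * (16 * (?N * ?N + 1)) \<le> \<epsilon>" by (simp add: pos_less_divide_eq)
    then show ?thesis using tail_mass_nonneg[of R] by (simp add: algebra_simps)
  qed
  have Rexp: "?N * exp (- (2 * R)) \<le> \<epsilon> / 8"
  proof -
    have "exp (- (2 * R)) \<le> exp (ln (\<epsilon> / (8 * (?N + 1))))" using R(3) by (simp add: R3_def)
    also have "\<dots> = \<epsilon> / (8 * (?N + 1))" using \<epsilon> by simp
    finally have "exp (- (2 * R)) * (8 * (?N + 1)) \<le> \<epsilon>" by (simp add: pos_le_divide_eq)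
    then have "8 * (?N * exp (- (2 * R))) + 8 * exp (- (2 * R)) \<le> \<epsilon>" by (simp add: algebra_simps)
    then show ?thesis using exp_ge_zero[of "- (2 * R)"] by linarith
  qed
  obtain L where L: "L > 0" "\<And>x y. \<bar>x\<bar> \<le> 2 \<Longrightarrow> \<bar>y\<bar> \<le> 2 \<Longrightarrow> \<bar>kink_slope y - kink_slope x\<bar> \<le> L * \<bar>y - x\<bar>"
    using kink_slope_lipschitz[of 2] by metis
  obtain LW where LW: "LW > 0" "\<And>y z. \<bar>y\<bar> \<le> 2 \<Longrightarrow> \<bar>z\<bar> \<le> 2 \<Longrightarrow> \<bar>W y - W z\<bar> \<le> LW * \<bar>y - z\<bar>"
    using W_lipschitz[of 2] by metis
  define c where "c = 2 * R * (2 + 4 * L\<^sup>2) + 4"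
  have c: "c > 0" unfolding c_def using R by (intro add_nonneg_pos mult_nonneg_nonneg) auto
  define \<theta> where "\<theta> = Min {1, \<eta>2 / (4 * LW), \<epsilon> / (4 * (?N + 1) * c)}"
  have \<theta>: "\<theta> > 0" "\<theta> \<le> 1" "\<theta> \<le> \<eta>2 / (4 * LW)" "\<theta> \<le> \<epsilon> / (4 * (?N + 1) * c)"
  proof -
    show "\<theta> > 0" using \<eta>2 LW \<epsilon> c by (auto simp: \<theta>_def)
  qed (unfold \<theta>_def, (rule Min_le; simp)+)
  have \<theta>LW: "LW * \<theta> \<le> \<eta>2 / 4" using \<theta>(3) LW(1) by (simp add: field_simps)
  have \<theta>c: "?N * (c * \<theta>) \<le> \<epsilon> / 4"
  proof -
    have "\<theta> * (4 * (?N + 1) * c) \<le> \<epsilon>" using \<theta>(4) c by (subst (asm) pos_le_divide_eq) auto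
    then have "4 * (?N * (c * \<theta>)) + 4 * (c * \<theta>) \<le> \<epsilon>" by (simp add: algebra_simps)
    moreover have "c * \<theta> \<ge> 0" using c \<theta> by simp
    ultimately show ?thesis by linarith
  qed
  obtain \<eta>t \<delta>t where tr: "\<eta>t > 0" "\<delta>t > 0"
    "\<And>u l r s x y. u \<in> energy_sector U l r \<Longrightarrow> s \<in> {-1, 1} \<Longrightarrow> x \<le> y \<Longrightarrow> \<bar>fst u x + s\<bar> < \<delta>t \<Longrightarrow> \<bar>fst u y - s\<bar> < \<delta>t
      \<Longrightarrow> (LBINT z:{x..y}. energy_density u z) \<le> kink_energy + \<eta>t \<Longrightarrow>
      \<exists>a. x < a - R \<and> a + R < y \<and> (\<forall>z\<in>{a-R..a+R}. \<bar>fst u z - s * H (z - a)\<bar> \<le> \<theta>) \<and> (LBINT z:{a-R..a+R}. (defect s u z)\<^sup>2) \<le> \<theta>"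
    by (rule transition[OF R(1) \<theta>(1)]) blast
  define \<omega> where "\<omega> = \<eta>t / (2 * ?N + 1)"
  have \<omega>: "\<omega> > 0" "2 * ?N * \<omega> \<le> \<eta>t" using tr(1) by (auto simp: \<omega>_def field_simps)
  obtain \<delta>w where \<delta>w: "\<delta>w > 0" "\<And>\<iota> y. \<iota> \<in> {-1, 1} \<Longrightarrow> \<bar>y - \<iota>\<bar> < \<delta>w \<Longrightarrow> \<bar>W y - W \<iota>\<bar> \<le> \<omega>" using W_near[OF \<omega>(1)] by metis
  define \<delta> where "\<delta> = Min {\<delta>t, \<delta>w, d / 2}"
  have \<delta>: "\<delta> > 0" "\<delta> \<le> \<delta>t" "\<delta> \<le> \<delta>w" "\<delta> \<le> d / 2"
  proof -
    show "\<delta> > 0" using tr \<delta>w dg by (auto simp: \<delta>_def)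
  qed (unfold \<delta>_def, (rule Min_le; simp)+)
  show ?thesis
  proof (rule that[OF \<delta>(1)])
    fix u l r x
    assume u: "u \<in> energy_sector U l r" and lr: "l \<in> {-1, 1}" "r \<in> {-1, 1}" and en: "energy U u \<le> ennreal (?N * kink_energy)"
      and xm: "\<And>k. k < n \<Longrightarrow> x k \<le> x (Suc k)" and xv: "\<And>k. k \<le> n \<Longrightarrow> \<bar>fst u (x k) - (-1) ^ k\<bar> < \<delta>"
    let ?f = "fst u" and ?D = "weak_deriv (fst u)" and ?p = "snd u"
    have pm: "(-1::real) ^ k \<in> {-1, 1}" for k by (cases "even k") auto
    have cf: "continuous_on S ?f" for S by (rule ac_cont[OF sector_ac[OF u]])
    note di = energy_density_integrable[OF u]
    define TE where "TE = (LBINT z. energy_density u z)"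
    have TE: "TE + sqnorm ?p / 2 \<le> ?N * kink_energy"
      using en kink_energy_pos unfolding di(2) TE_def by (subst (asm) ennreal_le_iff) auto
    have Ile: "(LBINT z:S. energy_density u z) \<le> TE" if "S \<in> sets borel" for S
      unfolding TE_def set_lebesgue_integral_def using that
      by (intro integral_mono integrable_mult_indicator di(1)) (auto simp: indicator_def)
    have xmono: "x i \<le> x j" if "i \<le> j" "j \<le> n" for i j
      using that
    proof (induction j)
      case (Suc j)
      show ?case
      proof (cases "i = Suc j")
        case False
        then have "x i \<le> x j" using Suc by simp
        then show ?thesis using xm[of j] Suc.prems by simp
      qed simp
    qed simp
    define E where "E k = (LBINT z:{x k..x (Suc k)}. energy_density u z)" for k
    have chain: "(LBINT z:{x 0..x m}. energy_density u z) = (\<Sum>k<m. E k)" if "m \<le> n" for m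
      using that
    proof (induction m)
      case 0
      have "(LBINT z:{x 0..x 0}. energy_density u z) = 0"
        using set_integral_Icc_split[OF integrable_imp_locally[OF di(1)], of "x 0" "x 0" "x 0"] by simp
      then show ?case by simp
    next
      case (Suc m)
      then show ?case using energy_density_split[OF u xmono[of 0 m] xm[of m]] by (simp add: E_def)
    qed
    have sumE: "(\<Sum>k<n. E k) \<le> ?N * kink_energy" using chain[OF order_refl] Ile[OF borel_closed[OF closed_atLeastAtMost], of "x 0" "x n"] TE sqnorm_nonneg[of ?p] by linarith
    have Elow: "kink_energy - 2 * \<omega> \<le> E k" if "k < n" for k
    proof -
      have "\<bar>W (?f (x k)) - W ((-1) ^ k)\<bar> \<le> \<omega>" "\<bar>W (?f (x (Suc k))) - W ((-1) ^ Suc k)\<bar> \<le> \<omega>"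
        using xv[of k] xv[of "Suc k"] that \<delta>(3) by (intro \<delta>w(2) pm; simp)+
      moreover have "\<bar>W ((-1) ^ Suc k) - W ((-1) ^ k)\<bar> = kink_energy"
        using kink_energy_pos by (cases "even k") (auto simp: kink_energy_def)
      moreover have "\<bar>W (?f (x (Suc k))) - W (?f (x k))\<bar> \<le> E k"
        unfolding E_def by (rule bogomolny_le[OF u xm[OF that]])
      ultimately show ?thesis by linarith
    qed
    (* The other transitions leave at most this much energy for the k-th one. *)
    have Eup: "E k \<le> kink_energy + \<eta>t" if k: "k < n" for k
    proof -
      have "(\<Sum>i<n. E i) = E k + (\<Sum>i\<in>{..<n} - {k}. E i)" using k by (intro sum.remove) auto
      moreover have "(\<Sum>i\<in>{..<n} - {k}. kink_energy - 2 * \<omega>) \<le> (\<Sum>i\<in>{..<n} - {k}. E i)" by (rule sum_mono) (use Elow in auto)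
      moreover have "(\<Sum>i\<in>{..<n} - {k}. kink_energy - 2 * \<omega>) = (?N - 1) * (kink_energy - 2 * \<omega>)" using k by (simp add: of_nat_diff)
      ultimately have "E k \<le> ?N * kink_energy - (?N - 1) * (kink_energy - 2 * \<omega>)" using sumE by linarith
      also have "\<dots> = kink_energy + 2 * ?N * \<omega> - 2 * \<omega>" by (simp add: algebra_simps)
      finally show ?thesis using \<omega> by linarith
    qed
    have "\<exists>a. x (k - 1) < a - R \<and> a + R < x k \<and> (\<forall>z\<in>{a-R..a+R}. \<bar>?f z - (-1) ^ k * H (z - a)\<bar> \<le> \<theta>)
        \<and> (LBINT z:{a-R..a+R}. (defect ((-1) ^ k) u z)\<^sup>2) \<le> \<theta>" if k: "k \<in> {1..n}" for k
    proof -
      obtain i where i: "k = Suc i" "i < n" using k by (cases k) auto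
      have "\<exists>a. x i < a - R \<and> a + R < x (Suc i) \<and> (\<forall>z\<in>{a-R..a+R}. \<bar>?f z - (-1) ^ k * H (z - a)\<bar> \<le> \<theta>)
        \<and> (LBINT z:{a-R..a+R}. (defect ((-1) ^ k) u z)\<^sup>2) \<le> \<theta>"
      proof (rule tr(3)[OF u pm xm[OF i(2)]])
        show "\<bar>?f (x i) + (-1) ^ k\<bar> < \<delta>t" using xv[of i] i \<delta>(2) by simp
        show "\<bar>?f (x (Suc i)) - (-1) ^ k\<bar> < \<delta>t" using xv[of k] i \<delta>(2) by simp
        show "(LBINT z:{x i..x (Suc i)}. energy_density u z) \<le> kink_energy + \<eta>t" using Eup[OF i(2)] by (simp add: E_def)
      qed
      then show ?thesis using i by simp
    qed
    then obtain a where a: "\<And>k. k \<in> {1..n} \<Longrightarrow> x (k - 1) < a k - R" "\<And>k. k \<in> {1..n} \<Longrightarrow> a k + R < x k"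
      "\<And>k z. k \<in> {1..n} \<Longrightarrow> z \<in> {a k-R..a k+R} \<Longrightarrow> \<bar>?f z - (-1) ^ k * H (z - a k)\<bar> \<le> \<theta>"
      "\<And>k. k \<in> {1..n} \<Longrightarrow> (LBINT z:{a k-R..a k+R}. (defect ((-1) ^ k) u z)\<^sup>2) \<le> \<theta>" by metis
    have xa: "a j + R < x m" if "j \<in> {1..n}" "j \<le> m" "m \<le> n" for j m
      using a(2)[OF that(1)] xmono[OF that(2,3)] by simp
    have xa': "x m < a j - R" if "j \<in> {1..n}" "m < j" for j m
    proof -
      have "m \<le> j - 1" "j - 1 \<le> n" using that by auto
      from xmono[OF this] a(1)[OF that(1)] show ?thesis by simp
    qed
    have gap: "2 * R \<le> a (Suc k) - a k" if "k \<in> {1..<n}" for k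
      using a(2)[of k] a(1)[of "Suc k"] that by simp
    define J where "J k = {a k - R..a k + R}" for k
    have Jdisj: "disjoint_family_on J {1..n}"
    proof -
      have "J i \<inter> J j = {}" if "i \<in> {1..n}" "j \<in> {1..n}" "i < j" for i j
        using xa[of i i] xa'[of j i] that by (auto simp: J_def)
      then show ?thesis unfolding disjoint_family_on_def by (metis inf_commute linorder_neqE_nat)
    qed
    (* A window sees almost the whole increment of W of a kink. *)
    have EJ: "kink_energy - \<eta>2 \<le> (LBINT z:J k. energy_density u z)" if k: "k \<in> {1..n}" for k
    proof -
      let ?s = "(-1::real) ^ k"
      have s: "?s = 1 \<or> ?s = -1" using pm[of k] by auto
      have bnd: "\<bar>W (?f (a k + y)) - W (?s * H y)\<bar> \<le> \<eta>2 / 4" if y: "y \<in> {-R..R}" for y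
      proof -
        have cl: "\<bar>?f (a k + y) - ?s * H y\<bar> \<le> \<theta>" using a(3)[OF k, of "a k + y"] y by simp
        have h: "\<bar>?s * H y\<bar> \<le> 1" using s H_range[of y] by auto
        have "\<bar>W (?f (a k + y)) - W (?s * H y)\<bar> \<le> LW * \<bar>?f (a k + y) - ?s * H y\<bar>"
          using cl h \<theta>(2) by (intro LW(2)) auto
        also have "\<dots> \<le> LW * \<theta>" using cl LW(1) by (intro mult_left_mono) auto
        finally show ?thesis using \<theta>LW by simp
      qed
      have "\<bar>W (?s * H R) - W (?s * H (- R))\<bar> > kink_energy - \<eta>2 / 2" using s R(2) W_odd by auto
      moreover have "\<bar>W (?f (a k + R)) - W (?s * H R)\<bar> \<le> \<eta>2 / 4" "\<bar>W (?f (a k - R)) - W (?s * H (- R))\<bar> \<le> \<eta>2 / 4"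
        using bnd[of R] bnd[of "- R"] R(1) by auto
      moreover have "\<bar>W (?f (a k + R)) - W (?f (a k - R))\<bar> \<le> (LBINT z:J k. energy_density u z)"
        unfolding J_def by (rule bogomolny_le[OF u]) (use R in simp)
      ultimately show ?thesis by linarith
    qed
    (* The complement of the windows. It carries little energy since the windows use up nearly all of it. *)
    define off where "off = - (\<Union>k\<in>{1..n}. J k)"
    have Jm[measurable]: "J k \<in> sets borel" for k by (simp add: J_def)
    have offm[measurable]: "off \<in> sets borel" unfolding off_def by measurable
    define OFF where "OFF = (LBINT z:off. energy_density u z)"
    have iJ: "integrable lborel (\<lambda>z. indicator S z * energy_density u z)" if "S \<in> sets borel" for S
      using integrable_mult_indicator[OF _ di(1), of S] that by simp
    have split1: "indicator off z + (\<Sum>k\<in>{1..n}. indicator (J k) z) = (1::real)" for z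
    proof -
      have "(\<Sum>k\<in>{1..n}. indicator (J k) z) = (indicator (\<Union>k\<in>{1..n}. J k) z :: real)"
        by (rule indicator_UN_disjoint[OF _ Jdisj, symmetric]) simp
      then show ?thesis unfolding off_def by (simp only:) (simp add: indicator_def)
    qed
    have "TE = (LBINT z. indicator off z * energy_density u z + (\<Sum>k\<in>{1..n}. indicator (J k) z * energy_density u z))"
      unfolding TE_def
    proof (rule Bochner_Integration.integral_cong)
      fix z
      have "energy_density u z = (indicator off z + (\<Sum>k\<in>{1..n}. indicator (J k) z)) * energy_density u z" by (simp only: split1)
      then show "energy_density u z = indicator off z * energy_density u z + (\<Sum>k\<in>{1..n}. indicator (J k) z * energy_density u z)"
        by (simp only: distrib_right sum_distrib_right)
    qed simp
    also have "\<dots> = OFF + (\<Sum>k\<in>{1..n}. LBINT z:J k. energy_density u z)"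
    proof -
      have "integrable lborel (\<lambda>z. \<Sum>k\<in>{1..n}. indicator (J k) z * energy_density u z)"
        by (intro Bochner_Integration.integrable_sum iJ Jm)
      then show ?thesis
        unfolding OFF_def set_lebesgue_integral_def real_scaleR_def
        by (simp only: Bochner_Integration.integral_add[OF iJ[OF offm]] Bochner_Integration.integral_sum[OF iJ[OF Jm]])
    qed
    finally have TEs: "TE = OFF + (\<Sum>k\<in>{1..n}. LBINT z:J k. energy_density u z)" .
    have "(\<Sum>k\<in>{1..n}. kink_energy - \<eta>2) \<le> (\<Sum>k\<in>{1..n}. LBINT z:J k. energy_density u z)" by (rule sum_mono) (rule EJ)
    then have OFFp: "OFF + sqnorm ?p / 2 \<le> ?N * \<eta>2" using TE TEs by (simp add: right_diff_distrib)
    then have OFF: "OFF \<le> ?N * \<eta>2" using sqnorm_nonneg[of ?p] by linarith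
    have OFF0: "OFF \<ge> 0" unfolding OFF_def set_lebesgue_integral_def by (rule integral_nonneg_AE) simp
    (* Between the windows m and m + 1 the state starts near the vacuum (-1) ^ m at x m and lacks the
       energy to move away from it. *)
    have confined: "\<bar>?f z - (-1) ^ m\<bar> \<le> d" if m: "m \<le> n"
      and z: "\<And>j. j \<in> {1..n} \<Longrightarrow> j \<le> m \<Longrightarrow> a j + R < z" "\<And>j. j \<in> {1..n} \<Longrightarrow> m < j \<Longrightarrow> z < a j - R" for m z
    proof (rule ccontr)
      assume far: "\<not> ?thesis"
      have sub: "{min z (x m)..max z (x m)} \<subseteq> off"
      proof
        fix t assume t: "t \<in> {min z (x m)..max z (x m)}"
        have "t \<notin> J j" if j: "j \<in> {1..n}" for j
        proof (cases "j \<le> m")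
          case True
          have "a j + R < min z (x m)" using z(1)[OF j True] xa[OF j True m] by simp
          then show ?thesis using t by (auto simp: J_def)
        next
          case False
          then have "max z (x m) < a j - R" using z(2)[OF j] xa'[OF j] by simp
          then show ?thesis using t by (auto simp: J_def)
        qed
        then show "t \<in> off" by (simp add: off_def)
      qed
      have xm': "\<bar>?f (x m) - (-1) ^ m\<bar> \<le> d / 2" using xv[OF m] \<delta>(4) by simp
      let ?h = "\<lambda>t. \<bar>?f t - (-1) ^ m\<bar>"
      have ch: "continuous_on S ?h" for S by (intro continuous_intros cf)
      obtain t where t: "t \<in> {min z (x m)..max z (x m)}" "?h t = d"
      proof (cases "x m \<le> z")
        case True
        then have "\<exists>t\<ge>x m. t \<le> z \<and> ?h t = d" using xm' far dg by (intro IVT' ch) auto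
        then show ?thesis using that True by auto
      next
        case False
        then have "\<exists>t\<ge>z. t \<le> x m \<and> ?h t = d" using xm' far dg by (intro IVT2' ch) auto
        then show ?thesis using that False by auto
      qed
      have g: "g \<le> \<bar>W (?f t) - W (?f (x m))\<bar>" by (rule dg(5)[OF pm xm' t(2)])
      have Io: "(LBINT z:S. energy_density u z) \<le> OFF" if "S \<subseteq> off" "S \<in> sets borel" for S
        unfolding OFF_def set_lebesgue_integral_def real_scaleR_def
        using that by (intro integral_mono iJ offm) (auto simp: indicator_def)
      have "\<bar>W (?f t) - W (?f (x m))\<bar> \<le> OFF"
      proof (cases "x m \<le> t")
        case True
        have "{x m..t} \<subseteq> off" using sub t True by (auto simp: min_def max_def split: if_splits)
        from Io[OF this] bogomolny_le[OF u True] show ?thesis by simp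
      next
        case False
        then have le: "t \<le> x m" by simp
        have "{t..x m} \<subseteq> off" using sub t le by (auto simp: min_def max_def split: if_splits)
        from Io[OF this] bogomolny_le[OF u le] show ?thesis by (simp add: abs_minus_commute)
      qed
      then show False using g OFF \<eta>2(2) by linarith
    qed
    have l1: "l = 1"
    proof -
      have "\<forall>\<^sub>F z in at_bot. \<bar>?f z - 1\<bar> \<le> d"
        unfolding eventually_at_bot_linorder
      proof (intro exI[of _ "x 0"] allI impI)
        fix z assume "z \<le> x 0"
        then show "\<bar>?f z - 1\<bar> \<le> d" using confined[of 0 z] xa'[of _ 0] by force
      qed
      moreover have "((\<lambda>z. \<bar>?f z - 1\<bar>) \<longlongrightarrow> \<bar>l - 1\<bar>) at_bot"
        using u by (intro tendsto_intros) (simp add: energy_sector_def)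
      ultimately have "\<bar>l - 1\<bar> \<le> d" by (intro tendsto_upperbound) auto
      then show ?thesis using lr(1) dg(2) by auto
    qed
    have rn: "r = (-1) ^ n"
    proof -
      have "\<forall>\<^sub>F z in at_top. \<bar>?f z - (-1) ^ n\<bar> \<le> d"
        unfolding eventually_at_top_linorder
      proof (intro exI[of _ "x n"] allI impI)
        fix z assume "z \<ge> x n"
        then show "\<bar>?f z - (-1) ^ n\<bar> \<le> d" using confined[of n z] xa[of _ n] by force
      qed
      moreover have "((\<lambda>z. \<bar>?f z - (-1) ^ n\<bar>) \<longlongrightarrow> \<bar>r - (-1) ^ n\<bar>) at_top"
        using u by (intro tendsto_intros) (simp add: energy_sector_def)
      ultimately have "\<bar>r - (-1) ^ n\<bar> \<le> d" by (intro tendsto_upperbound) auto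
      then show ?thesis using lr(2) pm[of n] dg(2) by auto
    qed
    let ?v = "\<lambda>_::nat. 0::real"
    define w w' where "w z = ?f z - fst (multikink U n a ?v) z" and "w' z = ?D z - multikink_slope n a ?v z" for z
    define B where "B z = (\<Sum>j=1..n. tail_density R (a j) 0 z)" for z
    have lor: "lorentz 0 = 1" by (simp add: lorentz_def)
    have bk: "boosted_kink U b 0 z = H (z - b)" "boosted_slope b 0 z = kink_slope (H (z - b))" for b z
      by (simp_all add: boosted_kink_def boosted_slope_def lor)
    have iB: "integrable lborel B" unfolding B_def using tail_density_integral(1)[of 0 R] R by (intro Bochner_Integration.integrable_sum) auto
    have vB: "(LBINT z. B z) \<le> ?N * tail_mass R"
    proof -
      have "(LBINT z. B z) = (\<Sum>j=1..n. LBINT z. tail_density R (a j) 0 z)"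
        unfolding B_def using tail_density_integral(1)[of 0 R] R by (intro Bochner_Integration.integral_sum) auto
      also have "\<dots> \<le> (\<Sum>j=1..n. tail_mass R)"
        using tail_density_integral(2)[of 0 R] R by (intro sum_mono) (simp add: lor)
      finally show ?thesis by simp
    qed
    (* Bounds the part of the difference on a window that comes from the accuracy of the height. *)
    define K1 where "K1 = (2 + 4 * L\<^sup>2) * \<theta>\<^sup>2"
    have K1: "K1 \<ge> 0" by (simp add: K1_def)
    define F where "F z = (\<Sum>k=1..n. indicator (J k) z * (K1 + 4 * (defect ((-1) ^ k) u z)\<^sup>2)) + 8 * (indicator off z * energy_density u z) + 4 * ?N * B z" for z
    have F0: "indicator (J k) z * (K1 + 4 * (defect ((-1) ^ k) u z)\<^sup>2) \<ge> 0" for k z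
      using K1 by (simp add: indicator_def)
    have pw: "(w z)\<^sup>2 + (w' z)\<^sup>2 \<le> F z" for z
    proof (cases "\<exists>k\<in>{1..n}. z \<in> J k")
      case True
      then obtain k where k: "k \<in> {1..n}" "z \<in> J k" by blast
      let ?s = "(-1::real) ^ k"
      have s: "?s = 1 \<or> ?s = -1" using pm[of k] by auto
      have zk: "\<bar>z - a k\<bar> \<le> R" "z \<in> {a k - R..a k + R}" using k(2) by (auto simp: J_def)
      have mk: "(fst (multikink U n a ?v) z - ?s * H (z - a k))\<^sup>2 \<le> ?N * B z"
        "(multikink_slope n a ?v z - ?s * kink_slope (H (z - a k)))\<^sup>2 \<le> ?N * B z"
        using multikink_near(1,2)[where n = n and a = a and R = R and v = ?v and k = k and x = z] gap R(1) k(1) zk(1)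
        by (simp_all add: bk B_def)
      have cl: "\<bar>?f z - ?s * H (z - a k)\<bar> \<le> \<theta>" by (rule a(3)[OF k(1) zk(2)])
      then have cl2: "(?f z - ?s * H (z - a k))\<^sup>2 \<le> \<theta>\<^sup>2" by (metis abs_ge_zero power2_abs power_mono)
      have "w z = (?f z - ?s * H (z - a k)) + (?s * H (z - a k) - fst (multikink U n a ?v) z)" by (simp add: w_def)
      then have w: "(w z)\<^sup>2 \<le> 2 * \<theta>\<^sup>2 + 2 * (?N * B z)"
        using square_add_le[of "?f z - ?s * H (z - a k)" "?s * H (z - a k) - fst (multikink U n a ?v) z"] cl2 mk(1)
        by (simp add: power2_commute[of "fst (multikink U n a ?v) z"])
      have h: "\<bar>?s * H (z - a k)\<bar> \<le> 1" using s H_range[of "z - a k"] by auto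
      have sq: "kink_slope (?s * H (z - a k)) = kink_slope (H (z - a k))" using s kink_slope_even by auto
      let ?q = "?s * (kink_slope (?f z) - kink_slope (?s * H (z - a k)))"
      have "\<bar>?q\<bar> = \<bar>kink_slope (?f z) - kink_slope (?s * H (z - a k))\<bar>" using s by auto
      also have "\<dots> \<le> L * \<bar>?f z - ?s * H (z - a k)\<bar>" using cl h \<theta>(2) by (intro L(2)) auto
      also have "\<dots> \<le> L * \<theta>" using cl L(1) by (intro mult_left_mono) auto
      finally have "\<bar>?q\<bar>\<^sup>2 \<le> (L * \<theta>)\<^sup>2" by (intro power_mono) auto
      then have q2: "?q\<^sup>2 \<le> L\<^sup>2 * \<theta>\<^sup>2" by (simp add: power_mult_distrib)
      have "?D z - ?s * kink_slope (H (z - a k)) = defect ?s u z + ?q" by (simp add: defect_def sq algebra_simps)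
      then have e1: "(?D z - ?s * kink_slope (H (z - a k)))\<^sup>2 \<le> 2 * (defect ?s u z)\<^sup>2 + 2 * (L\<^sup>2 * \<theta>\<^sup>2)"
        using square_add_le[of "defect ?s u z" ?q] q2 by simp
      have "w' z = (?D z - ?s * kink_slope (H (z - a k))) + (?s * kink_slope (H (z - a k)) - multikink_slope n a ?v z)" by (simp add: w'_def)
      then have w': "(w' z)\<^sup>2 \<le> 4 * (defect ?s u z)\<^sup>2 + 4 * (L\<^sup>2 * \<theta>\<^sup>2) + 2 * (?N * B z)"
        using square_add_le[of "?D z - ?s * kink_slope (H (z - a k))" "?s * kink_slope (H (z - a k)) - multikink_slope n a ?v z"] e1 mk(2)
        by (simp add: power2_commute[of "multikink_slope n a ?v z"])
      have "indicator (J k) z * (K1 + 4 * (defect ?s u z)\<^sup>2) \<le> (\<Sum>k=1..n. indicator (J k) z * (K1 + 4 * (defect ((-1) ^ k) u z)\<^sup>2))"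
        using k(1) F0 by (intro member_le_sum) auto
      moreover have "indicator (J k) z = (1::real)" using k(2) by simp
      moreover have "0 \<le> 8 * (indicator off z * energy_density u z)" by simp
      ultimately have "K1 + 4 * (defect ?s u z)\<^sup>2 + 4 * ?N * B z \<le> F z" unfolding F_def by (simp only: mult_1_left)
      then show ?thesis using w w' by (simp add: K1_def algebra_simps)
    next
      case False
      then have zoff: "z \<in> off" by (simp add: off_def)
      have nz: "z < a j - R \<or> a j + R < z" if "j \<in> {1..n}" for j using False that by (force simp: J_def)
      have far: "R \<le> \<bar>z - a j\<bar>" if "j \<in> {1..n}" for j using nz[OF that] by auto
      have "a k \<le> a (Suc k)" if "k \<in> {1..<n}" for k using gap[OF that] R by simp
      from last_index[where n = n and a = a and x = z, OF this]
      obtain m where m: "m \<le> n" "\<And>j. j \<in> {1..n} \<Longrightarrow> a j \<le> z \<longleftrightarrow> j \<le> m" by blast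
      have c1: "a j + R < z" if "j \<in> {1..n}" "j \<le> m" for j using nz[OF that(1)] m(2)[OF that(1)] that(2) R(1) by auto
      have c2: "z < a j - R" if "j \<in> {1..n}" "m < j" for j using nz[OF that(1)] m(2)[OF that(1)] that(2) R(1) by auto
      have "(?f z - (-1) ^ m)\<^sup>2 \<le> 4 * U (?f z)" by (rule dg(4)[OF pm confined[OF m(1) c1 c2]])
      moreover have mk: "(fst (multikink U n a ?v) z - (-1) ^ m)\<^sup>2 \<le> ?N * B z" "(multikink_slope n a ?v z)\<^sup>2 \<le> ?N * B z"
        using multikink_far[where n = n and a = a and R = R and v = ?v and m = m and x = z] m far by (simp_all add: B_def)
      moreover have "w z = (?f z - (-1) ^ m) + ((-1) ^ m - fst (multikink U n a ?v) z)" by (simp add: w_def)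
      ultimately have w: "(w z)\<^sup>2 \<le> 8 * U (?f z) + 2 * (?N * B z)"
        using square_add_le[of "?f z - (-1) ^ m" "(-1) ^ m - fst (multikink U n a ?v) z"]
        by (simp add: power2_commute[of "fst (multikink U n a ?v) z"])
      have w': "(w' z)\<^sup>2 \<le> 2 * (?D z)\<^sup>2 + 2 * (?N * B z)"
        using square_add_le[of "?D z" "- multikink_slope n a ?v z"] mk(2) by (simp add: w'_def)
      have "8 * energy_density u z + 4 * ?N * B z \<le> F z"
      proof -
        have "0 \<le> (\<Sum>k=1..n. indicator (J k) z * (K1 + 4 * (defect ((-1) ^ k) u z)\<^sup>2))" by (rule sum_nonneg) (rule F0)
        moreover have "indicator off z = (1::real)" using zoff by simp
        ultimately show ?thesis unfolding F_def by (simp only: mult_1_left; linarith)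
      qed
      moreover have "8 * U (?f z) + 2 * (?D z)\<^sup>2 \<le> 8 * energy_density u z" by (simp add: energy_density_def)
      ultimately show ?thesis using w w' by linarith
    qed
    have id: "integrable lborel (\<lambda>z. indicator (J k) z * (K1 + 4 * (defect s u z)\<^sup>2))"
      and vd: "(LBINT z. indicator (J k) z * (K1 + 4 * (defect s u z)\<^sup>2)) = K1 * (2 * R) + 4 * (LBINT z:J k. (defect s u z)\<^sup>2)" for k s
    proof -
      have i1: "integrable lborel (\<lambda>z. K1 * indicator (J k) z)"
        unfolding J_def by (intro integrable_mult_right integrable_real_indicator) (auto simp: emeasure_lborel_Icc_eq)
      have "integrable lborel (\<lambda>z. (defect s u z)\<^sup>2)" using defect_L2[OF u] by (simp add: L2_def)
      from integrable_mult_indicator[OF _ this, of "J k"]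
      have i2: "integrable lborel (\<lambda>z. indicator (J k) z * (defect s u z)\<^sup>2)" by simp
      have e: "indicator (J k) z * (K1 + 4 * (defect s u z)\<^sup>2) = K1 * indicator (J k) z + 4 * (indicator (J k) z * (defect s u z)\<^sup>2)" for z
        by (simp add: algebra_simps)
      show "integrable lborel (\<lambda>z. indicator (J k) z * (K1 + 4 * (defect s u z)\<^sup>2))" unfolding e using i1 i2 by simp
      have "(LBINT z. K1 * indicator (J k) z) = K1 * (2 * R)" using R by (simp add: J_def)
      then show "(LBINT z. indicator (J k) z * (K1 + 4 * (defect s u z)\<^sup>2)) = K1 * (2 * R) + 4 * (LBINT z:J k. (defect s u z)\<^sup>2)"
        unfolding e using i1 i2 by (simp add: set_lebesgue_integral_def)
    qed
    have isum: "integrable lborel (\<lambda>z. \<Sum>k=1..n. indicator (J k) z * (K1 + 4 * (defect ((-1) ^ k) u z)\<^sup>2))"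
      by (intro Bochner_Integration.integrable_sum id)
    have iF: "integrable lborel F"
      unfolding F_def by (intro Bochner_Integration.integrable_add integrable_mult_right isum iJ offm iB)
    have vF: "(LBINT z. F z) \<le> \<epsilon> / 4 + 8 * OFF + \<epsilon> / 4"
    proof -
      have "(LBINT z. F z) = (\<Sum>k=1..n. K1 * (2 * R) + 4 * (LBINT z:J k. (defect ((-1) ^ k) u z)\<^sup>2)) + 8 * OFF + 4 * ?N * (LBINT z. B z)"
      proof -
        define G where "G z = (\<Sum>k=1..n. indicator (J k) z * (K1 + 4 * (defect ((-1) ^ k) u z)\<^sup>2))" for z
        have iG: "integrable lborel G" unfolding G_def by (rule isum)
        have "(LBINT z. G z) = (\<Sum>k=1..n. K1 * (2 * R) + 4 * (LBINT z:J k. (defect ((-1) ^ k) u z)\<^sup>2))"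
          unfolding G_def by (simp only: Bochner_Integration.integral_sum[OF id] vd)
        moreover have "F z = G z + 8 * (indicator off z * energy_density u z) + 4 * ?N * B z" for z by (simp only: F_def G_def)
        moreover have "(LBINT z. G z + 8 * (indicator off z * energy_density u z) + 4 * ?N * B z) = (LBINT z. G z) + 8 * OFF + 4 * ?N * (LBINT z. B z)"
          using iG iJ[OF offm] iB by (simp add: OFF_def set_lebesgue_integral_def)
        ultimately show ?thesis by (simp only:)
      qed
      also have "(\<Sum>k=1..n. K1 * (2 * R) + 4 * (LBINT z:J k. (defect ((-1) ^ k) u z)\<^sup>2)) \<le> (\<Sum>k=1..n. c * \<theta>)"
      proof (rule sum_mono)
        fix k assume k: "k \<in> {1..n}"
        have "\<theta>\<^sup>2 \<le> \<theta>" using \<theta> by (simp add: power2_eq_square mult_left_le)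
        then have "K1 \<le> (2 + 4 * L\<^sup>2) * \<theta>" unfolding K1_def by (intro mult_left_mono) auto
        then have "K1 * (2 * R) \<le> (2 + 4 * L\<^sup>2) * \<theta> * (2 * R)" using R by (intro mult_right_mono) auto
        moreover have "4 * (LBINT z:J k. (defect ((-1) ^ k) u z)\<^sup>2) \<le> 4 * \<theta>" using a(4)[OF k] by (simp add: J_def)
        ultimately show "K1 * (2 * R) + 4 * (LBINT z:J k. (defect ((-1) ^ k) u z)\<^sup>2) \<le> c * \<theta>"
          by (simp add: c_def algebra_simps)
      qed
      also have "(\<Sum>k=1..n. c * \<theta>) = ?N * (c * \<theta>)" by simp
      also have "\<dots> \<le> \<epsilon> / 4" by (rule \<theta>c)
      also have "4 * ?N * (LBINT z. B z) \<le> \<epsilon> / 4"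
        using mult_left_mono[OF vB, of "4 * ?N"] Rtail by simp
      finally show ?thesis by simp
    qed
    have acw: "ac w w'" unfolding w_def w'_def by (rule ac_diff[OF sector_ac[OF u] multikink_ac])
    note [measurable] = ac_measurable[OF acw]
    have Lw: "L2 w" "L2 w'"
      by (rule L2_dominated[OF _ iF]; (measurable)?; use pw in \<open>auto intro!: AE_I2 intro: order_trans[OF _ pw]\<close>)+
    have "sqnorm w + sqnorm w' = (LBINT z. (w z)\<^sup>2 + (w' z)\<^sup>2)" using Lw by (simp add: sqnorm_def L2_def)
    also have "\<dots> \<le> (LBINT z. F z)" using Lw iF pw by (intro integral_mono) (auto simp: L2_def)
    finally have nw: "sqnorm w + sqnorm w' \<le> \<epsilon> / 4 + 8 * OFF + \<epsilon> / 4" using vF by simp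
    have sp: "snd (multikink U n a ?v) = (\<lambda>z. 0)" by (rule ext) (simp add: snd_multikink)
    have "u - multikink U n a ?v = (w, ?p)"
      by (simp add: prod_eq_iff fun_diff_def w_def sp fun_eq_iff)
    then have sn: "sqnorm_HL (u - multikink U n a ?v) = ennreal (sqnorm w + sqnorm w' + sqnorm ?p)"
      using sqnorm_HL_eq[OF acw Lw sector_L2(2)[OF u]] by simp
    have int: "interaction n a ?v \<le> \<epsilon> / 8"
    proof -
      have "interaction n a ?v = (\<Sum>k\<in>{1..<n}. exp (- (a (Suc k) - a k)))" by (simp add: interaction_def)
      also have "\<dots> \<le> (\<Sum>k\<in>{1..<n}. exp (- (2 * R)))"
      proof (rule sum_mono)
        fix k assume "k \<in> {1..<n}"
        from gap[OF this] show "exp (- (a (Suc k) - a k)) \<le> exp (- (2 * R))" by simp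
      qed
      also have "\<dots> = real (n - 1) * exp (- (2 * R))" by simp
      also have "\<dots> \<le> ?N * exp (- (2 * R))" by (intro mult_right_mono) auto
      finally show ?thesis using Rexp by simp
    qed
    have "multikink_dist U n u \<le> sqnorm_HL (u - multikink U n a ?v) + ennreal (interaction n a ?v)"
      unfolding multikink_dist_def
    proof (rule INF_lower2[of "(a, ?v)"])
      have "a k \<le> a (Suc k)" if "k \<in> {1..<n}" for k using gap[OF that] R(1) by simp
      then show "(a, ?v) \<in> {(a, v). (\<forall>k\<in>{1..<n}. a k \<le> a (Suc k)) \<and> (\<forall>k\<in>{1..n}. \<bar>v k\<bar> < 1)}" by simp
    qed simp
    also have "\<dots> = ennreal (sqnorm w + sqnorm w' + sqnorm ?p + interaction n a ?v)"
      unfolding sn using interaction_nonneg[of n a ?v] by (subst ennreal_plus[symmetric]) auto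
    also have "\<dots> < ennreal \<epsilon>"
    proof (rule ennreal_lessI)
      show "sqnorm w + sqnorm w' + sqnorm ?p + interaction n a ?v < \<epsilon>"
        using nw int OFFp OFF0 sqnorm_nonneg[of ?p] \<eta>2(3) \<epsilon> by linarith
    qed (rule \<epsilon>)
    finally show "l = 1 \<and> r = (-1) ^ n \<and> multikink_dist U n u < ennreal \<epsilon>" using l1 rn by simp
  qed
qed

end

context wave begin

text \<open>
  The energy bound is available at every time by conservation, so the previous lemma applies at each late time.
\<close>

lemma cluster_imp_small_dist:
  assumes kc: "kink_cluster U n \<phi>"
  shows "l = 1" "r = (-1) ^ n" "((\<lambda>t. multikink_dist U n (\<phi> t)) \<longlongrightarrow> 0) at_top"
proof -
  have "of_nat n * potential_energy U (kink U) = ennreal (real n * kink_energy)"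
    using kink_energy_pos by (simp add: potential_energy_kink ennreal_mult ennreal_of_nat_eq_real_of_nat)
  then have en: "energy U (\<phi> t) \<le> ennreal (real n * kink_energy)" for t
    using kc energy_conserved[of t 0] by (simp add: kink_cluster_def)
  obtain x :: "nat \<Rightarrow> real \<Rightarrow> real" where x: "\<And>t k. k < n \<Longrightarrow> x k t \<le> x (Suc k) t"
    "\<And>k. k \<le> n \<Longrightarrow> ((\<lambda>t. fst (\<phi> t) (x k t)) \<longlongrightarrow> (-1) ^ k) at_top"
    using kc unfolding kink_cluster_def by blast
  have main: "\<forall>\<^sub>F t in at_top. l = 1 \<and> r = (-1) ^ n \<and> multikink_dist U n (\<phi> t) < ennreal \<epsilon>" if \<epsilon>: "\<epsilon> > 0" for \<epsilon>
  proof -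
    obtain \<delta> where \<delta>: "\<delta> > 0"
      "\<And>u l r y. u \<in> energy_sector U l r \<Longrightarrow> l \<in> {-1, 1} \<Longrightarrow> r \<in> {-1, 1} \<Longrightarrow> energy U u \<le> ennreal (real n * kink_energy)
      \<Longrightarrow> (\<And>k. k < n \<Longrightarrow> y k \<le> y (Suc k)) \<Longrightarrow> (\<And>k. k \<le> n \<Longrightarrow> \<bar>fst u (y k) - (-1) ^ k\<bar> < \<delta>)
      \<Longrightarrow> l = 1 \<and> r = (-1) ^ n \<and> multikink_dist U n u < ennreal \<epsilon>"
      by (rule cluster_near_multikink[OF \<epsilon>, of n]) blast
    have "\<forall>\<^sub>F t in at_top. \<forall>k\<in>{..n}. \<bar>fst (\<phi> t) (x k t) - (-1) ^ k\<bar> < \<delta>"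
    proof (rule eventually_ball_finite)
      show "\<forall>k\<in>{..n}. \<forall>\<^sub>F t in at_top. \<bar>fst (\<phi> t) (x k t) - (-1) ^ k\<bar> < \<delta>"
        using tendstoD[OF x(2) \<delta>(1)] by (simp add: dist_real_def)
    qed simp
    then show ?thesis
    proof eventually_elim
      case (elim t)
      show ?case by (rule \<delta>(2)[of "\<phi> t" l r "\<lambda>k. x k t", OF in_sector lr en]) (use x(1) elim in auto)
    qed
  qed
  from eventually_happens[OF main[OF zero_less_one]] show "l = 1" "r = (-1) ^ n" by auto
  show "((\<lambda>t. multikink_dist U n (\<phi> t)) \<longlongrightarrow> 0) at_top"
  proof (rule order_tendstoI)
    fix y :: ennreal assume "y < 0" then show "\<forall>\<^sub>F t in at_top. y < multikink_dist U n (\<phi> t)" by simp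
  next
    fix y :: ennreal assume y: "0 < y"
    then obtain \<epsilon> where \<epsilon>: "\<epsilon> > 0" "ennreal \<epsilon> \<le> y"
      by (cases y) (auto intro: that[of 1])
    show "\<forall>\<^sub>F t in at_top. multikink_dist U n (\<phi> t) < y"
      using main[OF \<epsilon>(1)] by eventually_elim (use \<epsilon>(2) in \<open>auto intro: less_le_trans\<close>)
  qed
qed

end

theorem proposition1p3:
  fixes U :: "real \<Rightarrow> real" and n :: nat and \<phi> :: "real \<Rightarrow> state"
  assumes "smooth U"
    and "\<And>y. U y \<ge> 0"
    and "\<And>y. U (- y) = U y"
    and "\<And>y. y \<in> {-1<..<1} \<Longrightarrow> U y > 0"
    and "U (-1) = 0" and "U 1 = 0"
    and "(deriv ^^ 2) U (-1) = 1" and "(deriv ^^ 2) U 1 = 1"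
    and "solution U \<phi>"
  shows "kink_cluster U n \<phi> \<longleftrightarrow>
    (\<forall>t. \<phi> t \<in> energy_sector U 1 ((-1) ^ n)) \<and>
    ((\<lambda>t. multikink_dist U n (\<phi> t)) \<longlongrightarrow> 0) at_top"
proof -
  obtain l r where lr: "l \<in> {-1, 1}" "r \<in> {-1, 1}" "\<And>t. \<phi> t \<in> energy_sector U l r"
    using assms(9) unfolding solution_def by blast
  interpret wave U \<phi> l r
    by unfold_locales (use assms lr in \<open>auto simp: solution_def\<close>)
  show ?thesis
    using cluster_imp_small_dist small_dist_imp_cluster in_sector by metis
qed

end
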